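(* Let $D$ be a domain in $\mathbb{R}^2$, $x_0\in\mathbb{R}^2$, $0<\varepsilon<\varepsilon_0<\infty$ and $\alpha>1$. Then every homeomorphism $f:D\to\mathbb{R}^2$ with bounded image, with finite distortion, of class $W^{1,1}_{\rm loc}(D)$, and with $K_{I,\alpha}(\cdot,f)\in L^1_{\rm loc}(D)$ satisfies $$M_\alpha\big(f(\Gamma(C_1,C_2,D))\big)\le\int_{A(x_0,\varepsilon,\varepsilon_0)}K_{I,\alpha}(x,f)\,\eta^\alpha(|x-x_0|)\,dm(x)$$ for any compact sets $C_2\subset D\setminus B(x_0,\varepsilon_0)$ and $C_1\subset\overline{B(x_0,\varepsilon)}\cap D$ and every Lebesgue measurable $\eta:(\varepsilon,\varepsilon_0)\to[0,\infty]$ with $\int_\varepsilon^{\varepsilon_0}\eta(r)\,dr=1$.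
   Context: $A(x_0,r_1,r_2)=\{x\in\mathbb{R}^2:r_1<|x-x_0|<r_2\}$. $f$ has finite distortion if $f\in W^{1,1}_{\rm loc}$ and $\|f'(x)\|^2\le K(x)J(x,f)$ a.e. for some a.e. finite $K$. For $x\in D$ and $q\ge1$, with $l(f'(x))=\min_{|h|=1}|f'(x)h|$ and $J(x,f)$ the Jacobian: $K_{I,q}(x,f)=\frac{|J(x,f)|}{l(f'(x))^q}$ if $J(x,f)\ne0$; $=1$ if $f'(x)=0$; $=\infty$ otherwise. For a path family $\Gamma$, $M_\alpha(\Gamma)=\inf\int\rho^\alpha\,dm$ over Borel $\rho\ge0$ with $\int_\gamma\rho|dx|\ge1$ for all locally rectifiable $\gamma\in\Gamma$; $\Gamma(E,F,G)$ is the family of paths joining $E$ to $F$ with interior points in $G$; $f(\Gamma)=\{f\circ\gamma\}$. *)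

theory Defs
  imports "HOL-Analysis.Analysis"
begin

type_synonym R2 = "real ^ 2"

definition enn_powr :: "ennreal \<Rightarrow> real \<Rightarrow> ennreal" where
  "enn_powr x a = (if x = \<infinity> then \<infinity> else ennreal (enn2real x powr a))"

definition partial_deriv :: "(R2 \<Rightarrow> real) \<Rightarrow> 2 \<Rightarrow> R2 \<Rightarrow> real" where
  "partial_deriv \<phi> j x = frechet_derivative \<phi> (at x) (axis j 1)"

fun C_k :: "nat \<Rightarrow> (R2 \<Rightarrow> real) \<Rightarrow> bool" where
  "C_k 0 \<phi> = continuous_on UNIV \<phi>"
| "C_k (Suc k) \<phi> = ((\<forall>x. \<phi> differentiable (at x)) \<and> continuous_on UNIV \<phi>
      \<and> (\<forall>j. C_k k (partial_deriv \<phi> j)))"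

definition smooth_fun :: "(R2 \<Rightarrow> real) \<Rightarrow> bool" where
  "smooth_fun \<phi> = (\<forall>k. C_k k \<phi>)"

definition test_fun :: "R2 set \<Rightarrow> (R2 \<Rightarrow> real) \<Rightarrow> bool" where
  "test_fun D \<phi> = (smooth_fun \<phi> \<and> compact (closure {x. \<phi> x \<noteq> 0})
                    \<and> closure {x. \<phi> x \<noteq> 0} \<subseteq> D)"

definition loc_integrable :: "R2 set \<Rightarrow> (R2 \<Rightarrow> 'b::{banach,second_countable_topology}) \<Rightarrow> bool" where
  "loc_integrable D u = (\<forall>C. compact C \<and> C \<subseteq> D \<longrightarrow> set_integrable lebesgue C u)"

definition loc_integrable_enn :: "R2 set \<Rightarrow> (R2 \<Rightarrow> ennreal) \<Rightarrow> bool" where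
  "loc_integrable_enn D u = ((\<lambda>x. u x * indicator D x) \<in> borel_measurable lebesgue \<and>
      (\<forall>C. compact C \<and> C \<subseteq> D \<longrightarrow> (\<integral>\<^sup>+ x\<in>C. u x \<partial>lebesgue) < \<infinity>))"

text \<open>The matrix field Df represents the weak differential f': its j-th column is
  the weak partial derivative of f in the j-th coordinate direction, i.e.
  (Df x) *v h = sum_j h_j (partial_j f)(x).\<close>
definition weak_differential :: "R2 set \<Rightarrow> (R2 \<Rightarrow> R2) \<Rightarrow> (R2 \<Rightarrow> real^2^2) \<Rightarrow> bool" where
  "weak_differential D f Df =
     (\<forall>j \<phi>. test_fun D \<phi> \<longrightarrow>
        (LINT x:D|lebesgue. partial_deriv \<phi> j x *\<^sub>R f x)
          = - (LINT x:D|lebesgue. \<phi> x *\<^sub>R column j (Df x)))"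

definition sobolev_W11_loc :: "R2 set \<Rightarrow> (R2 \<Rightarrow> R2) \<Rightarrow> (R2 \<Rightarrow> real^2^2) \<Rightarrow> bool" where
  "sobolev_W11_loc D f Df =
     (loc_integrable D f \<and> (\<forall>j. loc_integrable D (\<lambda>x. column j (Df x)))
      \<and> weak_differential D f Df)"

definition mnorm :: "real^2^2 \<Rightarrow> real" where
  "mnorm A = onorm (\<lambda>h. A *v h)"

definition lnorm :: "real^2^2 \<Rightarrow> real" where
  "lnorm A = Inf {norm (A *v h) | h. norm h = 1}"

definition finite_distortion :: "R2 set \<Rightarrow> (R2 \<Rightarrow> R2) \<Rightarrow> (R2 \<Rightarrow> real^2^2) \<Rightarrow> bool" where
  "finite_distortion D f Df =
     (sobolev_W11_loc D f Df \<and>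
      (\<exists>K :: R2 \<Rightarrow> real. AE x in lebesgue. x \<in> D \<longrightarrow>
          (mnorm (Df x))\<^sup>2 \<le> K x * det (Df x)))"

definition K_I :: "R2 set \<Rightarrow> (R2 \<Rightarrow> real^2^2) \<Rightarrow> real \<Rightarrow> R2 \<Rightarrow> ennreal" where
  "K_I D Df q x =
     (if x \<notin> D then 0
      else if det (Df x) \<noteq> 0 then ennreal (\<bar>det (Df x)\<bar> / (lnorm (Df x) powr q))
      else if Df x = 0 then 1 else \<infinity>)"

definition path_variation :: "(real \<Rightarrow> R2) \<Rightarrow> real \<Rightarrow> real \<Rightarrow> ennreal" where
  "path_variation \<gamma> a b =
     (SUP p \<in> {(n, t). t 0 = a \<and> t n = b \<and> (\<forall>i<n. t i \<le> t (Suc i))}.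
        ennreal (\<Sum>i<fst p. dist (\<gamma> (snd p i)) (\<gamma> (snd p (Suc i)))))"

text \<open>A path on the closed interval [0,1] is locally rectifiable iff it is rectifiable.\<close>
definition loc_rectifiable :: "(real \<Rightarrow> R2) \<Rightarrow> bool" where
  "loc_rectifiable \<gamma> = (path \<gamma> \<and> path_variation \<gamma> 0 1 < \<infinity>)"

text \<open>length function s_gamma(t), clamped to [0,1] (monotone and continuous)\<close>
definition length_fun :: "(real \<Rightarrow> R2) \<Rightarrow> real \<Rightarrow> real" where
  "length_fun \<gamma> t = enn2real (path_variation \<gamma> 0 (max 0 (min 1 t)))"

definition line_integral :: "(R2 \<Rightarrow> ennreal) \<Rightarrow> (real \<Rightarrow> R2) \<Rightarrow> ennreal" where
  "line_integral \<rho> \<gamma> = (\<integral>\<^sup>+ t. \<rho> (\<gamma> t) * indicator {0..1} t \<partial>interval_measure (length_fun \<gamma>))"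

definition admissible :: "(real \<Rightarrow> R2) set \<Rightarrow> (R2 \<Rightarrow> ennreal) \<Rightarrow> bool" where
  "admissible \<Gamma> \<rho> = (\<rho> \<in> borel_measurable borel \<and>
      (\<forall>\<gamma>\<in>\<Gamma>. loc_rectifiable \<gamma> \<longrightarrow> line_integral \<rho> \<gamma> \<ge> 1))"

definition modulus :: "real \<Rightarrow> (real \<Rightarrow> R2) set \<Rightarrow> ennreal" where
  "modulus a \<Gamma> = (INF \<rho> \<in> {\<rho>. admissible \<Gamma> \<rho>}. \<integral>\<^sup>+ x. enn_powr (\<rho> x) a \<partial>lebesgue)"

definition joining_paths :: "R2 set \<Rightarrow> R2 set \<Rightarrow> R2 set \<Rightarrow> (real \<Rightarrow> R2) set" where
  "joining_paths E F G = {\<gamma>. path \<gamma> \<and> \<gamma> 0 \<in> E \<and> \<gamma> 1 \<in> F \<and> (\<forall>t\<in>{0<..<1}. \<gamma> t \<in> G)}"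

definition annulus :: "R2 \<Rightarrow> real \<Rightarrow> real \<Rightarrow> R2 set" where
  "annulus x0 r1 r2 = {x. r1 < dist x x0 \<and> dist x x0 < r2}"

end

theory Submission imports Defs "HOL-Computational_Algebra.Polynomial"
begin

text \<open>
  Write \<open>g\<close> for the inverse of \<open>f\<close>. The weak derivative makes \<open>f\<close> absolutely continuous on almost every
  line of every direction. Slicing by the lines \<open>x \<bullet> v = t\<close> with \<open>t\<close> between \<open>v \<bullet> g p\<close> and \<open>v \<bullet> g (p + h e)\<close>,
  and covering the image of such a slice by small rectangles, bounds the integral of \<open>\<bar>v \<bullet> (g (p + h e) - g p)\<bar>\<close>
  over a ball of radius \<open>\<delta>\<close> by \<open>h\<close> times the integral of \<open>|Df w|\<close>, \<open>w\<close> orthogonal to \<open>v\<close>, over the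
  preimage of the concentric ball of radius \<open>\<delta> + h\<close>. One-dimensional maximal functions along coordinate
  lines exhaust \<open>D\<close>, up to a null set, by pieces on which \<open>f\<close> is differentiable with derivative \<open>Df\<close>,
  so the area formula holds there. Finite distortion together with \<open>l(A) |A w| \<le> |det A|\<close> then replaces the
  bound by \<open>h\<close> times the integral of \<open>G = 1 / l(f' \<circ> g)\<close> over the larger ball in the image.

  Hence ball averages of \<open>G\<close> are upper gradients of ball averages of \<open>g\<close>. As the former converge to \<open>G\<close> in
  \<open>L\<^sup>\<alpha>\<close> locally, Fuglede's argument makes \<open>G\<close> an upper gradient of \<open>g\<close> along all rectifiable curves
  outside a family of modulus zero. So \<open>\<rho> = \<eta>(|g - x0|) G\<close> is admissible off that family, and the area formula
  bounds the integral of \<open>\<rho>\<^sup>\<alpha>\<close> by that of \<open>K\<^sub>I \<eta>\<^sup>\<alpha>\<close>.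
\<close>

section \<open>Path variation and line integrals\<close>

text \<open>The obstacle is that \<open>f\<close> need not satisfy Lusin's condition: it may carry a
  null set to a set of positive area, and \<open>g\<close> is not known beforehand to be
  differentiable or absolutely continuous on lines. So increments of \<open>g\<close> are first
  bounded by integrals over the domain, which do not see null sets, and only then moved to the image
  of the good pieces; \<open>G\<close> is 0 on the rest of the image. The only regularity of
  \<open>g\<close> that enters is continuity. The slicing is two-dimensional: slices by one
  coordinate are lines, their images are curves, and a curve swept along a vector of length
  \<open>h\<close> covers an area of at most \<open>h\<close> times its length. The weight 1/l is
  forced: its power \<alpha> times the Jacobian is \<open>K_I\<close>, so local integrability of
  \<open>K_I\<close> places \<open>G\<close> locally in L^\<alpha>. Averages of \<open>g\<close> are
  regular enough for an estimate along every rectifiable curve, while for \<open>g\<close> itself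
  the estimate is obtained only up to exceptional curves.\<close>

lemma path_variation_upper:
  assumes "t 0 = a" "t n = b" "\<And>i. i < n \<Longrightarrow> t i \<le> t (Suc i)"
  shows "ennreal (\<Sum>i<n. dist (\<gamma> (t i)) (\<gamma> (t (Suc i)))) \<le> path_variation \<gamma> a b"
proof -
  have "(n, t) \<in> {(n, t). t 0 = a \<and> t n = b \<and> (\<forall>i<n. t i \<le> t (Suc i))}"
    using assms by auto
  from SUP_upper[OF this, of "\<lambda>p. ennreal (\<Sum>i<fst p. dist (\<gamma> (snd p i)) (\<gamma> (snd p (Suc i))))"]
  show ?thesis unfolding path_variation_def by simp
qed

lemma path_variation_le:
  assumes "\<And>n t. t 0 = a \<Longrightarrow> t n = b \<Longrightarrow> (\<And>i. i < n \<Longrightarrow> t i \<le> t (Suc i)) \<Longrightarrow>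
     ennreal (\<Sum>i<n. dist (\<gamma> (t i)) (\<gamma> (t (Suc i)))) \<le> c"
  shows "path_variation \<gamma> a b \<le> c"
  unfolding path_variation_def by (rule SUP_least) (use assms in auto)

lemma dist_le_path_variation:
  assumes "a \<le> b"
  shows "ennreal (dist (\<gamma> a) (\<gamma> b)) \<le> path_variation \<gamma> a b"
  using path_variation_upper[of "\<lambda>i. if i = 0 then a else b" a 1 b \<gamma>] assms by simp

text \<open>Clamping by \<open>min\<close> and \<open>max\<close> cuts a partition at
  \<open>z\<close> while keeping its indices, so no refined partition has to be built. The triangle
  inequality matters only for a step that straddles \<open>z\<close>.\<close>

lemma dist_le_split_at:
  fixes x y z :: real and \<gamma> :: "real \<Rightarrow> 'a::metric_space"
  assumes "x \<le> y"
  shows "dist (\<gamma> x) (\<gamma> y) \<le> dist (\<gamma> (min x z)) (\<gamma> (min y z)) + dist (\<gamma> (max x z)) (\<gamma> (max y z))"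
  using assms dist_triangle[of "\<gamma> x" "\<gamma> y" "\<gamma> z"] by (auto simp: min_def max_def)

lemma partition_bounds:
  fixes t :: "nat \<Rightarrow> real"
  assumes "\<And>i. i < n \<Longrightarrow> t i \<le> t (Suc i)" "i \<le> n"
  shows "t 0 \<le> t i \<and> t i \<le> t n"
proof -
  have "j \<le> n \<Longrightarrow> i \<le> j \<Longrightarrow> t i \<le> t j" for i j
    by (induction j) (use assms in \<open>auto simp: le_Suc_eq intro: order_trans\<close>)
  then show ?thesis using assms by simp
qed

text \<open>Only the part beyond \<open>b\<close> is replaced by its variation. The part before
  \<open>b\<close> stays a sum over the given partition, clamped, because right continuity later
  needs this particular sum to be small.\<close>

lemma path_variation_split_le:
  assumes "t 0 = a" "t n = c" "\<And>i. i < n \<Longrightarrow> t i \<le> t (Suc i)" "a \<le> b" "b \<le> c"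
  shows "ennreal (\<Sum>i<n. dist (\<gamma> (t i)) (\<gamma> (t (Suc i))))
     \<le> ennreal (\<Sum>i<n. dist (\<gamma> (min (t i) b)) (\<gamma> (min (t (Suc i)) b))) + path_variation \<gamma> b c"
proof -
  have "(\<Sum>i<n. dist (\<gamma> (t i)) (\<gamma> (t (Suc i))))
     \<le> (\<Sum>i<n. dist (\<gamma> (min (t i) b)) (\<gamma> (min (t (Suc i)) b)))
       + (\<Sum>i<n. dist (\<gamma> (max (t i) b)) (\<gamma> (max (t (Suc i)) b)))"
    unfolding sum.distrib[symmetric] by (intro sum_mono dist_le_split_at) (use assms in auto)
  then have "ennreal (\<Sum>i<n. dist (\<gamma> (t i)) (\<gamma> (t (Suc i))))
     \<le> ennreal (\<Sum>i<n. dist (\<gamma> (min (t i) b)) (\<gamma> (min (t (Suc i)) b)))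
       + ennreal (\<Sum>i<n. dist (\<gamma> (max (t i) b)) (\<gamma> (max (t (Suc i)) b)))"
    by (subst ennreal_plus[symmetric]) (auto intro!: sum_nonneg ennreal_leI)
  also have "\<dots> \<le> ennreal (\<Sum>i<n. dist (\<gamma> (min (t i) b)) (\<gamma> (min (t (Suc i)) b))) + path_variation \<gamma> b c"
  proof (intro add_left_mono path_variation_upper)
    show "max (t i) b \<le> max (t (Suc i)) b" if "i < n" for i using assms(3)[OF that] by linarith
  qed (use assms in auto)
  finally show ?thesis .
qed

lemma path_variation_subadditive:
  assumes "a \<le> b" "b \<le> c"
  shows "path_variation \<gamma> a c \<le> path_variation \<gamma> a b + path_variation \<gamma> b c"
proof (rule path_variation_le)
  fix n and t :: "nat \<Rightarrow> real"
  assume t: "t 0 = a" "t n = c" "\<And>i. i < n \<Longrightarrow> t i \<le> t (Suc i)"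
  have "ennreal (\<Sum>i<n. dist (\<gamma> (t i)) (\<gamma> (t (Suc i))))
     \<le> ennreal (\<Sum>i<n. dist (\<gamma> (min (t i) b)) (\<gamma> (min (t (Suc i)) b))) + path_variation \<gamma> b c"
    by (rule path_variation_split_le) (use t assms in auto)
  also have "\<dots> \<le> path_variation \<gamma> a b + path_variation \<gamma> b c"
    by (intro add_right_mono path_variation_upper) (use t assms in \<open>auto simp: min_le_iff_disj\<close>)
  finally show "ennreal (\<Sum>i<n. dist (\<gamma> (t i)) (\<gamma> (t (Suc i)))) \<le> \<dots>" .
qed

text \<open>Two partitions with the common node \<open>b\<close> concatenate to one of the whole
  interval; taking both suprema, over nonempty families, passes this on to the variations.\<close>

lemma path_variation_superadditive:
  assumes "a \<le> b" "b \<le> c"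
  shows "path_variation \<gamma> a b + path_variation \<gamma> b c \<le> path_variation \<gamma> a c"
proof -
  let ?P = "\<lambda>a b. {(n, t). t 0 = a \<and> t n = b \<and> (\<forall>i<n. t i \<le> t (Suc i))}"
  let ?s = "\<lambda>p. ennreal (\<Sum>i<fst p. dist (\<gamma> (snd p i)) (\<gamma> (snd p (Suc i))))"
  have ne: "?P a b \<noteq> {}" if "a \<le> b" for a b :: real
    using that by (auto intro!: exI[of _ 1] exI[of _ "\<lambda>i. if i = 0 then a else b"])
  have key: "?s p + ?s q \<le> path_variation \<gamma> a c" if p: "p \<in> ?P a b" and q: "q \<in> ?P b c" for p q
  proof -
    obtain n t where pn: "p = (n, t)" by (cases p)
    obtain m u where qn: "q = (m, u)" by (cases q)
    \<comment> \<open>At index \<open>n\<close> both branches describe the node \<open>b\<close>,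
      since \<open>t n = u 0\<close>.\<close>
    let ?w = "\<lambda>i. if i \<le> n then t i else u (i - n)"
    have t: "t 0 = a" "t n = b" "\<And>i. i < n \<Longrightarrow> t i \<le> t (Suc i)" using p pn by auto
    have u: "u 0 = b" "u m = c" "\<And>i. i < m \<Longrightarrow> u i \<le> u (Suc i)" using q qn by auto
    have w: "?w (n + i) = u i" for i using t u by (cases i) auto
    have "(\<Sum>i<n+m. dist (\<gamma> (?w i)) (\<gamma> (?w (Suc i))))
       = (\<Sum>i<n. dist (\<gamma> (?w i)) (\<gamma> (?w (Suc i)))) + (\<Sum>i<m. dist (\<gamma> (?w (n + i))) (\<gamma> (?w (n + Suc i))))"
      by (simp only: sum.nat_group lessThan_atLeast0 add_Suc_right sum.atLeastLessThan_concat[symmetric, of 0 n "n+m"] le_add1 zero_le sum.atLeastLessThan_shift_0[of _ n "n+m"]) (simp add: add.commute)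
    also have "\<dots> = (\<Sum>i<n. dist (\<gamma> (t i)) (\<gamma> (t (Suc i)))) + (\<Sum>i<m. dist (\<gamma> (u i)) (\<gamma> (u (Suc i))))"
      unfolding w by simp
    finally have "?s p + ?s q = ennreal (\<Sum>i<n+m. dist (\<gamma> (?w i)) (\<gamma> (?w (Suc i))))"
      by (simp add: pn qn sum_nonneg)
    also have "\<dots> \<le> path_variation \<gamma> a c"
    proof (rule path_variation_upper)
      show "?w (n + m) = c" using w u by simp
      fix i assume i: "i < n + m"
      show "?w i \<le> ?w (Suc i)"
      proof (cases "i < n")
        case True then show ?thesis using t by auto
      next
        case False
        then obtain k where "i = n + k" by (metis le_Suc_ex not_less)
        then show ?thesis using w[of k] w[of "Suc k"] u(3)[of k] i by (simp only: add_Suc_right nat_add_left_cancel_less)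
      qed
    qed (use t in auto)
    finally show ?thesis .
  qed
  have "path_variation \<gamma> a b + path_variation \<gamma> b c = (SUP p\<in>?P a b. SUP q\<in>?P b c. ?s p + ?s q)"
    unfolding path_variation_def
    apply (subst ennreal_SUP_add_left[symmetric]) using ne[OF assms(1)] apply simp
    apply (subst ennreal_SUP_add_right[symmetric]) using ne[OF assms(2)] apply auto
    done
  also have "\<dots> \<le> path_variation \<gamma> a c"
    by (intro SUP_least key)
  finally show ?thesis .
qed

lemma path_variation_additive:
  "a \<le> b \<Longrightarrow> b \<le> c \<Longrightarrow> path_variation \<gamma> a c = path_variation \<gamma> a b + path_variation \<gamma> b c"
  by (intro antisym path_variation_subadditive path_variation_superadditive)

text \<open>A partition of the interval from \<open>t\<close> to 1 that nearly attains the variation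
  is clamped at a point \<open>s\<close> close to \<open>t\<close>. Its finitely many clamped steps
  are tiny by continuity of the path, so nearly all of the variation lies beyond \<open>s\<close>,
  and additivity leaves at most \<open>e\<close> before \<open>s\<close>.\<close>

lemma path_variation_right_small:
  assumes \<gamma>: "continuous_on {0..1} \<gamma>" and fin: "path_variation \<gamma> 0 1 < \<infinity>" and t: "0 \<le> t" "t < 1" and e: "0 < e"
  shows "\<exists>s. t < s \<and> s \<le> 1 \<and> path_variation \<gamma> t s \<le> ennreal e"
proof -
  have fin1: "path_variation \<gamma> t 1 < \<infinity>"
    using path_variation_additive[of 0 t 1 \<gamma>] fin t by (auto simp: less_top)
  have "\<exists>n u. u 0 = t \<and> u n = 1 \<and> (\<forall>i<n. u i \<le> u (Suc i)) \<and>
     path_variation \<gamma> t 1 \<le> ennreal (\<Sum>i<n. dist (\<gamma> (u i)) (\<gamma> (u (Suc i)))) + ennreal (e/2)"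
  \<comment> \<open>Subtracting e/2 gives a strictly smaller value only if the variation is
    positive, so the value 0 is treated by the trivial partition.\<close>
  proof (cases "path_variation \<gamma> t 1 = 0")
    case True
    then show ?thesis
      using t by (intro exI[of _ 1] exI[of _ "\<lambda>i. if i = 0 then t else 1"]) auto
  next
    case False
    let ?P = "{(n, u). u 0 = t \<and> u n = 1 \<and> (\<forall>i<n. u i \<le> u (Suc i))}"
    let ?s = "\<lambda>p. ennreal (\<Sum>i<fst p. dist (\<gamma> (snd p i)) (\<gamma> (snd p (Suc i))))"
    have "path_variation \<gamma> t 1 - ennreal (e/2) < path_variation \<gamma> t 1"
      by (rule ennreal_between) (use fin1 e False in \<open>auto simp: zero_less_iff_neq_zero\<close>)
    then have "path_variation \<gamma> t 1 - ennreal (e/2) < (SUP p\<in>?P. ?s p)"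
      by (simp add: path_variation_def)
    then obtain p where p: "p \<in> ?P" "path_variation \<gamma> t 1 - ennreal (e/2) < ?s p"
      unfolding less_SUP_iff by blast
    obtain n u where nu: "p = (n, u)" by (cases p)
    have "path_variation \<gamma> t 1 \<le> ?s p + ennreal (e/2)"
      using less_imp_le[OF p(2)] by (simp add: ennreal_minus_le_iff add.commute)
    then show ?thesis using p(1) nu by auto
  qed
  then obtain n u where u: "u 0 = t" "u n = 1" "\<And>i. i < n \<Longrightarrow> u i \<le> u (Suc i)"
     and v: "path_variation \<gamma> t 1 \<le> ennreal (\<Sum>i<n. dist (\<gamma> (u i)) (\<gamma> (u (Suc i)))) + ennreal (e/2)" by blast
  have ut: "i \<le> n \<Longrightarrow> t \<le> u i" for i using partition_bounds[of n u i] u by auto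
  \<comment> \<open>The \<open>n\<close> steps together contribute at most
    \<open>n * \<tau>\<close>, which is at most e/2; the summand 1 covers
    \<open>n = 0\<close>.\<close>
  define \<tau> where "\<tau> = e / (2 * (real n + 1))"
  have "\<tau> > 0" using e by (simp add: \<tau>_def)
  have "continuous (at t within {0..1}) \<gamma>" using \<gamma> t by (simp add: continuous_on_eq_continuous_within)
  then obtain d where d: "d > 0" "\<And>x. x \<in> {0..1} \<Longrightarrow> dist x t < d \<Longrightarrow> dist (\<gamma> x) (\<gamma> t) < \<tau>/2"
    using \<open>\<tau> > 0\<close> unfolding continuous_within_eps_delta by (meson half_gt_zero)
  define s where "s = min 1 (t + d/2)"
  have s: "t < s" "s \<le> 1" "s < t + d" using t d by (auto simp: s_def)
  have small: "dist (\<gamma> (min (u i) s)) (\<gamma> (min (u (Suc i)) s)) \<le> \<tau>" if "i < n" for i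
  proof -
    have "dist (\<gamma> (min (u j) s)) (\<gamma> t) < \<tau>/2" if "j \<le> n" for j
      by (rule d(2)) (use ut[OF that] s t in \<open>auto simp: min_def dist_real_def\<close>)
    from this[of i] this[of "Suc i"] show ?thesis using that
      dist_triangle_half_l[of "\<gamma> (min (u i) s)" "\<gamma> t" \<tau> "\<gamma> (min (u (Suc i)) s)"] by (simp add: less_imp_le)
  qed
  have "(\<Sum>i<n. dist (\<gamma> (min (u i) s)) (\<gamma> (min (u (Suc i)) s))) \<le> real n * \<tau>"
    using sum_bounded_above[of "{..<n}" _ \<tau>] small by simp
  also have "\<dots> \<le> e/2" using e by (simp add: \<tau>_def field_simps)
  finally have sm: "(\<Sum>i<n. dist (\<gamma> (min (u i) s)) (\<gamma> (min (u (Suc i)) s))) \<le> e/2" .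
  have "path_variation \<gamma> t s + path_variation \<gamma> s 1 = path_variation \<gamma> t 1"
    using path_variation_additive[of t s 1 \<gamma>] s by simp
  also have "\<dots> \<le> ennreal (\<Sum>i<n. dist (\<gamma> (u i)) (\<gamma> (u (Suc i)))) + ennreal (e/2)" by (rule v)
  also have "\<dots> \<le> (ennreal (\<Sum>i<n. dist (\<gamma> (min (u i) s)) (\<gamma> (min (u (Suc i)) s))) + path_variation \<gamma> s 1) + ennreal (e/2)"
    by (intro add_right_mono path_variation_split_le) (use u s in auto)
  also have "\<dots> \<le> (ennreal (e/2) + path_variation \<gamma> s 1) + ennreal (e/2)"
    using sm by (intro add_right_mono ennreal_leI)
  also have "\<dots> = ennreal e + path_variation \<gamma> s 1"
  proof -
    have "ennreal (e/2) + ennreal (e/2) = ennreal e" using e by (subst ennreal_plus[symmetric]) auto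
    then show ?thesis by (metis add.assoc add.commute)
  qed
  finally have "path_variation \<gamma> t s + path_variation \<gamma> s 1 \<le> ennreal e + path_variation \<gamma> s 1" .
  moreover have "path_variation \<gamma> s 1 < \<infinity>"
    using path_variation_additive[of t s 1 \<gamma>] fin1 s by (auto simp: less_top)
  ultimately have "path_variation \<gamma> t s \<le> ennreal e" by (auto simp: ennreal_add_left_cancel_le add.commute)
  with s show ?thesis by blast
qed

lemma length_fun_diff:
  assumes fin: "path_variation \<gamma> 0 1 < \<infinity>" and "0 \<le> a" "a \<le> b" "b \<le> 1"
  shows "length_fun \<gamma> a \<le> length_fun \<gamma> b" "ennreal (length_fun \<gamma> b - length_fun \<gamma> a) = path_variation \<gamma> a b"
proof -
  have add: "path_variation \<gamma> 0 b = path_variation \<gamma> 0 a + path_variation \<gamma> a b"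
    by (rule path_variation_additive) (use assms in auto)
  have "path_variation \<gamma> 0 b < \<infinity>"
    using path_variation_additive[of 0 b 1 \<gamma>] assms by (auto simp: less_top)
  then have f: "path_variation \<gamma> 0 a < \<infinity>" "path_variation \<gamma> a b < \<infinity>" using add by (auto simp: less_top)
  have l: "length_fun \<gamma> b = enn2real (path_variation \<gamma> 0 b)" "length_fun \<gamma> a = enn2real (path_variation \<gamma> 0 a)"
    using assms by (auto simp: length_fun_def)
  have "length_fun \<gamma> b = length_fun \<gamma> a + enn2real (path_variation \<gamma> a b)"
    unfolding l add using f by (simp add: enn2real_plus)
  then show "length_fun \<gamma> a \<le> length_fun \<gamma> b" "ennreal (length_fun \<gamma> b - length_fun \<gamma> a) = path_variation \<gamma> a b"
    using f by (auto simp: ennreal_enn2real)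
qed

lemma length_fun_clamp: "length_fun \<gamma> t = length_fun \<gamma> (max 0 (min 1 t))"
  by (simp add: length_fun_def)

lemma length_fun_mono:
  assumes "path_variation \<gamma> 0 1 < \<infinity>" "a \<le> b"
  shows "length_fun \<gamma> a \<le> length_fun \<gamma> b"
  using length_fun_diff(1)[OF assms(1), of "max 0 (min 1 a)" "max 0 (min 1 b)"] assms(2)
  by (subst (1 2) length_fun_clamp) auto

text \<open>\<open>interval_measure\<close> is known to give half-open intervals the increment of
  its generating function when that function is monotone and right continuous; this is the second
  condition for arc length.\<close>

lemma length_fun_right_continuous:
  assumes \<gamma>: "continuous_on {0..1} \<gamma>" and fin: "path_variation \<gamma> 0 1 < \<infinity>"
  shows "continuous (at_right a) (length_fun \<gamma>)"
proof -
  have "\<exists>s>a. \<forall>x. a < x \<and> x < s \<longrightarrow> \<bar>length_fun \<gamma> x - length_fun \<gamma> a\<bar> \<le> e" if "e > 0" for e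
  proof (cases "0 \<le> a \<and> a < 1")
    case True
    then obtain s where s: "a < s" "s \<le> 1" "path_variation \<gamma> a s \<le> ennreal e"
      using path_variation_right_small[OF \<gamma> fin, of a e] \<open>e > 0\<close> by auto
    have "ennreal (length_fun \<gamma> s - length_fun \<gamma> a) \<le> ennreal e"
      using length_fun_diff(2)[OF fin, of a s] True s by simp
    then have "length_fun \<gamma> s - length_fun \<gamma> a \<le> e"
      using that by (simp add: ennreal_le_iff)
    then have "\<bar>length_fun \<gamma> x - length_fun \<gamma> a\<bar> \<le> e" if "a < x" "x < s" for x
      using length_fun_mono[OF fin, of a x] length_fun_mono[OF fin, of x s] that by auto
    then show ?thesis using s by blast
  next
    case False
    \<comment> \<open>Left of 0 and from 1 on, clamping makes the length function constant on an
      interval to the right of \<open>a\<close>.\<close>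
    have "\<bar>length_fun \<gamma> x - length_fun \<gamma> a\<bar> \<le> e" if "a < x" "x < (if a < 0 then 0 else a + 1)" for x
    proof -
      have "max 0 (min 1 x) = max 0 (min 1 a)" using that False by (auto split: if_splits simp: min_def max_def)
      then show ?thesis using \<open>e > 0\<close> by (subst (1 2) length_fun_clamp) simp
    qed
    then show ?thesis by (intro exI[of _ "if a < 0 then 0 else a + 1"]) (auto split: if_splits)
  qed
  note * = this
  show ?thesis
    unfolding continuous_within tendsto_iff
  proof (intro allI impI)
    fix e :: real assume "e > 0"
    then obtain s where "s > a" "\<forall>x. a < x \<and> x < s \<longrightarrow> \<bar>length_fun \<gamma> x - length_fun \<gamma> a\<bar> \<le> e/2"
      using *[of "e/2"] by auto
    then show "\<forall>\<^sub>F x in at_right a. dist (length_fun \<gamma> x) (length_fun \<gamma> a) < e"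
      unfolding eventually_at_right_field dist_real_def using \<open>e > 0\<close> by (intro exI[of _ s]) fastforce
  qed
qed

lemma emeasure_length_measure_ge:
  assumes "loc_rectifiable \<gamma>" "0 \<le> a" "a \<le> b" "b \<le> 1"
  shows "ennreal (dist (\<gamma> a) (\<gamma> b)) \<le> emeasure (interval_measure (length_fun \<gamma>)) {a<..b}"
proof -
  have fin: "path_variation \<gamma> 0 1 < \<infinity>" and \<gamma>: "continuous_on {0..1} \<gamma>"
    using assms by (auto simp: loc_rectifiable_def path_def)
  have "emeasure (interval_measure (length_fun \<gamma>)) {a<..b} = ennreal (length_fun \<gamma> b - length_fun \<gamma> a)"
    by (rule emeasure_interval_measure_Ioc[OF \<open>a \<le> b\<close> length_fun_mono[OF fin] length_fun_right_continuous[OF \<gamma> fin]])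
  then show ?thesis using dist_le_path_variation[of a b \<gamma>] length_fun_diff(2)[OF fin assms(2-)] assms by simp
qed

text \<open>Half-open intervals add up without overlap, so an estimate on short intervals sums to
  one on every interval. Steps of length \<delta>/2 stay within the strict bound \<delta>.\<close>

lemma norm_diff_le_emeasure_Ioc:
  fixes \<Psi> :: "real \<Rightarrow> 'b::real_normed_vector" and \<nu> :: "real measure"
  assumes sets: "sets \<nu> = sets borel" and "\<delta> > 0"
    and loc: "\<And>s t. a \<le> s \<Longrightarrow> s \<le> t \<Longrightarrow> t \<le> b \<Longrightarrow> t - s < \<delta> \<Longrightarrow> ennreal (norm (\<Psi> t - \<Psi> s)) \<le> emeasure \<nu> {s<..t}"
    and "a \<le> b"
  shows "ennreal (norm (\<Psi> b - \<Psi> a)) \<le> emeasure \<nu> {a<..b}"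
proof -
  have step: "\<forall>t. a \<le> t \<and> t \<le> b \<and> t - a \<le> real n * (\<delta>/2) \<longrightarrow> ennreal (norm (\<Psi> t - \<Psi> a)) \<le> emeasure \<nu> {a<..t}" for n
  proof (induction n)
    case 0 then show ?case by auto
  next
    case (Suc n)
    show ?case
    proof (intro allI impI)
      fix t assume t: "a \<le> t \<and> t \<le> b \<and> t - a \<le> real (Suc n) * (\<delta>/2)"
      define s where "s = max a (t - \<delta>/2)"
      have s: "a \<le> s" "s \<le> t" "t \<le> b" "t - s < \<delta>" using t \<open>\<delta> > 0\<close> by (auto simp: s_def)
      have "s - a \<le> real n * (\<delta>/2)" using t \<open>\<delta> > 0\<close> by (auto simp: s_def field_simps max_def)
      then have "ennreal (norm (\<Psi> s - \<Psi> a)) \<le> emeasure \<nu> {a<..s}" using Suc s by auto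
      moreover have "ennreal (norm (\<Psi> t - \<Psi> s)) \<le> emeasure \<nu> {s<..t}" by (rule loc) (use s in auto)
      moreover have "emeasure \<nu> {a<..t} = emeasure \<nu> {a<..s} + emeasure \<nu> {s<..t}"
        by (subst plus_emeasure) (use s sets in \<open>auto simp: ivl_disj_un\<close>)
      moreover have "ennreal (norm (\<Psi> t - \<Psi> a)) \<le> ennreal (norm (\<Psi> s - \<Psi> a)) + ennreal (norm (\<Psi> t - \<Psi> s))"
        using norm_triangle_ineq[of "\<Psi> s - \<Psi> a" "\<Psi> t - \<Psi> s"]
        by (simp add: ennreal_plus[symmetric] del: ennreal_plus)
      ultimately show "ennreal (norm (\<Psi> t - \<Psi> a)) \<le> emeasure \<nu> {a<..t}"
        by (metis add_mono order_trans)
    qed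
  qed
  obtain n where "(b - a) / (\<delta>/2) \<le> real n" using real_arch_simple by blast
  then have "b - a \<le> real n * (\<delta>/2)" using \<open>\<delta> > 0\<close> by (simp add: field_simps)
  then show ?thesis using step[of n] \<open>a \<le> b\<close> by auto
qed

lemma borel_measurable_on_path:
  fixes H :: "R2 \<Rightarrow> ennreal"
  assumes "continuous_on {0..1} \<gamma>" "H \<in> borel_measurable borel"
  shows "(\<lambda>t. H (\<gamma> t) * indicator {0..1::real} t) \<in> borel_measurable borel"
proof -
  have "\<gamma> \<in> borel_measurable (restrict_space borel {0..1})"
    by (rule borel_measurable_continuous_on_restrict[OF assms(1)])
  then have "(\<lambda>t. H (\<gamma> t)) \<in> borel_measurable (restrict_space borel {0..1})"
    using assms(2) by (rule measurable_compose)
  then show ?thesis by (subst (asm) borel_measurable_restrict_space_iff_ennreal) auto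
qed

text \<open>The local hypothesis lets \<open>u\<close>, the parameter at which \<open>H\<close> is
  evaluated, vary independently of \<open>s\<close> and \<open>t\<close>. Hence the difference
  quotient of \<Phi> is a constant lower bound for \<open>H\<close> on the whole short piece, and
  the length measure of that piece is at least the chord.\<close>

lemma norm_diff_le_line_integral:
  fixes \<Phi> :: "R2 \<Rightarrow> 'b::real_normed_vector"
  assumes rect: "loc_rectifiable \<gamma>" and H: "H \<in> borel_measurable borel" and "\<kappa> > 0"
    and loc: "\<And>s t u. \<lbrakk>s \<in> {0..1}; t \<in> {0..1}; u \<in> {0..1}; dist (\<gamma> s) (\<gamma> t) < \<kappa>; dist (\<gamma> s) (\<gamma> u) < \<kappa>\<rbrakk>
        \<Longrightarrow> ennreal (norm (\<Phi> (\<gamma> t) - \<Phi> (\<gamma> s))) \<le> ennreal (dist (\<gamma> s) (\<gamma> t)) * H (\<gamma> u)"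
    and ab: "0 \<le> a" "a \<le> b" "b \<le> 1"
  shows "ennreal (norm (\<Phi> (\<gamma> b) - \<Phi> (\<gamma> a)))
     \<le> (\<integral>\<^sup>+ t\<in>{a<..b}. H (\<gamma> t) * indicator {0..1} t \<partial>interval_measure (length_fun \<gamma>))"
proof -
  let ?\<mu> = "interval_measure (length_fun \<gamma>)"
  define \<nu> where "\<nu> = density ?\<mu> (\<lambda>t. H (\<gamma> t) * indicator {0..1} t)"
  have \<gamma>: "continuous_on {0..1} \<gamma>" using rect by (auto simp: loc_rectifiable_def path_def)
  have meas: "(\<lambda>t. H (\<gamma> t) * indicator {0..1::real} t) \<in> borel_measurable ?\<mu>"
    using borel_measurable_on_path[OF \<gamma> H] unfolding measurable_cong_sets[OF sets_interval_measure refl] .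
  have em: "emeasure \<nu> {s<..t} = (\<integral>\<^sup>+ t\<in>{s<..t}. H (\<gamma> t) * indicator {0..1} t \<partial>?\<mu>)" for s t
    unfolding \<nu>_def by (rule emeasure_density) (use meas in auto)
  have "uniformly_continuous_on {0..1} \<gamma>" by (rule compact_uniformly_continuous[OF \<gamma>]) simp
  then obtain \<delta> where \<delta>: "\<delta> > 0" "\<And>s t. s \<in> {0..1} \<Longrightarrow> t \<in> {0..1} \<Longrightarrow> dist t s < \<delta> \<Longrightarrow> dist (\<gamma> t) (\<gamma> s) < \<kappa>"
    unfolding uniformly_continuous_on_def using \<open>\<kappa> > 0\<close> by blast
  have "ennreal (norm (\<Phi> (\<gamma> b) - \<Phi> (\<gamma> a))) \<le> emeasure \<nu> {a<..b}"
  proof (rule norm_diff_le_emeasure_Ioc[where \<Psi> = "\<lambda>t. \<Phi> (\<gamma> t)" and \<delta> = \<delta>])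
    show "sets \<nu> = sets borel" by (simp add: \<nu>_def)
    fix s t assume st: "a \<le> s" "s \<le> t" "t \<le> b" "t - s < \<delta>"
    show "ennreal (norm (\<Phi> (\<gamma> t) - \<Phi> (\<gamma> s))) \<le> emeasure \<nu> {s<..t}"
    proof (cases "s = t")
      case False
      define c where "c = ennreal (norm (\<Phi> (\<gamma> t) - \<Phi> (\<gamma> s)))"
      define d where "d = dist (\<gamma> s) (\<gamma> t)"
      have close: "dist (\<gamma> s) (\<gamma> u) < \<kappa>" if "u \<in> {s<..t}" for u
        using \<delta>(2)[of u s] that st ab by (auto simp: dist_real_def)
      have cH: "c \<le> ennreal d * H (\<gamma> u)" if "u \<in> {s<..t}" for u
        unfolding c_def d_def by (rule loc) (use that st ab close[of t] close[OF that] False in auto)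
      show ?thesis
      \<comment> \<open>For coinciding endpoints the hypothesis reads \<open>c \<le> 0 * H\<close>,
        and the product is 0 even where \<open>H\<close> is infinite.\<close>
      proof (cases "d = 0")
        case True
        then show ?thesis using cH[of t] False st by (simp add: c_def)
      next
        case dn: False
        then have "d > 0" by (simp add: d_def)
        have "c / ennreal d \<le> H (\<gamma> u)" if "u \<in> {s<..t}" for u
          using cH[OF that] \<open>d > 0\<close> by (simp add: divide_le_posI_ennreal mult.commute)
        then have "(\<integral>\<^sup>+ u. c / ennreal d * indicator {s<..t} u \<partial>?\<mu>) \<le> (\<integral>\<^sup>+ u\<in>{s<..t}. H (\<gamma> u) * indicator {0..1} u \<partial>?\<mu>)"
          using st ab by (intro nn_integral_mono) (auto simp: indicator_def)
        also have "(\<integral>\<^sup>+ u. c / ennreal d * indicator {s<..t} u \<partial>?\<mu>) = c / ennreal d * emeasure ?\<mu> {s<..t}"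
          by (rule nn_integral_cmult_indicator) auto
        finally have "c / ennreal d * emeasure ?\<mu> {s<..t} \<le> emeasure \<nu> {s<..t}" unfolding em .
        moreover have "c / ennreal d * ennreal d \<le> c / ennreal d * emeasure ?\<mu> {s<..t}"
          using emeasure_length_measure_ge[OF rect, of s t] st ab by (intro mult_left_mono) (auto simp: d_def)
        moreover have "c / ennreal d * ennreal d = c"
          using \<open>d > 0\<close> by (simp add: ennreal_divide_times mult_divide_eq_ennreal)
        ultimately show ?thesis by (simp add: c_def)
      qed
    qed simp
  qed (use \<delta> ab in auto)
  then show ?thesis unfolding em .
qed

text \<open>Take the first time \<open>t\<close> at which \<open>r\<close> reaches \<open>d\<close>
  and the last time \<open>s\<close> before \<open>t\<close> at which \<open>r\<close> is at most
  \<open>c\<close>. Between them \<open>r\<close> stays strictly inside, and the increment across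
  this open time interval is at least \<open>d - c\<close>.\<close>

lemma emeasure_Ioo_le_crossing:
  fixes r :: "real \<Rightarrow> real" and \<nu> :: "real measure"
  assumes sets: "sets \<nu> = sets borel"
    and r: "continuous_on {0..1} r"
    and loc: "\<And>s t. 0 \<le> s \<Longrightarrow> s \<le> t \<Longrightarrow> t \<le> 1 \<Longrightarrow> ennreal \<bar>r t - r s\<bar> \<le> emeasure \<nu> {s<..t}"
    and cd: "c < d" "r 0 \<le> c" "d \<le> r 1"
  shows "ennreal (d - c) \<le> emeasure \<nu> {t\<in>{0..1}. c < r t \<and> r t < d}"
proof -
  let ?T = "{t\<in>{0..1}. d \<le> r t}"
  have "?T = {0..1} \<inter> r -` {d..}" by auto
  then have "compact ?T"
    using continuous_closed_preimage[OF r closed_atLeastAtMost closed_atLeast[of d]] bounded_subset[OF bounded_closed_interval[of 0 "1::real"]]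
    by (simp add: compact_eq_bounded_closed)
  moreover have "1 \<in> ?T" using cd by auto
  then have "?T \<noteq> {}" by blast
  ultimately obtain t where t: "t \<in> ?T" "\<And>x. x \<in> ?T \<Longrightarrow> t \<le> x"
    using compact_attains_inf[of ?T] by blast
  let ?S = "{s\<in>{0..t}. r s \<le> c}"
  have rt: "continuous_on {0..t} r" using r t by (auto intro: continuous_on_subset)
  have "?S = {0..t} \<inter> r -` {..c}" by auto
  then have "compact ?S"
    using continuous_closed_preimage[OF rt closed_atLeastAtMost closed_atMost[of c]] bounded_subset[OF bounded_closed_interval[of 0 t]]
    by (simp add: compact_eq_bounded_closed)
  moreover have "0 \<in> ?S" using cd t by auto
  then have "?S \<noteq> {}" by blast
  ultimately obtain s where s: "s \<in> ?S" "\<And>x. x \<in> ?S \<Longrightarrow> x \<le> s"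
    using compact_attains_sup[of ?S] by blast
  have "s < t" using s t cd by (cases "s = t") auto
  have sub: "{s<..<t} \<subseteq> {t\<in>{0..1}. c < r t \<and> r t < d}"
  proof
    fix x assume x: "x \<in> {s<..<t}"
    have "x \<notin> ?S" "x \<notin> ?T" using s(2)[of x] t(2)[of x] x by auto
    then show "x \<in> {t\<in>{0..1}. c < r t \<and> r t < d}" using x s(1) t(1) by auto
  qed
  have M: "{t\<in>{0..1}. c < r t \<and> r t < d} \<in> sets borel"
  proof -
    have "r -` {c<..<d} \<inter> {0..1} \<in> sets borel"
      using measurable_sets[OF borel_measurable_continuous_on_restrict[OF r], of "{c<..<d}"]
      by (auto simp: sets_restrict_space_iff space_restrict_space)
    moreover have "{t\<in>{0..1}. c < r t \<and> r t < d} = r -` {c<..<d} \<inter> {0..1}" by auto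
    ultimately show ?thesis by simp
  qed
  \<comment> \<open>The hypothesis controls half-open intervals, whose right endpoint
    \<open>t\<close> is outside the set because \<open>r t \<ge> d\<close>. A left limit at
    \<open>t\<close> gives the estimate for the open interval, so that an atom of \<nu> at
    \<open>t\<close> is not counted.\<close>
  have "((\<lambda>x. ennreal (r x - r s)) \<longlongrightarrow> ennreal (r t - r s)) (at t within {0..1})"
    using r t by (intro tendsto_ennrealI tendsto_diff tendsto_const) (auto simp: continuous_on_def)
  then have lim: "((\<lambda>x. ennreal (r x - r s)) \<longlongrightarrow> ennreal (r t - r s)) (at_left t)"
    using at_within_Icc_at_left[of 0 t] tendsto_within_subset[of _ _ t "{0..1}" "{0..t}"] \<open>s < t\<close> s t by auto
  have "ennreal (d - c) \<le> ennreal (r t - r s)" using s t by (intro ennreal_leI) auto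
  also have "\<dots> \<le> emeasure \<nu> {s<..<t}"
  proof (rule tendsto_upperbound[OF lim])
    have "eventually (\<lambda>x. s < x \<and> x < t) (at_left t)"
      using \<open>s < t\<close> by (auto simp: eventually_at_left_field intro: exI[of _ s])
    then show "\<forall>\<^sub>F x in at_left t. ennreal (r x - r s) \<le> emeasure \<nu> {s<..<t}"
    proof eventually_elim
      case (elim x)
      have "ennreal (r x - r s) \<le> ennreal \<bar>r x - r s\<bar>" by (intro ennreal_leI) auto
      also have "\<dots> \<le> emeasure \<nu> {s<..x}" by (rule loc) (use elim s t in auto)
      also have "\<dots> \<le> emeasure \<nu> {s<..<t}" by (rule emeasure_mono) (use elim sets in auto)
      finally show ?case .
    qed
  qed simp
  also have "\<dots> \<le> emeasure \<nu> {t\<in>{0..1}. c < r t \<and> r t < d}"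
    by (rule emeasure_mono[OF sub]) (use M sets in auto)
  finally show ?thesis .
qed

lemma open_bounded_real_countable_Ioo:
  fixes U :: "real set"
  assumes "open U" "bounded U"
  obtains I where "countable I" "\<And>p. p \<in> I \<Longrightarrow> fst p < snd p \<and> {fst p<..<snd p} \<subseteq> U"
     "disjoint_family_on (\<lambda>p. {fst p<..<snd p}) I" "U = (\<Union>p\<in>I. {fst p<..<snd p})"
proof -
  have "\<exists>a b. a < b \<and> C = {a<..<b}" if "C \<in> components U" for C
  proof -
    have "open C" "connected C" "C \<noteq> {}" "bounded C"
      using open_components[OF assms(1) that] in_components_connected[OF that] in_components_nonempty[OF that]
        bounded_subset[OF assms(2) in_components_subset[OF that]] by auto
    then have "is_interval C" by (simp add: is_interval_connected_1)
    define a b where "a = Inf C" and "b = Sup C"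
    have bd: "bdd_above C" "bdd_below C" using \<open>bounded C\<close> bounded_imp_bdd_above bounded_imp_bdd_below by auto
    have "C = {a<..<b}"
    proof (intro set_eqI iffI)
      fix x assume "x \<in> C"
      then obtain e where e: "e > 0" "ball x e \<subseteq> C" using \<open>open C\<close> openE by blast
      then have "x - e/2 \<in> C" "x + e/2 \<in> C" by (auto simp: dist_real_def subset_iff)
      then have "a \<le> x - e/2" "x + e/2 \<le> b" using bd unfolding a_def b_def by (auto intro: cInf_lower cSup_upper)
      then show "x \<in> {a<..<b}" using e by auto
    next
      fix x assume "x \<in> {a<..<b}"
      then obtain y z where "y \<in> C" "z \<in> C" "y < x" "x < z" 
        unfolding a_def b_def using bd \<open>C \<noteq> {}\<close> by (auto simp: cInf_less_iff less_cSup_iff)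
      then show "x \<in> C" using \<open>is_interval C\<close> unfolding is_interval_1 by (meson less_imp_le)
    qed
    then show ?thesis using \<open>C \<noteq> {}\<close> by (metis greaterThanLessThan_empty_iff not_less)
  qed
  then obtain A B where AB: "\<And>C. C \<in> components U \<Longrightarrow> A C < B C \<and> C = {A C<..<B C}" by metis
  let ?I = "(\<lambda>C. (A C, B C)) ` components U"
  have dis: "disjoint (components U)"
    by (meson components_eq disjoint_def in_components_nonempty)
  show thesis
  proof (rule that[of ?I])
    show "countable ?I"
      using countable_disjoint_open_subsets[of "components U"] dis open_components[OF assms(1)] by simp
    show "\<And>p. p \<in> ?I \<Longrightarrow> fst p < snd p \<and> {fst p<..<snd p} \<subseteq> U"
      using AB in_components_subset by force
    show "disjoint_family_on (\<lambda>p. {fst p<..<snd p}) ?I"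
      unfolding disjoint_family_on_def
    proof (intro ballI impI)
      fix p q assume "p \<in> ?I" "q \<in> ?I" "p \<noteq> q"
      then obtain C C' where "C \<in> components U" "C' \<in> components U" "p = (A C, B C)" "q = (A C', B C')" "C \<noteq> C'" by auto
      then show "{fst p<..<snd p} \<inter> {fst q<..<snd q} = {}"
        using AB[of C] AB[of C'] components_nonoverlap[of C U C'] by auto
    qed
    have "U = \<Union> (components U)" by (simp add: Union_components)
    also have "\<dots> = (\<Union>p\<in>?I. {fst p<..<snd p})" using AB by auto
    finally show "U = (\<Union>p\<in>?I. {fst p<..<snd p})" .
  qed
qed

text \<open>The image under \<open>r\<close> of \<nu> on the unit interval dominates Lebesgue
  measure between \<open>c\<close> and \<open>d\<close>: on intervals by a single crossing, then on
  open sets by countable additivity, then on Borel sets by outer regularity, for which the total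
  mass is finite. The function \<open>r\<close> may go back and forth.\<close>

lemma nn_integral_Ioo_le_crossing:
  fixes r :: "real \<Rightarrow> real" and \<nu> :: "real measure"
  assumes sets: "sets \<nu> = sets borel" and fin: "emeasure \<nu> UNIV < \<infinity>"
    and r: "continuous_on {0..1} r"
    and loc: "\<And>s t. 0 \<le> s \<Longrightarrow> s \<le> t \<Longrightarrow> t \<le> 1 \<Longrightarrow> ennreal \<bar>r t - r s\<bar> \<le> emeasure \<nu> {s<..t}"
    and cd: "c < d" "r 0 \<le> c" "d \<le> r 1"
    and h: "h \<in> borel_measurable borel"
  shows "(\<integral>\<^sup>+ x\<in>{c<..<d}. h x \<partial>lborel) \<le> (\<integral>\<^sup>+ t. h (r t) * indicator {c<..<d} (r t) * indicator {0..1} t \<partial>\<nu>)"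
proof -
  \<comment> \<open>Clamping the argument extends \<open>r\<close> to a continuous function on the
    whole line, of which a push-forward can be taken.\<close>
  define r' where "r' t = r (max 0 (min 1 t))" for t
  have r': "r' \<in> borel_measurable borel"
    unfolding r'_def by (intro borel_measurable_continuous_onI continuous_on_compose2[OF r] continuous_intros) auto
  have r'': "r' \<in> borel_measurable \<nu>" using r' unfolding measurable_cong_sets[OF sets refl] .
  define N where "N = distr (density \<nu> (indicator {0..1})) borel r'"
  have Nm: "r' \<in> borel_measurable (density \<nu> (indicator {0..1}))" using r'' by simp
  have sN: "sets N = sets borel" by (simp add: N_def)
  have eN: "emeasure N B = emeasure \<nu> {t\<in>{0..1}. r t \<in> B}" if "B \<in> sets borel" for B
  proof -
    have eq: "{0..1} \<inter> (r' -` B \<inter> space \<nu>) = {t\<in>{0..1}. r t \<in> B}"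
      using sets_eq_imp_space_eq[OF sets] by (auto simp: r'_def)
    have M: "r' -` B \<inter> space \<nu> \<in> sets \<nu>" using r'' that by (rule measurable_sets)
    have "emeasure N B = emeasure (density \<nu> (indicator {0..1})) (r' -` B \<inter> space \<nu>)"
      unfolding N_def by (subst emeasure_distr[OF Nm]) (use that in auto)
    also have "\<dots> = emeasure \<nu> ({0..1} \<inter> (r' -` B \<inter> space \<nu>))"
      by (rule emeasure_restricted) (use M sets in auto)
    finally show ?thesis unfolding eq .
  qed
  have finN: "emeasure N (space N) \<noteq> \<infinity>"
  proof -
    have "emeasure N (space N) \<le> emeasure \<nu> UNIV"
      using eN[of UNIV] sets_eq_imp_space_eq[OF sN] by (auto intro!: emeasure_mono simp: sets)
    then show ?thesis using fin by (auto simp: top_unique)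
  qed
  have opn: "emeasure lborel U \<le> emeasure N U" if U: "open U" "U \<subseteq> {c<..<d}" for U
  proof -
    have "bounded U" by (rule bounded_subset[OF _ U(2)]) (rule bounded_Ioo)
    obtain I where I: "countable I" "\<And>p. p \<in> I \<Longrightarrow> fst p < snd p \<and> {fst p<..<snd p} \<subseteq> U"
      "disjoint_family_on (\<lambda>p. {fst p<..<snd p}) I" "U = (\<Union>p\<in>I. {fst p<..<snd p})"
      by (rule open_bounded_real_countable_Ioo[OF U(1) \<open>bounded U\<close>]) (rule that)
    have "emeasure lborel U = (\<integral>\<^sup>+ p. emeasure lborel {fst p<..<snd p} \<partial>count_space I)"
      unfolding I(4)[THEN arg_cong[where f="emeasure lborel"]]
      by (rule emeasure_UN_countable) (use I(1-3) in auto)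
    also have "\<dots> \<le> (\<integral>\<^sup>+ p. emeasure N {fst p<..<snd p} \<partial>count_space I)"
    proof (rule nn_integral_mono)
      fix p assume "p \<in> space (count_space I)"
      then have p: "fst p < snd p" "{fst p<..<snd p} \<subseteq> {c<..<d}" using I(2)[of p] U by auto
      then have p2: "c \<le> fst p" "snd p \<le> d" by (auto simp: greaterThanLessThan_subseteq_greaterThanLessThan)
      have "emeasure lborel {fst p<..<snd p} = ennreal (snd p - fst p)" using p by simp
      also have "\<dots> \<le> emeasure \<nu> {t \<in> {0..1}. fst p < r t \<and> r t < snd p}"
        by (rule emeasure_Ioo_le_crossing[OF sets r loc]) (use p p2 cd in auto)
      also have "\<dots> = emeasure N {fst p<..<snd p}" by (subst eN) auto
      finally show "emeasure lborel {fst p<..<snd p} \<le> emeasure N {fst p<..<snd p}" .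
    qed
    also have "\<dots> = emeasure N U"
      unfolding I(4)[THEN arg_cong[where f="emeasure N"]]
      by (rule emeasure_UN_countable[symmetric]) (use I(1-3) sN in auto)
    finally show ?thesis .
  qed
  have le: "emeasure (density lborel (indicator {c<..<d})) B \<le> emeasure N B" if B: "B \<in> sets borel" for B
  proof -
    have "emeasure (density lborel (indicator {c<..<d})) B = emeasure lborel ({c<..<d} \<inter> B)"
      by (rule emeasure_restricted) (use B in auto)
    also have "\<dots> \<le> emeasure N B"
      unfolding outer_regular[OF sN finN B]
    proof (rule INF_greatest)
      fix U assume "U \<in> {U. B \<subseteq> U \<and> open U}"
      then have U: "B \<subseteq> U" "open U" by auto
      have "emeasure lborel ({c<..<d} \<inter> B) \<le> emeasure lborel ({c<..<d} \<inter> U)"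
        by (rule emeasure_mono) (use U in auto)
      also have "\<dots> \<le> emeasure N ({c<..<d} \<inter> U)" by (rule opn) (use U in auto)
      also have "\<dots> \<le> emeasure N U" by (rule emeasure_mono) (use U sN in auto)
      finally show "emeasure lborel ({c<..<d} \<inter> B) \<le> emeasure N U" .
    qed
    finally show ?thesis .
  qed
  have h': "(\<lambda>x. h x * indicator {c<..<d} x) \<in> borel_measurable borel" using h by measurable
  have "(\<integral>\<^sup>+ x\<in>{c<..<d}. h x \<partial>lborel) = (\<integral>\<^sup>+ x. h x * indicator {c<..<d} x \<partial>density lborel (indicator {c<..<d}))"
    using h by (subst nn_integral_density) (auto intro!: nn_integral_cong simp: indicator_def)
  also have "\<dots> \<le> (\<integral>\<^sup>+ x. h x * indicator {c<..<d} x \<partial>N)"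
  proof (rule nn_integral_mono_measure)
    show "density lborel (indicator {c<..<d}) \<le> N"
    proof -
      have sp: "space (density lborel (indicator {c<..<d})) = space N"
        using sets_eq_imp_space_eq[OF sN] by simp
      have "emeasure (density lborel (indicator {c<..<d})) B \<le> emeasure N B" for B
        using le[of B] by (cases "B \<in> sets borel") (simp_all add: emeasure_notin_sets)
      then show ?thesis unfolding le_measure_iff using sp sN by (simp add: le_fun_def)
    qed
  qed (use sN in simp)
  also have "\<dots> = (\<integral>\<^sup>+ t. h (r' t) * indicator {c<..<d} (r' t) \<partial>density \<nu> (indicator {0..1}))"
    unfolding N_def by (rule nn_integral_distr[OF Nm]) (use h' in simp)
  also have "\<dots> = (\<integral>\<^sup>+ t. indicator {0..1} t * (h (r' t) * indicator {c<..<d} (r' t)) \<partial>\<nu>)"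
  proof (rule nn_integral_density)
    have "(\<lambda>t. h (r' t) * indicator {c<..<d} (r' t)) \<in> borel_measurable borel"
      by (rule measurable_compose[OF r' h'])
    then show "(\<lambda>t. h (r' t) * indicator {c<..<d} (r' t)) \<in> borel_measurable \<nu>"
      unfolding measurable_cong_sets[OF sets refl] .
    show "indicator {0..1} \<in> borel_measurable \<nu>"
      unfolding measurable_cong_sets[OF sets refl] by measurable
  qed
  also have "\<dots> = (\<integral>\<^sup>+ t. h (r t) * indicator {c<..<d} (r t) * indicator {0..1} t \<partial>\<nu>)"
    by (rule nn_integral_cong) (auto simp: r'_def indicator_def)
  finally show ?thesis .
qed

section \<open>Orthonormal frames of the plane\<close>

lemma prod_Basis_R2:
  fixes l u :: R2
  shows "(\<Prod>b\<in>Basis. (u - l) \<bullet> b) = (u$1 - l$1) * (u$2 - l$2)"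
proof -
  have B: "(Basis :: R2 set) = {axis 1 1, axis 2 1}"
    by (auto simp: Basis_vec_def UNIV_2)
  have "(axis 1 1 :: R2) \<noteq> axis 2 1" by (simp add: axis_eq_axis)
  then show ?thesis unfolding B by (simp add: inner_axis)
qed

lemma continuous_on_vector2:
  "continuous_on UNIV (\<lambda>p::real\<times>real. vector [fst p, snd p] :: R2)"
proof -
  have eq: "(\<lambda>p::real\<times>real. vector [fst p, snd p] :: R2) = (\<lambda>p. \<chi> i. if i = 1 then fst p else snd p)"
    by (auto simp: vec_eq_iff forall_2)
  have "continuous_on UNIV (\<lambda>x::real\<times>real. if i = (1::2) then fst x else snd x)" for i
    by (cases "i = 1") (auto intro: continuous_intros)
  then show ?thesis unfolding eq by (rule continuous_on_vec_lambda)
qed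

text \<open>Fubini is available for the product of two lines; agreement on boxes carries it over to
  \<open>real ^ 2\<close>.\<close>

lemma distr_lborel_vector2: "distr (lborel :: (real \<times> real) measure) borel (\<lambda>p. vector [fst p, snd p]) = (lborel :: R2 measure)"
proof (rule lborel_eqI[symmetric])
  have m: "(\<lambda>p::real\<times>real. vector [fst p, snd p] :: R2) \<in> borel_measurable lborel"
    using continuous_on_vector2 by (simp add: borel_measurable_continuous_onI)
  fix l u :: R2
  assume lu: "\<And>b. b \<in> Basis \<Longrightarrow> l \<bullet> b \<le> u \<bullet> b"
  have "l $ i \<le> u $ i" for i using lu[of "axis i 1"] by (simp add: inner_axis)
  then have le: "l $ 1 \<le> u $ 1" "l $ 2 \<le> u $ 2" by auto
  have pre: "(\<lambda>p::real\<times>real. vector [fst p, snd p] :: R2) -` box l u \<inter> space lborel = {l$1<..<u$1} \<times> {l$2<..<u$2}"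
    by (auto simp: mem_box_cart forall_2)
  have "emeasure (distr lborel borel (\<lambda>p::real\<times>real. vector [fst p, snd p] :: R2)) (box l u)
      = emeasure (lborel \<Otimes>\<^sub>M lborel) ({l$1<..<u$1} \<times> {l$2<..<u$2})"
    by (subst emeasure_distr[OF m]) (auto simp: pre[simplified] lborel_prod)
  also have "\<dots> = emeasure lborel {l$1<..<u$1} * emeasure lborel {l$2<..<u$2}"
    by (rule lborel.emeasure_pair_measure_Times) auto
  also have "\<dots> = ennreal ((u$1 - l$1) * (u$2 - l$2))"
    using le by (simp add: ennreal_mult)
  also have "\<dots> = ennreal (\<Prod>b\<in>Basis. (u - l) \<bullet> b)"
    by (simp only: prod_Basis_R2)
  finally show "emeasure (distr lborel borel (\<lambda>p::real\<times>real. vector [fst p, snd p] :: R2)) (box l u) = ennreal (\<Prod>b\<in>Basis. (u - l) \<bullet> b)" .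
qed simp

text \<open>No orientation is prescribed, so the two vectors may be exchanged; both orders are used
  for the two families of coordinate lines.\<close>

definition frame :: "R2 \<Rightarrow> R2 \<Rightarrow> bool" where
  "frame v w \<longleftrightarrow> norm v = 1 \<and> norm w = 1 \<and> v \<bullet> w = 0"

lemma frame_simps:
  assumes "frame v w"
  shows "v \<bullet> v = 1" "w \<bullet> w = 1" "v \<bullet> w = 0" "w \<bullet> v = 0" "norm v = 1" "norm w = 1"
  using assms by (auto simp: frame_def norm_eq_1 inner_commute)

lemma distr_lborel_orthogonal:
  fixes T :: "R2 \<Rightarrow> R2"
  assumes T: "orthogonal_transformation T"
  shows "distr lborel borel T = lborel"
proof (rule lborel_eqI[symmetric])
  have lin: "linear T" using T by (simp add: orthogonal_transformation_linear)
  have m: "T \<in> borel_measurable lborel"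
    using linear_continuous_on[OF linear_conv_bounded_linear[THEN iffD1, OF lin]] by (simp add: borel_measurable_continuous_onI)
  have bij: "bij T" using T by (rule orthogonal_transformation_bij)
  have inv: "orthogonal_transformation (inv T)" using T by (rule orthogonal_transformation_inv)
  fix l u :: R2
  assume lu: "\<And>b. b \<in> Basis \<Longrightarrow> l \<bullet> b \<le> u \<bullet> b"
  have "emeasure (distr lborel borel T) (box l u) = emeasure lborel (T -` box l u)"
    by (subst emeasure_distr[OF m]) auto
  also have "T -` box l u = inv T ` box l u" using bij by (simp add: bij_vimage_eq_inv_image)
  also have "emeasure lborel (inv T ` box l u) = emeasure lebesgue (inv T ` box l u)"
  proof -
    have "inv T ` box l u \<in> sets borel"
      using m bij measurable_sets[of T lborel borel "box l u"] by (simp add: bij_vimage_eq_inv_image)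
    then show ?thesis by simp
  qed
  also have "\<dots> = ennreal (measure lebesgue (inv T ` box l u))"
    by (rule emeasure_eq_measure2[OF measurable_orthogonal_image[OF inv]]) simp
  also have "\<dots> = ennreal (measure lebesgue (box l u))"
    by (subst measure_orthogonal_image[OF inv]) auto
  also have "\<dots> = ennreal (\<Prod>b\<in>Basis. (u - l) \<bullet> b)"
    using lu by (simp add: measure_lborel_box_eq)
  finally show "emeasure (distr lborel borel T) (box l u) = ennreal (\<Prod>b\<in>Basis. (u - l) \<bullet> b)" .
qed simp

lemma frame_orthogonal_transformation:
  assumes "frame v w"
  shows "orthogonal_transformation (\<lambda>x::R2. (x$1) *\<^sub>R v + (x$2) *\<^sub>R w)"
proof -
  have "((x$1) *\<^sub>R v + (x$2) *\<^sub>R w) \<bullet> ((y$1) *\<^sub>R v + (y$2) *\<^sub>R w) = x \<bullet> y" for x y :: R2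
  proof -
    have "((x$1) *\<^sub>R v + (x$2) *\<^sub>R w) \<bullet> ((y$1) *\<^sub>R v + (y$2) *\<^sub>R w) = x$1 * y$1 + x$2 * y$2"
      by (simp add: inner_simps frame_simps[OF assms])
    also have "\<dots> = x \<bullet> y" by (simp add: inner_vec_def UNIV_2)
    finally show ?thesis .
  qed
  moreover have "linear (\<lambda>x::R2. (x$1) *\<^sub>R v + (x$2) *\<^sub>R w)"
    by (rule linearI) (auto simp: algebra_simps)
  ultimately show ?thesis unfolding orthogonal_transformation_def by blast
qed

lemma frame_decomp:
  assumes "frame v w"
  shows "(x \<bullet> v) *\<^sub>R v + (x \<bullet> w) *\<^sub>R w = x"
proof -
  obtain z :: R2 where "x = (z$1) *\<^sub>R v + (z$2) *\<^sub>R w"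
    using surjD[OF orthogonal_transformation_surj[OF frame_orthogonal_transformation[OF assms]]] by blast
  then show ?thesis by (simp add: inner_simps frame_simps[OF assms])
qed

lemma frame_coord_measurable [measurable]:
  "(\<lambda>p::real\<times>real. fst p *\<^sub>R v + snd p *\<^sub>R w :: R2) \<in> borel_measurable borel"
  "(\<lambda>p::real\<times>real. fst p *\<^sub>R v + snd p *\<^sub>R w :: R2) \<in> lborel \<rightarrow>\<^sub>M borel"
  by (auto intro!: borel_measurable_continuous_onI continuous_intros)

text \<open>Frame coordinates are the standard ones followed by an orthogonal map, and both steps
  preserve area.\<close>

lemma distr_lborel_frame:
  assumes "frame v w"
  shows "distr (lborel :: (real \<times> real) measure) borel (\<lambda>p. fst p *\<^sub>R v + snd p *\<^sub>R w) = (lborel :: R2 measure)"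
proof -
  define T where "T x = (x$1) *\<^sub>R v + (x$2) *\<^sub>R w" for x :: R2
  have orth: "orthogonal_transformation T"
    unfolding T_def by (rule frame_orthogonal_transformation[OF assms])
  then have lin: "linear T" by (rule orthogonal_transformation_linear)
  have T: "distr lborel borel T = lborel" by (rule distr_lborel_orthogonal[OF orth])
  have m: "T \<in> borel_measurable borel"
    using linear_continuous_on[OF linear_conv_bounded_linear[THEN iffD1, OF lin]] by (simp add: borel_measurable_continuous_onI)
  have c: "(\<lambda>p::real\<times>real. vector [fst p, snd p] :: R2) \<in> lborel \<rightarrow>\<^sub>M borel"
    using continuous_on_vector2 by (simp add: borel_measurable_continuous_onI)
  have "lborel = distr (distr (lborel :: (real \<times> real) measure) borel (\<lambda>p. vector [fst p, snd p])) borel T"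
    using T distr_lborel_vector2 by simp
  also have "\<dots> = distr (lborel :: (real \<times> real) measure) borel (T \<circ> (\<lambda>p. vector [fst p, snd p]))"
    by (rule distr_distr) (use m c in auto)
  also have "T \<circ> (\<lambda>p. vector [fst p, snd p]) = (\<lambda>p. fst p *\<^sub>R v + snd p *\<^sub>R w)"
    by (auto simp: T_def)
  finally show ?thesis by simp
qed

lemma nn_integral_frame:
  assumes "frame v w" and F: "F \<in> borel_measurable borel"
  shows "(\<integral>\<^sup>+ x. F x \<partial>lborel) = (\<integral>\<^sup>+ a. (\<integral>\<^sup>+ b. F (a *\<^sub>R v + b *\<^sub>R w) \<partial>lborel) \<partial>lborel)"
proof -
  have "(\<integral>\<^sup>+ x. F x \<partial>lborel) = (\<integral>\<^sup>+ p. F (fst p *\<^sub>R v + snd p *\<^sub>R w) \<partial>(lborel :: (real\<times>real) measure))"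
    using nn_integral_distr[OF frame_coord_measurable(2), of F v w] F by (simp add: distr_lborel_frame[OF assms(1)])
  also have "\<dots> = (\<integral>\<^sup>+ p. F (fst p *\<^sub>R v + snd p *\<^sub>R w) \<partial>(lborel \<Otimes>\<^sub>M lborel))"
    by (simp add: lborel_prod)
  also have "\<dots> = (\<integral>\<^sup>+ a. (\<integral>\<^sup>+ b. F (a *\<^sub>R v + b *\<^sub>R w) \<partial>lborel) \<partial>lborel)"
    using lborel.nn_integral_fst[of "\<lambda>p. F (fst p *\<^sub>R v + snd p *\<^sub>R w)" lborel] measurable_compose[OF frame_coord_measurable(1)[of v w] F]
    by (simp add: lborel_prod)
  finally show ?thesis .
qed

lemma integrable_frame:
  fixes F :: "R2 \<Rightarrow> 'b::{banach,second_countable_topology}"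
  assumes "frame v w" and F: "integrable lborel F"
  shows "integrable (lborel \<Otimes>\<^sub>M lborel) (\<lambda>p. F (fst p *\<^sub>R v + snd p *\<^sub>R w))"
    and "(\<integral>x. F x \<partial>lborel) = (\<integral>a. (\<integral>b. F (a *\<^sub>R v + b *\<^sub>R w) \<partial>lborel) \<partial>lborel)"
proof -
  have "integrable (distr (lborel :: (real \<times> real) measure) borel (\<lambda>p. fst p *\<^sub>R v + snd p *\<^sub>R w)) F"
    using F distr_lborel_frame[OF assms(1)] by simp
  then have "integrable (lborel :: (real \<times> real) measure) (\<lambda>p. F (fst p *\<^sub>R v + snd p *\<^sub>R w))"
    by (rule integrable_distr[OF frame_coord_measurable(2)])
  then show 1: "integrable (lborel \<Otimes>\<^sub>M lborel) (\<lambda>p. F (fst p *\<^sub>R v + snd p *\<^sub>R w))"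
    by (simp add: lborel_prod)
  have "(\<integral>x. F x \<partial>lborel) = (\<integral>p. F (fst p *\<^sub>R v + snd p *\<^sub>R w) \<partial>(lborel :: (real\<times>real) measure))"
    using integral_distr[OF frame_coord_measurable(2), of F v w] F by (simp add: distr_lborel_frame[OF assms(1)])
  also have "\<dots> = (\<integral>p. F (fst p *\<^sub>R v + snd p *\<^sub>R w) \<partial>(lborel \<Otimes>\<^sub>M lborel))"
    by (simp add: lborel_prod)
  also have "\<dots> = (\<integral>a. (\<integral>b. F (a *\<^sub>R v + b *\<^sub>R w) \<partial>lborel) \<partial>lborel)"
    using lborel_pair.integral_fst'[OF 1] by simp
  finally show "(\<integral>x. F x \<partial>lborel) = (\<integral>a. (\<integral>b. F (a *\<^sub>R v + b *\<^sub>R w) \<partial>lborel) \<partial>lborel)" .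
qed

section \<open>Smooth cut-off functions\<close>

text \<open>The derivative is asserted to exist instead of being produced by an operator: an
  induction on the order can then name it explicitly for sums, products and affine
  substitutions.\<close>

primrec Ck1 :: "nat \<Rightarrow> (real \<Rightarrow> real) \<Rightarrow> bool" where
  "Ck1 0 a = continuous_on UNIV a"
| "Ck1 (Suc k) a = (\<exists>a'. (\<forall>x. (a has_real_derivative a' x) (at x)) \<and> Ck1 k a')"

lemma Ck1_Suc_D: "Ck1 (Suc k) a \<Longrightarrow> Ck1 k a"
proof (induction k arbitrary: a)
  case 0
  then show ?case by (auto intro!: DERIV_continuous_on continuous_at_imp_continuous_on intro: DERIV_isCont)
next
  case (Suc k)
  then show ?case by (metis Ck1.simps(2))
qed

lemma Ck1_continuous: "Ck1 k a \<Longrightarrow> continuous_on UNIV a"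
  by (induction k) (auto dest: Ck1_Suc_D simp del: Ck1.simps(2))

lemma Ck1_const: "Ck1 k (\<lambda>x. c)"
  by (induction k arbitrary: c) (auto intro!: exI[of _ "\<lambda>x. 0"])

lemma Ck1_add: "Ck1 k a \<Longrightarrow> Ck1 k b \<Longrightarrow> Ck1 k (\<lambda>x. a x + b x)"
proof (induction k arbitrary: a b)
  case (Suc k)
  then obtain a' b' where "\<forall>x. (a has_real_derivative a' x) (at x)" "Ck1 k a'" "\<forall>x. (b has_real_derivative b' x) (at x)" "Ck1 k b'" by auto
  then show ?case using Suc.IH[of a' b'] by (auto intro!: exI[of _ "\<lambda>x. a' x + b' x"] DERIV_add)
qed (auto intro: continuous_intros)

lemma Ck1_mult: "Ck1 k a \<Longrightarrow> Ck1 k b \<Longrightarrow> Ck1 k (\<lambda>x. a x * b x)"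
proof (induction k arbitrary: a b)
  case (Suc k)
  obtain a' where a: "\<forall>x. (a has_real_derivative a' x) (at x)" "Ck1 k a'" using Suc.prems by auto
  obtain b' where b: "\<forall>x. (b has_real_derivative b' x) (at x)" "Ck1 k b'" using Suc.prems by auto
  have "Ck1 k (\<lambda>x. a' x * b x + b' x * a x)"
    using Suc a b by (intro Ck1_add Suc.IH) (auto dest: Ck1_Suc_D simp del: Ck1.simps)
  then show ?case using a b by (auto intro!: exI[of _ "\<lambda>x. a' x * b x + b' x * a x"] DERIV_mult)
qed (auto intro: continuous_intros)

lemma Ck1_affine: "Ck1 k a \<Longrightarrow> Ck1 k (\<lambda>x. a (m * x + c))"
proof (induction k arbitrary: a)
  case 0 then show ?case by (auto intro!: continuous_on_compose2[of UNIV a] continuous_intros)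
next
  case (Suc k)
  then obtain a' where a: "\<forall>x. (a has_real_derivative a' x) (at x)" "Ck1 k a'" by auto
  have "((\<lambda>x. a (m * x + c)) has_real_derivative a' (m * x + c) * m) (at x)" for x
    by (rule DERIV_chain2[of a _ "\<lambda>x. m * x + c"]) (use a in \<open>auto intro!: derivative_eq_intros\<close>)
  moreover have "Ck1 k (\<lambda>x. a' (m * x + c) * m)" by (intro Ck1_mult Ck1_const Suc.IH a)
  ultimately show ?case by (auto intro!: exI[of _ "\<lambda>x. a' (m * x + c) * m"])
qed

text \<open>The polynomial factor closes the family under differentiation: with t = 1/x, the
  derivative of p(t) exp(-t) is again of this form, with t^2 (p - p') in place of p. One induction
  over all \<open>p\<close> then gives smoothness.\<close>

definition flat :: "real poly \<Rightarrow> real \<Rightarrow> real" where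
  "flat p x = (if x \<le> 0 then 0 else poly p (1/x) * exp (- (1/x)))"

lemma flat_tendsto_0: "((\<lambda>x. poly p (1/x) * exp (- (1/x))) \<longlongrightarrow> 0) (at_right (0::real))"
proof -
  have mono: "((\<lambda>t::real. t ^ i * exp (- t)) \<longlongrightarrow> 0) at_top" for i
    using tendsto_power_div_exp_0[of i] by (simp add: exp_minus field_simps)
  have "((\<lambda>t. \<Sum>i\<le>degree p. coeff p i * (t ^ i * exp (- t))) \<longlongrightarrow> (\<Sum>i\<le>degree p. coeff p i * 0)) at_top"
    by (intro tendsto_sum tendsto_mult tendsto_const mono)
  then have "((\<lambda>t. poly p t * exp (- t)) \<longlongrightarrow> 0) at_top"
    by (simp add: poly_altdef sum_distrib_right mult.assoc)
  then have "((\<lambda>x. poly p (inverse x) * exp (- (inverse x))) \<longlongrightarrow> 0) (at_right 0)"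
    by (rule filterlim_compose[OF _ filterlim_inverse_at_top_right])
  then show ?thesis by (simp add: inverse_eq_divide)
qed

lemma flat_deriv: "(flat p has_real_derivative flat (monom 1 2 * (p - pderiv p)) x) (at x)"
proof (cases "x = 0")
  case False
  show ?thesis
  proof (cases "x < 0")
    case True
    have "((\<lambda>x. 0) has_real_derivative 0) (at x)" by simp
    then have "(flat p has_real_derivative 0) (at x)"
      by (rule has_field_derivative_transform_within_open[of _ _ _ "{..<0}"]) (use True in \<open>auto simp: flat_def\<close>)
    then show ?thesis using True by (simp add: flat_def)
  next
    case False
    with \<open>x \<noteq> 0\<close> have x: "x > 0" by simp
    have "((\<lambda>x. poly p (1/x) * exp (- (1/x))) has_real_derivative
       (poly (pderiv p) (1/x) * (- (1/x^2))) * exp (- (1/x)) + poly p (1/x) * (exp (- (1/x)) * (1/x^2))) (at x)"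
      using x by (auto intro!: derivative_eq_intros DERIV_chain2[OF poly_DERIV] simp: power2_eq_square field_simps)
    then have "(flat p has_real_derivative
       (poly (pderiv p) (1/x) * (- (1/x^2))) * exp (- (1/x)) + poly p (1/x) * (exp (- (1/x)) * (1/x^2))) (at x)"
      by (rule has_field_derivative_transform_within_open[of _ _ _ "{0<..}"]) (use x in \<open>auto simp: flat_def\<close>)
    then show ?thesis using x by (simp add: flat_def poly_monom power_one_over algebra_simps)
  qed
next
  case True
  \<comment> \<open>Dividing by \<open>h\<close> multiplies the polynomial in 1/h by its variable,
    hence \<open>pCons 0 p\<close>.\<close>
  have r: "((\<lambda>h. (flat p h - flat p 0) / h) \<longlongrightarrow> 0) (at_right 0)"
  proof (rule Lim_transform_eventually[OF flat_tendsto_0[of "pCons 0 p"]])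
    show "\<forall>\<^sub>F x in at_right 0. poly (pCons 0 p) (1 / x) * exp (- (1 / x)) = (flat p x - flat p 0) / x"
      unfolding eventually_at_right_field by (intro exI[of _ 1]) (auto simp: flat_def)
  qed
  have l: "((\<lambda>h. (flat p h - flat p 0) / h) \<longlongrightarrow> 0) (at_left 0)"
    by (rule Lim_transform_eventually[of "\<lambda>_. 0"])
       (auto simp: eventually_at_left_field flat_def intro!: exI[of _ "-1"])
  have "((\<lambda>h. (flat p h - flat p 0) / h) \<longlongrightarrow> 0) (at 0)"
    using r l by (simp add: filterlim_split_at)
  then show ?thesis using True by (simp add: has_field_derivative_iff flat_def)
qed

lemma Ck1_flat: "Ck1 k (flat p)"
proof (induction k arbitrary: p)
  case 0 then show ?case
    using flat_deriv[of p] by (auto intro!: continuous_at_imp_continuous_on intro: DERIV_isCont)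
next
  case (Suc k) then show ?case using flat_deriv[of p] by auto
qed

text \<open>The product of \<open>flat 1\<close> with its reflection is a bump on the unit interval;
  \<psi> is this bump normalised to integral 1, and \<open>S\<close> is its primitive. Later
  \<open>S\<close> yields cut-offs and \<psi> yields approximate identities.\<close>

lemma smooth_step_exists:
  obtains S \<psi> :: "real \<Rightarrow> real" where "\<And>k. Ck1 k S" "\<And>x. (S has_real_derivative \<psi> x) (at x)" "\<And>k. Ck1 k \<psi>"
    "\<And>x. 0 \<le> \<psi> x" "\<And>x. x \<notin> {0..1} \<Longrightarrow> \<psi> x = 0" "\<And>x. x \<le> 0 \<Longrightarrow> S x = 0" "\<And>x. 1 \<le> x \<Longrightarrow> S x = 1"
    "\<And>x. 0 \<le> S x \<and> S x \<le> 1" "(\<psi> has_integral 1) {0..1}"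
proof -
  define \<beta> where "\<beta> x = flat 1 x * flat 1 (-1 * x + 1)" for x
  have \<beta>k: "Ck1 k \<beta>" for k
    unfolding \<beta>_def by (intro Ck1_mult Ck1_flat Ck1_affine)
  have \<beta>c: "continuous_on A \<beta>" for A using Ck1_continuous[OF \<beta>k] continuous_on_subset by blast
  have \<beta>0: "0 \<le> \<beta> x" "x \<notin> {0<..<1} \<Longrightarrow> \<beta> x = 0" "x \<in> {0<..<1} \<Longrightarrow> \<beta> x > 0" for x
    by (auto simp: \<beta>_def flat_def)
  define I where "I = integral {0..1} \<beta>"
  have int: "\<beta> integrable_on {a..b}" for a b using integrable_continuous_real \<beta>c by blast
  have "I > 0"
  proof -
    have "I \<noteq> 0" using integral_eq_0_iff[OF \<beta>c[of "{0..1}"]] \<beta>0(1) \<beta>0(3)[of "1/2"] unfolding I_def by force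
    moreover have "I \<ge> 0" unfolding I_def by (rule integral_nonneg[OF int]) (use \<beta>0 in auto)
    ultimately show ?thesis by simp
  qed
  define \<psi> where "\<psi> x = \<beta> x * (1/I)" for x
  \<comment> \<open>Starting at -1 makes each x \<ge> 0 an interior point of a larger interval of
    integration, so differentiability at 0 is two-sided.\<close>
  define S where "S x = integral {-1..x} \<psi>" for x
  have \<psi>k: "Ck1 k \<psi>" for k unfolding \<psi>_def by (intro Ck1_mult \<beta>k Ck1_const)
  have \<psi>c: "continuous_on A \<psi>" for A using Ck1_continuous[OF \<psi>k] continuous_on_subset by blast
  have \<psi>0: "0 \<le> \<psi> x" "x \<notin> {0<..<1} \<Longrightarrow> \<psi> x = 0" for x using \<beta>0 \<open>I > 0\<close> by (auto simp: \<psi>_def)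
  have \<psi>int: "\<psi> integrable_on {a..b}" for a b using integrable_continuous_real \<psi>c by blast
  have S0: "S x = 0" if "x \<le> 0" for x
  proof -
    have "integral {-1..x} \<psi> = integral {-1..x} (\<lambda>_. 0)" by (rule integral_cong) (use that \<psi>0 in auto)
    then show ?thesis by (simp add: S_def)
  qed
  have \<psi>1: "integral {0..1} \<psi> = 1" using \<open>I > 0\<close> unfolding \<psi>_def I_def by simp
  have Sd: "(S has_real_derivative \<psi> x) (at x)" for x
  proof (cases "x < 0")
    case True
    have "((\<lambda>x. 0) has_real_derivative 0) (at x)" by simp
    then have "(S has_real_derivative 0) (at x)"
      by (rule has_field_derivative_transform_within_open[of _ _ _ "{..<0}"]) (use True S0 in auto)
    then show ?thesis using True \<psi>0 by simp
  next
    case False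
    have "((\<lambda>u. integral {-1..u} \<psi>) has_vector_derivative \<psi> x) (at x within {-1..x+1})"
      by (rule integral_has_vector_derivative[OF \<psi>c]) (use False in auto)
    then have "((\<lambda>u. integral {-1..u} \<psi>) has_vector_derivative \<psi> x) (at x)"
      using at_within_interior[of x "{-1..x+1}"] False by (simp add: interior_atLeastAtMost_real)
    then show ?thesis unfolding S_def[abs_def] by (simp add: has_real_derivative_iff_has_vector_derivative)
  qed
  have S1: "S x = 1" if "1 \<le> x" for x
  proof -
    have "integral {1..x} \<psi> = integral {1..x} (\<lambda>_. 0)" by (rule integral_cong) (use that \<psi>0 in auto)
    moreover have "integral {-1..0} \<psi> = 0" using S0[of 0] by (simp add: S_def)
    moreover have "integral {-1..0} \<psi> + integral {0..1} \<psi> = integral {-1..1} \<psi>" by (rule Henstock_Kurzweil_Integration.integral_combine[OF _ _ \<psi>int]) auto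
    moreover have "integral {-1..1} \<psi> + integral {1..x} \<psi> = integral {-1..x} \<psi>" by (rule Henstock_Kurzweil_Integration.integral_combine[OF _ _ \<psi>int]) (use that in auto)
    ultimately show ?thesis using \<psi>1 by (simp add: S_def)
  qed
  have Smono: "S x \<le> S y" if "x \<le> y" for x y
    by (rule DERIV_nonneg_imp_nondecreasing[OF that]) (use Sd \<psi>0 in blast)
  have "0 \<le> S x \<and> S x \<le> 1" for x
    using Smono[of "min x 0" x] Smono[of x "max x 1"] S0[of "min x 0"] S1[of "max x 1"] by auto
  moreover have "Ck1 k S" for k
    by (rule Ck1_Suc_D) (use Sd \<psi>k in auto)
  moreover have "(\<psi> has_integral 1) {0..1}" using \<psi>1 \<psi>int by (metis integrable_integral)
  moreover have "\<psi> x = 0" if "x \<notin> {0..1}" for x using \<psi>0(2) that by auto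
  ultimately show thesis using that[of S \<psi>] Sd \<psi>k \<psi>0(1) S0 S1 by blast
qed

section \<open>Product test functions\<close>

lemma partial_deriv_eq:
  assumes "(\<phi> has_derivative d) (at x)"
  shows "partial_deriv \<phi> j x = d (axis j 1)"
  using frechet_derivative_at[OF assms] by (simp add: partial_deriv_def)

lemma C_k_add: "C_k k \<phi> \<Longrightarrow> C_k k \<psi> \<Longrightarrow> C_k k (\<lambda>x. \<phi> x + \<psi> x)"
proof (induction k arbitrary: \<phi> \<psi>)
  case (Suc k)
  have "partial_deriv (\<lambda>x. \<phi> x + \<psi> x) j = (\<lambda>x. partial_deriv \<phi> j x + partial_deriv \<psi> j x)" for j
  proof
    fix x
    have "(\<phi> has_derivative frechet_derivative \<phi> (at x)) (at x)" "(\<psi> has_derivative frechet_derivative \<psi> (at x)) (at x)"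
      using Suc.prems by (auto simp: frechet_derivative_works[symmetric])
    from has_derivative_add[OF this] show "partial_deriv (\<lambda>x. \<phi> x + \<psi> x) j x = partial_deriv \<phi> j x + partial_deriv \<psi> j x"
      by (subst partial_deriv_eq) (auto simp: partial_deriv_def)
  qed
  then show ?case using Suc by (auto intro: continuous_intros)
qed (auto intro: continuous_intros)

lemma C_k_cmult: "C_k k \<phi> \<Longrightarrow> C_k k (\<lambda>x. c * \<phi> x)"
proof (induction k arbitrary: \<phi>)
  case (Suc k)
  have "partial_deriv (\<lambda>x. c * \<phi> x) j = (\<lambda>x. c * partial_deriv \<phi> j x)" for j
  proof
    fix x
    have "(\<phi> has_derivative frechet_derivative \<phi> (at x)) (at x)"
      using Suc.prems by (auto simp: frechet_derivative_works[symmetric])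
    from has_derivative_mult_right[OF this, of c] show "partial_deriv (\<lambda>x. c * \<phi> x) j x = c * partial_deriv \<phi> j x"
      by (subst partial_deriv_eq) (auto simp: partial_deriv_def)
  qed
  then show ?case using Suc by (auto intro: continuous_intros)
qed (auto intro: continuous_intros)

lemma has_derivative_product_fun:
  assumes "(a has_real_derivative a') (at (x \<bullet> v))" "(b has_real_derivative b') (at (x \<bullet> w))"
  shows "((\<lambda>x::R2. a (x \<bullet> v) * b (x \<bullet> w)) has_derivative (\<lambda>h. (h \<bullet> v) * (a' * b (x \<bullet> w)) + (h \<bullet> w) * (a (x \<bullet> v) * b'))) (at x)"
proof -
  have 1: "((\<lambda>x::R2. a (x \<bullet> v)) has_derivative (\<lambda>h. a' * (h \<bullet> v))) (at x)"
    using has_derivative_compose[OF bounded_linear_imp_has_derivative[OF bounded_linear_inner_left], of a "\<lambda>y. a' * y" x v] assms(1)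
    by (simp add: has_field_derivative_def)
  have 2: "((\<lambda>x::R2. b (x \<bullet> w)) has_derivative (\<lambda>h. b' * (h \<bullet> w))) (at x)"
    using has_derivative_compose[OF bounded_linear_imp_has_derivative[OF bounded_linear_inner_left], of b "\<lambda>y. b' * y" x w] assms(2)
    by (simp add: has_field_derivative_def)
  show ?thesis by (rule has_derivative_eq_rhs[OF has_derivative_mult[OF 1 2]]) (auto simp: algebra_simps)
qed

lemma partial_deriv_product_fun:
  assumes "(a has_real_derivative a') (at (x \<bullet> v))" "(b has_real_derivative b') (at (x \<bullet> w))"
  shows "partial_deriv (\<lambda>x::R2. a (x \<bullet> v) * b (x \<bullet> w)) j x = v $ j * (a' * b (x \<bullet> w)) + w $ j * (a (x \<bullet> v) * b')"
  by (subst partial_deriv_eq[OF has_derivative_product_fun[OF assms]]) (simp add: inner_axis')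

text \<open>Each partial derivative is a linear combination of two products of the same kind, so the
  induction closes once sums and multiples are available.\<close>

lemma C_k_product_fun: "Ck1 k a \<Longrightarrow> Ck1 k b \<Longrightarrow> C_k k (\<lambda>x::R2. a (x \<bullet> v) * b (x \<bullet> w))"
proof (induction k arbitrary: a b)
  case 0
  then show ?case by (auto intro!: continuous_intros continuous_on_compose2[of UNIV a] continuous_on_compose2[of UNIV b])
next
  case (Suc k)
  obtain a' where a: "\<And>x. (a has_real_derivative a' x) (at x)" "Ck1 k a'" using Suc.prems by auto
  obtain b' where b: "\<And>x. (b has_real_derivative b' x) (at x)" "Ck1 k b'" using Suc.prems by auto
  have kk: "Ck1 k a" "Ck1 k b" using Suc.prems by (auto intro: Ck1_Suc_D simp del: Ck1.simps)
  let ?\<phi> = "\<lambda>x::R2. a (x \<bullet> v) * b (x \<bullet> w)"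
  have d: "?\<phi> differentiable (at x)" for x
    using has_derivative_product_fun[OF a(1) b(1)] differentiableI by blast
  have p: "partial_deriv ?\<phi> j = (\<lambda>x. v $ j * (a' (x \<bullet> v) * b (x \<bullet> w)) + w $ j * (a (x \<bullet> v) * b' (x \<bullet> w)))" for j
    by (rule ext) (rule partial_deriv_product_fun[OF a(1) b(1)])
  have "C_k k (partial_deriv ?\<phi> j)" for j
    unfolding p by (intro C_k_add C_k_cmult Suc.IH a b kk)
  moreover have "continuous_on UNIV ?\<phi>"
    using d by (auto intro!: continuous_at_imp_continuous_on differentiable_imp_continuous_within)
  ultimately show ?case using d by auto
qed

text \<open>A Dynkin system argument: half-open intervals are stable under intersection and generate
  the Borel sets. Complements need the total integral to vanish, which follows by letting the
  intervals grow.\<close>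

lemma AE_zero_if_Ioc_integrals_zero:
  fixes h :: "real \<Rightarrow> R2"
  assumes int: "integrable lborel h" and z: "\<And>c d. c < d \<Longrightarrow> (LINT x:{c<..d}|lborel. h x) = 0"
  shows "AE x in lborel. h x = 0"
proof (rule sigma_finite_measure.density_zero[OF lborel.sigma_finite_measure_axioms int])
  have total: "integral\<^sup>L lborel h = 0"
  proof -
    have "(\<lambda>n. LINT x:{- real n<..real n}|lborel. h x) \<longlonglongrightarrow> (LINT x:(\<Union>n. {- real n<..real n})|lborel. h x)"
    proof (rule set_integral_cont_up)
      show "incseq (\<lambda>n. {- real n<..real n})" by (auto simp: incseq_def)
      show "set_integrable lborel (\<Union>n. {- real n<..real n}) h"
        unfolding set_integrable_def by (rule integrable_mult_indicator) (use int in auto)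
    qed auto
    moreover have "(\<Union>n. {- real n<..real n}) = UNIV"
    proof (intro set_eqI iffI UNIV_I)
      fix x :: real
      obtain n where "\<bar>x\<bar> < real n" using reals_Archimedean2 by blast
      then show "x \<in> (\<Union>n. {- real n<..real n})" by (auto intro!: exI[of _ n])
    qed
    moreover have "(LINT x:{- real n<..real n}|lborel. h x) = 0" for n
      using z[of "- real n" "real n"] by (cases "n = 0") (auto simp: set_lebesgue_integral_def)
    ultimately have "(LINT x:UNIV|lborel. h x) = 0" by (simp add: LIMSEQ_const_iff)
    then show ?thesis by (simp add: set_lebesgue_integral_def)
  qed
  have si: "set_integrable lborel A h" if "A \<in> sets borel" for A
    unfolding set_integrable_def by (rule integrable_mult_indicator) (use int that in auto)
  have eq: "sets (lborel::real measure) = sigma_sets UNIV (range (\<lambda>(a, b). {a<..b}))"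
    by (simp add: borel_sigma_sets_Ioc)
  have sub: "A \<in> sigma_sets UNIV (range (\<lambda>(a, b). {a<..b::real})) \<Longrightarrow> A \<in> sets borel" for A
    by (simp add: borel_sigma_sets_Ioc)
  have main: "set_lebesgue_integral lborel A h = 0" if "A \<in> sigma_sets UNIV (range (\<lambda>(a, b). {a<..b::real}))" for A
  proof (rule sigma_sets_induct_disjoint[OF _ _ that])
    show "Int_stable (range (\<lambda>(a, b). {a<..b::real}))"
    proof (rule Int_stableI)
      fix A B assume "A \<in> range (\<lambda>(a, b). {a<..b::real})" "B \<in> range (\<lambda>(a, b). {a<..b::real})"
      then obtain a b c d where "A = {a<..b}" "B = {c<..d}" by auto
      then have "A \<inter> B = (\<lambda>(a, b). {a<..b}) (max a c, min b d)" by auto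
      then show "A \<inter> B \<in> range (\<lambda>(a, b). {a<..b::real})" by (metis rangeI)
    qed
    show "range (\<lambda>(a, b). {a<..b::real}) \<subseteq> Pow UNIV" by simp
    show "(LINT x:{}|lborel. h x) = 0" by (simp add: set_lebesgue_integral_def)
  next
    fix A assume "A \<in> range (\<lambda>(a, b). {a<..b::real})"
    then obtain a b where A: "A = {a<..b}" by auto
    show "(LINT x:A|lborel. h x) = 0"
      using z[of a b] unfolding A by (cases "a < b") (auto simp: set_lebesgue_integral_def)
  next
    fix A assume A: "A \<in> sigma_sets UNIV (range (\<lambda>(a, b). {a<..b::real}))" "(LINT x:A|lborel. h x) = 0"
    have "(LINT x:A \<union> (UNIV - A)|lborel. h x) = (LINT x:A|lborel. h x) + (LINT x:UNIV - A|lborel. h x)"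
      by (rule set_integral_Un) (use si sub[OF A(1)] in auto)
    then show "(LINT x:UNIV - A|lborel. h x) = 0" using A(2) total by (simp add: set_lebesgue_integral_def)
  next
    fix A :: "nat \<Rightarrow> real set" assume A: "disjoint_family A" "range A \<subseteq> sigma_sets UNIV (range (\<lambda>(a, b). {a<..b}))"
      "\<And>i. (LINT x:A i|lborel. h x) = 0"
    have Ab: "A i \<in> sets borel" for i using A(2) sub by blast
    have "(\<integral>x\<in>(\<Union>i. A i). h x \<partial>lborel) = (\<Sum>i. \<integral>x\<in>A i. h x \<partial>lborel)"
      by (rule lebesgue_integral_countable_add) (use A(1) Ab in \<open>auto simp: disjoint_family_on_def intro!: si\<close>)
    then show "(LINT x:\<Union> (range A)|lborel. h x) = 0" using A(3) by simp
  qed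
  fix A :: "real set" assume "A \<in> sets lborel"
  then show "set_lebesgue_integral lborel A h = 0" using main eq by auto
qed

text \<open>The estimate behind approximate identities: \<open>k\<close> is a probability density on
  the interval, and \<open>F\<close> is close to \<open>y\<close> wherever this density is
  nonzero.\<close>

lemma norm_weighted_average_diff_le:
  fixes F :: "real \<Rightarrow> 'a::euclidean_space"
  assumes F: "continuous_on {p..q} F" and k: "continuous_on {p..q} k" "\<And>s. 0 \<le> k s" "(LINT s:{p..q}|lborel. k s) = 1"
    and close: "\<And>s. s \<in> {p..q} \<Longrightarrow> k s \<noteq> 0 \<Longrightarrow> norm (F s - y) \<le> e"
  shows "norm ((LINT s:{p..q}|lborel. k s *\<^sub>R F s) - y) \<le> e"
proof -
  have ik: "set_integrable lborel {p..q} k" unfolding set_integrable_def by (rule borel_integrable_compact[OF _ k(1)]) simp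
  have iF: "set_integrable lborel {p..q} (\<lambda>s. k s *\<^sub>R F s)" unfolding set_integrable_def
    by (rule borel_integrable_compact) (use k F in \<open>auto intro: continuous_intros\<close>)
  have ic: "set_integrable lborel {p..q} (\<lambda>s. k s *\<^sub>R z)" for z :: 'a unfolding set_integrable_def
    by (rule borel_integrable_compact) (use k in \<open>auto intro: continuous_intros\<close>)
  have "(LINT s:{p..q}|lborel. k s *\<^sub>R y) = y"
    using integral_scaleR_left[of y lborel "\<lambda>s. indicator {p..q} s * k s"] ik k(3)
    by (simp add: set_lebesgue_integral_def set_integrable_def)
  then have "(LINT s:{p..q}|lborel. k s *\<^sub>R F s) - y = (LINT s:{p..q}|lborel. k s *\<^sub>R F s - k s *\<^sub>R y)"
    using set_integral_diff(2)[OF iF ic[of y]] by simp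
  also have "norm \<dots> \<le> (LINT s:{p..q}|lborel. norm (k s *\<^sub>R F s - k s *\<^sub>R y))"
    by (rule set_integral_norm_bound) (rule set_integral_diff(1)[OF iF ic])
  also have "\<dots> \<le> (LINT s:{p..q}|lborel. k s * e)"
  proof (rule set_integral_mono)
    show "set_integrable lborel {p..q} (\<lambda>s. norm (k s *\<^sub>R F s - k s *\<^sub>R y))"
      by (rule set_integrable_norm) (rule set_integral_diff(1)[OF iF ic])
    show "set_integrable lborel {p..q} (\<lambda>s. k s * e)" using ik by (rule set_integrable_mult_left)
    fix s assume "s \<in> {p..q}"
    have "norm (k s *\<^sub>R F s - k s *\<^sub>R y) = k s * norm (F s - y)"
      using k(2)[of s] by (simp add: scaleR_diff_right[symmetric])
    also have "\<dots> \<le> k s * e" using close[OF \<open>s \<in> {p..q}\<close>] k(2)[of s] by (cases "k s = 0") (auto intro: mult_left_mono)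
    finally show "norm (k s *\<^sub>R F s - k s *\<^sub>R y) \<le> k s * e" .
  qed
  also have "\<dots> = e" using k(3) by (simp add: set_integral_mult_left)
  finally show ?thesis .
qed

lemma set_integral_lincomb:
  fixes G1 G2 :: "'a \<Rightarrow> 'b::{banach, second_countable_topology}"
  assumes "set_integrable M Q G1" "set_integrable M Q G2"
  shows "(LINT x:Q|M. c1 *\<^sub>R G1 x + c2 *\<^sub>R G2 x) = c1 *\<^sub>R (LINT x:Q|M. G1 x) + c2 *\<^sub>R (LINT x:Q|M. G2 x)"
proof -
  have i: "integrable M (\<lambda>x. c1 *\<^sub>R (indicator Q x *\<^sub>R G1 x))" "integrable M (\<lambda>x. c2 *\<^sub>R (indicator Q x *\<^sub>R G2 x))"
    by (rule integrable_scaleR_right, use assms in \<open>simp add: set_integrable_def\<close>)+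
  have "(LINT x:Q|M. c1 *\<^sub>R G1 x + c2 *\<^sub>R G2 x) = (\<integral>x. c1 *\<^sub>R (indicator Q x *\<^sub>R G1 x) + c2 *\<^sub>R (indicator Q x *\<^sub>R G2 x) \<partial>M)"
    unfolding set_lebesgue_integral_def by (rule Bochner_Integration.integral_cong) (auto simp: indicator_def)
  also have "\<dots> = (\<integral>x. c1 *\<^sub>R (indicator Q x *\<^sub>R G1 x) \<partial>M) + (\<integral>x. c2 *\<^sub>R (indicator Q x *\<^sub>R G2 x) \<partial>M)"
    by (rule Bochner_Integration.integral_add[OF i])
  also have "\<dots> = c1 *\<^sub>R (LINT x:Q|M. G1 x) + c2 *\<^sub>R (LINT x:Q|M. G2 x)"
    unfolding set_lebesgue_integral_def by (simp only: integral_scaleR_right)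
  finally show ?thesis .
qed

section \<open>Absolute continuity on lines\<close>

text \<open>The weak differential is taken Borel, so that its restriction to every single line is
  measurable, and integrals are with respect to \<open>lborel\<close>, to which Fubini in frame
  coordinates applies.\<close>

locale W11 =
  fixes D :: "R2 set" and f :: "R2 \<Rightarrow> R2" and Df :: "R2 \<Rightarrow> real^2^2"
  assumes open_D: "open D" and cont_f: "continuous_on D f"
    and Df_borel: "Df \<in> borel_measurable borel"
    and Df_int: "\<And>C. compact C \<Longrightarrow> C \<subseteq> D \<Longrightarrow> set_integrable lborel C Df"
    and weak: "\<And>j \<phi>. test_fun D \<phi> \<Longrightarrow> (LINT x:D|lborel. partial_deriv \<phi> j x *\<^sub>R f x)
          = - (LINT x:D|lborel. \<phi> x *\<^sub>R column j (Df x))"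
begin

lemma bounded_linear_mult_vec: "bounded_linear (\<lambda>A::real^2^2. A *v w)"
  by (rule linear_conv_bounded_linear[THEN iffD1], rule linearI)
     (auto simp: matrix_vector_mult_add_rdistrib scaleR_matrix_vector_assoc)

lemma Df_mult_int: "compact C \<Longrightarrow> C \<subseteq> D \<Longrightarrow> set_integrable lborel C (\<lambda>x. Df x *v w)"
  using integrable_bounded_linear[OF bounded_linear_mult_vec, of lborel "\<lambda>x. indicator C x *\<^sub>R Df x" w] Df_int[of C]
  by (simp add: set_integrable_def scaleR_matrix_vector_assoc)

definition rect :: "R2 \<Rightarrow> R2 \<Rightarrow> real \<Rightarrow> real \<Rightarrow> real \<Rightarrow> real \<Rightarrow> R2 set" where
  "rect v w A1 A2 B1 B2 = {x. x \<bullet> v \<in> {A1..A2} \<and> x \<bullet> w \<in> {B1..B2}}"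

lemma compact_rect:
  assumes fr: "frame v w"
  shows "compact (rect v w A1 A2 B1 B2)"
proof -
  have "closed (rect v w A1 A2 B1 B2)"
    unfolding rect_def by (auto intro!: closed_Collect_conj closed_Collect_le continuous_intros)
  moreover have "bounded (rect v w A1 A2 B1 B2)"
    unfolding bounded_iff
  proof (intro exI ballI)
    fix x assume x: "x \<in> rect v w A1 A2 B1 B2"
    have "norm x = norm ((x \<bullet> v) *\<^sub>R v + (x \<bullet> w) *\<^sub>R w)" by (simp add: frame_decomp[OF fr])
    also have "\<dots> \<le> \<bar>x \<bullet> v\<bar> + \<bar>x \<bullet> w\<bar>"
      using norm_triangle_ineq[of "(x \<bullet> v) *\<^sub>R v" "(x \<bullet> w) *\<^sub>R w"] by (simp add: frame_simps[OF fr])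
    also have "\<dots> \<le> (\<bar>A1\<bar> + \<bar>A2\<bar>) + (\<bar>B1\<bar> + \<bar>B2\<bar>)" using x by (auto simp: rect_def)
    finally show "norm x \<le> (\<bar>A1\<bar> + \<bar>A2\<bar>) + (\<bar>B1\<bar> + \<bar>B2\<bar>)" .
  qed
  ultimately show ?thesis by (simp add: compact_eq_bounded_closed)
qed

text \<open>Weighting the two weak partial derivatives by the components of \<open>w\<close> gives
  the directional derivative. The terms with the derivative of \<open>a\<close> cancel because
  \<open>v\<close> and \<open>w\<close> are orthogonal.\<close>

lemma weak_directional:
  assumes fr: "frame v w" and Q: "rect v w A1 A2 B1 B2 \<subseteq> D"
    and a: "\<And>k. Ck1 k a" "\<And>t. t \<notin> {A1..A2} \<Longrightarrow> a t = 0"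
    and b: "\<And>k. Ck1 k b" "\<And>s. s \<notin> {B1..B2} \<Longrightarrow> b s = 0"
    and db: "\<And>s. (b has_real_derivative b' s) (at s)" "continuous_on UNIV b'"
  shows "(LINT x:rect v w A1 A2 B1 B2|lborel. (a (x \<bullet> v) * b' (x \<bullet> w)) *\<^sub>R f x)
       = - (LINT x:rect v w A1 A2 B1 B2|lborel. (a (x \<bullet> v) * b (x \<bullet> w)) *\<^sub>R (Df x *v w))"
proof -
  let ?Q = "rect v w A1 A2 B1 B2"
  let ?\<phi> = "\<lambda>x::R2. a (x \<bullet> v) * b (x \<bullet> w)"
  obtain a' where da: "\<And>s. (a has_real_derivative a' s) (at s)" and "Ck1 0 a'"
    using a(1)[of 1] by auto
  then have ca': "continuous_on UNIV a'" by simp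
  have ca: "continuous_on UNIV a" "continuous_on UNIV b" using a(1)[of 0] b(1)[of 0] by auto
  have cmp: "compact ?Q" by (rule compact_rect[OF fr])
  have a'0: "a' t = 0" if "t \<notin> {A1..A2}" for t
  proof (rule DERIV_unique[OF da])
    have "((\<lambda>_. 0) has_real_derivative 0) (at t)" by simp
    then show "(a has_real_derivative 0) (at t)"
      by (rule has_field_derivative_transform_within_open[of _ _ _ "- {A1..A2}"]) (use that a in auto)
  qed
  have b'0: "b' t = 0" if "t \<notin> {B1..B2}" for t
  proof (rule DERIV_unique[OF db(1)])
    have "((\<lambda>_. 0) has_real_derivative 0) (at t)" by simp
    then show "(b has_real_derivative 0) (at t)"
      by (rule has_field_derivative_transform_within_open[of _ _ _ "- {B1..B2}"]) (use that b in auto)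
  qed
  have supp: "{x. ?\<phi> x \<noteq> 0} \<subseteq> ?Q" using a b by (auto simp: rect_def)
  have clQ: "closed ?Q" using cmp by (rule compact_imp_closed)
  have cl: "closure {x. ?\<phi> x \<noteq> 0} \<subseteq> ?Q" using closure_minimal[OF supp clQ] .
  have test: "test_fun D ?\<phi>"
    unfolding test_fun_def smooth_fun_def
  proof (intro conjI allI)
    show "C_k k ?\<phi>" for k by (rule C_k_product_fun[OF a(1) b(1)])
    show "compact (closure {x. ?\<phi> x \<noteq> 0})"
      using cl cmp by (meson bounded_subset closed_closure compact_eq_bounded_closed)
    show "closure {x. ?\<phi> x \<noteq> 0} \<subseteq> D" using cl Q by blast
  qed
  have pd: "partial_deriv ?\<phi> j x = v $ j * (a' (x \<bullet> v) * b (x \<bullet> w)) + w $ j * (a (x \<bullet> v) * b' (x \<bullet> w))" for j x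
    by (rule partial_deriv_product_fun[OF da db(1)])
  \<comment> \<open>Replacing \<open>D\<close> by the rectangle matters because integrability is
    known on compact subsets of \<open>D\<close> only.\<close>
  have loc: "(LINT x:D|lborel. g x) = (LINT x:?Q|lborel. g x)" if "\<And>x. x \<notin> ?Q \<Longrightarrow> g x = 0" for g :: "R2 \<Rightarrow> R2"
    unfolding set_lebesgue_integral_def
    by (rule Bochner_Integration.integral_cong) (use that Q in \<open>auto simp: indicator_def\<close>)
  have fQ: "continuous_on ?Q f" using cont_f Q by (rule continuous_on_subset)
  have cc: "continuous_on ?Q (\<lambda>x. h (x \<bullet> u))" if "continuous_on UNIV h" for h :: "real \<Rightarrow> real" and u
    by (rule continuous_on_compose2[OF that]) (auto intro: continuous_intros)
  have i1: "set_integrable lborel ?Q (\<lambda>x. partial_deriv ?\<phi> j x *\<^sub>R f x)" for j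
    unfolding set_integrable_def pd
    by (rule borel_integrable_compact[OF cmp]) (intro continuous_intros cc ca ca' db fQ)
  have i2: "set_integrable lborel ?Q (\<lambda>x. ?\<phi> x *\<^sub>R column j (Df x))" for j
  proof -
    have c\<phi>: "continuous_on ?Q ?\<phi>" by (intro continuous_intros cc ca)
    then obtain M where M: "\<And>x. x \<in> ?Q \<Longrightarrow> norm (?\<phi> x) \<le> M"
      using compact_imp_bounded[OF compact_continuous_image[OF c\<phi> cmp]] unfolding bounded_iff by blast
    have col: "column j A = A *v axis j 1" for A :: "real^2^2"
      by (simp add: matrix_vector_mult_basis)
    have iD: "integrable lborel (\<lambda>x. indicator ?Q x *\<^sub>R column j (Df x))"
      using Df_mult_int[OF cmp Q, of "axis j 1"] unfolding set_integrable_def col .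
    have m: "(\<lambda>x. indicator ?Q x *\<^sub>R (?\<phi> x *\<^sub>R column j (Df x))) \<in> borel_measurable lborel"
    proof -
      have eq: "(\<lambda>x. indicator ?Q x *\<^sub>R (?\<phi> x *\<^sub>R column j (Df x))) = (\<lambda>x. ?\<phi> x *\<^sub>R (indicator ?Q x *\<^sub>R column j (Df x)))"
        by (auto simp: fun_eq_iff)
      have "?\<phi> \<in> borel_measurable lborel"
        using C_k_product_fun[OF a(1)[of 0] b(1)[of 0], of v w] by (auto intro: borel_measurable_continuous_onI)
      then show ?thesis unfolding eq by (rule borel_measurable_scaleR[OF _ borel_measurable_integrable[OF iD]])
    qed
    show ?thesis unfolding set_integrable_def
    proof (rule Bochner_Integration.integrable_bound[OF integrable_scaleR_right[OF iD, of M] m], rule AE_I2)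
      fix x
      show "norm (indicator ?Q x *\<^sub>R (?\<phi> x *\<^sub>R column j (Df x))) \<le> norm (M *\<^sub>R (indicator ?Q x *\<^sub>R column j (Df x)))"
        using M[of x] by (auto simp: indicator_def intro!: mult_right_mono)
    qed
  qed
  have eqj: "(LINT x:?Q|lborel. partial_deriv ?\<phi> j x *\<^sub>R f x) = - (LINT x:?Q|lborel. ?\<phi> x *\<^sub>R column j (Df x))" for j
  proof -
    have "(LINT x:?Q|lborel. partial_deriv ?\<phi> j x *\<^sub>R f x) = (LINT x:D|lborel. partial_deriv ?\<phi> j x *\<^sub>R f x)"
      by (rule loc[symmetric]) (use pd a b a'0 b'0 in \<open>auto simp: rect_def\<close>)
    also have "\<dots> = - (LINT x:D|lborel. ?\<phi> x *\<^sub>R column j (Df x))" by (rule weak[OF test])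
    also have "(LINT x:D|lborel. ?\<phi> x *\<^sub>R column j (Df x)) = (LINT x:?Q|lborel. ?\<phi> x *\<^sub>R column j (Df x))"
      by (rule loc) (use a b in \<open>auto simp: rect_def\<close>)
    finally show ?thesis .
  qed
  have vw: "w $ 1 * v $ 1 + w $ 2 * v $ 2 = 0" "w $ 1 * w $ 1 + w $ 2 * w $ 2 = 1"
    using frame_simps[OF fr] by (auto simp: inner_vec_def UNIV_2)
  have "(LINT x:?Q|lborel. (a (x \<bullet> v) * b' (x \<bullet> w)) *\<^sub>R f x)
    = (LINT x:?Q|lborel. w $ 1 *\<^sub>R (partial_deriv ?\<phi> 1 x *\<^sub>R f x) + w $ 2 *\<^sub>R (partial_deriv ?\<phi> 2 x *\<^sub>R f x))"
  proof (rule arg_cong[where f="set_lebesgue_integral lborel ?Q"], rule ext)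
    fix x
    have "a (x \<bullet> v) * b' (x \<bullet> w) = w $ 1 * partial_deriv ?\<phi> 1 x + w $ 2 * partial_deriv ?\<phi> 2 x"
    proof -
      have "w $ 1 * partial_deriv ?\<phi> 1 x + w $ 2 * partial_deriv ?\<phi> 2 x
        = (w $ 1 * v $ 1 + w $ 2 * v $ 2) * (a' (x \<bullet> v) * b (x \<bullet> w)) + (w $ 1 * w $ 1 + w $ 2 * w $ 2) * (a (x \<bullet> v) * b' (x \<bullet> w))"
        unfolding pd by (simp only: ring_distribs mult.assoc add.assoc add.commute add.left_commute mult.commute mult.left_commute)
      then show ?thesis unfolding vw by simp
    qed
    then show "(a (x \<bullet> v) * b' (x \<bullet> w)) *\<^sub>R f x = w $ 1 *\<^sub>R (partial_deriv ?\<phi> 1 x *\<^sub>R f x) + w $ 2 *\<^sub>R (partial_deriv ?\<phi> 2 x *\<^sub>R f x)"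
      by (simp add: scaleR_add_left[symmetric])
  qed
  also have "\<dots> = w $ 1 *\<^sub>R (LINT x:?Q|lborel. partial_deriv ?\<phi> 1 x *\<^sub>R f x) + w $ 2 *\<^sub>R (LINT x:?Q|lborel. partial_deriv ?\<phi> 2 x *\<^sub>R f x)"
    by (rule set_integral_lincomb[OF i1 i1])
  also have "\<dots> = - (w $ 1 *\<^sub>R (LINT x:?Q|lborel. ?\<phi> x *\<^sub>R column 1 (Df x)) + w $ 2 *\<^sub>R (LINT x:?Q|lborel. ?\<phi> x *\<^sub>R column 2 (Df x)))"
    unfolding eqj by simp
  also have "\<dots> = - (LINT x:?Q|lborel. w $ 1 *\<^sub>R (?\<phi> x *\<^sub>R column 1 (Df x)) + w $ 2 *\<^sub>R (?\<phi> x *\<^sub>R column 2 (Df x)))"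
    by (simp only: set_integral_lincomb[OF i2 i2])
  also have "(\<lambda>x. w $ 1 *\<^sub>R (?\<phi> x *\<^sub>R column 1 (Df x)) + w $ 2 *\<^sub>R (?\<phi> x *\<^sub>R column 2 (Df x))) = (\<lambda>x. ?\<phi> x *\<^sub>R (Df x *v w))"
    by (auto simp: fun_eq_iff vec_eq_iff matrix_vector_mult_def column_def UNIV_2 algebra_simps)
  finally show ?thesis .
qed

lemma indicator_rect:
  assumes "frame v w"
  shows "indicator (rect v w A1 A2 B1 B2) (t *\<^sub>R v + s *\<^sub>R w) = (indicator {A1..A2} t * indicator {B1..B2} s :: 'a::linordered_field)"
  by (auto simp: rect_def inner_simps frame_simps[OF assms] indicator_def)

text \<open>By Fubini the weak equation says that the slice integral \<open>H\<close> is orthogonal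
  to every smooth \<open>a\<close> supported in [A1, A2]. Smooth trapezoids converge boundedly to
  indicators of intervals, so \<open>H\<close> has zero integral over every interval and vanishes
  almost everywhere.\<close>

lemma acl_test:
  assumes fr: "frame v w" and Q: "rect v w A1 A2 B1 B2 \<subseteq> D"
    and b: "\<And>k. Ck1 k b" "\<And>s. s \<notin> {B1..B2} \<Longrightarrow> b s = 0"
    and db: "\<And>s. (b has_real_derivative b' s) (at s)" "continuous_on UNIV b'"
  shows "AE t in lborel. t \<in> {A1..A2} \<longrightarrow>
     (LINT s:{B1..B2}|lborel. b' s *\<^sub>R f (t *\<^sub>R v + s *\<^sub>R w) + b s *\<^sub>R (Df (t *\<^sub>R v + s *\<^sub>R w) *v w)) = 0"
proof -
  obtain S \<psi> :: "real \<Rightarrow> real" where S: "\<And>k. Ck1 k S"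
    "\<And>x. x \<le> 0 \<Longrightarrow> S x = 0" "\<And>x. 1 \<le> x \<Longrightarrow> S x = 1" "\<And>x. 0 \<le> S x \<and> S x \<le> 1"
    by (rule smooth_step_exists) blast
  let ?Q = "rect v w A1 A2 B1 B2"
  have cmp: "compact ?Q" by (rule compact_rect[OF fr])
  define g where "g x = indicator ?Q x *\<^sub>R (b' (x \<bullet> w) *\<^sub>R f x + b (x \<bullet> w) *\<^sub>R (Df x *v w))" for x
  have cb: "continuous_on UNIV b" using b(1)[of 0] by simp
  have cc: "continuous_on X (\<lambda>x. h (x \<bullet> u))" if "continuous_on UNIV h" for h :: "real \<Rightarrow> real" and u :: R2 and X
    by (rule continuous_on_compose2[OF that]) (auto intro: continuous_intros)
  have fQ: "continuous_on ?Q f" using cont_f Q by (rule continuous_on_subset)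
  have scal: "integrable lborel (\<lambda>x. indicator ?Q x *\<^sub>R (h (x \<bullet> u) *\<^sub>R F x))"
    if h: "continuous_on UNIV h" and F: "integrable lborel (\<lambda>x. indicator ?Q x *\<^sub>R F x)" for h :: "real \<Rightarrow> real" and u and F :: "R2 \<Rightarrow> R2"
  proof -
    obtain M where M: "\<And>x. x \<in> ?Q \<Longrightarrow> norm (h (x \<bullet> u)) \<le> M"
      using compact_imp_bounded[OF compact_continuous_image[OF cc[OF h, of ?Q u] cmp]] unfolding bounded_iff by blast
    have "(\<lambda>x. h (x \<bullet> u)) \<in> borel_measurable lborel"
      using cc[OF h, of UNIV u] by (auto intro: borel_measurable_continuous_onI)
    from borel_measurable_scaleR[OF this borel_measurable_integrable[OF F]]
    have m: "(\<lambda>x. indicator ?Q x *\<^sub>R (h (x \<bullet> u) *\<^sub>R F x)) \<in> borel_measurable lborel"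
      by (simp add: mult.commute)
    show ?thesis
    proof (rule Bochner_Integration.integrable_bound[OF integrable_scaleR_right[OF F, of M] m], rule AE_I2)
      fix x
      show "norm (indicator ?Q x *\<^sub>R (h (x \<bullet> u) *\<^sub>R F x)) \<le> norm (M *\<^sub>R (indicator ?Q x *\<^sub>R F x))"
        using M[of x] by (auto simp: indicator_def intro!: mult_right_mono)
    qed
  qed
  have if1: "integrable lborel (\<lambda>x. indicator ?Q x *\<^sub>R (b' (x \<bullet> w) *\<^sub>R f x))"
    by (rule scal[OF db(2)]) (rule borel_integrable_compact[OF cmp fQ])
  have if2: "integrable lborel (\<lambda>x. indicator ?Q x *\<^sub>R (b (x \<bullet> w) *\<^sub>R (Df x *v w)))"
    by (rule scal[OF cb]) (use Df_mult_int[OF cmp Q] in \<open>simp add: set_integrable_def\<close>)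
  have gi: "integrable lborel g"
    unfolding g_def scaleR_add_right by (rule Bochner_Integration.integrable_add[OF if1 if2])
  define H where "H t = (\<integral>s. g (t *\<^sub>R v + s *\<^sub>R w) \<partial>lborel)" for t
  have Hi: "integrable lborel H"
    using lborel_pair.integrable_fst'[OF integrable_frame(1)[OF fr gi]] by (simp add: H_def[abs_def])
  have Hz: "H t = 0" if "t \<notin> {A1..A2}" for t
    unfolding H_def g_def indicator_rect[OF fr] using that by simp
  have aH: "(\<integral>t. a t *\<^sub>R H t \<partial>lborel) = 0" if a: "\<And>k. Ck1 k a" "\<And>t. t \<notin> {A1..A2} \<Longrightarrow> a t = 0" for a
  proof -
    have ca: "continuous_on UNIV a" using a(1)[of 0] by simp
    have ia1: "integrable lborel (\<lambda>x. indicator ?Q x *\<^sub>R (a (x \<bullet> v) *\<^sub>R (b' (x \<bullet> w) *\<^sub>R f x)))"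
      by (rule scal[OF ca if1])
    have ia2: "integrable lborel (\<lambda>x. indicator ?Q x *\<^sub>R (a (x \<bullet> v) *\<^sub>R (b (x \<bullet> w) *\<^sub>R (Df x *v w))))"
      by (rule scal[OF ca if2])
    have "(\<integral>x. a (x \<bullet> v) *\<^sub>R g x \<partial>lborel)
       = (LINT x:?Q|lborel. (a (x \<bullet> v) * b' (x \<bullet> w)) *\<^sub>R f x) + (LINT x:?Q|lborel. (a (x \<bullet> v) * b (x \<bullet> w)) *\<^sub>R (Df x *v w))"
      using Bochner_Integration.integral_add[OF ia1 ia2]
      by (simp add: g_def set_lebesgue_integral_def scaleR_add_right mult.commute mult.left_commute mult.assoc)
    also have "\<dots> = 0" using weak_directional[OF fr Q a b db] by simp
    finally have 0: "(\<integral>x. a (x \<bullet> v) *\<^sub>R g x \<partial>lborel) = 0" .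
    have iag: "integrable lborel (\<lambda>x. a (x \<bullet> v) *\<^sub>R g x)"
      using Bochner_Integration.integrable_add[OF ia1 ia2] by (simp add: g_def scaleR_add_right mult.commute mult.left_commute mult.assoc)
    have "(\<integral>x. a (x \<bullet> v) *\<^sub>R g x \<partial>lborel) = (\<integral>t. (\<integral>s. a t *\<^sub>R g (t *\<^sub>R v + s *\<^sub>R w) \<partial>lborel) \<partial>lborel)"
      using integrable_frame(2)[OF fr iag] by (simp add: inner_simps frame_simps[OF fr])
    also have "\<dots> = (\<integral>t. a t *\<^sub>R H t \<partial>lborel)" by (simp add: H_def)
    finally show ?thesis using 0 by simp
  qed
  have "AE t in lborel. H t = 0"
  proof (rule AE_zero_if_Ioc_integrals_zero[OF Hi])
    fix c0 d0 :: real assume "c0 < d0"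
    \<comment> \<open>The test functions must live in [A1, A2]; \<open>H\<close> vanishes outside,
      so intersecting with it affects at most the endpoints.\<close>
    define c d where "c = max c0 A1" and "d = min d0 A2"
    have outside: "(LINT x:{c0<..d0}|lborel. H x) = (LINT x:{c<..<d}|lborel. H x)"
      unfolding set_lebesgue_integral_def
    proof (rule integral_cong_AE)
      show "(\<lambda>x. indicat_real {c0<..d0} x *\<^sub>R H x) \<in> borel_measurable lborel"
        "(\<lambda>x. indicat_real {c<..<d} x *\<^sub>R H x) \<in> borel_measurable lborel" using Hi by auto
      have "AE x in lborel. x \<noteq> A1 \<and> x \<noteq> A2 \<and> x \<noteq> d0"
        using AE_lborel_singleton[of A1] AE_lborel_singleton[of A2] AE_lborel_singleton[of d0] by eventually_elim auto
      then show "AE x in lborel. indicat_real {c0<..d0} x *\<^sub>R H x = indicat_real {c<..<d} x *\<^sub>R H x"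
      proof eventually_elim
        case (elim x)
        then show ?case using Hz[of x] by (auto simp: indicator_def c_def d_def)
      qed
    qed
    show "(LINT x:{c0<..d0}|lborel. H x) = 0"
    proof (cases "c < d")
      case False
      then show ?thesis unfolding outside by (simp add: set_lebesgue_integral_def)
    next
      case True
      \<comment> \<open>This rises from 0 to 1 on [c, c + 1/n] and falls back on [d - 1/n, d]; the
        support is right once n (d - c) \<ge> 1.\<close>
      define a where "a n t = S (real n * t + (- real n * c)) + (-1) * S (real n * t + (- real n * d + 1))" for n :: nat and t
      have ak: "Ck1 k (a n)" for k n unfolding a_def by (intro Ck1_add Ck1_mult Ck1_const Ck1_affine S)
      have asupp: "a n t = 0" if n: "real n * (d - c) \<ge> 1" and t: "t \<notin> {c..d}" for n t
      proof (cases "t < c")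
        case True
        have n1: "real n * t \<le> real n * c" using True by (intro mult_left_mono) auto
        then have "real n * t + (- real n * c) \<le> 0" by simp
        moreover have "real n * t + (- real n * d + 1) \<le> 0" using n1 n by (simp add: algebra_simps)
        ultimately show ?thesis unfolding a_def by (simp add: S)
      next
        case False
        then have n1: "real n * d \<le> real n * t" using t by (intro mult_left_mono) auto
        then have "1 \<le> real n * t + (- real n * c)" using n by (simp add: algebra_simps)
        moreover have "1 \<le> real n * t + (- real n * d + 1)" using n1 by (simp add: algebra_simps)
        ultimately show ?thesis unfolding a_def by (simp add: S)
      qed
      have alim: "(\<lambda>n. a n t) \<longlonglongrightarrow> indicator {c<..<d} t" if "t \<noteq> c" "t \<noteq> d" for t
      proof (rule tendsto_eventually)
        let ?\<delta> = "min \<bar>t - c\<bar> (min \<bar>t - d\<bar> (d - c))"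
        have \<delta>: "?\<delta> > 0" using that True by auto
        have "eventually (\<lambda>n. real n \<ge> 1 / ?\<delta>) sequentially"
          using filterlim_real_sequentially by (simp add: filterlim_at_top)
        then show "\<forall>\<^sub>F n in sequentially. a n t = indicator {c<..<d} t"
        proof eventually_elim
          case (elim n)
          then have n: "real n * ?\<delta> \<ge> 1" using \<delta> by (simp add: field_simps)
          have n1: "real n * \<bar>t - c\<bar> \<ge> 1" "real n * \<bar>t - d\<bar> \<ge> 1" "real n * (d - c) \<ge> 1"
            using n mult_left_mono[of ?\<delta> "\<bar>t - c\<bar>" "real n"] mult_left_mono[of ?\<delta> "\<bar>t - d\<bar>" "real n"] mult_left_mono[of ?\<delta> "d - c" "real n"] by linarith+
          show ?case
          proof (cases "t \<in> {c<..<d}")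
            case False
            then show ?thesis using asupp[OF n1(3), of t] that by (auto simp: indicator_def)
          next
            case True
            then have "1 \<le> real n * t + (- real n * c)" "real n * t + (- real n * d + 1) \<le> 0"
              using n1 by (auto simp: abs_if algebra_simps split: if_splits)
            then show ?thesis unfolding a_def using True by (simp add: S)
          qed
        qed
      qed
      have "(\<lambda>n. \<integral>t. a n t *\<^sub>R H t \<partial>lborel) \<longlonglongrightarrow> (\<integral>t. indicator {c<..<d} t *\<^sub>R H t \<partial>lborel)"
      proof (rule integral_dominated_convergence[where w="\<lambda>t. 2 * norm (H t)"])
        show "(\<lambda>t. indicat_real {c<..<d} t *\<^sub>R H t) \<in> borel_measurable lborel" using Hi by auto
        show "(\<lambda>t. a n t *\<^sub>R H t) \<in> borel_measurable lborel" for n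
          using Hi ak[of 0 n] by (intro borel_measurable_scaleR) (auto intro: borel_measurable_continuous_onI)
        show "integrable lborel (\<lambda>t. 2 * norm (H t))" using Hi by auto
        show "AE t in lborel. (\<lambda>n. a n t *\<^sub>R H t) \<longlonglongrightarrow> indicator {c<..<d} t *\<^sub>R H t"
          using AE_lborel_singleton[of c] AE_lborel_singleton[of d]
          by eventually_elim (intro tendsto_scaleR alim tendsto_const)
        have "\<bar>a n t\<bar> \<le> 2" for n t
          using S(4)[of "real n * t + (- real n * c)"] S(4)[of "real n * t + (- real n * d + 1)"] unfolding a_def by linarith
        then show "AE t in lborel. norm (a n t *\<^sub>R H t) \<le> 2 * norm (H t)" for n
          by (intro AE_I2) (auto intro!: mult_right_mono)
      qed
      moreover have "eventually (\<lambda>n. (\<integral>t. a n t *\<^sub>R H t \<partial>lborel) = 0) sequentially"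
      proof -
        have "eventually (\<lambda>n. real n \<ge> 1 / (d - c)) sequentially"
          using filterlim_real_sequentially by (simp add: filterlim_at_top)
        then show ?thesis
        proof eventually_elim
          case (elim n)
          then have n: "real n * (d - c) \<ge> 1" using True by (simp add: field_simps)
          show ?case by (rule aH[OF ak asupp[OF n]]) (auto simp: c_def d_def)
        qed
      qed
      ultimately have "(\<integral>t. indicator {c<..<d} t *\<^sub>R H t \<partial>lborel) = 0"
        by (rule LIMSEQ_unique[OF _ tendsto_eventually])
      then show ?thesis unfolding outside by (simp add: set_lebesgue_integral_def)
    qed
  qed
  then show ?thesis
  proof eventually_elim
    case (elim t)
    then show ?case unfolding H_def g_def indicator_rect[OF fr]
      by (auto simp: set_lebesgue_integral_def inner_simps frame_simps[OF fr])
  qed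
qed

lemma Rats_dense_eq_const:
  fixes F :: "real \<Rightarrow> R2"
  assumes "continuous_on {B1..B2} F" "B1 < B2"
    and "\<And>p q. p \<in> \<rat> \<Longrightarrow> q \<in> \<rat> \<Longrightarrow> B1 < p \<Longrightarrow> p < q \<Longrightarrow> q < B2 \<Longrightarrow> F p = F q"
    and "x \<in> {B1..B2}" "y \<in> {B1..B2}"
  shows "F x = F y"
proof -
  obtain r where r: "r \<in> \<rat>" "B1 < r" "r < B2" using Rats_dense_in_real[OF \<open>B1 < B2\<close>] by blast
  have cl: "closure (\<rat> \<inter> {B1<..<B2}) = {B1..B2}"
  proof -
    have "closure (\<rat> \<inter> {B1<..<B2}) = closure {B1<..<B2}"
      using closure_open_Int_superset[of "{B1<..<B2}" "\<rat>"] Rats_closure_real by (simp add: Int_commute)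
    then show ?thesis using assms(2) by simp
  qed
  have "F z = F r" if "z \<in> {B1..B2}" for z
  proof (rule continuous_constant_on_closure[of "\<rat> \<inter> {B1<..<B2}" F])
    show "continuous_on (closure (\<rat> \<inter> {B1<..<B2})) F" using assms(1) cl by simp
    show "F p = F r" if "p \<in> \<rat> \<inter> {B1<..<B2}" for p
    proof (cases p r rule: linorder_cases)
      case less then show ?thesis using assms(3)[of p r] that r by auto
    next
      case greater then show ?thesis using assms(3)[of r p, symmetric] that r by auto
    qed simp
    show "z \<in> closure (\<rat> \<inter> {B1<..<B2})" using that cl by simp
  qed
  then show ?thesis using assms(4,5) by metis
qed

text \<open>The exceptional null set must serve all \<open>p\<close> and \<open>q\<close> at once.
  Therefore only countably many test functions are used, with rational \<open>p\<close>,
  \<open>q\<close> and integer \<open>n\<close>; on a good line \<open>n\<close> tends to infinity,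
  and since both sides are continuous in the endpoints the identity extends to real ones.\<close>

lemma acl_rect:
  assumes fr: "frame v w" and Q: "rect v w A1 A2 B1 B2 \<subseteq> D" and B: "B1 < B2"
  shows "AE t in lborel. t \<in> {A1..A2} \<longrightarrow>
     set_integrable lborel {B1..B2} (\<lambda>s. Df (t *\<^sub>R v + s *\<^sub>R w) *v w) \<and>
     (\<forall>p q. B1 \<le> p \<and> p \<le> q \<and> q \<le> B2 \<longrightarrow>
        f (t *\<^sub>R v + q *\<^sub>R w) - f (t *\<^sub>R v + p *\<^sub>R w) = (LINT s:{p..q}|lborel. Df (t *\<^sub>R v + s *\<^sub>R w) *v w))"
proof -
  obtain S \<psi> :: "real \<Rightarrow> real" where S: "\<And>k. Ck1 k S" "\<And>x. (S has_real_derivative \<psi> x) (at x)" "\<And>k. Ck1 k \<psi>"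
    "\<And>x. 0 \<le> \<psi> x" "\<And>x. x \<notin> {0..1} \<Longrightarrow> \<psi> x = 0"
    "\<And>x. x \<le> 0 \<Longrightarrow> S x = 0" "\<And>x. 1 \<le> x \<Longrightarrow> S x = 1" "\<And>x. 0 \<le> S x \<and> S x \<le> 1"
    by (rule smooth_step_exists) blast
  have \<psi>c: "continuous_on UNIV \<psi>" using S(3)[of 0] by simp
  let ?Q = "rect v w A1 A2 B1 B2"
  have cmp: "compact ?Q" by (rule compact_rect[OF fr])
  \<comment> \<open>\<open>b\<close> is a smooth trapezoid on [p, q] with derivative
    \<open>k1 - k2\<close>, where \<open>k1\<close> is an approximate identity at \<open>p\<close>
    from the right and \<open>k2\<close> one at \<open>q\<close> from the left. Testing with
    \<open>b\<close> tends to the value of \<open>f\<close> at \<open>p\<close> minus that at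
    \<open>q\<close> plus the integral of the derivative between them.\<close>
  define k1 k2 b b' where "k1 p n s = real n * \<psi> (real n * s + (- real n * p))"
    and "k2 q n s = real n * \<psi> (real n * s + (- real n * q + 1))"
    and "b p q n s = S (real n * s + (- real n * p)) + (-1) * S (real n * s + (- real n * q + 1))"
    and "b' p q n s = k1 p n s - k2 q n s"
    for p q s :: real and n :: nat
  have affd: "((\<lambda>s. S (m * s + c)) has_real_derivative m * \<psi> (m * s + c)) (at s)" for m c s
  proof -
    have "((\<lambda>s. m * s + c) has_real_derivative m) (at s)" by (auto intro!: derivative_eq_intros)
    from DERIV_chain2[OF S(2) this] show ?thesis by (simp add: mult.commute)
  qed
  have db: "(b p q n has_real_derivative b' p q n s) (at s)" for p q n s
    unfolding b_def b'_def k1_def k2_def using DERIV_add[OF affd[of "real n" "- real n * p" s] DERIV_cmult[OF affd[of "real n" "- real n * q + 1" s], of "-1"]] by simp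
  have bk: "Ck1 k (b p q n)" for k p q n unfolding b_def by (intro Ck1_add Ck1_mult Ck1_const Ck1_affine S)
  have affc: "continuous_on X (\<lambda>s. m * \<psi> (m * s + c))" for m c X
    by (intro continuous_intros continuous_on_compose2[OF \<psi>c]) auto
  have kc: "continuous_on X (k1 p n)" "continuous_on X (k2 p n)" for p n X unfolding k1_def k2_def by (rule affc)+
  have b'c: "continuous_on X (b' p q n)" for p q n X unfolding b'_def by (intro continuous_intros kc)
  have bsupp: "b p q n t = 0" if n: "real n * (q - p) \<ge> 1" and t: "t \<notin> {p..q}" for p q n t
  proof (cases "t < p")
    case True
    have n1: "real n * t \<le> real n * p" using True by (intro mult_left_mono) auto
    then have "real n * t + (- real n * p) \<le> 0" by simp
    moreover have "real n * t + (- real n * q + 1) \<le> 0" using n1 n by (simp add: algebra_simps)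
    ultimately show ?thesis unfolding b_def by (simp add: S)
  next
    case False
    then have n1: "real n * q \<le> real n * t" using t by (intro mult_left_mono) auto
    then have "1 \<le> real n * t + (- real n * p)" using n by (simp add: algebra_simps)
    moreover have "1 \<le> real n * t + (- real n * q + 1)" using n1 by (simp add: algebra_simps)
    ultimately show ?thesis unfolding b_def by (simp add: S)
  qed
  have b'supp: "b' p q n t = 0" if n: "real n * (q - p) \<ge> 1" and t: "t \<notin> {p..q}" for p q n t
  proof (rule DERIV_unique[OF db])
    have "((\<lambda>_. 0) has_real_derivative 0) (at t)" by simp
    then show "(b p q n has_real_derivative 0) (at t)"
      by (rule has_field_derivative_transform_within_open[of _ _ _ "- {p..q}"]) (use that bsupp[OF n] in auto)
  qed
  let ?R = "{(p, q, n). p \<in> \<rat> \<and> q \<in> \<rat> \<and> B1 < p \<and> p < q \<and> q < B2 \<and> real n * (q - p) \<ge> 1}"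
  have "countable ?R"
    by (rule countable_subset[of _ "\<rat> \<times> \<rat> \<times> UNIV"]) (auto intro: countable_rat)
  moreover have "AE t in lborel. t \<in> {A1..A2} \<longrightarrow> (LINT s:{B1..B2}|lborel. b' p q n s *\<^sub>R f (t *\<^sub>R v + s *\<^sub>R w) + b p q n s *\<^sub>R (Df (t *\<^sub>R v + s *\<^sub>R w) *v w)) = 0"
    if "(p, q, n) \<in> ?R" for p q n
    by (rule acl_test[OF fr Q bk _ db b'c]) (use that bsupp in auto)
  ultimately have ae1: "AE t in lborel. \<forall>r\<in>?R. t \<in> {A1..A2} \<longrightarrow>
     (case r of (p, q, n) \<Rightarrow> (LINT s:{B1..B2}|lborel. b' p q n s *\<^sub>R f (t *\<^sub>R v + s *\<^sub>R w) + b p q n s *\<^sub>R (Df (t *\<^sub>R v + s *\<^sub>R w) *v w)) = 0)"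
    by (subst AE_ball_countable) auto
  have "integrable lborel (\<lambda>x. indicator ?Q x *\<^sub>R (Df x *v w))"
    using Df_mult_int[OF cmp Q] by (simp add: set_integrable_def)
  from lborel_pair.AE_integrable_fst'[OF integrable_frame(1)[OF fr this]]
  have ae2: "AE t in lborel. integrable lborel (\<lambda>s. indicator ?Q (t *\<^sub>R v + s *\<^sub>R w) *\<^sub>R (Df (t *\<^sub>R v + s *\<^sub>R w) *v w))"
    by simp
  from ae1 ae2 show ?thesis
  proof eventually_elim
    case (elim t)
    show ?case
    proof (intro impI)
      assume t: "t \<in> {A1..A2}"
      let ?F = "\<lambda>s. f (t *\<^sub>R v + s *\<^sub>R w)" and ?P = "\<lambda>s. Df (t *\<^sub>R v + s *\<^sub>R w) *v w"
      have Pi: "set_integrable lborel {B1..B2} ?P"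
        using elim(2) t unfolding set_integrable_def indicator_rect[OF fr] by simp
      have inQ: "t *\<^sub>R v + s *\<^sub>R w \<in> ?Q" if "s \<in> {B1..B2}" for s
        using that t by (auto simp: rect_def inner_simps frame_simps[OF fr])
      have Fc: "continuous_on {B1..B2} ?F"
        by (rule continuous_on_compose2[OF cont_f]) (use inQ Q in \<open>auto intro!: continuous_intros\<close>)
      have Psub: "set_integrable lborel {p..q} ?P" if "B1 \<le> p" "q \<le> B2" for p q
        by (rule set_integrable_subset[OF Pi]) (use that in auto)
      have rat: "?F q - ?F p = (LINT s:{p..q}|lborel. ?P s)" if pq: "p \<in> \<rat>" "q \<in> \<rat>" "B1 < p" "p < q" "q < B2" for p q
      proof -
        have sub: "{p..q} \<subseteq> {B1..B2}" using pq by auto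
        have Fpq: "continuous_on {p..q} ?F" by (rule continuous_on_subset[OF Fc sub])
        have bigev: "eventually (\<lambda>n. real n \<ge> c) sequentially" for c
          using filterlim_real_sequentially by (simp add: filterlim_at_top)
        have ev1: "eventually (\<lambda>n. real n * (q - p) \<ge> 1) sequentially"
          using bigev[of "1 / (q - p)"] by eventually_elim (use pq in \<open>simp add: field_simps\<close>)
        have zero: "(LINT s:{p..q}|lborel. k1 p n s *\<^sub>R ?F s) - (LINT s:{p..q}|lborel. k2 q n s *\<^sub>R ?F s)
            + (LINT s:{p..q}|lborel. b p q n s *\<^sub>R ?P s) = 0" if n: "real n * (q - p) \<ge> 1" for n
        proof -
          have "(p, q, n) \<in> ?R" using pq n by auto
          then have z: "(LINT s:{B1..B2}|lborel. b' p q n s *\<^sub>R ?F s + b p q n s *\<^sub>R ?P s) = 0"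
            using elim(1) t by blast
          have "(LINT s:{B1..B2}|lborel. b' p q n s *\<^sub>R ?F s + b p q n s *\<^sub>R ?P s)
              = (LINT s:{p..q}|lborel. b' p q n s *\<^sub>R ?F s + b p q n s *\<^sub>R ?P s)"
            unfolding set_lebesgue_integral_def
            by (rule Bochner_Integration.integral_cong) (use sub bsupp[OF n] b'supp[OF n] in \<open>auto simp: indicator_def\<close>)
          also have "\<dots> = (LINT s:{p..q}|lborel. b' p q n s *\<^sub>R ?F s) + (LINT s:{p..q}|lborel. b p q n s *\<^sub>R ?P s)"
          proof (rule set_integral_add(2))
            show "set_integrable lborel {p..q} (\<lambda>s. b' p q n s *\<^sub>R ?F s)" unfolding set_integrable_def
              by (rule borel_integrable_compact) (auto intro!: continuous_intros b'c Fpq)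
            show "set_integrable lborel {p..q} (\<lambda>s. b p q n s *\<^sub>R ?P s)"
              unfolding set_integrable_def
            proof (rule Bochner_Integration.integrable_bound[OF integrable_scaleR_right[where c=2]])
              show "integrable lborel (\<lambda>s. indicator {p..q} s *\<^sub>R ?P s)" using Psub[of p q] pq by (simp add: set_integrable_def)
              have "(\<lambda>s. b p q n s *\<^sub>R (indicator {p..q} s *\<^sub>R ?P s)) \<in> borel_measurable lborel"
              proof (rule borel_measurable_scaleR)
                show "b p q n \<in> borel_measurable lborel" using bk[of 0 p q n] by (auto intro: borel_measurable_continuous_onI)
                show "(\<lambda>s. indicator {p..q} s *\<^sub>R ?P s) \<in> borel_measurable lborel"
                  using Psub[of p q] pq unfolding set_integrable_def by (intro borel_measurable_integrable) auto
              qed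
              then show "(\<lambda>s. indicator {p..q} s *\<^sub>R (b p q n s *\<^sub>R ?P s)) \<in> borel_measurable lborel"
                by (simp add: mult.commute)
              have "\<bar>b p q n s\<bar> \<le> 2" for s
                using S(8)[of "real n * s + (- real n * p)"] S(8)[of "real n * s + (- real n * q + 1)"] unfolding b_def by linarith
              then show "AE s in lborel. norm (indicator {p..q} s *\<^sub>R (b p q n s *\<^sub>R ?P s)) \<le> norm (2 *\<^sub>R (indicator {p..q} s *\<^sub>R ?P s))"
                by (intro AE_I2) (auto simp: indicator_def intro!: mult_right_mono)
            qed
          qed
          also have "(LINT s:{p..q}|lborel. b' p q n s *\<^sub>R ?F s) = (LINT s:{p..q}|lborel. k1 p n s *\<^sub>R ?F s) - (LINT s:{p..q}|lborel. k2 q n s *\<^sub>R ?F s)"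
            unfolding b'_def scaleR_diff_left
            by (rule set_integral_diff(2); unfold set_integrable_def; rule borel_integrable_compact) (auto intro!: continuous_intros kc Fpq)
          finally show ?thesis using z by simp
        qed
        have kint: "(LINT s:{p..q}|lborel. k1 p n s) = 1" "(LINT s:{p..q}|lborel. k2 q n s) = 1" if n: "real n * (q - p) \<ge> 1" for n
        proof -
          have "(LINT s:{p..q}|lborel. k1 p n s) = S (real n * q + (- real n * p)) - S (real n * p + (- real n * p))"
            unfolding set_lebesgue_integral_def
          proof (rule integral_FTC_Icc[where F="\<lambda>s. S (real n * s + (- real n * p))"])
            show "((\<lambda>s. S (real n * s + (- real n * p))) has_vector_derivative k1 p n x) (at x within {p..q})" for x
              unfolding has_real_derivative_iff_has_vector_derivative[symmetric] k1_def
              by (rule has_field_derivative_at_within[OF affd])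
          qed (use pq kc in auto)
          then show "(LINT s:{p..q}|lborel. k1 p n s) = 1" using n by (simp add: S algebra_simps)
          have "(LINT s:{p..q}|lborel. k2 q n s) = S (real n * q + (- real n * q + 1)) - S (real n * p + (- real n * q + 1))"
            unfolding set_lebesgue_integral_def
          proof (rule integral_FTC_Icc[where F="\<lambda>s. S (real n * s + (- real n * q + 1))"])
            show "((\<lambda>s. S (real n * s + (- real n * q + 1))) has_vector_derivative k2 q n x) (at x within {p..q})" for x
              unfolding has_real_derivative_iff_has_vector_derivative[symmetric] k2_def
              by (rule has_field_derivative_at_within[OF affd])
          qed (use pq kc in auto)
          then show "(LINT s:{p..q}|lborel. k2 q n s) = 1" using n by (simp add: S algebra_simps)
        qed
        have lim12: "(\<lambda>n. LINT s:{p..q}|lborel. k1 p n s *\<^sub>R ?F s) \<longlonglongrightarrow> ?F p"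
          "(\<lambda>n. LINT s:{p..q}|lborel. k2 q n s *\<^sub>R ?F s) \<longlonglongrightarrow> ?F q"
        proof -
          have close: "\<exists>d>0. \<forall>s\<in>{p..q}. \<bar>s - x\<bar> \<le> d \<longrightarrow> norm (?F s - ?F x) \<le> e" if "x \<in> {p..q}" "e > 0" for x e
          proof -
            have "\<exists>d>0. \<forall>s\<in>{p..q}. dist s x < d \<longrightarrow> dist (?F s) (?F x) < e"
              using Fpq that unfolding continuous_on_iff by blast
            then obtain d where "d > 0" "\<forall>s\<in>{p..q}. dist s x < d \<longrightarrow> dist (?F s) (?F x) < e" by blast
            then show ?thesis by (intro exI[of _ "d/2"]) (force simp: dist_norm)
          qed
          show "(\<lambda>n. LINT s:{p..q}|lborel. k1 p n s *\<^sub>R ?F s) \<longlonglongrightarrow> ?F p"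
          proof (rule LIMSEQ_I)
            fix e :: real assume "e > 0"
            obtain d where d: "d > 0" "\<forall>s\<in>{p..q}. \<bar>s - p\<bar> \<le> d \<longrightarrow> norm (?F s - ?F p) \<le> e/2"
              using close[of p "e/2"] pq \<open>e > 0\<close> by auto
            have "eventually (\<lambda>n. norm ((LINT s:{p..q}|lborel. k1 p n s *\<^sub>R ?F s) - ?F p) < e) sequentially"
              using ev1 bigev[of "1/d"]
            proof eventually_elim
              case (elim n)
              have "real n > 0" using elim(1) by (cases n) auto
              have "norm ((LINT s:{p..q}|lborel. k1 p n s *\<^sub>R ?F s) - ?F p) \<le> e/2"
              proof (rule norm_weighted_average_diff_le[OF Fpq kc(1) _ kint(1)[OF elim(1)]])
                show "0 \<le> k1 p n s" for s using S(4) by (simp add: k1_def)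
                fix s assume s: "s \<in> {p..q}" "k1 p n s \<noteq> 0"
                then have "real n * s + (- real n * p) \<in> {0..1}" using S(5) by (force simp: k1_def)
                then have "real n * (s - p) \<le> real n * d" using elim(2) d(1) by (simp add: algebra_simps field_simps)
                then have "s - p \<le> d" using \<open>real n > 0\<close> by simp
                then show "norm (?F s - ?F p) \<le> e/2" using d(2) s(1) by auto
              qed
              then show ?case using \<open>e > 0\<close> by simp
            qed
            then show "\<exists>no. \<forall>n\<ge>no. norm ((LINT s:{p..q}|lborel. k1 p n s *\<^sub>R ?F s) - ?F p) < e"
              by (simp add: eventually_sequentially)
          qed
          show "(\<lambda>n. LINT s:{p..q}|lborel. k2 q n s *\<^sub>R ?F s) \<longlonglongrightarrow> ?F q"
          proof (rule LIMSEQ_I)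
            fix e :: real assume "e > 0"
            obtain d where d: "d > 0" "\<forall>s\<in>{p..q}. \<bar>s - q\<bar> \<le> d \<longrightarrow> norm (?F s - ?F q) \<le> e/2"
              using close[of q "e/2"] pq \<open>e > 0\<close> by auto
            have "eventually (\<lambda>n. norm ((LINT s:{p..q}|lborel. k2 q n s *\<^sub>R ?F s) - ?F q) < e) sequentially"
              using ev1 bigev[of "1/d"]
            proof eventually_elim
              case (elim n)
              have "real n > 0" using elim(1) by (cases n) auto
              have "norm ((LINT s:{p..q}|lborel. k2 q n s *\<^sub>R ?F s) - ?F q) \<le> e/2"
              proof (rule norm_weighted_average_diff_le[OF Fpq kc(2) _ kint(2)[OF elim(1)]])
                show "0 \<le> k2 q n s" for s using S(4) by (simp add: k2_def)
                fix s assume s: "s \<in> {p..q}" "k2 q n s \<noteq> 0"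
                then have "real n * s + (- real n * q + 1) \<in> {0..1}" using S(5) by (force simp: k2_def)
                then have "real n * (q - s) \<le> real n * d" using elim(2) d(1) by (simp add: algebra_simps field_simps)
                then have "q - s \<le> d" using \<open>real n > 0\<close> by simp
                then show "norm (?F s - ?F q) \<le> e/2" using d(2) s(1) by auto
              qed
              then show ?case using \<open>e > 0\<close> by simp
            qed
            then show "\<exists>no. \<forall>n\<ge>no. norm ((LINT s:{p..q}|lborel. k2 q n s *\<^sub>R ?F s) - ?F q) < e"
              by (simp add: eventually_sequentially)
          qed
        qed
        have lim3: "(\<lambda>n. LINT s:{p..q}|lborel. b p q n s *\<^sub>R ?P s) \<longlonglongrightarrow> (LINT s:{p..q}|lborel. ?P s)"
          unfolding set_lebesgue_integral_def
        proof (rule integral_dominated_convergence[where w="\<lambda>s. 2 * norm (indicator {p..q} s *\<^sub>R ?P s)"])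
          have Ppq: "integrable lborel (\<lambda>s. indicator {p..q} s *\<^sub>R ?P s)" using Psub[of p q] pq by (simp add: set_integrable_def)
          then show "(\<lambda>s. indicat_real {p..q} s *\<^sub>R ?P s) \<in> borel_measurable lborel" by (rule borel_measurable_integrable)
          show "integrable lborel (\<lambda>s. 2 * norm (indicator {p..q} s *\<^sub>R ?P s))" using Ppq by (intro integrable_mult_right integrable_norm)
          fix n
          have "(\<lambda>s. b p q n s *\<^sub>R (indicator {p..q} s *\<^sub>R ?P s)) \<in> borel_measurable lborel"
            by (rule borel_measurable_scaleR[OF _ borel_measurable_integrable[OF Ppq]])
               (use bk[of 0 p q n] in \<open>auto intro: borel_measurable_continuous_onI\<close>)
          then show "(\<lambda>s. indicat_real {p..q} s *\<^sub>R (b p q n s *\<^sub>R ?P s)) \<in> borel_measurable lborel"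
            by (simp add: mult.commute)
          have "\<bar>b p q n s\<bar> \<le> 2" for s
            using S(8)[of "real n * s + (- real n * p)"] S(8)[of "real n * s + (- real n * q + 1)"] unfolding b_def by linarith
          then show "AE s in lborel. norm (indicat_real {p..q} s *\<^sub>R (b p q n s *\<^sub>R ?P s)) \<le> 2 * norm (indicat_real {p..q} s *\<^sub>R ?P s)"
            by (intro AE_I2) (auto simp: indicator_def intro!: mult_right_mono)
        next
          have bl: "(\<lambda>n. b p q n s) \<longlonglongrightarrow> 1" if s: "p < s" "s < q" for s
          proof (rule tendsto_eventually)
            have e1: "eventually (\<lambda>n. real n * (s - p) \<ge> 1) sequentially"
              using bigev[of "1 / (s - p)"] by eventually_elim (use s in \<open>simp add: field_simps\<close>)
            have e2: "eventually (\<lambda>n. real n * (q - s) \<ge> 1) sequentially"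
              using bigev[of "1 / (q - s)"] by eventually_elim (use s in \<open>simp add: field_simps\<close>)
            from e1 e2 show "\<forall>\<^sub>F n in sequentially. b p q n s = 1"
            proof eventually_elim
              case (elim n)
              then have "1 \<le> real n * s + (- real n * p)" "real n * s + (- real n * q + 1) \<le> 0" by (auto simp: algebra_simps)
              then show ?case unfolding b_def by (simp add: S)
            qed
          qed
          show "AE s in lborel. (\<lambda>n. indicat_real {p..q} s *\<^sub>R (b p q n s *\<^sub>R ?P s)) \<longlonglongrightarrow> indicat_real {p..q} s *\<^sub>R ?P s"
            using AE_lborel_singleton[of p] AE_lborel_singleton[of q]
          proof eventually_elim
            case (elim s)
            show ?case
            proof (cases "p < s \<and> s < q")
              case True
              have "(\<lambda>n. b p q n s *\<^sub>R ?P s) \<longlonglongrightarrow> 1 *\<^sub>R ?P s" using bl True by (intro tendsto_scaleR tendsto_const) auto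
              then show ?thesis using True by simp
            qed (use elim in \<open>auto simp: indicator_def\<close>)
          qed
        qed
        have "(\<lambda>n. (LINT s:{p..q}|lborel. k1 p n s *\<^sub>R ?F s) - (LINT s:{p..q}|lborel. k2 q n s *\<^sub>R ?F s)
            + (LINT s:{p..q}|lborel. b p q n s *\<^sub>R ?P s)) \<longlonglongrightarrow> ?F p - ?F q + (LINT s:{p..q}|lborel. ?P s)"
          by (intro tendsto_intros lim12 lim3)
        moreover have "(\<lambda>n. (LINT s:{p..q}|lborel. k1 p n s *\<^sub>R ?F s) - (LINT s:{p..q}|lborel. k2 q n s *\<^sub>R ?F s)
            + (LINT s:{p..q}|lborel. b p q n s *\<^sub>R ?P s)) \<longlonglongrightarrow> 0"
          by (rule tendsto_eventually) (use ev1 zero in \<open>auto elim: eventually_mono\<close>)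
        ultimately have "?F p - ?F q + (LINT s:{p..q}|lborel. ?P s) = 0" by (rule LIMSEQ_unique)
        then show ?thesis by (simp add: algebra_simps add_eq_0_iff2)
      qed
      \<comment> \<open>Minus this indefinite integral, the function on the line takes one value at
        all rational points, and by continuity everywhere.\<close>
      define J where "J s = integral {B1..s} ?P" for s
      have PHK: "?P integrable_on {B1..B2}" by (rule set_borel_integral_eq_integral(1)[OF Pi])
      have Jc: "continuous_on {B1..B2} J" unfolding J_def by (rule indefinite_integral_continuous_1[OF PHK])
      have Jd: "J q - J p = (LINT s:{p..q}|lborel. ?P s)" if "B1 \<le> p" "p \<le> q" "q \<le> B2" for p q
      proof -
        have "integral {B1..p} ?P + integral {p..q} ?P = integral {B1..q} ?P"
          by (rule Henstock_Kurzweil_Integration.integral_combine) (use that PHK in \<open>auto intro: integrable_on_subinterval\<close>)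
        then show ?thesis using set_borel_integral_eq_integral(2)[OF Psub[of p q]] that by (simp add: J_def algebra_simps)
      qed
      have const: "?F x - J x = ?F y - J y" if "x \<in> {B1..B2}" "y \<in> {B1..B2}" for x y
      proof (rule Rats_dense_eq_const[of B1 B2 "\<lambda>x. ?F x - J x"])
        show "continuous_on {B1..B2} (\<lambda>x. ?F x - J x)" by (intro continuous_intros Fc Jc)
        fix p q :: real assume "p \<in> \<rat>" "q \<in> \<rat>" "B1 < p" "p < q" "q < B2"
        then show "?F p - J p = ?F q - J q" using rat[of p q] Jd[of p q] by (simp add: algebra_simps)
      qed (use that B in auto)
      show "set_integrable lborel {B1..B2} ?P \<and>
        (\<forall>p q. B1 \<le> p \<and> p \<le> q \<and> q \<le> B2 \<longrightarrow> ?F q - ?F p = (LINT s:{p..q}|lborel. ?P s))"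
      proof (intro conjI Pi allI impI)
        fix p q assume pq: "B1 \<le> p \<and> p \<le> q \<and> q \<le> B2"
        then have "?F q - ?F p = J q - J p" using const[of p q] by (simp add: algebra_simps)
        then show "?F q - ?F p = (LINT s:{p..q}|lborel. ?P s)" using Jd pq by simp
      qed
    qed
  qed
qed

text \<open>A segment inside the open set has a rectangle with rational sides around it that is
  still inside, so countably many null sets account for all segments.\<close>

lemma acl_line:
  assumes fr: "frame v w"
  shows "AE t in lborel. \<forall>p q. p \<le> q \<and> (\<forall>s\<in>{p..q}. t *\<^sub>R v + s *\<^sub>R w \<in> D) \<longrightarrow>
     set_integrable lborel {p..q} (\<lambda>s. Df (t *\<^sub>R v + s *\<^sub>R w) *v w) \<and>
     f (t *\<^sub>R v + q *\<^sub>R w) - f (t *\<^sub>R v + p *\<^sub>R w) = (LINT s:{p..q}|lborel. Df (t *\<^sub>R v + s *\<^sub>R w) *v w)"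
proof -
  let ?R = "{(A1, A2, B1, B2). A1 \<in> \<rat> \<and> A2 \<in> \<rat> \<and> B1 \<in> \<rat> \<and> B2 \<in> \<rat> \<and> rect v w A1 A2 B1 B2 \<subseteq> D \<and> B1 < B2}"
  let ?S = "\<lambda>t p q. set_integrable lborel {p..q} (\<lambda>s. Df (t *\<^sub>R v + s *\<^sub>R w) *v w)"
  let ?E = "\<lambda>t p q. f (t *\<^sub>R v + q *\<^sub>R w) - f (t *\<^sub>R v + p *\<^sub>R w) = (LINT s:{p..q}|lborel. Df (t *\<^sub>R v + s *\<^sub>R w) *v w)"
  have "countable ?R"
    by (rule countable_subset[of _ "\<rat> \<times> \<rat> \<times> \<rat> \<times> \<rat>"]) (auto intro: countable_rat)
  moreover have "AE t in lborel. t \<in> {A1..A2} \<longrightarrow> ?S t B1 B2 \<and> (\<forall>p q. B1 \<le> p \<and> p \<le> q \<and> q \<le> B2 \<longrightarrow> ?E t p q)"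
    if "(A1, A2, B1, B2) \<in> ?R" for A1 A2 B1 B2
    by (rule acl_rect[OF fr]) (use that in auto)
  ultimately have "AE t in lborel. \<forall>r\<in>?R. case r of (A1, A2, B1, B2) \<Rightarrow>
      t \<in> {A1..A2} \<longrightarrow> ?S t B1 B2 \<and> (\<forall>p q. B1 \<le> p \<and> p \<le> q \<and> q \<le> B2 \<longrightarrow> ?E t p q)"
    by (subst AE_ball_countable) auto
  then show ?thesis
  proof eventually_elim
    case (elim t)
    show ?case
    proof (intro allI impI)
      fix p q :: real
      assume pq: "p \<le> q \<and> (\<forall>s\<in>{p..q}. t *\<^sub>R v + s *\<^sub>R w \<in> D)"
      let ?K = "(\<lambda>s. t *\<^sub>R v + s *\<^sub>R w) ` {p..q}"
      have "compact ?K" by (intro compact_continuous_image continuous_intros) simp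
      moreover have "?K \<subseteq> D" using pq by auto
      ultimately obtain d where d: "d > 0" "(\<Union>x\<in>?K. ball x d) \<subseteq> D"
        using compact_subset_open_imp_ball_epsilon_subset[OF _ open_D] by metis
      obtain A1 where A1: "A1 \<in> \<rat>" "t - d/2 < A1" "A1 < t" using Rats_dense_in_real[of "t - d/2" t] d by auto
      obtain A2 where A2: "A2 \<in> \<rat>" "t < A2" "A2 < t + d/2" using Rats_dense_in_real[of t "t + d/2"] d by auto
      obtain B1 where B1: "B1 \<in> \<rat>" "p - d/2 < B1" "B1 < p" using Rats_dense_in_real[of "p - d/2" p] d by auto
      obtain B2 where B2: "B2 \<in> \<rat>" "q < B2" "B2 < q + d/2" using Rats_dense_in_real[of q "q + d/2"] d by auto
      have "rect v w A1 A2 B1 B2 \<subseteq> D"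
      proof
        fix x assume x: "x \<in> rect v w A1 A2 B1 B2"
        define s where "s = max p (min q (x \<bullet> w))"
        have "x - (t *\<^sub>R v + s *\<^sub>R w) = (x \<bullet> v - t) *\<^sub>R v + (x \<bullet> w - s) *\<^sub>R w"
          by (subst (1) frame_decomp[OF fr, of x, symmetric]) (simp add: algebra_simps)
        then have "norm (x - (t *\<^sub>R v + s *\<^sub>R w)) \<le> \<bar>x \<bullet> v - t\<bar> + \<bar>x \<bullet> w - s\<bar>"
          using norm_triangle_ineq[of "(x \<bullet> v - t) *\<^sub>R v" "(x \<bullet> w - s) *\<^sub>R w"] by (simp add: frame_simps[OF fr])
        moreover have xx: "A1 \<le> x \<bullet> v" "x \<bullet> v \<le> A2" "B1 \<le> x \<bullet> w" "x \<bullet> w \<le> B2" using x by (auto simp: rect_def)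
        have "\<bar>x \<bullet> v - t\<bar> < d/2" using xx A1 A2 by linarith
        moreover have "\<bar>x \<bullet> w - s\<bar> < d/2" using xx B1 B2 d pq unfolding s_def by linarith
        ultimately have "norm (x - (t *\<^sub>R v + s *\<^sub>R w)) < d" by linarith
        then have "x \<in> ball (t *\<^sub>R v + s *\<^sub>R w) d" by (simp add: dist_norm norm_minus_commute)
        moreover have "s \<in> {p..q}" using pq by (auto simp: s_def)
        ultimately show "x \<in> D" using d by blast
      qed
      then have "(A1, A2, B1, B2) \<in> ?R" using A1 A2 B1 B2 pq by auto
      from bspec[OF elim this]
      have "t \<in> {A1..A2} \<longrightarrow> ?S t B1 B2 \<and> (\<forall>p q. B1 \<le> p \<and> p \<le> q \<and> q \<le> B2 \<longrightarrow> ?E t p q)"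
        by (simp only: prod.case)
      then have "?S t B1 B2" "?E t p q" using A1 A2 B1 B2 pq by (auto simp only: atLeastAtMost_iff less_imp_le)
      then show "?S t p q \<and> ?E t p q" using B1 B2 by (auto elim!: set_integrable_subset)
    qed
  qed
qed

lemma emeasure_rect:
  assumes "frame v w" "A1 \<le> A2" "B1 \<le> B2"
  shows "emeasure lborel (rect v w A1 A2 B1 B2) = ennreal ((A2 - A1) * (B2 - B1))"
proof -
  have b: "rect v w A1 A2 B1 B2 \<in> sets borel"
    using compact_rect[OF assms(1)] by (simp add: borel_compact)
  have i: "indicator (rect v w A1 A2 B1 B2) (t *\<^sub>R v + s *\<^sub>R w) = (indicator {A1..A2} t * indicator {B1..B2} s :: ennreal)" for t s
    by (auto simp: rect_def inner_simps frame_simps[OF assms(1)] indicator_def)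
  have "emeasure lborel (rect v w A1 A2 B1 B2) = (\<integral>\<^sup>+ x. indicator (rect v w A1 A2 B1 B2) x \<partial>lborel)"
    using b by simp
  also have "\<dots> = (\<integral>\<^sup>+ t. (\<integral>\<^sup>+ s. indicator {A1..A2} t * indicator {B1..B2} s \<partial>lborel) \<partial>lborel)"
    using nn_integral_frame[OF assms(1), of "indicator (rect v w A1 A2 B1 B2)"] b by (simp add: i)
  also have "\<dots> = (\<integral>\<^sup>+ t. ennreal (B2 - B1) * indicator {A1..A2} t \<partial>lborel)"
    using assms by (simp add: nn_integral_cmult mult.commute)
  also have "\<dots> = ennreal ((A2 - A1) * (B2 - B1))"
    using assms by (simp add: nn_integral_cmult ennreal_mult mult.commute)
  finally show ?thesis .
qed

lemma norm_diff_le_nn_integral_line: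
  assumes "set_integrable lborel {p..q} P" "y = (LINT s:{p..q}|lborel. P s)"
  shows "ennreal (norm (y::R2)) \<le> (\<integral>\<^sup>+ s\<in>{p..q}. ennreal (norm (P s)) \<partial>lborel)"
proof -
  have "ennreal (norm y) \<le> (\<integral>\<^sup>+ s. ennreal (norm (indicator {p..q} s *\<^sub>R P s)) \<partial>lborel)"
    unfolding assms(2) set_lebesgue_integral_def
    by (rule integral_norm_bound_ennreal) (use assms(1) in \<open>simp add: set_integrable_def\<close>)
  also have "\<dots> = (\<integral>\<^sup>+ s\<in>{p..q}. ennreal (norm (P s)) \<partial>lborel)"
    by (rule nn_integral_cong) (auto simp: indicator_def)
  finally show ?thesis .
qed

text \<open>\<open>W\<close> consists of points that reach the image curve after moving at most
  \<open>h\<close> along \<open>e\<close>. A short piece of the curve has extent at most \<tau>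
  along \<open>e\<close> and at most its length along \<open>e'\<close>, so its share of
  \<open>W\<close> lies in a rectangle of width \<open>h + \<tau>\<close> whose height is at most
  the integral of |Df w| over the piece. The pieces do not overlap, so the integrals add up.\<close>

lemma slice_measure_le:
  assumes fr: "frame v w" and fr': "frame e e'" and h: "h > 0" and \<tau>: "\<tau> > 0"
    and Pt: "open Pt" "bounded Pt" "\<And>s. s \<in> Pt \<Longrightarrow> t *\<^sub>R v + s *\<^sub>R w \<in> D"
    and acl: "\<forall>p q. p \<le> q \<and> (\<forall>s\<in>{p..q}. t *\<^sub>R v + s *\<^sub>R w \<in> D) \<longrightarrow>
     set_integrable lborel {p..q} (\<lambda>s. Df (t *\<^sub>R v + s *\<^sub>R w) *v w) \<and>
     f (t *\<^sub>R v + q *\<^sub>R w) - f (t *\<^sub>R v + p *\<^sub>R w) = (LINT s:{p..q}|lborel. Df (t *\<^sub>R v + s *\<^sub>R w) *v w)"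
    and W: "W \<in> sets borel" "\<And>p. p \<in> W \<Longrightarrow> \<exists>s\<in>Pt. \<exists>\<sigma>\<in>{0..h}. f (t *\<^sub>R v + s *\<^sub>R w) = p + \<sigma> *\<^sub>R e"
  shows "emeasure lborel W \<le> ennreal (h + \<tau>) * (\<integral>\<^sup>+ s\<in>Pt. ennreal (norm (Df (t *\<^sub>R v + s *\<^sub>R w) *v w)) \<partial>lborel)"
proof -
  let ?F = "\<lambda>s. f (t *\<^sub>R v + s *\<^sub>R w)"
  let ?N = "\<lambda>s. ennreal (norm (Df (t *\<^sub>R v + s *\<^sub>R w) *v w))"
  have Fc: "continuous_on Pt ?F"
    by (rule continuous_on_compose2[OF cont_f]) (use Pt in \<open>auto intro!: continuous_intros\<close>)
  have "\<exists>r>0. s \<in> Pt \<longrightarrow> ball s r \<subseteq> Pt \<and> (\<forall>s'\<in>ball s r. \<bar>?F s' \<bullet> e - ?F s \<bullet> e\<bar> \<le> \<tau>/2)" for s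
  proof (cases "s \<in> Pt")
    case True
    obtain r1 where r1: "r1 > 0" "ball s r1 \<subseteq> Pt" using Pt(1) True openE by blast
    have "continuous_on Pt (\<lambda>s. ?F s \<bullet> e)" by (intro continuous_intros Fc)
    then obtain r2 where r2: "r2 > 0" "\<And>s'. s' \<in> Pt \<Longrightarrow> dist s' s < r2 \<Longrightarrow> dist (?F s' \<bullet> e) (?F s \<bullet> e) < \<tau>/2"
      using True \<tau> unfolding continuous_on_iff by (meson half_gt_zero)
    show ?thesis
    proof (intro exI[of _ "min r1 r2"] conjI impI ballI)
      show "min r1 r2 > 0" using r1 r2 by simp
      show "ball s (min r1 r2) \<subseteq> Pt" using r1 by auto
      fix s' assume s': "s' \<in> ball s (min r1 r2)"
      then have "s' \<in> Pt" "dist s' s < r2" using r1 by (auto simp: dist_commute)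
      then show "\<bar>?F s' \<bullet> e - ?F s \<bullet> e\<bar> \<le> \<tau>/2" using r2(2)[of s'] by (simp add: dist_real_def)
    qed
  qed (auto intro: exI[of _ 1])
  then obtain r where r: "\<And>s. r s > 0" "\<And>s. s \<in> Pt \<Longrightarrow> ball s (r s) \<subseteq> Pt"
    "\<And>s s'. s \<in> Pt \<Longrightarrow> s' \<in> ball s (r s) \<Longrightarrow> \<bar>?F s' \<bullet> e - ?F s \<bullet> e\<bar> \<le> \<tau>/2" by metis
  \<comment> \<open>The gauge says how far the curve may be followed while its
    \<open>e\<close>-coordinate moves by at most \<tau>/2; the covering lemma yields nonoverlapping
    closed intervals subordinate to it.\<close>
  have ga: "gauge (\<lambda>s. ball s (r s))" using r(1) by (auto simp: gauge_def)
  obtain B where B: "B > 0" "\<And>s. s \<in> Pt \<Longrightarrow> \<bar>s\<bar> \<le> B" using Pt(2) by (metis bounded_pos real_norm_def)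
  have sub: "Pt \<subseteq> cbox (-B) B" and ne: "box (-B) B \<noteq> {}" using B by (auto simp: box_eq_empty abs_le_iff) force
  obtain \<D> where \<D>: "countable \<D>" "\<Union>\<D> \<subseteq> cbox (-B) B"
     "\<And>K. K \<in> \<D> \<Longrightarrow> interior K \<noteq> {} \<and> (\<exists>c d. K = cbox c d)"
     "pairwise (\<lambda>A B. interior A \<inter> interior B = {}) \<D>"
     "\<And>K. K \<in> \<D> \<Longrightarrow> \<exists>x \<in> Pt \<inter> K. K \<subseteq> ball x (r x)"
     "Pt \<subseteq> \<Union>\<D>"
    by (rule covering_lemma[OF sub ne ga]) (rule that; assumption)
  have "\<exists>c d x. c < d \<and> K = {c..d} \<and> x \<in> Pt \<and> x \<in> K \<and> K \<subseteq> ball x (r x)" if KD: "K \<in> \<D>" for K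
  proof -
    obtain c d where K: "K = {c..d}" using \<D>(3)[OF KD] by auto
    have "interior K = {c<..<d}" unfolding K by (simp add: interior_atLeastAtMost_real)
    then have "c < d" using \<D>(3)[OF KD] by auto
    then show ?thesis using \<D>(5)[OF KD] K by blast
  qed
  then obtain lo hi x0 where K: "\<And>K. K \<in> \<D> \<Longrightarrow> lo K < hi K \<and> K = {lo K..hi K} \<and> x0 K \<in> Pt \<and> x0 K \<in> K \<and> K \<subseteq> ball (x0 K) (r (x0 K))"
    by metis
  have KP: "K \<subseteq> Pt" if "K \<in> \<D>" for K using K[OF that] r(2)[of "x0 K"] by blast
  have cov: "\<exists>R. R \<in> sets borel \<and> emeasure lborel R \<le> ennreal (h + \<tau>) * (\<integral>\<^sup>+ s\<in>interior K. ?N s \<partial>lborel) \<and>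
      (\<forall>p s \<sigma>. s \<in> K \<longrightarrow> \<sigma> \<in> {0..h} \<longrightarrow> ?F s = p + \<sigma> *\<^sub>R e \<longrightarrow> p \<in> R)" if KD: "K \<in> \<D>" for K
  proof -
    define c d x where "c = lo K" and "d = hi K" and "x = x0 K"
    have cd: "c < d" "K = {c..d}" "x \<in> Pt" "x \<in> K" "K \<subseteq> ball x (r x)" using K[OF KD] by (auto simp: c_def d_def x_def)
    have ce': "continuous_on {c..d} (\<lambda>s. ?F s \<bullet> e')"
      by (intro continuous_intros continuous_on_subset[OF Fc]) (use KP[OF KD] cd in auto)
    obtain s1 where s1: "s1 \<in> {c..d}" "\<And>s. s \<in> {c..d} \<Longrightarrow> ?F s1 \<bullet> e' \<le> ?F s \<bullet> e'"
      using continuous_attains_inf[OF compact_Icc _ ce'] cd by auto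
    obtain s2 where s2: "s2 \<in> {c..d}" "\<And>s. s \<in> {c..d} \<Longrightarrow> ?F s \<bullet> e' \<le> ?F s2 \<bullet> e'"
      using continuous_attains_sup[OF compact_Icc _ ce'] cd by auto
    \<comment> \<open>The extra \<open>h\<close> on the lower side is there because \<open>p\<close>
      is the curve point minus \<sigma> times \<open>e\<close>.\<close>
    let ?Rc = "rect e e' (?F x \<bullet> e - \<tau>/2 - h) (?F x \<bullet> e + \<tau>/2) (?F s1 \<bullet> e') (?F s2 \<bullet> e')"
    define L where "L = ?F s2 \<bullet> e' - ?F s1 \<bullet> e'"
    have "L \<ge> 0" using s1(2)[OF s2(1)] by (simp add: L_def)
    have "L \<le> norm (?F s2 - ?F s1)"
      using Cauchy_Schwarz_ineq2[of "?F s2 - ?F s1" e'] frame_simps[OF fr'] by (simp add: L_def inner_diff_left)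
    then have "ennreal L \<le> ennreal (norm (?F (max s1 s2) - ?F (min s1 s2)))"
      by (intro ennreal_leI) (auto simp: max_def min_def norm_minus_commute)
    also have "\<dots> \<le> (\<integral>\<^sup>+ s\<in>{min s1 s2..max s1 s2}. ?N s \<partial>lborel)"
    proof -
      have "\<forall>s\<in>{min s1 s2..max s1 s2}. t *\<^sub>R v + s *\<^sub>R w \<in> D"
      proof
        fix s assume "s \<in> {min s1 s2..max s1 s2}"
        then have "s \<in> K" using s1(1) s2(1) cd(2) by auto
        then show "t *\<^sub>R v + s *\<^sub>R w \<in> D" using KP[OF KD] Pt(3) by blast
      qed
      then have "set_integrable lborel {min s1 s2..max s1 s2} (\<lambda>s. Df (t *\<^sub>R v + s *\<^sub>R w) *v w)"
        "?F (max s1 s2) - ?F (min s1 s2) = (LINT s:{min s1 s2..max s1 s2}|lborel. Df (t *\<^sub>R v + s *\<^sub>R w) *v w)"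
        using acl by auto
      then show ?thesis by (rule norm_diff_le_nn_integral_line)
    qed
    also have "\<dots> \<le> (\<integral>\<^sup>+ s\<in>{c..d}. ?N s \<partial>lborel)"
      by (rule nn_integral_mono) (use s1(1) s2(1) in \<open>auto simp: indicator_def\<close>)
    \<comment> \<open>Passing to interiors loses two endpoints and makes the intervals disjoint, as
      countable additivity requires.\<close>
    also have "\<dots> = (\<integral>\<^sup>+ s\<in>interior K. ?N s \<partial>lborel)"
    proof (rule nn_integral_cong_AE)
      show "AE s in lborel. ?N s * indicator {c..d} s = ?N s * indicator (interior K) s"
        using AE_lborel_singleton[of c] AE_lborel_singleton[of d]
        by eventually_elim (auto simp: indicator_def cd(2) interior_atLeastAtMost_real)
    qed
    finally have L: "ennreal L \<le> (\<integral>\<^sup>+ s\<in>interior K. ?N s \<partial>lborel)" .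
    have "emeasure lborel ?Rc = ennreal ((?F x \<bullet> e + \<tau>/2 - (?F x \<bullet> e - \<tau>/2 - h)) * L)"
      unfolding L_def by (rule emeasure_rect[OF fr']) (use h \<tau> \<open>L \<ge> 0\<close> in \<open>auto simp: L_def\<close>)
    also have "\<dots> = ennreal (h + \<tau>) * ennreal L"
      using h \<tau> \<open>L \<ge> 0\<close> by (subst ennreal_mult[symmetric]) (auto simp: algebra_simps)
    also have "\<dots> \<le> ennreal (h + \<tau>) * (\<integral>\<^sup>+ s\<in>interior K. ?N s \<partial>lborel)" by (intro mult_left_mono L) simp
    finally have 1: "emeasure lborel ?Rc \<le> ennreal (h + \<tau>) * (\<integral>\<^sup>+ s\<in>interior K. ?N s \<partial>lborel)" .
    have 2: "p \<in> ?Rc" if s: "s \<in> K" "\<sigma> \<in> {0..h}" "?F s = p + \<sigma> *\<^sub>R e" for p s \<sigma>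
    proof -
      have pe: "p \<bullet> e = ?F s \<bullet> e - \<sigma>" "p \<bullet> e' = ?F s \<bullet> e'"
        unfolding s(3) by (auto simp: inner_simps frame_simps[OF fr'])
      have "\<bar>?F s \<bullet> e - ?F x \<bullet> e\<bar> \<le> \<tau>/2" by (rule r(3)) (use cd s in auto)
      moreover have "?F s1 \<bullet> e' \<le> ?F s \<bullet> e'" "?F s \<bullet> e' \<le> ?F s2 \<bullet> e'" using s1(2)[of s] s2(2)[of s] s(1) cd(2) by auto
      moreover have "0 \<le> \<sigma>" "\<sigma> \<le> h" using s(2) by auto
      ultimately show ?thesis unfolding rect_def mem_Collect_eq pe atLeastAtMost_iff by (intro conjI) linarith+
    qed
    have 3: "?Rc \<in> sets borel" using compact_rect[OF fr'] by (simp add: borel_compact)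
    show ?thesis using 1 2 3 by blast
  qed
  have "\<exists>R. \<forall>K\<in>\<D>. R K \<in> sets borel \<and> emeasure lborel (R K) \<le> ennreal (h + \<tau>) * (\<integral>\<^sup>+ s\<in>interior K. ?N s \<partial>lborel) \<and>
      (\<forall>p s \<sigma>. s \<in> K \<longrightarrow> \<sigma> \<in> {0..h} \<longrightarrow> ?F s = p + \<sigma> *\<^sub>R e \<longrightarrow> p \<in> R K)"
    by (rule bchoice) (rule ballI, erule cov)
  then obtain R where R0: "\<forall>K\<in>\<D>. R K \<in> sets borel \<and> emeasure lborel (R K) \<le> ennreal (h + \<tau>) * (\<integral>\<^sup>+ s\<in>interior K. ?N s \<partial>lborel) \<and>
      (\<forall>p s \<sigma>. s \<in> K \<longrightarrow> \<sigma> \<in> {0..h} \<longrightarrow> ?F s = p + \<sigma> *\<^sub>R e \<longrightarrow> p \<in> R K)" by (elim exE)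
  have R: "R K \<in> sets borel"
    "emeasure lborel (R K) \<le> ennreal (h + \<tau>) * (\<integral>\<^sup>+ s\<in>interior K. ?N s \<partial>lborel)"
    "\<And>p s \<sigma>. s \<in> K \<Longrightarrow> \<sigma> \<in> {0..h} \<Longrightarrow> ?F s = p + \<sigma> *\<^sub>R e \<Longrightarrow> p \<in> R K" if "K \<in> \<D>" for K
    using bspec[OF R0 that] by (simp_all only: simp_thms)
  have Nm: "?N \<in> borel_measurable lborel"
  proof -
    have "(\<lambda>s. t *\<^sub>R v + s *\<^sub>R w) \<in> borel \<rightarrow>\<^sub>M borel" by (intro borel_measurable_continuous_onI continuous_intros)
    from measurable_compose[OF this Df_borel] have "(\<lambda>s. Df (t *\<^sub>R v + s *\<^sub>R w)) \<in> borel_measurable borel" .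
    moreover have "(\<lambda>A::real^2^2. A *v w) \<in> borel_measurable borel"
      by (rule borel_measurable_continuous_onI[OF linear_continuous_on[OF bounded_linear_mult_vec]])
    ultimately have "(\<lambda>s. Df (t *\<^sub>R v + s *\<^sub>R w) *v w) \<in> borel_measurable borel" by (rule measurable_compose)
    then show ?thesis by simp
  qed
  have "emeasure lborel W = (\<integral>\<^sup>+ p. indicator W p \<partial>lborel)" using W(1) by simp
  also have "\<dots> \<le> (\<integral>\<^sup>+ p. (\<integral>\<^sup>+ K. indicator (R K) p \<partial>count_space \<D>) \<partial>lborel)"
  proof (rule nn_integral_mono)
    fix p
    show "indicator W p \<le> (\<integral>\<^sup>+ K. indicator (R K) p \<partial>count_space \<D>)"
    proof (cases "p \<in> W")
      case True
      then obtain s \<sigma> where s: "s \<in> Pt" "\<sigma> \<in> {0..h}" "?F s = p + \<sigma> *\<^sub>R e" using W(2) by blast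
      then obtain K where "K \<in> \<D>" "s \<in> K" using \<D>(6) by blast
      then have "p \<in> R K" using R(3)[of K s \<sigma> p] s by simp
      then show ?thesis using nn_integral_ge_point[OF \<open>K \<in> \<D>\<close>, of "\<lambda>K. indicator (R K) p"] True by (simp add: indicator_def)
    qed simp
  qed
  also have "\<dots> = (\<integral>\<^sup>+ K. (\<integral>\<^sup>+ p. indicator (R K) p \<partial>lborel) \<partial>count_space \<D>)"
    by (rule nn_integral_count_space_nn_integral[OF \<D>(1)]) (use R(1) in auto)
  also have "\<dots> \<le> (\<integral>\<^sup>+ K. ennreal (h + \<tau>) * (\<integral>\<^sup>+ s\<in>interior K. ?N s \<partial>lborel) \<partial>count_space \<D>)"
    by (rule nn_integral_mono) (use R(1,2) in auto)
  also have "\<dots> = ennreal (h + \<tau>) * (\<integral>\<^sup>+ K. emeasure (density lborel ?N) (interior K) \<partial>count_space \<D>)"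
    using Nm by (subst nn_integral_cmult[symmetric]) (auto simp: emeasure_density)
  also have "(\<integral>\<^sup>+ K. emeasure (density lborel ?N) (interior K) \<partial>count_space \<D>) = emeasure (density lborel ?N) (\<Union>K\<in>\<D>. interior K)"
    by (rule emeasure_UN_countable[symmetric]) (use \<D>(1,4) in \<open>auto simp: disjoint_family_on_def pairwise_def\<close>)
  also have "\<dots> \<le> emeasure (density lborel ?N) Pt"
    by (rule emeasure_mono) (use KP interior_subset Pt(1) in \<open>auto simp: subset_iff\<close>)
  also have "\<dots> = (\<integral>\<^sup>+ s\<in>Pt. ?N s \<partial>lborel)"
    by (rule emeasure_density[OF Nm]) (use Pt(1) in auto)
  finally show ?thesis by (simp add: mult_left_mono)
qed

end

section \<open>Increments of the inverse homeomorphism\<close>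

text \<open>Removes the thickness \<tau> of the covering rectangles; an infinite integral makes the
  claim trivial because \<open>h\<close> is positive.\<close>

lemma ennreal_le_mult_limit:
  fixes x I :: ennreal
  assumes "h > 0" "\<And>\<tau>. \<tau> > 0 \<Longrightarrow> x \<le> ennreal (h + \<tau>) * I"
  shows "x \<le> ennreal h * I"
proof (cases I)
  case top
  then show ?thesis using \<open>h > 0\<close> by (simp add: ennreal_mult_top)
next
  case (real i)
  show ?thesis
  proof (rule ennreal_le_epsilon)
    fix e :: real assume "0 < e"
    have "x \<le> ennreal (h + e / (i + 1)) * I" by (rule assms(2)) (use real \<open>0 < e\<close> in auto)
    also have "\<dots> = ennreal ((h + e / (i + 1)) * i)" using real assms(1) \<open>0 < e\<close> by (simp add: ennreal_mult)
    also have "\<dots> \<le> ennreal (h * i + e)"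
    proof (rule ennreal_leI)
      have "e / (i + 1) * i \<le> e" using real \<open>0 < e\<close> by (simp add: field_simps)
      then show "(h + e / (i + 1)) * i \<le> h * i + e" by (simp add: ring_distribs)
    qed
    also have "\<dots> = ennreal h * I + ennreal e" using real assms(1) \<open>0 < e\<close> by (simp add: ennreal_mult)
    finally show "x \<le> ennreal h * I + ennreal e" .
  qed
qed

locale W11_homeo = W11 +
  fixes g :: "R2 \<Rightarrow> R2"
  assumes hom: "homeomorphism D (f ` D) f g"
begin

lemma gf: "x \<in> D \<Longrightarrow> g (f x) = x" and fg: "y \<in> f ` D \<Longrightarrow> f (g y) = y" and gD: "y \<in> f ` D \<Longrightarrow> g y \<in> D"
  and cont_g: "continuous_on (f ` D) g" and inj_f: "inj_on f D"
  using hom by (auto simp: homeomorphism_def inj_on_def) metis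

lemma open_fD: "open (f ` D)"
  by (rule invariance_of_domain[OF cont_f open_D inj_f])

lemma g_image: "U \<subseteq> f ` D \<Longrightarrow> g ` U = D \<inter> f -` U"
  using gf fg gD by (force simp: image_iff)

text \<open>The increment of \<open>v \<bullet> g\<close> is the length of the set of levels
  \<open>t\<close> between its two values, so Tonelli exchanges \<open>p\<close> and
  \<open>t\<close>. For a fixed level, the intermediate value theorem on the segment from
  \<open>p\<close> to \<open>p + h e\<close> produces a point whose \<open>g\<close>-image lies on
  the line \<open>x \<bullet> v = t\<close>, which is what the slice estimate asks for.\<close>

lemma inverse_increment_le:
  assumes fr: "frame v w" and fr': "frame e e'" and "\<delta> > 0" and h: "h > 0" and U: "cball y (\<delta> + h) \<subseteq> f ` D"
  shows "(\<integral>\<^sup>+ p\<in>ball y \<delta>. ennreal \<bar>v \<bullet> g (p + h *\<^sub>R e) - v \<bullet> g p\<bar> \<partial>lborel)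
     \<le> ennreal h * (\<integral>\<^sup>+ x\<in>g ` ball y (\<delta> + h). ennreal (norm (Df x *v w)) \<partial>lborel)"
proof -
  let ?B = "ball y \<delta>" and ?U = "ball y (\<delta> + h)"
  let ?N = "\<lambda>x. ennreal (norm (Df x *v w))"
  define P where "P = g ` ?U"
  have Usub: "?U \<subseteq> f ` D" using U ball_subset_cball by blast
  have Peq: "P = D \<inter> f -` ?U" unfolding P_def by (rule g_image[OF Usub])
  have Po: "open P" unfolding Peq by (rule continuous_open_preimage[OF cont_f open_D open_ball])
  have Pb: "bounded P"
  proof -
    have "compact (g ` cball y (\<delta> + h))"
      by (intro compact_continuous_image continuous_on_subset[OF cont_g U] compact_cball)
    then show ?thesis unfolding P_def
      using compact_imp_bounded bounded_subset image_mono[OF ball_subset_cball] by metis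
  qed
  have shift: "p + \<sigma> *\<^sub>R e \<in> ?U" if "p \<in> ?B" "\<sigma> \<in> {0..h}" for p \<sigma>
  proof -
    have "dist y (p + \<sigma> *\<^sub>R e) \<le> dist y p + dist p (p + \<sigma> *\<^sub>R e)" by (rule dist_triangle)
    also have "dist p (p + \<sigma> *\<^sub>R e) = \<sigma>" using that frame_simps[OF fr'] by (simp add: dist_norm)
    finally show ?thesis using that by simp
  qed
  have cg: "continuous_on ?U g" by (rule continuous_on_subset[OF cont_g Usub])
  define a b where "a p = v \<bullet> g p" and "b p = v \<bullet> g (p + h *\<^sub>R e)" for p
  have ca: "continuous_on ?B a" unfolding a_def
    by (intro continuous_intros continuous_on_subset[OF cg]) (use h in auto)
  have cb: "continuous_on ?B b" unfolding b_def
    by (intro continuous_intros continuous_on_compose2[OF cg]) (use shift h in auto)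
  define S where "S = ?B \<times> (UNIV :: real set)"
  \<comment> \<open>\<open>k\<close> is positive exactly when \<open>snd z\<close> lies strictly
    between the two values, in either order; by its continuity the set of these pairs is open, and
    Tonelli applies to it.\<close>
  define k where "k z = max (min (snd z - a (fst z)) (b (fst z) - snd z)) (min (snd z - b (fst z)) (a (fst z) - snd z))" for z :: "R2 \<times> real"
  have cfst: "continuous_on S (\<lambda>z. a (fst z))" "continuous_on S (\<lambda>z. b (fst z))"
    by (rule continuous_on_compose2[OF ca] continuous_on_compose2[OF cb]; auto simp: S_def intro!: continuous_intros)+
  have ck: "continuous_on S k" unfolding k_def by (intro continuous_intros cfst)
  define \<Omega> where "\<Omega> = S \<inter> k -` {0<..}"
  have \<Omega>o: "open \<Omega>" unfolding \<Omega>_def by (rule continuous_open_preimage[OF ck]) (auto simp: S_def intro: open_Times)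
  have \<Omega>iff: "(p, t) \<in> \<Omega> \<longleftrightarrow> p \<in> ?B \<and> (a p < t \<and> t < b p \<or> b p < t \<and> t < a p)" for p t
    by (auto simp: \<Omega>_def S_def k_def less_max_iff_disj)
  have \<Omega>m: "(\<lambda>(p, t). indicator \<Omega> (p, t) :: ennreal) \<in> borel_measurable (lborel \<Otimes>\<^sub>M lborel)"
    using \<Omega>o unfolding lborel_prod by simp
  have inner: "(\<integral>\<^sup>+ t. indicator \<Omega> (p, t) \<partial>lborel) = ennreal \<bar>b p - a p\<bar> * indicator ?B p" for p
  proof (cases "p \<in> ?B")
    case True
    have "indicator \<Omega> (p, t) = (indicator {min (a p) (b p)<..<max (a p) (b p)} t :: ennreal)" for t
      using True by (auto simp: indicator_def \<Omega>iff)
    then have "(\<integral>\<^sup>+ t. indicator \<Omega> (p, t) \<partial>lborel) = emeasure lborel {min (a p) (b p)<..<max (a p) (b p)}" by simp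
    also have "\<dots> = ennreal \<bar>b p - a p\<bar>" by (simp add: min_def max_def)
    finally show ?thesis using True by simp
  next
    case False
    then show ?thesis by (simp add: indicator_def \<Omega>iff)
  qed
  have slice: "AE t in lborel. (\<integral>\<^sup>+ p. indicator \<Omega> (p, t) \<partial>lborel) \<le> ennreal h * (\<integral>\<^sup>+ s. ?N (t *\<^sub>R v + s *\<^sub>R w) * indicator P (t *\<^sub>R v + s *\<^sub>R w) \<partial>lborel)"
    using acl_line[OF fr]
  proof eventually_elim
    case (elim t)
    define Pt where "Pt = {s. t *\<^sub>R v + s *\<^sub>R w \<in> P}"
    define W where "W = {p. (p, t) \<in> \<Omega>}"
    have Pt1: "open Pt"
      unfolding Pt_def using open_vimage[OF Po, of "\<lambda>s. t *\<^sub>R v + s *\<^sub>R w"] by (simp add: vimage_def continuous_intros)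
    have Pt2: "bounded Pt"
    proof -
      obtain M where M: "\<And>x. x \<in> P \<Longrightarrow> norm x \<le> M" using Pb by (auto simp: bounded_iff)
      have "\<bar>s\<bar> \<le> M" if "s \<in> Pt" for s
      proof -
        have "\<bar>s\<bar> = \<bar>(t *\<^sub>R v + s *\<^sub>R w) \<bullet> w\<bar>" by (simp add: inner_simps frame_simps[OF fr])
        also have "\<dots> \<le> norm (t *\<^sub>R v + s *\<^sub>R w)" using Cauchy_Schwarz_ineq2[of "t *\<^sub>R v + s *\<^sub>R w" w] frame_simps[OF fr] by simp
        also have "\<dots> \<le> M" using M that by (simp add: Pt_def)
        finally show ?thesis .
      qed
      then show ?thesis by (auto simp: bounded_iff)
    qed
    have Wo: "open W"
      unfolding W_def using open_vimage[OF \<Omega>o, of "\<lambda>p. (p, t)"] by (simp add: vimage_def continuous_intros)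
    have Wp: "\<exists>s\<in>Pt. \<exists>\<sigma>\<in>{0..h}. f (t *\<^sub>R v + s *\<^sub>R w) = p + \<sigma> *\<^sub>R e" if "p \<in> W" for p
    proof -
      have pB: "p \<in> ?B" and bet: "a p < t \<and> t < b p \<or> b p < t \<and> t < a p" using that by (auto simp: W_def \<Omega>iff)
      let ?q = "\<lambda>\<sigma>. v \<bullet> g (p + \<sigma> *\<^sub>R e)"
      have cq: "continuous_on {0..h} ?q"
        by (intro continuous_intros continuous_on_compose2[OF cg]) (use shift[OF pB] in auto)
      have q0: "?q 0 = a p" "?q h = b p" by (auto simp: a_def b_def)
      have "\<exists>\<sigma>. 0 \<le> \<sigma> \<and> \<sigma> \<le> h \<and> ?q \<sigma> = t"
      proof (cases "a p < t")
        case True then show ?thesis using bet q0 h by (intro IVT'[OF _ _ _ cq]) auto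
      next
        case False then show ?thesis using bet q0 h by (intro IVT2'[OF _ _ _ cq]) auto
      qed
      then obtain \<sigma> where \<sigma>: "\<sigma> \<in> {0..h}" "?q \<sigma> = t" by auto
      define x where "x = g (p + \<sigma> *\<^sub>R e)"
      have xU: "p + \<sigma> *\<^sub>R e \<in> ?U" by (rule shift[OF pB \<sigma>(1)])
      have "x \<bullet> v = t" using \<sigma> by (simp add: x_def inner_commute)
      then have xx: "t *\<^sub>R v + (x \<bullet> w) *\<^sub>R w = x" using frame_decomp[OF fr, of x] by simp
      have "x \<in> P" using xU by (simp add: x_def P_def)
      moreover have "f x = p + \<sigma> *\<^sub>R e" unfolding x_def by (rule fg) (use xU Usub in blast)
      ultimately show ?thesis using xx \<sigma>(1) by (intro bexI[of _ "x \<bullet> w"] bexI[of _ \<sigma>]) (auto simp: Pt_def)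
    qed
    have PtD: "\<And>s. s \<in> Pt \<Longrightarrow> t *\<^sub>R v + s *\<^sub>R w \<in> D" by (auto simp: Pt_def Peq)
    have ind: "indicator P (t *\<^sub>R v + s *\<^sub>R w) = (indicator Pt s :: ennreal)" for s by (simp add: Pt_def indicator_def)
    have "(\<integral>\<^sup>+ p. indicator \<Omega> (p, t) \<partial>lborel) = (\<integral>\<^sup>+ p. indicator W p \<partial>lborel)"
      by (rule nn_integral_cong) (auto simp: W_def indicator_def)
    also have "\<dots> = emeasure lborel W" using Wo by simp
    also have "\<dots> \<le> ennreal h * (\<integral>\<^sup>+ s\<in>Pt. ?N (t *\<^sub>R v + s *\<^sub>R w) \<partial>lborel)"
    proof (rule ennreal_le_mult_limit[OF h])
      fix \<tau> :: real assume "\<tau> > 0"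
      show "emeasure lborel W \<le> ennreal (h + \<tau>) * (\<integral>\<^sup>+ s\<in>Pt. ?N (t *\<^sub>R v + s *\<^sub>R w) \<partial>lborel)"
        by (rule slice_measure_le[OF fr fr' h \<open>\<tau> > 0\<close> Pt1 Pt2 PtD elim _ Wp]) (use Wo in auto)
    qed
    finally show ?case unfolding ind .
  qed
  have Nm: "(\<lambda>x. ?N x * indicator P x) \<in> borel_measurable borel"
  proof -
    have "(\<lambda>A::real^2^2. A *v w) \<in> borel_measurable borel"
      by (rule borel_measurable_continuous_onI[OF linear_continuous_on[OF bounded_linear_mult_vec]])
    from measurable_compose[OF Df_borel this] have [measurable]: "(\<lambda>x. Df x *v w) \<in> borel_measurable borel" .
    have [measurable]: "P \<in> sets borel" using Po by simp
    show ?thesis by measurable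
  qed
  have "(\<integral>\<^sup>+ p\<in>?B. ennreal \<bar>b p - a p\<bar> \<partial>lborel) = (\<integral>\<^sup>+ p. (\<integral>\<^sup>+ t. indicator \<Omega> (p, t) \<partial>lborel) \<partial>lborel)"
    unfolding inner ..
  also have "\<dots> = (\<integral>\<^sup>+ t. (\<integral>\<^sup>+ p. indicator \<Omega> (p, t) \<partial>lborel) \<partial>lborel)"
    using lborel_pair.Fubini'[OF \<Omega>m] by simp
  also have "\<dots> \<le> (\<integral>\<^sup>+ t. ennreal h * (\<integral>\<^sup>+ s. ?N (t *\<^sub>R v + s *\<^sub>R w) * indicator P (t *\<^sub>R v + s *\<^sub>R w) \<partial>lborel) \<partial>lborel)"
    by (rule nn_integral_mono_AE[OF slice])
  also have "\<dots> = ennreal h * (\<integral>\<^sup>+ t. (\<integral>\<^sup>+ s. ?N (t *\<^sub>R v + s *\<^sub>R w) * indicator P (t *\<^sub>R v + s *\<^sub>R w) \<partial>lborel) \<partial>lborel)"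
  proof (rule nn_integral_cmult)
    have "(\<lambda>p. ?N (fst p *\<^sub>R v + snd p *\<^sub>R w) * indicator P (fst p *\<^sub>R v + snd p *\<^sub>R w)) \<in> borel_measurable (lborel \<Otimes>\<^sub>M lborel)"
      unfolding lborel_prod by (rule measurable_compose[OF frame_coord_measurable(2) Nm])
    from lborel.borel_measurable_nn_integral_fst[OF this]
    show "(\<lambda>t. \<integral>\<^sup>+ s. ?N (t *\<^sub>R v + s *\<^sub>R w) * indicator P (t *\<^sub>R v + s *\<^sub>R w) \<partial>lborel) \<in> borel_measurable lborel" by simp
  qed
  also have "\<dots> = ennreal h * (\<integral>\<^sup>+ x\<in>P. ?N x \<partial>lborel)"
    using nn_integral_frame[OF fr Nm] by simp
  finally show ?thesis by (simp add: a_def b_def P_def)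
qed

end

section \<open>Differentiable pieces and the area formula\<close>

definition seg :: "real \<Rightarrow> real \<Rightarrow> real set" where
  "seg x y = {min x y..max x y}"

text \<open>Every bad point is an endpoint of an interval on which the average of \<open>G\<close>
  exceeds \<tau>. The Vitali lemma selects disjoint ones whose fivefold enlargements cover
  \<open>E\<close>, which explains the constant 5. The finite integral of \<open>G\<close> bounds
  the radii, as that lemma demands.\<close>

lemma maximal_1d:
  fixes G :: "real \<Rightarrow> ennreal"
  assumes G: "G \<in> borel_measurable borel" and \<tau>: "\<tau> > 0" and E: "E \<in> sets borel"
    and bad: "\<And>x. x \<in> E \<Longrightarrow> \<exists>y. ennreal (\<tau> * \<bar>y - x\<bar>) < (\<integral>\<^sup>+ s\<in>seg x y. G s \<partial>lborel)"
  shows "ennreal \<tau> * emeasure lborel E \<le> 5 * (\<integral>\<^sup>+ s. G s \<partial>lborel)"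
proof (cases "(\<integral>\<^sup>+ s. G s \<partial>lborel)")
  case top
  then show ?thesis by (simp add: ennreal_mult_top)
next
  case (real I)
  define Y where "Y x = (SOME y. ennreal (\<tau> * \<bar>y - x\<bar>) < (\<integral>\<^sup>+ s\<in>seg x y. G s \<partial>lborel))" for x
  have Y: "ennreal (\<tau> * \<bar>Y x - x\<bar>) < (\<integral>\<^sup>+ s\<in>seg x (Y x). G s \<partial>lborel)" if "x \<in> E" for x
    unfolding Y_def by (rule someI_ex[OF bad[OF that]])
  define a r where "a x = (x + Y x) / 2" and "r x = \<bar>Y x - x\<bar> / 2" for x
  have seg: "cball (a x) (r x) = seg x (Y x)" for x
    by (auto simp: a_def r_def seg_def cball_eq_atLeastAtMost min_def max_def abs_if field_simps)
  have rb: "0 < r x \<and> r x \<le> I / \<tau>" if "x \<in> E" for x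
  proof -
    have "Y x \<noteq> x"
    proof
      assume "Y x = x"
      have "(\<integral>\<^sup>+ s\<in>seg x (Y x). G s \<partial>lborel) = (\<integral>\<^sup>+ s. 0 \<partial>(lborel::real measure))"
      proof (intro nn_integral_cong_AE)
        show "AE s in lborel. G s * indicator (seg x (Y x)) s = 0"
          using AE_lborel_singleton[of x] by eventually_elim (simp add: \<open>Y x = x\<close> seg_def indicator_def)
      qed
      then show False using Y[OF that] by simp
    qed
    moreover have "\<tau> * \<bar>Y x - x\<bar> \<le> I"
    proof -
      have "(\<integral>\<^sup>+ s\<in>seg x (Y x). G s \<partial>lborel) \<le> (\<integral>\<^sup>+ s. G s \<partial>lborel)"
        by (rule nn_integral_mono) (auto simp: indicator_def)
      then have "ennreal (\<tau> * \<bar>Y x - x\<bar>) \<le> ennreal I" using Y[OF that] real by (simp add: order.strict_implies_order order.strict_trans1)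
      then show ?thesis using real by (simp add: ennreal_le_iff)
    qed
    moreover have "0 \<le> \<tau> * \<bar>Y x - x\<bar>" using \<tau> by simp
    ultimately have "\<tau> * r x \<le> I" "Y x \<noteq> x" by (simp_all add: r_def)
    then show ?thesis using \<tau> by (simp add: r_def pos_le_divide_eq mult.commute)
  qed
  obtain C where C: "countable C" "C \<subseteq> E"
     "pairwise (\<lambda>i j. disjnt (cball (a i) (r i)) (cball (a j) (r j))) C"
     "\<And>i. i \<in> E \<Longrightarrow> \<exists>j. j \<in> C \<and> \<not> disjnt (cball (a i) (r i)) (cball (a j) (r j)) \<and> cball (a i) (r i) \<subseteq> ball (a j) (5 * r j)"
    by (rule Vitali_covering_lemma_cballs_balls[where K=E and r=r and a=a and B="I / \<tau>", OF rb]) (assumption, (rule that; assumption))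
  have xin: "x \<in> cball (a x) (r x)" for x unfolding seg by (simp add: seg_def)
  have "emeasure lborel E = (\<integral>\<^sup>+ x. indicator E x \<partial>lborel)" using E by simp
  also have "\<dots> \<le> (\<integral>\<^sup>+ x. (\<integral>\<^sup>+ j. indicator (ball (a j) (5 * r j)) x \<partial>count_space C) \<partial>lborel)"
  proof (rule nn_integral_mono)
    fix x
    show "indicator E x \<le> (\<integral>\<^sup>+ j. indicator (ball (a j) (5 * r j)) x \<partial>count_space C)"
    proof (cases "x \<in> E")
      case True
      then obtain j where "j \<in> C" "cball (a x) (r x) \<subseteq> ball (a j) (5 * r j)" using C(4)[OF True] by blast
      then have "x \<in> ball (a j) (5 * r j)" using xin by blast
      then show ?thesis
        using nn_integral_ge_point[OF \<open>j \<in> C\<close>, of "\<lambda>j. indicator (ball (a j) (5 * r j)) x"] True by (simp add: indicator_def)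
    qed simp
  qed
  also have "\<dots> = (\<integral>\<^sup>+ j. (\<integral>\<^sup>+ x. indicator (ball (a j) (5 * r j)) x \<partial>lborel) \<partial>count_space C)"
    by (rule nn_integral_count_space_nn_integral[OF C(1)]) (rule borel_measurable_indicator, simp)
  also have "\<dots> = (\<integral>\<^sup>+ j. ennreal (5 * \<bar>Y j - j\<bar>) \<partial>count_space C)"
  proof (rule nn_integral_cong)
    fix j assume "j \<in> space (count_space C)"
    then have "r j > 0" using rb C(2) by auto
    have "ball (a j) (5 * r j) = {a j - 5 * r j<..<a j + 5 * r j}" by (auto simp: dist_real_def)
    then have "(\<integral>\<^sup>+ x. indicator (ball (a j) (5 * r j)) x \<partial>lborel) = ennreal (10 * r j)" using \<open>r j > 0\<close> by simp
    also have "10 * r j = 5 * \<bar>Y j - j\<bar>" by (simp add: r_def)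
    finally show "(\<integral>\<^sup>+ x. indicator (ball (a j) (5 * r j)) x \<partial>lborel) = ennreal (5 * \<bar>Y j - j\<bar>)" .
  qed
  finally have 1: "emeasure lborel E \<le> (\<integral>\<^sup>+ j. ennreal (5 * \<bar>Y j - j\<bar>) \<partial>count_space C)" .
  have "ennreal \<tau> * emeasure lborel E \<le> (\<integral>\<^sup>+ j. ennreal \<tau> * ennreal (5 * \<bar>Y j - j\<bar>) \<partial>count_space C)"
    using mult_left_mono[OF 1, of "ennreal \<tau>"] by (simp add: nn_integral_cmult)
  also have "\<dots> \<le> (\<integral>\<^sup>+ j. 5 * emeasure (density lborel G) (cball (a j) (r j)) \<partial>count_space C)"
  proof (rule nn_integral_mono)
    fix j assume "j \<in> space (count_space C)"
    then have j: "j \<in> E" using C(2) by auto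
    have "ennreal \<tau> * ennreal (5 * \<bar>Y j - j\<bar>) = 5 * ennreal (\<tau> * \<bar>Y j - j\<bar>)"
    proof -
      have "5 * ennreal (\<tau> * \<bar>Y j - j\<bar>) = ennreal 5 * ennreal (\<tau> * \<bar>Y j - j\<bar>)" by simp
      also have "\<dots> = ennreal (5 * (\<tau> * \<bar>Y j - j\<bar>))" using \<tau> by (subst ennreal_mult) auto
      also have "\<dots> = ennreal (\<tau> * (5 * \<bar>Y j - j\<bar>))" by (simp add: algebra_simps)
      also have "\<dots> = ennreal \<tau> * ennreal (5 * \<bar>Y j - j\<bar>)" using \<tau> by (subst ennreal_mult) auto
      finally show ?thesis by simp
    qed
    also have "\<dots> \<le> 5 * (\<integral>\<^sup>+ s\<in>seg j (Y j). G s \<partial>lborel)"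
      using Y[OF j] by (intro mult_left_mono) auto
    also have "\<dots> = 5 * emeasure (density lborel G) (cball (a j) (r j))"
      using G by (subst emeasure_density) (auto simp: seg, simp add: seg_def)
    finally show "ennreal \<tau> * ennreal (5 * \<bar>Y j - j\<bar>) \<le> 5 * emeasure (density lborel G) (cball (a j) (r j))" .
  qed
  also have "\<dots> = 5 * (\<integral>\<^sup>+ j. emeasure (density lborel G) (cball (a j) (r j)) \<partial>count_space C)"
    by (rule nn_integral_cmult) simp
  also have "(\<integral>\<^sup>+ j. emeasure (density lborel G) (cball (a j) (r j)) \<partial>count_space C) = emeasure (density lborel G) (\<Union>j\<in>C. cball (a j) (r j))"
    by (rule emeasure_UN_countable[symmetric]) (use C in \<open>auto simp: disjoint_family_on_def pairwise_def disjnt_def\<close>)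
  also have "\<dots> \<le> emeasure (density lborel G) UNIV" by (rule emeasure_mono) auto
  also have "\<dots> = (\<integral>\<^sup>+ s. G s \<partial>lborel)" using G by (subst emeasure_density) auto
  finally show ?thesis by (simp add: mult_left_mono)
qed

text \<open>The estimate on a line is integrated over all parallel lines. The bad set is defined
  with rational far endpoints only, which makes it Borel; real endpoints are recovered by enlarging
  the segment slightly to a rational one.\<close>

lemma maximal_2d:
  fixes G :: "R2 \<Rightarrow> ennreal"
  assumes fr: "frame v w" and G: "G \<in> borel_measurable borel" and \<tau>: "\<tau> > 0"
  obtains E where "E \<in> sets borel" "ennreal \<tau> * emeasure lborel E \<le> 5 * (\<integral>\<^sup>+ x. G x \<partial>lborel)"
    "\<And>t s s'. t *\<^sub>R v + s *\<^sub>R w \<notin> E \<Longrightarrow> (\<integral>\<^sup>+ \<sigma>\<in>seg s s'. G (t *\<^sub>R v + \<sigma> *\<^sub>R w) \<partial>lborel) \<le> ennreal (\<tau> * \<bar>s' - s\<bar>)"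
proof -
  define J where "J q x = (\<integral>\<^sup>+ \<sigma>. G ((x \<bullet> v) *\<^sub>R v + \<sigma> *\<^sub>R w) * indicator (seg (x \<bullet> w) q) \<sigma> \<partial>lborel)" for q :: real and x :: R2
  have Jm: "J q \<in> borel_measurable borel" for q
  proof -
    have m1: "(\<lambda>z::R2 \<times> real. (fst z \<bullet> v) *\<^sub>R v + snd z *\<^sub>R w) \<in> borel \<rightarrow>\<^sub>M borel"
      by (intro borel_measurable_continuous_onI continuous_intros)
    have "(\<lambda>z. G ((fst z \<bullet> v) *\<^sub>R v + snd z *\<^sub>R w)) \<in> borel_measurable (borel :: (R2 \<times> real) measure)"
      by (rule measurable_compose[OF m1 G])
    moreover have "{z::R2 \<times> real. min (fst z \<bullet> w) q \<le> snd z \<and> snd z \<le> max (fst z \<bullet> w) q} \<in> sets borel"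
      by (intro borel_closed closed_Collect_conj closed_Collect_le continuous_intros)
    then have "(\<lambda>z::R2 \<times> real. indicator {z::R2 \<times> real. min (fst z \<bullet> w) q \<le> snd z \<and> snd z \<le> max (fst z \<bullet> w) q} z :: ennreal) \<in> borel_measurable borel"
      by simp
    ultimately have "(\<lambda>z. G ((fst z \<bullet> v) *\<^sub>R v + snd z *\<^sub>R w) * indicator {z::R2 \<times> real. min (fst z \<bullet> w) q \<le> snd z \<and> snd z \<le> max (fst z \<bullet> w) q} z) \<in> borel_measurable (lborel \<Otimes>\<^sub>M lborel :: (R2 \<times> real) measure)"
      unfolding lborel_prod by simp
    from lborel.borel_measurable_nn_integral_fst[OF this]
    show ?thesis unfolding J_def seg_def by (simp add: indicator_def)
  qed
  define E where "E = (\<Union>q\<in>\<rat>. {x. ennreal (\<tau> * \<bar>q - x \<bullet> w\<bar>) < J q x})"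
  have Eb: "E \<in> sets borel"
    unfolding E_def
  proof (rule sets.countable_UN''[OF countable_rat])
    fix q :: real
    have "(\<lambda>x::R2. ennreal (\<tau> * \<bar>q - x \<bullet> w\<bar>)) \<in> borel_measurable borel" by measurable
    then have "{x\<in>space borel. ennreal (\<tau> * \<bar>q - x \<bullet> w\<bar>) < J q x} \<in> sets borel"
      by (rule borel_measurable_less[OF _ Jm])
    then show "{x. ennreal (\<tau> * \<bar>q - x \<bullet> w\<bar>) < J q x} \<in> sets borel" by simp
  qed
  have line: "(\<lambda>s. t *\<^sub>R v + s *\<^sub>R w) \<in> borel \<rightarrow>\<^sub>M borel" for t
    by (intro borel_measurable_continuous_onI continuous_intros)
  have Jl: "J q (t *\<^sub>R v + s *\<^sub>R w) = (\<integral>\<^sup>+ \<sigma>\<in>seg s q. G (t *\<^sub>R v + \<sigma> *\<^sub>R w) \<partial>lborel)" for q t s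
    unfolding J_def by (simp add: inner_simps frame_simps[OF fr])
  have lw: "(t *\<^sub>R v + s *\<^sub>R w) \<bullet> w = s" for t s by (simp add: inner_simps frame_simps[OF fr])
  have "ennreal \<tau> * emeasure lborel E = ennreal \<tau> * (\<integral>\<^sup>+ x. indicator E x \<partial>lborel)" using Eb by simp
  also have "\<dots> = ennreal \<tau> * (\<integral>\<^sup>+ t. (\<integral>\<^sup>+ s. indicator E (t *\<^sub>R v + s *\<^sub>R w) \<partial>lborel) \<partial>lborel)"
    using nn_integral_frame[OF fr, of "indicator E"] Eb by simp
  also have "\<dots> = (\<integral>\<^sup>+ t. ennreal \<tau> * (\<integral>\<^sup>+ s. indicator E (t *\<^sub>R v + s *\<^sub>R w) \<partial>lborel) \<partial>lborel)"
  proof (rule nn_integral_cmult[symmetric])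
    have "(\<lambda>p. indicator E (fst p *\<^sub>R v + snd p *\<^sub>R w) :: ennreal) \<in> borel_measurable (lborel \<Otimes>\<^sub>M lborel)"
      unfolding lborel_prod by (rule measurable_compose[OF frame_coord_measurable(2)]) (use Eb in simp)
    from lborel.borel_measurable_nn_integral_fst[OF this]
    show "(\<lambda>t. \<integral>\<^sup>+ s. indicator E (t *\<^sub>R v + s *\<^sub>R w) \<partial>lborel) \<in> borel_measurable lborel" by simp
  qed
  also have "\<dots> \<le> (\<integral>\<^sup>+ t. 5 * (\<integral>\<^sup>+ s. G (t *\<^sub>R v + s *\<^sub>R w) \<partial>lborel) \<partial>lborel)"
  proof (rule nn_integral_mono)
    fix t
    let ?Et = "{s. t *\<^sub>R v + s *\<^sub>R w \<in> E}"
    have Etb: "?Et \<in> sets borel" using measurable_sets[OF line Eb] by (simp add: vimage_def)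
    have "(\<integral>\<^sup>+ s. indicator E (t *\<^sub>R v + s *\<^sub>R w) \<partial>lborel) = (\<integral>\<^sup>+ s. indicator ?Et s \<partial>lborel)"
      by (rule nn_integral_cong) (auto simp: indicator_def)
    also have "\<dots> = emeasure lborel ?Et" using Etb by simp
    finally have eq: "(\<integral>\<^sup>+ s. indicator E (t *\<^sub>R v + s *\<^sub>R w) \<partial>lborel) = emeasure lborel ?Et" .
    show "ennreal \<tau> * (\<integral>\<^sup>+ s. indicator E (t *\<^sub>R v + s *\<^sub>R w) \<partial>lborel) \<le> 5 * (\<integral>\<^sup>+ s. G (t *\<^sub>R v + s *\<^sub>R w) \<partial>lborel)"
      unfolding eq
    proof (rule maximal_1d[OF measurable_compose[OF line G] \<tau> Etb])
      fix s assume "s \<in> ?Et"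
      then obtain q where "ennreal (\<tau> * \<bar>q - s\<bar>) < J q (t *\<^sub>R v + s *\<^sub>R w)" unfolding E_def by (auto simp: lw)
      then show "\<exists>q. ennreal (\<tau> * \<bar>q - s\<bar>) < (\<integral>\<^sup>+ \<sigma>\<in>seg s q. G (t *\<^sub>R v + \<sigma> *\<^sub>R w) \<partial>lborel)" unfolding Jl by blast
    qed
  qed
  also have "\<dots> = 5 * (\<integral>\<^sup>+ t. (\<integral>\<^sup>+ s. G (t *\<^sub>R v + s *\<^sub>R w) \<partial>lborel) \<partial>lborel)"
  proof (rule nn_integral_cmult)
    have "(\<lambda>p. G (fst p *\<^sub>R v + snd p *\<^sub>R w)) \<in> borel_measurable (lborel \<Otimes>\<^sub>M lborel)"
      unfolding lborel_prod by (rule measurable_compose[OF frame_coord_measurable(2) G])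
    from lborel.borel_measurable_nn_integral_fst[OF this]
    show "(\<lambda>t. \<integral>\<^sup>+ s. G (t *\<^sub>R v + s *\<^sub>R w) \<partial>lborel) \<in> borel_measurable lborel" by simp
  qed
  also have "\<dots> = 5 * (\<integral>\<^sup>+ x. G x \<partial>lborel)" using nn_integral_frame[OF fr G] by simp
  finally have 1: "ennreal \<tau> * emeasure lborel E \<le> 5 * (\<integral>\<^sup>+ x. G x \<partial>lborel)" .
  have 2: "(\<integral>\<^sup>+ \<sigma>\<in>seg s s'. G (t *\<^sub>R v + \<sigma> *\<^sub>R w) \<partial>lborel) \<le> ennreal (\<tau> * \<bar>s' - s\<bar>)" if notE: "t *\<^sub>R v + s *\<^sub>R w \<notin> E" for t s s'
  proof (rule ennreal_le_epsilon)
    fix e :: real assume "e > 0"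
    have "\<exists>q\<in>\<rat>. seg s s' \<subseteq> seg s q \<and> \<tau> * \<bar>q - s\<bar> \<le> \<tau> * \<bar>s' - s\<bar> + e"
    proof (cases "s \<le> s'")
      case True
      obtain q where q: "q \<in> \<rat>" "s' < q" "q < s' + e / \<tau>" using Rats_dense_in_real[of s' "s' + e / \<tau>"] \<open>e > 0\<close> \<tau> by auto
      then have "\<tau> * (q - s') \<le> e" using \<tau> by (simp add: field_simps)
      then show ?thesis using q True by (intro bexI[of _ q]) (auto simp: seg_def algebra_simps)
    next
      case False
      obtain q where q: "q \<in> \<rat>" "s' - e / \<tau> < q" "q < s'" using Rats_dense_in_real[of "s' - e / \<tau>" s'] \<open>e > 0\<close> \<tau> by auto
      then have "\<tau> * (s' - q) \<le> e" using \<tau> by (simp add: field_simps)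
      then show ?thesis using q False by (intro bexI[of _ q]) (auto simp: seg_def algebra_simps)
    qed
    then obtain q where q: "q \<in> \<rat>" "seg s s' \<subseteq> seg s q" "\<tau> * \<bar>q - s\<bar> \<le> \<tau> * \<bar>s' - s\<bar> + e" by blast
    have "(\<integral>\<^sup>+ \<sigma>\<in>seg s s'. G (t *\<^sub>R v + \<sigma> *\<^sub>R w) \<partial>lborel) \<le> (\<integral>\<^sup>+ \<sigma>\<in>seg s q. G (t *\<^sub>R v + \<sigma> *\<^sub>R w) \<partial>lborel)"
      by (rule nn_integral_mono) (use q(2) in \<open>auto simp: indicator_def\<close>)
    also have "\<dots> = J q (t *\<^sub>R v + s *\<^sub>R w)" by (simp add: Jl)
    also have "\<dots> \<le> ennreal (\<tau> * \<bar>q - s\<bar>)" using notE q(1) unfolding E_def by (auto simp: lw not_less)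
    also have "\<dots> \<le> ennreal (\<tau> * \<bar>s' - s\<bar> + e)" by (rule ennreal_leI[OF q(3)])
    also have "\<dots> = ennreal (\<tau> * \<bar>s' - s\<bar>) + ennreal e"
      using \<tau> \<open>e > 0\<close> by (intro ennreal_plus) auto
    finally show "(\<integral>\<^sup>+ \<sigma>\<in>seg s s'. G (t *\<^sub>R v + \<sigma> *\<^sub>R w) \<partial>lborel) \<le> ennreal (\<tau> * \<bar>s' - s\<bar>) + ennreal e" .
  qed
  show thesis by (rule that[OF Eb 1 2])
qed

section \<open>Density of continuous functions in L^p\<close>

lemma powr_add_le:
  fixes a b p :: real
  assumes "0 \<le> a" "0 \<le> b" "0 < p"
  shows "(a + b) powr p \<le> 2 powr p * (a powr p + b powr p)"
proof -
  have "(a + b) powr p \<le> (2 * max a b) powr p" using assms by (intro powr_mono2) auto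
  also have "\<dots> = 2 powr p * max a b powr p" using assms by (simp add: powr_mult)
  also have "\<dots> \<le> 2 powr p * (a powr p + b powr p)" by (intro mult_left_mono) (auto simp: max_def)
  finally show ?thesis .
qed

lemma tendsto_powr_0:
  fixes u :: "nat \<Rightarrow> real"
  assumes "u \<longlonglongrightarrow> 0" "p > 0" "\<And>n. 0 \<le> u n"
  shows "(\<lambda>n. u n powr p) \<longlonglongrightarrow> 0"
  using tendsto_powr'[OF assms(1) tendsto_const[of p]] assms(2,3) by simp

lemma Lp_truncation:
  fixes F :: "R2 \<Rightarrow> real"
  assumes F: "F \<in> borel_measurable borel" and p: "p > 0" and fin: "(\<integral>\<^sup>+ x. ennreal (\<bar>F x\<bar> powr p) \<partial>lborel) < \<infinity>" and e: "e > 0"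
  shows "\<exists>N>0. (\<integral>\<^sup>+ x. ennreal (\<bar>F x - indicator (cball 0 N) x * max (-N) (min N (F x))\<bar> powr p) \<partial>lborel) < ennreal e"
proof -
  let ?T = "\<lambda>n x. indicator (cball 0 (real n)) x * max (- real n) (min (real n) (F x))"
  have [measurable]: "F \<in> borel_measurable borel" by (rule F)
  have [measurable]: "?T n \<in> borel_measurable borel" for n
    by (intro borel_measurable_times borel_measurable_indicator borel_measurable_max borel_measurable_min borel_measurable_const F) simp
  have "(\<lambda>n. \<integral>\<^sup>+ x. ennreal (\<bar>F x - ?T n x\<bar> powr p) \<partial>lborel) \<longlonglongrightarrow> (\<integral>\<^sup>+ x. 0 \<partial>(lborel :: R2 measure))"
  proof (rule nn_integral_dominated_convergence[where w="\<lambda>x. ennreal (\<bar>F x\<bar> powr p)"])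
    show "AE x in lborel. ennreal (\<bar>F x - ?T n x\<bar> powr p) \<le> ennreal (\<bar>F x\<bar> powr p)" for n
      using p by (intro AE_I2 ennreal_leI powr_mono2) (auto simp: indicator_def max_def min_def)
    show "AE x in lborel. (\<lambda>n. ennreal (\<bar>F x - ?T n x\<bar> powr p)) \<longlonglongrightarrow> 0"
    proof (rule AE_I2)
      fix x :: R2
      have ev0: "eventually (\<lambda>n. real n \<ge> c) sequentially" for c
        using filterlim_real_sequentially by (simp add: filterlim_at_top)
      have ev: "eventually (\<lambda>n. real n \<ge> max (norm x) \<bar>F x\<bar>) sequentially" by (rule ev0)
      have "eventually (\<lambda>n. ennreal (\<bar>F x - ?T n x\<bar> powr p) = 0) sequentially"
        using ev
      proof eventually_elim
        case (elim n)
        then have "norm x \<le> real n" "\<bar>F x\<bar> \<le> real n" by auto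
        then have "?T n x = F x" by (auto simp: indicator_def max_def min_def abs_le_iff)
        then show ?case using p by simp
      qed
      then show "(\<lambda>n. ennreal (\<bar>F x - ?T n x\<bar> powr p)) \<longlonglongrightarrow> 0" by (rule tendsto_eventually)
    qed
  qed (use fin in auto)
  then have "eventually (\<lambda>n. (\<integral>\<^sup>+ x. ennreal (\<bar>F x - ?T n x\<bar> powr p) \<partial>lborel) < ennreal e) sequentially"
    using e by (intro order_tendstoD) auto
  moreover have "eventually (\<lambda>n. n > 0) sequentially" by (rule eventually_gt_at_top)
  ultimately have "eventually (\<lambda>n. n > 0 \<and> (\<integral>\<^sup>+ x. ennreal (\<bar>F x - ?T n x\<bar> powr p) \<partial>lborel) < ennreal e) sequentially"
    by (rule eventually_conj[rotated])
  then obtain n where "n > 0" "(\<integral>\<^sup>+ x. ennreal (\<bar>F x - ?T n x\<bar> powr p) \<partial>lborel) < ennreal e"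
    unfolding eventually_sequentially by blast
  then show ?thesis by (intro exI[of _ "real n"]) auto
qed

text \<open>A measurable function is an almost everywhere limit of continuous ones. Truncating these
  at height \<open>N\<close> and damping them to 0 between the radii \<open>N\<close> and
  \<open>N + 1\<close> keeps them dominated, so the convergence holds in the p-th mean.\<close>

lemma Lp_bounded_approx:
  fixes F :: "R2 \<Rightarrow> real"
  assumes F: "F \<in> borel_measurable borel" and p: "p > 0" and N: "N > 0"
    and bd: "\<And>x. \<bar>F x\<bar> \<le> N" and supp: "\<And>x. x \<notin> cball 0 N \<Longrightarrow> F x = 0" and e: "e > 0"
  shows "\<exists>c. continuous_on UNIV c \<and> (\<integral>\<^sup>+ x. ennreal (\<bar>F x - c x\<bar> powr p) \<partial>lborel) < ennreal e"
proof -
  have "Equivalence_Measurable_On_Borel.measurable_on F UNIV"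
    using F by (subst measurable_on_iff_borel_measurable) (auto simp: measurable_completion lebesgue_on_UNIV_eq)
  then obtain Z k where Z: "negligible Z" and k: "\<And>n. continuous_on UNIV (k n)" "\<And>x. x \<notin> Z \<Longrightarrow> (\<lambda>n. k n x) \<longlonglongrightarrow> F x"
    unfolding measurable_on_def by auto
  define cut where "cut x = max 0 (min 1 (N + 1 - norm x))" for x :: R2
  define c where "c n x = cut x * max (-N) (min N (k n x))" for n x
  have cc: "continuous_on UNIV (c n)" for n unfolding c_def cut_def by (intro continuous_intros k)
  have [measurable]: "F \<in> borel_measurable borel" "\<And>n. c n \<in> borel_measurable borel"
    using F cc by (auto intro: borel_measurable_continuous_onI)
  have AEZ: "AE x in lborel. x \<notin> Z"
    using Z AE_completion_iff[of "\<lambda>x. x \<notin> Z" lborel] by (metis (no_types) AE_not_in negligible_iff_null_sets)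
  have "(\<lambda>n. \<integral>\<^sup>+ x. ennreal (\<bar>F x - c n x\<bar> powr p) \<partial>lborel) \<longlonglongrightarrow> (\<integral>\<^sup>+ x. 0 \<partial>(lborel :: R2 measure))"
  proof (rule nn_integral_dominated_convergence[where w="\<lambda>x. ennreal ((2 * N) powr p) * indicator (cball 0 (N + 1)) x"])
    show "AE x in lborel. ennreal (\<bar>F x - c n x\<bar> powr p) \<le> ennreal ((2 * N) powr p) * indicator (cball 0 (N + 1)) x" for n
    proof (rule AE_I2)
      fix x
      show "ennreal (\<bar>F x - c n x\<bar> powr p) \<le> ennreal ((2 * N) powr p) * indicator (cball 0 (N + 1)) x"
      proof (cases "x \<in> cball 0 (N + 1)")
        case True
        have "\<bar>max (-N) (min N (k n x))\<bar> \<le> N" using N by auto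
        moreover have "0 \<le> cut x" "cut x \<le> 1" by (auto simp: cut_def)
        ultimately have "\<bar>c n x\<bar> \<le> N" unfolding c_def abs_mult using mult_mono[of "\<bar>cut x\<bar>" 1 "\<bar>max (-N) (min N (k n x))\<bar>" N] by simp
        then have "\<bar>F x - c n x\<bar> \<le> 2 * N" using bd[of x] by linarith
        then show ?thesis using True p by (auto intro!: ennreal_leI powr_mono2)
      next
        case False
        then have "cut x = 0" "F x = 0" using supp[of x] by (auto simp: cut_def)
        then show ?thesis using p by (simp add: c_def)
      qed
    qed
    show "(\<lambda>x. ennreal (\<bar>F x - c n x\<bar> powr p)) \<in> borel_measurable lborel" for n by measurable
    show "(\<lambda>x. ennreal ((2 * N) powr p) * indicator (cball 0 (N + 1)) x) \<in> borel_measurable (lborel::R2 measure)"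
      by (intro borel_measurable_times_ennreal borel_measurable_const borel_measurable_indicator) simp
    show "(\<integral>\<^sup>+ x. ennreal ((2 * N) powr p) * indicator (cball 0 (N + 1)) x \<partial>(lborel::R2 measure)) < \<infinity>"
    proof -
      have "emeasure lborel (cball (0::R2) (N + 1)) < \<infinity>" by (rule emeasure_bounded_finite) simp
      then show ?thesis by (simp add: nn_integral_cmult_indicator ennreal_mult_less_top)
    qed
    show "AE x in lborel. (\<lambda>n. ennreal (\<bar>F x - c n x\<bar> powr p)) \<longlonglongrightarrow> 0"
      using AEZ
    proof eventually_elim
      case (elim x)
      have "(\<lambda>n. c n x) \<longlonglongrightarrow> cut x * max (-N) (min N (F x))"
        unfolding c_def by (intro tendsto_intros k(2)[OF elim])
      also have "cut x * max (-N) (min N (F x)) = F x"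
      proof (cases "x \<in> cball 0 N")
        case True then show ?thesis using bd[of x] by (auto simp: cut_def max_def min_def abs_le_iff)
      next
        case False then show ?thesis using supp[OF False] N by simp
      qed
      finally have "(\<lambda>n. \<bar>F x - c n x\<bar>) \<longlonglongrightarrow> \<bar>F x - F x\<bar>" by (intro tendsto_intros)
      then have "(\<lambda>n. \<bar>F x - c n x\<bar>) \<longlonglongrightarrow> 0" by simp
      then have "(\<lambda>n. \<bar>F x - c n x\<bar> powr p) \<longlonglongrightarrow> 0" by (rule tendsto_powr_0) (use p in auto)
      then have "(\<lambda>n. ennreal (\<bar>F x - c n x\<bar> powr p)) \<longlonglongrightarrow> ennreal 0" by (rule tendsto_ennrealI)
      then show ?case by simp
    qed
  qed simp
  then have "eventually (\<lambda>n. (\<integral>\<^sup>+ x. ennreal (\<bar>F x - c n x\<bar> powr p) \<partial>lborel) < ennreal e) sequentially"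
    using e by (intro order_tendstoD) auto
  then obtain n where "(\<integral>\<^sup>+ x. ennreal (\<bar>F x - c n x\<bar> powr p) \<partial>lborel) < ennreal e"
    unfolding eventually_sequentially by blast
  then show ?thesis using cc by blast
qed

lemma Lp_continuous_dense:
  fixes F :: "R2 \<Rightarrow> real"
  assumes F: "F \<in> borel_measurable borel" and p: "p > 0" and fin: "(\<integral>\<^sup>+ x. ennreal (\<bar>F x\<bar> powr p) \<partial>lborel) < \<infinity>" and e: "e > 0"
  obtains c where "continuous_on UNIV c" "(\<integral>\<^sup>+ x. ennreal (\<bar>F x - c x\<bar> powr p) \<partial>lborel) \<le> ennreal e"
proof -
  \<comment> \<open>Half the allowance for each of two errors, truncation and continuous
    approximation, divided by the constant in \<open>powr_add_le\<close>.\<close>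
  define e' where "e' = e / (2 * 2 powr p)"
  have e': "e' > 0" using e by (simp add: e'_def)
  obtain N where N: "N > 0" and 1: "(\<integral>\<^sup>+ x. ennreal (\<bar>F x - indicator (cball 0 N) x * max (-N) (min N (F x))\<bar> powr p) \<partial>lborel) < ennreal e'"
    using Lp_truncation[OF F p fin e'] by blast
  define T where "T x = indicator (cball 0 N) x * max (-N) (min N (F x))" for x :: R2
  have [measurable]: "F \<in> borel_measurable borel" by (rule F)
  have [measurable]: "T \<in> borel_measurable borel" unfolding T_def
    by (intro borel_measurable_times borel_measurable_indicator borel_measurable_max borel_measurable_min borel_measurable_const F) simp
  obtain c where c: "continuous_on UNIV c" and 2: "(\<integral>\<^sup>+ x. ennreal (\<bar>T x - c x\<bar> powr p) \<partial>lborel) < ennreal e'"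
  proof -
    have b: "\<bar>T x\<bar> \<le> N" for x using N by (auto simp: T_def indicator_def max_def min_def)
    have s: "T x = 0" if "x \<notin> cball 0 N" for x using that by (simp add: T_def)
    have "T \<in> borel_measurable borel" by measurable
    from Lp_bounded_approx[OF this p N b s e'] show thesis using that by blast
  qed
  have [measurable]: "c \<in> borel_measurable borel" using c by (rule borel_measurable_continuous_onI)
  have "(\<integral>\<^sup>+ x. ennreal (\<bar>F x - c x\<bar> powr p) \<partial>lborel)
     \<le> (\<integral>\<^sup>+ x. ennreal (2 powr p) * (ennreal (\<bar>F x - T x\<bar> powr p) + ennreal (\<bar>T x - c x\<bar> powr p)) \<partial>lborel)"
  proof (rule nn_integral_mono)
    fix x
    have "\<bar>F x - c x\<bar> powr p \<le> (\<bar>F x - T x\<bar> + \<bar>T x - c x\<bar>) powr p" using p by (intro powr_mono2) auto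
    also have "\<dots> \<le> 2 powr p * (\<bar>F x - T x\<bar> powr p + \<bar>T x - c x\<bar> powr p)" using p by (intro powr_add_le) auto
    finally have "ennreal (\<bar>F x - c x\<bar> powr p) \<le> ennreal (2 powr p * (\<bar>F x - T x\<bar> powr p + \<bar>T x - c x\<bar> powr p))" by (rule ennreal_leI)
    also have "\<dots> = ennreal (2 powr p) * (ennreal (\<bar>F x - T x\<bar> powr p) + ennreal (\<bar>T x - c x\<bar> powr p))"
      by (simp add: ennreal_mult)
    finally show "ennreal (\<bar>F x - c x\<bar> powr p) \<le> \<dots>" .
  qed
  also have "\<dots> = ennreal (2 powr p) * ((\<integral>\<^sup>+ x. ennreal (\<bar>F x - T x\<bar> powr p) \<partial>lborel) + (\<integral>\<^sup>+ x. ennreal (\<bar>T x - c x\<bar> powr p) \<partial>lborel))"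
    by (subst nn_integral_cmult, measurable) (subst nn_integral_add, measurable)
  also have "\<dots> \<le> ennreal (2 powr p) * (ennreal e' + ennreal e')"
    using 1 2 by (intro mult_left_mono add_mono) (auto simp: T_def)
  also have "\<dots> = ennreal (2 powr p * (e' + e'))"
    using e' by (subst ennreal_plus[symmetric]) (auto simp: ennreal_mult)
  also have "2 powr p * (e' + e') = e" by (simp add: e'_def)
  finally show thesis using c by (intro that)
qed

lemma L1_continuous_dense_vec:
  fixes F :: "R2 \<Rightarrow> R2"
  assumes F: "F \<in> borel_measurable borel" and fin: "(\<integral>\<^sup>+ x. ennreal (norm (F x)) \<partial>lborel) < \<infinity>" and e: "e > 0"
  shows "\<exists>c. continuous_on UNIV c \<and> (\<integral>\<^sup>+ x. ennreal (norm (F x - c x)) \<partial>lborel) \<le> ennreal e"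
proof -
  have comp: "\<exists>c. continuous_on UNIV c \<and> (\<integral>\<^sup>+ x. ennreal \<bar>F x $ i - c x\<bar> \<partial>lborel) \<le> ennreal (e/2)" for i
  proof -
    have m: "(\<lambda>x. F x $ i) \<in> borel_measurable borel"
      by (rule measurable_compose[OF F]) (intro borel_measurable_continuous_onI continuous_intros)
    have f: "(\<integral>\<^sup>+ x. ennreal (\<bar>F x $ i\<bar> powr 1) \<partial>lborel) < \<infinity>"
    proof -
      have "(\<integral>\<^sup>+ x. ennreal (\<bar>F x $ i\<bar> powr 1) \<partial>lborel) \<le> (\<integral>\<^sup>+ x. ennreal (norm (F x)) \<partial>lborel)"
        by (intro nn_integral_mono ennreal_leI) (simp add: component_le_norm_cart)
      then show ?thesis using fin by (rule le_less_trans)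
    qed
    obtain c where "continuous_on UNIV c" "(\<integral>\<^sup>+ x. ennreal (\<bar>F x $ i - c x\<bar> powr 1) \<partial>lborel) \<le> ennreal (e/2)"
      by (rule Lp_continuous_dense[OF m _ f, of "e/2"]) (use e in auto)
    then show ?thesis by (auto simp: powr_one)
  qed
  obtain c1 where c1: "continuous_on UNIV c1" "(\<integral>\<^sup>+ x. ennreal \<bar>F x $ 1 - c1 x\<bar> \<partial>lborel) \<le> ennreal (e/2)" using comp by blast
  obtain c2 where c2: "continuous_on UNIV c2" "(\<integral>\<^sup>+ x. ennreal \<bar>F x $ 2 - c2 x\<bar> \<partial>lborel) \<le> ennreal (e/2)" using comp by blast
  define c where "c x = (c1 x *\<^sub>R axis 1 1 + c2 x *\<^sub>R axis 2 1 :: R2)" for x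
  have cc: "continuous_on UNIV c" unfolding c_def by (intro continuous_intros c1 c2)
  have n: "norm (F x - c x) \<le> \<bar>F x $ 1 - c1 x\<bar> + \<bar>F x $ 2 - c2 x\<bar>" for x
    using norm_le_l1_cart[of "F x - c x"] by (simp add: UNIV_2 c_def axis_def)
  have [measurable]: "(\<lambda>x. F x $ i) \<in> borel_measurable borel" for i
    by (rule measurable_compose[OF F]) (intro borel_measurable_continuous_onI continuous_intros)
  have [measurable]: "c1 \<in> borel_measurable borel" "c2 \<in> borel_measurable borel"
    using c1 c2 by (auto intro: borel_measurable_continuous_onI)
  have "(\<integral>\<^sup>+ x. ennreal (norm (F x - c x)) \<partial>lborel) \<le> (\<integral>\<^sup>+ x. ennreal \<bar>F x $ 1 - c1 x\<bar> + ennreal \<bar>F x $ 2 - c2 x\<bar> \<partial>lborel)"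
    by (intro nn_integral_mono) (use n in \<open>simp add: ennreal_plus[symmetric] ennreal_leI del: ennreal_plus\<close>)
  also have "\<dots> = (\<integral>\<^sup>+ x. ennreal \<bar>F x $ 1 - c1 x\<bar> \<partial>lborel) + (\<integral>\<^sup>+ x. ennreal \<bar>F x $ 2 - c2 x\<bar> \<partial>lborel)"
    by (rule nn_integral_add) measurable
  also have "\<dots> \<le> ennreal (e/2) + ennreal (e/2)" by (intro add_mono c1 c2)
  also have "\<dots> = ennreal e" using e by (subst ennreal_plus[symmetric]) auto
  finally show ?thesis using cc by blast
qed

section \<open>Differentiability on sets of almost full measure\<close>

text \<open>Each removed line has infinite length, but the set of removed lines has measure zero,
  and the product is 0 in the extended reals.\<close>

lemma null_strip:
  assumes fr: "frame v w" and N: "N \<in> null_sets lborel"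
  shows "{x. x \<bullet> v \<in> N} \<in> null_sets (lborel :: R2 measure)"
proof -
  have Nb: "N \<in> sets borel" "emeasure lborel N = 0" using N by auto
  have m: "(\<lambda>x::R2. x \<bullet> v) \<in> borel \<rightarrow>\<^sub>M borel" by (intro borel_measurable_continuous_onI continuous_intros)
  have b: "{x. x \<bullet> v \<in> N} \<in> sets borel" using measurable_sets[OF m Nb(1)] by (simp add: vimage_def)
  have "emeasure lborel {x. x \<bullet> v \<in> N} = (\<integral>\<^sup>+ x. indicator {x. x \<bullet> v \<in> N} x \<partial>lborel)" using b by simp
  also have "\<dots> = (\<integral>\<^sup>+ t. (\<integral>\<^sup>+ s. indicator {x. x \<bullet> v \<in> N} (t *\<^sub>R v + s *\<^sub>R w) \<partial>lborel) \<partial>lborel)"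
    by (rule nn_integral_frame[OF fr]) (use b in simp)
  also have "\<dots> = (\<integral>\<^sup>+ t. \<infinity> * indicator N t \<partial>lborel)"
    by (intro nn_integral_cong) (auto simp: inner_simps frame_simps[OF fr] indicator_def)
  also have "\<dots> = 0" using Nb by (subst nn_integral_cmult_indicator) auto
  finally show ?thesis using b by auto
qed

context W11 begin

text \<open>\<open>P\<close> is compared with the constant \<open>c0\<close> through the
  approximation \<open>C\<close>: the error \<open>P - C\<close> is controlled in the mean only,
  whereas \<open>C\<close> is uniformly close to \<open>c0\<close> on the interval.\<close>

lemma line_increment_forward:
  assumes P: "set_integrable lborel {p..q} P" "y = (LINT s:{p..q}|lborel. P s)" and pq: "p \<le> q"
    and C: "(\<integral>\<^sup>+ s\<in>{p..q}. ennreal (norm (P s - C s)) \<partial>lborel) \<le> ennreal (\<tau> * (q - p))" "C \<in> borel_measurable borel" "P \<in> borel_measurable borel"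
    and close: "\<And>s. s \<in> {p..q} \<Longrightarrow> norm (C s - c0) \<le> \<eta>" and pos: "0 \<le> \<tau>" "0 \<le> \<eta>"
  shows "norm ((y::R2) - (q - p) *\<^sub>R c0) \<le> (\<tau> + \<eta>) * (q - p)"
proof -
  have [measurable]: "C \<in> borel_measurable borel" "P \<in> borel_measurable borel" by (rule C)+
  have ic: "set_integrable lborel {p..q} (\<lambda>s. c0)" unfolding set_integrable_def by (rule borel_integrable_compact) auto
  have "(LINT s:{p..q}|lborel. c0) = (q - p) *\<^sub>R c0"
    using pq by (simp add: set_lebesgue_integral_def)
  then have "y - (q - p) *\<^sub>R c0 = (LINT s:{p..q}|lborel. P s - c0)"
    using set_integral_diff(2)[OF P(1) ic] P(2) by simp
  then have "ennreal (norm (y - (q - p) *\<^sub>R c0)) \<le> (\<integral>\<^sup>+ s\<in>{p..q}. ennreal (norm (P s - c0)) \<partial>lborel)"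
    by (intro norm_diff_le_nn_integral_line[of p q "\<lambda>s. P s - c0"] set_integral_diff(1)[OF P(1) ic])
  also have "\<dots> \<le> (\<integral>\<^sup>+ s. ennreal (norm (P s - C s)) * indicator {p..q} s + ennreal \<eta> * indicator {p..q} s \<partial>lborel)"
  proof (rule nn_integral_mono)
    fix s
    show "ennreal (norm (P s - c0)) * indicator {p..q} s \<le> ennreal (norm (P s - C s)) * indicator {p..q} s + ennreal \<eta> * indicator {p..q} s"
    proof (cases "s \<in> {p..q}")
      case True
      have "norm (P s - c0) \<le> norm (P s - C s) + \<eta>"
        using norm_triangle_ineq[of "P s - C s" "C s - c0"] close[OF True] by simp
      then show ?thesis using True pos by (simp add: ennreal_plus[symmetric] ennreal_leI del: ennreal_plus)
    qed simp
  qed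
  also have "\<dots> = (\<integral>\<^sup>+ s\<in>{p..q}. ennreal (norm (P s - C s)) \<partial>lborel) + ennreal \<eta> * ennreal (q - p)"
    using pq by (subst nn_integral_add) (auto simp: nn_integral_cmult_indicator)
  also have "\<dots> \<le> ennreal (\<tau> * (q - p)) + ennreal (\<eta> * (q - p))"
    using C(1) pq pos by (intro add_mono) (auto simp: ennreal_mult)
  also have "\<dots> = ennreal ((\<tau> + \<eta>) * (q - p))"
    using pq pos by (subst ennreal_plus[symmetric]) (auto simp: algebra_simps intro: mult_left_mono)
  finally show ?thesis using pq pos by (subst (asm) ennreal_le_iff) auto
qed

lemma line_increment:
  assumes fr: "frame v w"
    and acl: "set_integrable lborel (seg s s') (\<lambda>\<sigma>. Df (t *\<^sub>R v + \<sigma> *\<^sub>R w) *v w)"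
      "f (t *\<^sub>R v + max s s' *\<^sub>R w) - f (t *\<^sub>R v + min s s' *\<^sub>R w) = (LINT \<sigma>:seg s s'|lborel. Df (t *\<^sub>R v + \<sigma> *\<^sub>R w) *v w)"
    and C: "(\<integral>\<^sup>+ \<sigma>\<in>seg s s'. ennreal (norm (Df (t *\<^sub>R v + \<sigma> *\<^sub>R w) *v w - C (t *\<^sub>R v + \<sigma> *\<^sub>R w))) \<partial>lborel) \<le> ennreal (\<tau> * \<bar>s' - s\<bar>)"
      "continuous_on UNIV C"
    and close: "\<And>\<sigma>. \<sigma> \<in> seg s s' \<Longrightarrow> norm (C (t *\<^sub>R v + \<sigma> *\<^sub>R w) - c0) \<le> \<eta>" and pos: "0 \<le> \<tau>" "0 \<le> \<eta>"
  shows "norm (f (t *\<^sub>R v + s' *\<^sub>R w) - f (t *\<^sub>R v + s *\<^sub>R w) - (s' - s) *\<^sub>R c0) \<le> (\<tau> + \<eta>) * \<bar>s' - s\<bar>"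
proof -
  have line: "(\<lambda>s. t *\<^sub>R v + s *\<^sub>R w) \<in> borel \<rightarrow>\<^sub>M borel"
    by (intro borel_measurable_continuous_onI continuous_intros)
  have Cm: "(\<lambda>\<sigma>. C (t *\<^sub>R v + \<sigma> *\<^sub>R w)) \<in> borel_measurable borel"
    by (rule measurable_compose[OF line]) (rule borel_measurable_continuous_onI[OF C(2)])
  have w: "(\<lambda>A::real^2^2. A *v w) \<in> borel_measurable borel"
    by (rule borel_measurable_continuous_onI[OF linear_continuous_on[OF bounded_linear_mult_vec]])
  have Pm: "(\<lambda>\<sigma>. Df (t *\<^sub>R v + \<sigma> *\<^sub>R w) *v w) \<in> borel_measurable borel"
    by (rule measurable_compose[OF measurable_compose[OF line Df_borel] w])
  have abs: "\<bar>s' - s\<bar> = max s s' - min s s'" by (simp add: max_def min_def)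
  have "norm ((f (t *\<^sub>R v + max s s' *\<^sub>R w) - f (t *\<^sub>R v + min s s' *\<^sub>R w)) - (max s s' - min s s') *\<^sub>R c0) \<le> (\<tau> + \<eta>) * (max s s' - min s s')"
    by (rule line_increment_forward[OF acl[unfolded seg_def] _ C(1)[unfolded seg_def abs] Cm Pm]) (use close pos in \<open>auto simp: seg_def\<close>)
  moreover have "norm (f (t *\<^sub>R v + s' *\<^sub>R w) - f (t *\<^sub>R v + s *\<^sub>R w) - (s' - s) *\<^sub>R c0)
     = norm ((f (t *\<^sub>R v + max s s' *\<^sub>R w) - f (t *\<^sub>R v + min s s' *\<^sub>R w)) - (max s s' - min s s') *\<^sub>R c0)"
  proof (cases "s \<le> s'")
    case False
    have "f (t *\<^sub>R v + s' *\<^sub>R w) - f (t *\<^sub>R v + s *\<^sub>R w) - (s' - s) *\<^sub>R c0 = - ((f (t *\<^sub>R v + s *\<^sub>R w) - f (t *\<^sub>R v + s' *\<^sub>R w)) - (s - s') *\<^sub>R c0)"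
      by (simp add: algebra_simps)
    then show ?thesis using False by (simp only: norm_minus_cancel max_def min_def if_False)
  qed (simp add: max_def min_def)
  ultimately show ?thesis unfolding abs by simp
qed

lemma mult_vec_borel: "(\<lambda>x. Df x *v w) \<in> borel_measurable borel"
proof -
  have w: "(\<lambda>A::real^2^2. A *v w) \<in> borel_measurable borel"
    by (rule borel_measurable_continuous_onI[OF linear_continuous_on[OF bounded_linear_mult_vec]])
  show ?thesis by (rule measurable_compose[OF Df_borel w])
qed

text \<open>The error in the mean is chosen as \<tau>^2 with \<tau> = 2^(-k), so that level sets at
  height \<tau> have measure of order \<tau>: 5 \<tau> for each of the two directional maximal
  functions and \<tau> for the error itself, together 11 \<tau>. These bounds are summable in
  \<open>k\<close>.\<close>

lemma good_approximation:
  assumes fr: "frame e1 e2" and Q: "rect e1 e2 A1 A2 B1 B2 \<subseteq> D"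
  shows "\<exists>c1 c2 E. continuous_on UNIV c1 \<and> continuous_on UNIV c2 \<and> E \<in> sets borel \<and> emeasure lborel E \<le> ennreal (11 * (1/2)^k) \<and>
    (\<forall>x\<in>rect e1 e2 A1 A2 B1 B2 - E. norm (Df x *v e1 - c1 x) \<le> (1/2)^k \<and> norm (Df x *v e2 - c2 x) \<le> (1/2)^k \<and>
      (\<forall>s\<in>{A1..A2}. (\<integral>\<^sup>+ \<sigma>\<in>seg (x \<bullet> e1) s. ennreal (norm (Df ((x \<bullet> e2) *\<^sub>R e2 + \<sigma> *\<^sub>R e1) *v e1 - c1 ((x \<bullet> e2) *\<^sub>R e2 + \<sigma> *\<^sub>R e1))) \<partial>lborel) \<le> ennreal ((1/2)^k * \<bar>s - x \<bullet> e1\<bar>)) \<and>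
      (\<forall>s\<in>{B1..B2}. (\<integral>\<^sup>+ \<sigma>\<in>seg (x \<bullet> e2) s. ennreal (norm (Df ((x \<bullet> e1) *\<^sub>R e1 + \<sigma> *\<^sub>R e2) *v e2 - c2 ((x \<bullet> e1) *\<^sub>R e1 + \<sigma> *\<^sub>R e2))) \<partial>lborel) \<le> ennreal ((1/2)^k * \<bar>s - x \<bullet> e2\<bar>)))"
proof -
  let ?Q = "rect e1 e2 A1 A2 B1 B2"
  have fr': "frame e2 e1" using fr by (simp add: frame_def inner_commute)
  have cmp: "compact ?Q" by (rule compact_rect[OF fr])
  have Qb: "?Q \<in> sets borel" using cmp by (simp add: borel_compact)
  define \<tau> where "\<tau> = (1/2::real)^k"
  have \<tau>: "\<tau> > 0" by (simp add: \<tau>_def)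
  have ap: "\<exists>c. continuous_on UNIV c \<and> (\<integral>\<^sup>+ x. ennreal (norm (indicator ?Q x *\<^sub>R (Df x *v w) - c x)) \<partial>lborel) \<le> ennreal (\<tau> * \<tau> / 2)" for w
  proof (rule L1_continuous_dense_vec)
    show "(\<lambda>x. indicator ?Q x *\<^sub>R (Df x *v w)) \<in> borel_measurable borel"
      by (rule borel_measurable_scaleR[OF borel_measurable_indicator[OF Qb] mult_vec_borel])
    have "integrable lborel (\<lambda>x. indicator ?Q x *\<^sub>R (Df x *v w))"
      using Df_mult_int[OF cmp Q] by (simp add: set_integrable_def)
    then show "(\<integral>\<^sup>+ x. ennreal (norm (indicator ?Q x *\<^sub>R (Df x *v w))) \<partial>lborel) < \<infinity>"
      by (simp add: integrable_iff_bounded)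
    show "\<tau> * \<tau> / 2 > 0" using \<tau> by simp
  qed
  obtain c1 where c1: "continuous_on UNIV c1" "(\<integral>\<^sup>+ x. ennreal (norm (indicator ?Q x *\<^sub>R (Df x *v e1) - c1 x)) \<partial>lborel) \<le> ennreal (\<tau> * \<tau> / 2)" using ap by blast
  obtain c2 where c2: "continuous_on UNIV c2" "(\<integral>\<^sup>+ x. ennreal (norm (indicator ?Q x *\<^sub>R (Df x *v e2) - c2 x)) \<partial>lborel) \<le> ennreal (\<tau> * \<tau> / 2)" using ap by blast
  have [measurable]: "c1 \<in> borel_measurable borel" "c2 \<in> borel_measurable borel"
    using c1 c2 by (auto intro: borel_measurable_continuous_onI)
  have [measurable]: "?Q \<in> sets borel" by (rule Qb)
  have [measurable]: "(\<lambda>x. Df x *v w) \<in> borel_measurable borel" for w by (rule mult_vec_borel)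
  \<comment> \<open>One function collects the errors of both directions, which is why each
    approximation is granted half of \<tau>^2.\<close>
  define G where "G x = (ennreal (norm (Df x *v e1 - c1 x)) + ennreal (norm (Df x *v e2 - c2 x))) * indicator ?Q x" for x
  have Gm: "G \<in> borel_measurable borel" unfolding G_def by measurable
  have "(\<integral>\<^sup>+ x. G x \<partial>lborel) \<le> (\<integral>\<^sup>+ x. ennreal (norm (indicator ?Q x *\<^sub>R (Df x *v e1) - c1 x)) + ennreal (norm (indicator ?Q x *\<^sub>R (Df x *v e2) - c2 x)) \<partial>lborel)"
    by (rule nn_integral_mono) (auto simp: G_def indicator_def)
  also have "\<dots> = (\<integral>\<^sup>+ x. ennreal (norm (indicator ?Q x *\<^sub>R (Df x *v e1) - c1 x)) \<partial>lborel) + (\<integral>\<^sup>+ x. ennreal (norm (indicator ?Q x *\<^sub>R (Df x *v e2) - c2 x)) \<partial>lborel)"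
    by (rule nn_integral_add) measurable
  also have "\<dots> \<le> ennreal (\<tau> * \<tau> / 2) + ennreal (\<tau> * \<tau> / 2)" by (intro add_mono c1 c2)
  also have "\<dots> = ennreal (\<tau> * \<tau>)" using \<tau> by (subst ennreal_plus[symmetric]) auto
  finally have GI: "(\<integral>\<^sup>+ x. G x \<partial>lborel) \<le> ennreal (\<tau> * \<tau>)" .
  have cancel: "m \<le> ennreal (c * \<tau>)" if "ennreal \<tau> * m \<le> ennreal (c * (\<tau> * \<tau>))" "c > 0" for m c
  proof (cases m)
    case top then show ?thesis using that \<tau> by (simp add: ennreal_mult_top top_unique)
  next
    case (real r)
    then have "ennreal (\<tau> * r) \<le> ennreal (c * (\<tau> * \<tau>))" using that \<tau> by (simp add: ennreal_mult)
    then have "\<tau> * r \<le> \<tau> * (c * \<tau>)" using that \<tau> real by (simp add: ennreal_le_iff mult.left_commute)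
    then have "r \<le> c * \<tau>" using \<tau> by simp
    then show ?thesis using real by (simp add: ennreal_leI)
  qed
  have five: "5 * (\<integral>\<^sup>+ x. G x \<partial>lborel) \<le> ennreal (5 * (\<tau> * \<tau>))"
    using mult_left_mono[OF GI, of 5] \<tau> by (simp add: ennreal_mult)
  obtain E1 where E1: "E1 \<in> sets borel" "ennreal \<tau> * emeasure lborel E1 \<le> 5 * (\<integral>\<^sup>+ x. G x \<partial>lborel)"
    "\<And>t s s'. t *\<^sub>R e2 + s *\<^sub>R e1 \<notin> E1 \<Longrightarrow> (\<integral>\<^sup>+ \<sigma>\<in>seg s s'. G (t *\<^sub>R e2 + \<sigma> *\<^sub>R e1) \<partial>lborel) \<le> ennreal (\<tau> * \<bar>s' - s\<bar>)"
    by (rule maximal_2d[OF fr' Gm \<tau>]) (rule that; assumption)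
  obtain E2 where E2: "E2 \<in> sets borel" "ennreal \<tau> * emeasure lborel E2 \<le> 5 * (\<integral>\<^sup>+ x. G x \<partial>lborel)"
    "\<And>t s s'. t *\<^sub>R e1 + s *\<^sub>R e2 \<notin> E2 \<Longrightarrow> (\<integral>\<^sup>+ \<sigma>\<in>seg s s'. G (t *\<^sub>R e1 + \<sigma> *\<^sub>R e2) \<partial>lborel) \<le> ennreal (\<tau> * \<bar>s' - s\<bar>)"
    by (rule maximal_2d[OF fr Gm \<tau>]) (rule that; assumption)
  define E3 where "E3 = {x. ennreal \<tau> < G x}"
  have E3b: "E3 \<in> sets borel" unfolding E3_def using Gm by measurable
  have "ennreal \<tau> * emeasure lborel E3 = (\<integral>\<^sup>+ x. ennreal \<tau> * indicator E3 x \<partial>lborel)"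
    using E3b by (simp add: nn_integral_cmult_indicator)
  also have "\<dots> \<le> (\<integral>\<^sup>+ x. G x \<partial>lborel)" by (rule nn_integral_mono) (auto simp: E3_def indicator_def)
  also have "\<dots> \<le> ennreal (1 * (\<tau> * \<tau>))" using GI by simp
  finally have e3: "emeasure lborel E3 \<le> ennreal (1 * \<tau>)" by (rule cancel) simp
  have e1: "emeasure lborel E1 \<le> ennreal (5 * \<tau>)" by (rule cancel[OF order_trans[OF E1(2) five]]) simp
  have e2: "emeasure lborel E2 \<le> ennreal (5 * \<tau>)" by (rule cancel[OF order_trans[OF E2(2) five]]) simp
  define E where "E = E1 \<union> (E2 \<union> E3)"
  have Eb: "E \<in> sets borel" unfolding E_def using E1 E2 E3b by auto
  have "emeasure lborel E \<le> emeasure lborel E1 + (emeasure lborel E2 + emeasure lborel E3)"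
    unfolding E_def using E1(1) E2(1) E3b
    by (intro order_trans[OF emeasure_subadditive] add_mono order_refl emeasure_subadditive) auto
  also have "\<dots> \<le> ennreal (5 * \<tau>) + (ennreal (5 * \<tau>) + ennreal (1 * \<tau>))" by (intro add_mono e1 e2 e3)
  also have "\<dots> = ennreal (11 * \<tau>)" using \<tau> by (simp add: ennreal_plus[symmetric] del: ennreal_plus)
  finally have Em: "emeasure lborel E \<le> ennreal (11 * \<tau>)" .
  have main: "norm (Df x *v e1 - c1 x) \<le> \<tau> \<and> norm (Df x *v e2 - c2 x) \<le> \<tau> \<and>
      (\<forall>s\<in>{A1..A2}. (\<integral>\<^sup>+ \<sigma>\<in>seg (x \<bullet> e1) s. ennreal (norm (Df ((x \<bullet> e2) *\<^sub>R e2 + \<sigma> *\<^sub>R e1) *v e1 - c1 ((x \<bullet> e2) *\<^sub>R e2 + \<sigma> *\<^sub>R e1))) \<partial>lborel) \<le> ennreal (\<tau> * \<bar>s - x \<bullet> e1\<bar>)) \<and>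
      (\<forall>s\<in>{B1..B2}. (\<integral>\<^sup>+ \<sigma>\<in>seg (x \<bullet> e2) s. ennreal (norm (Df ((x \<bullet> e1) *\<^sub>R e1 + \<sigma> *\<^sub>R e2) *v e2 - c2 ((x \<bullet> e1) *\<^sub>R e1 + \<sigma> *\<^sub>R e2))) \<partial>lborel) \<le> ennreal (\<tau> * \<bar>s - x \<bullet> e2\<bar>))"
    if x: "x \<in> ?Q - E" for x
  proof (intro conjI ballI)
    have xQ: "x \<in> ?Q" and x3: "x \<notin> E1" "x \<notin> E2" "x \<notin> E3" using x by (auto simp: E_def)
    have xc: "A1 \<le> x \<bullet> e1" "x \<bullet> e1 \<le> A2" "B1 \<le> x \<bullet> e2" "x \<bullet> e2 \<le> B2" using xQ by (auto simp: rect_def)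
    have "ennreal (norm (Df x *v e1 - c1 x) + norm (Df x *v e2 - c2 x)) \<le> ennreal \<tau>"
      using x3(3) xQ by (simp add: E3_def G_def not_less)
    then have le: "norm (Df x *v e1 - c1 x) + norm (Df x *v e2 - c2 x) \<le> \<tau>" using \<tau> by (simp add: ennreal_le_iff del: ennreal_plus)
    show "norm (Df x *v e1 - c1 x) \<le> \<tau>" using le norm_ge_zero[of "Df x *v e2 - c2 x"] by linarith
    show "norm (Df x *v e2 - c2 x) \<le> \<tau>" using le norm_ge_zero[of "Df x *v e1 - c1 x"] by linarith
    fix s
    { assume s: "s \<in> {A1..A2}"
      have "(\<integral>\<^sup>+ \<sigma>\<in>seg (x \<bullet> e1) s. ennreal (norm (Df ((x \<bullet> e2) *\<^sub>R e2 + \<sigma> *\<^sub>R e1) *v e1 - c1 ((x \<bullet> e2) *\<^sub>R e2 + \<sigma> *\<^sub>R e1))) \<partial>lborel)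
        \<le> (\<integral>\<^sup>+ \<sigma>\<in>seg (x \<bullet> e1) s. G ((x \<bullet> e2) *\<^sub>R e2 + \<sigma> *\<^sub>R e1) \<partial>lborel)"
      proof (rule nn_integral_mono)
        fix \<sigma>
        show "ennreal (norm (Df ((x \<bullet> e2) *\<^sub>R e2 + \<sigma> *\<^sub>R e1) *v e1 - c1 ((x \<bullet> e2) *\<^sub>R e2 + \<sigma> *\<^sub>R e1))) * indicator (seg (x \<bullet> e1) s) \<sigma> \<le> G ((x \<bullet> e2) *\<^sub>R e2 + \<sigma> *\<^sub>R e1) * indicator (seg (x \<bullet> e1) s) \<sigma>"
        proof (cases "\<sigma> \<in> seg (x \<bullet> e1) s")
          case True
          then have "A1 \<le> \<sigma>" "\<sigma> \<le> A2" using s xc by (auto simp: seg_def)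
          then have "(x \<bullet> e2) *\<^sub>R e2 + \<sigma> *\<^sub>R e1 \<in> ?Q" using xc by (simp add: rect_def inner_simps frame_simps[OF fr])
          then show ?thesis by (simp add: G_def mult_right_mono)
        qed simp
      qed
      also have "\<dots> \<le> ennreal (\<tau> * \<bar>s - x \<bullet> e1\<bar>)"
        by (rule E1(3)) (use x3(1) frame_decomp[OF fr', of x] in simp)
      finally show "(\<integral>\<^sup>+ \<sigma>\<in>seg (x \<bullet> e1) s. ennreal (norm (Df ((x \<bullet> e2) *\<^sub>R e2 + \<sigma> *\<^sub>R e1) *v e1 - c1 ((x \<bullet> e2) *\<^sub>R e2 + \<sigma> *\<^sub>R e1))) \<partial>lborel) \<le> ennreal (\<tau> * \<bar>s - x \<bullet> e1\<bar>)" . }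
    { assume s: "s \<in> {B1..B2}"
      have "(\<integral>\<^sup>+ \<sigma>\<in>seg (x \<bullet> e2) s. ennreal (norm (Df ((x \<bullet> e1) *\<^sub>R e1 + \<sigma> *\<^sub>R e2) *v e2 - c2 ((x \<bullet> e1) *\<^sub>R e1 + \<sigma> *\<^sub>R e2))) \<partial>lborel)
        \<le> (\<integral>\<^sup>+ \<sigma>\<in>seg (x \<bullet> e2) s. G ((x \<bullet> e1) *\<^sub>R e1 + \<sigma> *\<^sub>R e2) \<partial>lborel)"
      proof (rule nn_integral_mono)
        fix \<sigma>
        show "ennreal (norm (Df ((x \<bullet> e1) *\<^sub>R e1 + \<sigma> *\<^sub>R e2) *v e2 - c2 ((x \<bullet> e1) *\<^sub>R e1 + \<sigma> *\<^sub>R e2))) * indicator (seg (x \<bullet> e2) s) \<sigma> \<le> G ((x \<bullet> e1) *\<^sub>R e1 + \<sigma> *\<^sub>R e2) * indicator (seg (x \<bullet> e2) s) \<sigma>"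
        proof (cases "\<sigma> \<in> seg (x \<bullet> e2) s")
          case True
          then have "B1 \<le> \<sigma>" "\<sigma> \<le> B2" using s xc by (auto simp: seg_def)
          then have "(x \<bullet> e1) *\<^sub>R e1 + \<sigma> *\<^sub>R e2 \<in> ?Q" using xc by (simp add: rect_def inner_simps frame_simps[OF fr])
          then show ?thesis by (simp add: G_def mult_right_mono)
        qed simp
      qed
      also have "\<dots> \<le> ennreal (\<tau> * \<bar>s - x \<bullet> e2\<bar>)"
        by (rule E2(3)) (use x3(2) frame_decomp[OF fr, of x] in simp)
      finally show "(\<integral>\<^sup>+ \<sigma>\<in>seg (x \<bullet> e2) s. ennreal (norm (Df ((x \<bullet> e1) *\<^sub>R e1 + \<sigma> *\<^sub>R e2) *v e2 - c2 ((x \<bullet> e1) *\<^sub>R e1 + \<sigma> *\<^sub>R e2))) \<partial>lborel) \<le> ennreal (\<tau> * \<bar>s - x \<bullet> e2\<bar>)" . }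
  qed
  show ?thesis unfolding \<tau>_def[symmetric]
    using c1(1) c2(1) Eb Em main by blast
qed

text \<open>An increment from \<open>x\<close> to \<open>y\<close> is split at a corner about which
  nothing is known: the first leg is estimated from \<open>x\<close> and the second from
  \<open>y\<close>. Both ends therefore have to be good points, and the derivative is taken relative
  to the good set. Borel-Cantelli shows that almost every point of the rectangle is good from some
  \<open>m\<close> on.\<close>

lemma differentiable_pieces_rect:
  assumes fr: "frame e1 e2" and Q: "rect e1 e2 A1 A2 B1 B2 \<subseteq> D" and AB: "A1 < A2" "B1 < B2"
  shows "\<exists>S::nat \<Rightarrow> R2 set. (\<forall>m. S m \<in> sets borel \<and> S m \<subseteq> D \<and> (\<forall>x\<in>S m. (f has_derivative (\<lambda>h. Df x *v h)) (at x within S m)))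
    \<and> (AE x in lborel. x \<in> rect e1 e2 A1 A2 B1 B2 \<longrightarrow> x \<in> (\<Union>m. S m))"
proof -
  let ?Q = "rect e1 e2 A1 A2 B1 B2"
  have fr': "frame e2 e1" using fr by (simp add: frame_def inner_commute)
  have Q': "rect e2 e1 B1 B2 A1 A2 = ?Q" by (auto simp: rect_def)
  have cmp: "compact ?Q" by (rule compact_rect[OF fr])
  have Qb: "?Q \<in> sets borel" using cmp by (simp add: borel_compact)
  have "\<forall>k. \<exists>c1 c2 E. continuous_on UNIV c1 \<and> continuous_on UNIV c2 \<and> E \<in> sets borel \<and> emeasure lborel E \<le> ennreal (11 * (1/2)^k) \<and>
    (\<forall>x\<in>rect e1 e2 A1 A2 B1 B2 - E. norm (Df x *v e1 - c1 x) \<le> (1/2)^k \<and> norm (Df x *v e2 - c2 x) \<le> (1/2)^k \<and>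
      (\<forall>s\<in>{A1..A2}. (\<integral>\<^sup>+ \<sigma>\<in>seg (x \<bullet> e1) s. ennreal (norm (Df ((x \<bullet> e2) *\<^sub>R e2 + \<sigma> *\<^sub>R e1) *v e1 - c1 ((x \<bullet> e2) *\<^sub>R e2 + \<sigma> *\<^sub>R e1))) \<partial>lborel) \<le> ennreal ((1/2)^k * \<bar>s - x \<bullet> e1\<bar>)) \<and>
      (\<forall>s\<in>{B1..B2}. (\<integral>\<^sup>+ \<sigma>\<in>seg (x \<bullet> e2) s. ennreal (norm (Df ((x \<bullet> e1) *\<^sub>R e1 + \<sigma> *\<^sub>R e2) *v e2 - c2 ((x \<bullet> e1) *\<^sub>R e1 + \<sigma> *\<^sub>R e2))) \<partial>lborel) \<le> ennreal ((1/2)^k * \<bar>s - x \<bullet> e2\<bar>)))"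
    by (intro allI good_approximation[OF fr Q])
  from this[unfolded choice_iff]
  obtain c1 c2 E where ap: "\<And>k. continuous_on UNIV (c1 k)" "\<And>k. continuous_on UNIV (c2 k)" "\<And>k. E k \<in> sets borel" "\<And>k. emeasure lborel (E k) \<le> ennreal (11 * (1/2)^k)"
    and G: "\<And>k x. x \<in> ?Q - E k \<Longrightarrow> norm (Df x *v e1 - c1 k x) \<le> (1/2)^k \<and> norm (Df x *v e2 - c2 k x) \<le> (1/2)^k \<and>
      (\<forall>s\<in>{A1..A2}. (\<integral>\<^sup>+ \<sigma>\<in>seg (x \<bullet> e1) s. ennreal (norm (Df ((x \<bullet> e2) *\<^sub>R e2 + \<sigma> *\<^sub>R e1) *v e1 - c1 k ((x \<bullet> e2) *\<^sub>R e2 + \<sigma> *\<^sub>R e1))) \<partial>lborel) \<le> ennreal ((1/2)^k * \<bar>s - x \<bullet> e1\<bar>)) \<and>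
      (\<forall>s\<in>{B1..B2}. (\<integral>\<^sup>+ \<sigma>\<in>seg (x \<bullet> e2) s. ennreal (norm (Df ((x \<bullet> e1) *\<^sub>R e1 + \<sigma> *\<^sub>R e2) *v e2 - c2 k ((x \<bullet> e1) *\<^sub>R e1 + \<sigma> *\<^sub>R e2))) \<partial>lborel) \<le> ennreal ((1/2)^k * \<bar>s - x \<bullet> e2\<bar>))"
    by (elim exE) blast
  obtain N1 where N1: "N1 \<in> null_sets lborel" "\<And>t. t \<in> {B1..B2} \<Longrightarrow> t \<notin> N1 \<Longrightarrow>
     set_integrable lborel {A1..A2} (\<lambda>s. Df (t *\<^sub>R e2 + s *\<^sub>R e1) *v e1) \<and>
     (\<forall>p q. A1 \<le> p \<and> p \<le> q \<and> q \<le> A2 \<longrightarrow> f (t *\<^sub>R e2 + q *\<^sub>R e1) - f (t *\<^sub>R e2 + p *\<^sub>R e1) = (LINT s:{p..q}|lborel. Df (t *\<^sub>R e2 + s *\<^sub>R e1) *v e1))"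
    using acl_rect[OF fr' Q[folded Q'] AB(1)] unfolding eventually_ae_filter by auto
  obtain N2 where N2: "N2 \<in> null_sets lborel" "\<And>t. t \<in> {A1..A2} \<Longrightarrow> t \<notin> N2 \<Longrightarrow>
     set_integrable lborel {B1..B2} (\<lambda>s. Df (t *\<^sub>R e1 + s *\<^sub>R e2) *v e2) \<and>
     (\<forall>p q. B1 \<le> p \<and> p \<le> q \<and> q \<le> B2 \<longrightarrow> f (t *\<^sub>R e1 + q *\<^sub>R e2) - f (t *\<^sub>R e1 + p *\<^sub>R e2) = (LINT s:{p..q}|lborel. Df (t *\<^sub>R e1 + s *\<^sub>R e2) *v e2))"
    using acl_rect[OF fr Q AB(2)] unfolding eventually_ae_filter by auto
  \<comment> \<open>Points on lines without absolute continuity: the first leg runs along the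
    \<open>e1\<close>-line through \<open>x\<close>, the second along the \<open>e2\<close>-line
    through \<open>y\<close>.\<close>
  define Z where "Z = {x. x \<bullet> e2 \<in> N1} \<union> {x. x \<bullet> e1 \<in> N2}"
  have Z: "Z \<in> null_sets lborel" unfolding Z_def by (intro null_sets.Un null_strip[OF fr' N1(1)] null_strip[OF fr N2(1)])
  define S where "S m = ?Q - Z - (\<Union>k\<in>{m..}. E k)" for m :: nat
  have Sb: "S m \<in> sets borel" for m unfolding S_def using Qb Z ap(3) by auto
  have deriv: "(f has_derivative (\<lambda>h. Df x *v h)) (at x within S m)" if x: "x \<in> S m" for x m
    unfolding has_derivative_within_alt
  proof (intro conjI allI impI)
    show "bounded_linear (\<lambda>h. Df x *v h)" by (rule matrix_vector_mul_bounded_linear)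
    fix \<epsilon> :: real assume \<epsilon>: "\<epsilon> > 0"
    obtain k0 where k0: "(1/2::real)^k0 < \<epsilon>/8" using real_arch_pow_inv[of "\<epsilon>/8" "1/2"] \<epsilon> by auto
    \<comment> \<open>\<open>k \<ge> m\<close> makes both points avoid \<open>E k\<close>, and
      2^(-k) below \<epsilon>/8 makes a leg cost at most \<tau> + \<epsilon>/4 + \<tau> \<le>
      \<epsilon>/2 per unit of length.\<close>
    define k where "k = max k0 m"
    define \<tau> where "\<tau> = (1/2::real)^k"
    have \<tau>: "0 < \<tau>" "\<tau> \<le> \<epsilon>/8"
    proof -
      have "(1/2::real)^k \<le> (1/2)^k0" unfolding k_def by (rule power_decreasing) auto
      then show "\<tau> \<le> \<epsilon>/8" using k0 unfolding \<tau>_def by linarith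
    qed (simp add: \<tau>_def)
    have Gx: "x \<in> ?Q - E k" "x \<notin> Z" using x unfolding S_def k_def by (auto simp: max_def)
    obtain d1 where d1: "d1 > 0" "\<And>z. dist z x < d1 \<Longrightarrow> dist (c1 k z) (c1 k x) < \<epsilon>/4"
      using ap(1)[of k] \<epsilon> unfolding continuous_on_iff by (metis UNIV_I zero_less_divide_iff zero_less_numeral)
    obtain d2 where d2: "d2 > 0" "\<And>z. dist z x < d2 \<Longrightarrow> dist (c2 k z) (c2 k x) < \<epsilon>/4"
      using ap(2)[of k] \<epsilon> unfolding continuous_on_iff by (metis UNIV_I zero_less_divide_iff zero_less_numeral)
    show "\<exists>d>0. \<forall>y\<in>S m. norm (y - x) < d \<longrightarrow> norm (f y - f x - Df x *v (y - x)) \<le> \<epsilon> * norm (y - x)"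
    \<comment> \<open>Half the radius, because a point of the second leg may be as far from
      \<open>x\<close> as the sum of both coordinate differences.\<close>
    proof (intro exI[of _ "min d1 d2 / 2"] conjI ballI impI)
      show "min d1 d2 / 2 > 0" using d1 d2 by simp
      fix y assume y: "y \<in> S m" and near: "norm (y - x) < min d1 d2 / 2"
      have Gy: "y \<in> ?Q - E k" "y \<notin> Z" using y unfolding S_def k_def by (auto simp: max_def)
      have xc: "x \<bullet> e1 \<in> {A1..A2}" "x \<bullet> e2 \<in> {B1..B2}" "y \<bullet> e1 \<in> {A1..A2}" "y \<bullet> e2 \<in> {B1..B2}"
        using Gx Gy by (auto simp: rect_def)
      have n1: "\<bar>y \<bullet> e1 - x \<bullet> e1\<bar> \<le> norm (y - x)"
        using Cauchy_Schwarz_ineq2[of "y - x" e1] frame_simps[OF fr] by (simp add: inner_diff_left)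
      have n2: "\<bar>y \<bullet> e2 - x \<bullet> e2\<bar> \<le> norm (y - x)"
        using Cauchy_Schwarz_ineq2[of "y - x" e2] frame_simps[OF fr] by (simp add: inner_diff_left)
      have xd: "(x \<bullet> e2) *\<^sub>R e2 + (x \<bullet> e1) *\<^sub>R e1 = x" "(y \<bullet> e1) *\<^sub>R e1 + (y \<bullet> e2) *\<^sub>R e2 = y" "(x \<bullet> e1) *\<^sub>R e1 + (x \<bullet> e2) *\<^sub>R e2 = x"
        using frame_decomp[OF fr] frame_decomp[OF fr'] by auto
      have c1x: "norm (c1 k x - Df x *v e1) \<le> \<tau>" "norm (c2 k x - Df x *v e2) \<le> \<tau>"
        using G[OF Gx(1)] unfolding \<tau>_def by (auto simp: norm_minus_commute)
      \<comment> \<open>first leg: from \<open>x\<close> to the corner with the abscissa of \<open>y\<close> and the ordinate of \<open>x\<close>\<close>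
      have leg1: "norm (f ((x \<bullet> e2) *\<^sub>R e2 + (y \<bullet> e1) *\<^sub>R e1) - f ((x \<bullet> e2) *\<^sub>R e2 + (x \<bullet> e1) *\<^sub>R e1) - (y \<bullet> e1 - x \<bullet> e1) *\<^sub>R (Df x *v e1)) \<le> (\<tau> + (\<epsilon>/4 + \<tau>)) * \<bar>y \<bullet> e1 - x \<bullet> e1\<bar>"
      proof (rule line_increment[OF fr', where C="c1 k"])
        have t: "x \<bullet> e2 \<notin> N1" using Gx(2) by (auto simp: Z_def)
        note acl = N1(2)[OF xc(2) t]
        show "set_integrable lborel (seg (x \<bullet> e1) (y \<bullet> e1)) (\<lambda>\<sigma>. Df ((x \<bullet> e2) *\<^sub>R e2 + \<sigma> *\<^sub>R e1) *v e1)"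
          by (rule set_integrable_subset[OF conjunct1[OF acl]]) (use xc in \<open>auto simp: seg_def\<close>)
        show "f ((x \<bullet> e2) *\<^sub>R e2 + max (x \<bullet> e1) (y \<bullet> e1) *\<^sub>R e1) - f ((x \<bullet> e2) *\<^sub>R e2 + min (x \<bullet> e1) (y \<bullet> e1) *\<^sub>R e1) = (LINT \<sigma>:seg (x \<bullet> e1) (y \<bullet> e1)|lborel. Df ((x \<bullet> e2) *\<^sub>R e2 + \<sigma> *\<^sub>R e1) *v e1)"
          unfolding seg_def by (rule conjunct2[OF acl, rule_format]) (use xc in auto)
        show "(\<integral>\<^sup>+ \<sigma>\<in>seg (x \<bullet> e1) (y \<bullet> e1). ennreal (norm (Df ((x \<bullet> e2) *\<^sub>R e2 + \<sigma> *\<^sub>R e1) *v e1 - c1 k ((x \<bullet> e2) *\<^sub>R e2 + \<sigma> *\<^sub>R e1))) \<partial>lborel) \<le> ennreal (\<tau> * \<bar>y \<bullet> e1 - x \<bullet> e1\<bar>)"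
          using G[OF Gx(1)] xc unfolding \<tau>_def by blast
        show "continuous_on UNIV (c1 k)" by (rule ap)
        show "norm (c1 k ((x \<bullet> e2) *\<^sub>R e2 + \<sigma> *\<^sub>R e1) - Df x *v e1) \<le> \<epsilon>/4 + \<tau>" if "\<sigma> \<in> seg (x \<bullet> e1) (y \<bullet> e1)" for \<sigma>
        proof -
          have "(x \<bullet> e2) *\<^sub>R e2 + \<sigma> *\<^sub>R e1 - ((x \<bullet> e2) *\<^sub>R e2 + (x \<bullet> e1) *\<^sub>R e1) = (\<sigma> - x \<bullet> e1) *\<^sub>R e1"
            by (simp add: algebra_simps)
          then have "(x \<bullet> e2) *\<^sub>R e2 + \<sigma> *\<^sub>R e1 - x = (\<sigma> - x \<bullet> e1) *\<^sub>R e1" unfolding xd(1) .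
          then have "dist ((x \<bullet> e2) *\<^sub>R e2 + \<sigma> *\<^sub>R e1) x = \<bar>\<sigma> - x \<bullet> e1\<bar>" by (simp add: dist_norm frame_simps[OF fr])
          also have "\<dots> < d1" using that n1 near d1 d2 by (auto simp: seg_def min_def max_def split: if_splits)
          finally have "norm (c1 k ((x \<bullet> e2) *\<^sub>R e2 + \<sigma> *\<^sub>R e1) - c1 k x) < \<epsilon>/4" using d1(2) by (simp add: dist_norm)
          then show ?thesis using c1x(1) norm_triangle_ineq[of "c1 k ((x \<bullet> e2) *\<^sub>R e2 + \<sigma> *\<^sub>R e1) - c1 k x" "c1 k x - Df x *v e1"] by simp
        qed
      qed (use \<tau> \<epsilon> in auto)
      \<comment> \<open>The second leg is run from \<open>y\<close> towards the corner, so that the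
        maximal bound at the good point \<open>y\<close> applies, while the comparison value remains
        the differential at \<open>x\<close>.\<close>
      have leg2: "norm (f ((y \<bullet> e1) *\<^sub>R e1 + (x \<bullet> e2) *\<^sub>R e2) - f ((y \<bullet> e1) *\<^sub>R e1 + (y \<bullet> e2) *\<^sub>R e2) - (x \<bullet> e2 - y \<bullet> e2) *\<^sub>R (Df x *v e2)) \<le> (\<tau> + (\<epsilon>/4 + \<tau>)) * \<bar>x \<bullet> e2 - y \<bullet> e2\<bar>"
      proof (rule line_increment[OF fr, where C="c2 k"])
        have t: "y \<bullet> e1 \<notin> N2" using Gy(2) by (auto simp: Z_def)
        note acl = N2(2)[OF xc(3) t]
        show "set_integrable lborel (seg (y \<bullet> e2) (x \<bullet> e2)) (\<lambda>\<sigma>. Df ((y \<bullet> e1) *\<^sub>R e1 + \<sigma> *\<^sub>R e2) *v e2)"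
          by (rule set_integrable_subset[OF conjunct1[OF acl]]) (use xc in \<open>auto simp: seg_def\<close>)
        show "f ((y \<bullet> e1) *\<^sub>R e1 + max (y \<bullet> e2) (x \<bullet> e2) *\<^sub>R e2) - f ((y \<bullet> e1) *\<^sub>R e1 + min (y \<bullet> e2) (x \<bullet> e2) *\<^sub>R e2) = (LINT \<sigma>:seg (y \<bullet> e2) (x \<bullet> e2)|lborel. Df ((y \<bullet> e1) *\<^sub>R e1 + \<sigma> *\<^sub>R e2) *v e2)"
          unfolding seg_def by (rule conjunct2[OF acl, rule_format]) (use xc in auto)
        show "(\<integral>\<^sup>+ \<sigma>\<in>seg (y \<bullet> e2) (x \<bullet> e2). ennreal (norm (Df ((y \<bullet> e1) *\<^sub>R e1 + \<sigma> *\<^sub>R e2) *v e2 - c2 k ((y \<bullet> e1) *\<^sub>R e1 + \<sigma> *\<^sub>R e2))) \<partial>lborel) \<le> ennreal (\<tau> * \<bar>x \<bullet> e2 - y \<bullet> e2\<bar>)"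
          using G[OF Gy(1)] xc unfolding \<tau>_def by blast
        show "continuous_on UNIV (c2 k)" by (rule ap)
        show "norm (c2 k ((y \<bullet> e1) *\<^sub>R e1 + \<sigma> *\<^sub>R e2) - Df x *v e2) \<le> \<epsilon>/4 + \<tau>" if "\<sigma> \<in> seg (y \<bullet> e2) (x \<bullet> e2)" for \<sigma>
        proof -
          have "(y \<bullet> e1) *\<^sub>R e1 + \<sigma> *\<^sub>R e2 - ((x \<bullet> e1) *\<^sub>R e1 + (x \<bullet> e2) *\<^sub>R e2) = (y \<bullet> e1 - x \<bullet> e1) *\<^sub>R e1 + (\<sigma> - x \<bullet> e2) *\<^sub>R e2"
            by (simp add: algebra_simps)
          then have "(y \<bullet> e1) *\<^sub>R e1 + \<sigma> *\<^sub>R e2 - x = (y \<bullet> e1 - x \<bullet> e1) *\<^sub>R e1 + (\<sigma> - x \<bullet> e2) *\<^sub>R e2" unfolding xd(3) .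
          then have "dist ((y \<bullet> e1) *\<^sub>R e1 + \<sigma> *\<^sub>R e2) x \<le> \<bar>y \<bullet> e1 - x \<bullet> e1\<bar> + \<bar>\<sigma> - x \<bullet> e2\<bar>"
            using norm_triangle_ineq[of "(y \<bullet> e1 - x \<bullet> e1) *\<^sub>R e1" "(\<sigma> - x \<bullet> e2) *\<^sub>R e2"] by (simp add: dist_norm frame_simps[OF fr])
          also have "\<bar>\<sigma> - x \<bullet> e2\<bar> \<le> \<bar>y \<bullet> e2 - x \<bullet> e2\<bar>" using that by (auto simp: seg_def min_def max_def split: if_splits)
          finally have "dist ((y \<bullet> e1) *\<^sub>R e1 + \<sigma> *\<^sub>R e2) x < d2" using n1 n2 near d1 d2 by (auto simp: min_def split: if_splits)
          then have "norm (c2 k ((y \<bullet> e1) *\<^sub>R e1 + \<sigma> *\<^sub>R e2) - c2 k x) < \<epsilon>/4" using d2(2) by (simp add: dist_norm)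
          then show ?thesis using c1x(2) norm_triangle_ineq[of "c2 k ((y \<bullet> e1) *\<^sub>R e1 + \<sigma> *\<^sub>R e2) - c2 k x" "c2 k x - Df x *v e2"] by simp
        qed
      qed (use \<tau> \<epsilon> in auto)
      define z where "z = (y \<bullet> e1) *\<^sub>R e1 + (x \<bullet> e2) *\<^sub>R e2"
      have z': "(x \<bullet> e2) *\<^sub>R e2 + (y \<bullet> e1) *\<^sub>R e1 = z" by (simp add: z_def add.commute)
      have b1: "norm (f z - f x - (y \<bullet> e1 - x \<bullet> e1) *\<^sub>R (Df x *v e1)) \<le> (\<epsilon>/2) * norm (y - x)"
      proof -
        have "norm (f z - f x - (y \<bullet> e1 - x \<bullet> e1) *\<^sub>R (Df x *v e1)) \<le> (\<tau> + (\<epsilon>/4 + \<tau>)) * \<bar>y \<bullet> e1 - x \<bullet> e1\<bar>"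
          using leg1 unfolding z' xd .
        also have "\<dots> \<le> (\<epsilon>/2) * norm (y - x)" using \<tau> \<epsilon> n1 by (intro mult_mono) auto
        finally show ?thesis .
      qed
      have b2: "norm (f z - f y - (x \<bullet> e2 - y \<bullet> e2) *\<^sub>R (Df x *v e2)) \<le> (\<epsilon>/2) * norm (y - x)"
      proof -
        have "norm (f z - f y - (x \<bullet> e2 - y \<bullet> e2) *\<^sub>R (Df x *v e2)) \<le> (\<tau> + (\<epsilon>/4 + \<tau>)) * \<bar>x \<bullet> e2 - y \<bullet> e2\<bar>"
          using leg2 unfolding z_def[symmetric] xd .
        also have "\<dots> \<le> (\<epsilon>/2) * norm (y - x)" using \<tau> \<epsilon> n2 by (intro mult_mono) (auto simp: abs_minus_commute)
        finally show ?thesis .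
      qed
      have "y - x = (y \<bullet> e1 - x \<bullet> e1) *\<^sub>R e1 + (y \<bullet> e2 - x \<bullet> e2) *\<^sub>R e2"
        using frame_decomp[OF fr, of "y - x"] by (simp add: inner_diff_left)
      then have "Df x *v (y - x) = (y \<bullet> e1 - x \<bullet> e1) *\<^sub>R (Df x *v e1) + (y \<bullet> e2 - x \<bullet> e2) *\<^sub>R (Df x *v e2)"
        by (simp only: matrix_vector_right_distrib matrix_vector_mult_scaleR)
      then have eq: "f y - f x - Df x *v (y - x) = (f z - f x - (y \<bullet> e1 - x \<bullet> e1) *\<^sub>R (Df x *v e1)) - (f z - f y - (x \<bullet> e2 - y \<bullet> e2) *\<^sub>R (Df x *v e2))"
        by (simp add: algebra_simps)
      have "norm (f y - f x - Df x *v (y - x)) \<le> norm (f z - f x - (y \<bullet> e1 - x \<bullet> e1) *\<^sub>R (Df x *v e1)) + norm (f z - f y - (x \<bullet> e2 - y \<bullet> e2) *\<^sub>R (Df x *v e2))"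
        unfolding eq by (rule norm_triangle_ineq4)
      also have "\<dots> \<le> (\<epsilon>/2) * norm (y - x) + (\<epsilon>/2) * norm (y - x)" by (rule add_mono[OF b1 b2])
      finally show "norm (f y - f x - Df x *v (y - x)) \<le> \<epsilon> * norm (y - x)" by simp
    qed
  qed
  \<comment> \<open>The measures of the sets \<open>E k\<close> are summable, so almost every point
    lies in finitely many of them.\<close>
  have "AE x in lborel. eventually (\<lambda>n. x \<in> space lborel - E n) sequentially"
  proof (rule borel_cantelli_AE1)
    show "E n \<in> sets lborel" for n using ap(3) by simp
    show fin: "emeasure lborel (E n) < \<infinity>" for n using le_less_trans[OF ap(4)] by simp
    show "summable (\<lambda>n. measure lborel (E n))"
    proof (rule summable_comparison_test')
      show "summable (\<lambda>n. 11 * (1/2::real)^n)" by (intro summable_mult summable_geometric) simp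
      show "norm (measure lborel (E n)) \<le> 11 * (1/2)^n" if "n \<ge> 0" for n
        using ap(4)[of n] emeasure_eq_ennreal_measure[of lborel "E n"] fin[of n] by (simp add: less_top ennreal_le_iff)
    qed
  qed
  moreover have "AE x in lborel. x \<notin> Z" using Z by (rule AE_not_in)
  ultimately have ae: "AE x in lborel. x \<in> ?Q \<longrightarrow> x \<in> (\<Union>m. S m)"
  proof eventually_elim
    case (elim x)
    then obtain m where "\<forall>n\<ge>m. x \<notin> E n" by (auto simp: eventually_sequentially)
    then show ?case using elim(2) by (auto simp: S_def intro!: exI[of _ m])
  qed
  show ?thesis
    by (intro exI[of _ S] conjI allI ballI ae Sb deriv) (use Q in \<open>auto simp: S_def\<close>)
qed

end

lemma frame_axes: "frame (axis 1 1) (axis 2 1)"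
  by (simp add: frame_def inner_axis_axis)

lemma vimage_continuous_borel:
  fixes h :: "'a::topological_space \<Rightarrow> 'b::topological_space"
  assumes "continuous_on X h" "X \<in> sets borel" "A \<in> sets borel"
  shows "X \<inter> h -` A \<in> sets borel"
  using measurable_sets[OF borel_measurable_continuous_on_restrict[OF assms(1)] assms(3)] assms(2)
  by (simp add: sets_restrict_space_iff space_restrict_space Int_commute)

context W11 begin

lemma differentiable_pieces:
  shows "\<exists>T::nat \<Rightarrow> R2 set. (\<forall>n. T n \<in> sets borel \<and> T n \<subseteq> D \<and> (\<forall>x\<in>T n. (f has_derivative (\<lambda>h. Df x *v h)) (at x within T n)))
    \<and> (AE x in lborel. x \<in> D \<longrightarrow> x \<in> (\<Union>n. T n))"
proof -
  let ?e1 = "axis 1 1 :: R2" and ?e2 = "axis 2 1 :: R2"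
  let ?rect = "\<lambda>(A1, A2, B1, B2). rect ?e1 ?e2 A1 A2 B1 B2"
  let ?P = "\<lambda>S. S \<in> sets borel \<and> S \<subseteq> D \<and> (\<forall>x\<in>S. (f has_derivative (\<lambda>h. Df x *v h)) (at x within S))"
  define R where "R = {(A1, A2, B1, B2). A1 \<in> \<rat> \<and> A2 \<in> \<rat> \<and> B1 \<in> \<rat> \<and> B2 \<in> \<rat> \<and> rect ?e1 ?e2 A1 A2 B1 B2 \<subseteq> D \<and> A1 < A2 \<and> B1 < B2}"
  have Rc: "countable R"
    by (rule countable_subset[of _ "\<rat> \<times> \<rat> \<times> \<rat> \<times> \<rat>"]) (auto simp: R_def intro: countable_rat)
  have "\<forall>r\<in>R. \<exists>S::nat \<Rightarrow> R2 set. (\<forall>m. ?P (S m)) \<and> (AE x in lborel. x \<in> ?rect r \<longrightarrow> x \<in> (\<Union>m. S m))"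
  proof
    fix r assume "r \<in> R"
    then obtain A1 A2 B1 B2 where r: "r = (A1, A2, B1, B2)" "rect ?e1 ?e2 A1 A2 B1 B2 \<subseteq> D" "A1 < A2" "B1 < B2" unfolding R_def by auto
    show "\<exists>S::nat \<Rightarrow> R2 set. (\<forall>m. ?P (S m)) \<and> (AE x in lborel. x \<in> ?rect r \<longrightarrow> x \<in> (\<Union>m. S m))"
      unfolding r(1) prod.case by (rule differentiable_pieces_rect[OF frame_axes r(2-4)])
  qed
  from bchoice[OF this] obtain S :: "real \<times> real \<times> real \<times> real \<Rightarrow> nat \<Rightarrow> R2 set" where
    S: "\<forall>r\<in>R. (\<forall>m. ?P (S r m)) \<and> (AE x in lborel. x \<in> ?rect r \<longrightarrow> x \<in> (\<Union>m. S r m))" by (elim exE)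
  \<comment> \<open>The empty set is included so that the family is nonempty and can be enumerated
    by the naturals.\<close>
  define \<T> where "\<T> = insert {} ((\<lambda>(r, m). S r m) ` (R \<times> UNIV))"
  have Tc: "countable \<T>" unfolding \<T>_def using Rc by auto
  define T where "T = from_nat_into \<T>"
  have range: "range T = \<T>" unfolding T_def by (rule range_from_nat_into[OF _ Tc]) (simp add: \<T>_def)
  have PT: "?P (T n)" for n
  proof -
    have "T n \<in> \<T>" using range by auto
    then consider "T n = {}" | r m where "r \<in> R" "T n = S r m" unfolding \<T>_def by auto
    then show ?thesis
    proof cases
      case 1 then show ?thesis by simp
    next
      case 2
      have "?P (S r m)" using S 2(1) by blast
      then show ?thesis unfolding 2(2) .
    qed
  qed
  have "AE x in lborel. \<forall>r\<in>R. x \<in> ?rect r \<longrightarrow> x \<in> (\<Union>m. S r m)"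
    using S Rc by (subst AE_ball_countable) auto
  then have "AE x in lborel. x \<in> D \<longrightarrow> x \<in> (\<Union>n. T n)"
  proof eventually_elim
    case (elim x)
    show ?case
    proof
      assume "x \<in> D"
      then obtain d where d: "d > 0" "ball x d \<subseteq> D" using open_D openE by blast
      obtain A1 where A1: "A1 \<in> \<rat>" "x$1 - d/2 < A1" "A1 < x$1" using Rats_dense_in_real[of "x$1 - d/2" "x$1"] d by auto
      obtain A2 where A2: "A2 \<in> \<rat>" "x$1 < A2" "A2 < x$1 + d/2" using Rats_dense_in_real[of "x$1" "x$1 + d/2"] d by auto
      obtain B1 where B1: "B1 \<in> \<rat>" "x$2 - d/2 < B1" "B1 < x$2" using Rats_dense_in_real[of "x$2 - d/2" "x$2"] d by auto
      obtain B2 where B2: "B2 \<in> \<rat>" "x$2 < B2" "B2 < x$2 + d/2" using Rats_dense_in_real[of "x$2" "x$2 + d/2"] d by auto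
      have "rect ?e1 ?e2 A1 A2 B1 B2 \<subseteq> D"
      proof
        fix z assume "z \<in> rect ?e1 ?e2 A1 A2 B1 B2"
        then have z: "A1 \<le> z$1" "z$1 \<le> A2" "B1 \<le> z$2" "z$2 \<le> B2" by (auto simp: rect_def inner_axis)
        have "norm (z - x) \<le> \<bar>z$1 - x$1\<bar> + \<bar>z$2 - x$2\<bar>"
          using norm_le_l1_cart[of "z - x"] by (simp add: UNIV_2)
        also have "\<dots> < d" using z A1 A2 B1 B2 by linarith
        finally show "z \<in> D" using d by (auto simp: dist_norm norm_minus_commute subset_iff)
      qed
      then have r: "(A1, A2, B1, B2) \<in> R" using A1 A2 B1 B2 unfolding R_def by auto
      have "x \<in> ?rect (A1, A2, B1, B2)" using A1 A2 B1 B2 by (simp add: rect_def inner_axis)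
      then obtain m where "x \<in> S (A1, A2, B1, B2) m" using elim r by blast
      moreover have "S (A1, A2, B1, B2) m \<in> \<T>" using r unfolding \<T>_def by force
      ultimately show "x \<in> (\<Union>n. T n)" using range by (metis UN_I UNIV_I imageE)
    qed
  qed
  then show ?thesis using PT by (intro exI[of _ T] conjI allI) auto
qed

lemma det_borel [measurable]: "(\<lambda>x. det (Df x)) \<in> borel_measurable borel"
proof -
  have "(\<lambda>A::real^2^2. det A) \<in> borel_measurable borel"
    unfolding det_2 by (intro borel_measurable_continuous_onI continuous_intros)
  then show ?thesis by (rule measurable_compose[OF Df_borel])
qed

end

section \<open>Area formula for the homeomorphism\<close>

locale W11_bounded_homeo = W11_homeo +
  assumes bounded_image: "bounded (f ` D)"
begin

lemma image_borel: "A \<in> sets borel \<Longrightarrow> A \<subseteq> D \<Longrightarrow> f ` A \<in> sets borel"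
proof -
  assume A: "A \<in> sets borel" "A \<subseteq> D"
  have "f ` A = f ` D \<inter> g -` A" using A(2) gf by (force simp: image_iff)
  then show ?thesis using vimage_continuous_borel[OF cont_g _ A(1)] open_fD by simp
qed

text \<open>Differentiability relative to a set is what the change of variables for injective maps
  asks for; the bounded image has finite area, and this makes the Jacobian integrable on the
  piece.\<close>

lemma area_piece:
  assumes A: "A \<in> sets borel" "A \<subseteq> T" "T \<subseteq> D" and der: "\<And>x. x \<in> T \<Longrightarrow> (f has_derivative (\<lambda>h. Df x *v h)) (at x within T)"
  shows "emeasure lborel (f ` A) = (\<integral>\<^sup>+ x\<in>A. ennreal \<bar>det (Df x)\<bar> \<partial>lborel)"
proof -
  have AD: "A \<subseteq> D" using A by blast
  have Al: "A \<in> sets lebesgue" using A(1) by simp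
  have d: "(f has_derivative (\<lambda>h. Df x *v h)) (at x within A)" if "x \<in> A" for x
    by (rule has_derivative_subset[OF der]) (use that A in auto)
  have inj: "inj_on f A" by (rule inj_on_subset[OF inj_f AD])
  have fb: "f ` A \<in> sets borel" by (rule image_borel[OF A(1) AD])
  have bd: "bounded (f ` A)" by (rule bounded_subset[OF bounded_image]) (use AD in auto)
  have lm: "f ` A \<in> lmeasurable" using fb bd by (intro bounded_set_imp_lmeasurable) auto
  have mat: "matrix (\<lambda>h. Df x *v h) = Df x" for x by (rule matrix_of_matrix_vector_mul)
  have io: "(\<lambda>x. \<bar>det (Df x)\<bar>) integrable_on A"
    using measurable_differentiable_image_eq[OF Al d inj] lm by (simp add: mat)
  have "emeasure lborel (f ` A) = emeasure lebesgue (f ` A)" using fb by simp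
  also have "\<dots> = ennreal (measure lebesgue (f ` A))" by (rule emeasure_eq_measure2[OF lm])
  also have "measure lebesgue (f ` A) = integral A (\<lambda>x. \<bar>det (Df x)\<bar>)"
    using measure_differentiable_image_eq[OF Al d inj] io by (simp add: mat)
  also have "ennreal \<dots> = (\<integral>\<^sup>+ x. ennreal (indicator A x * \<bar>det (Df x)\<bar>) \<partial>lborel)"
  proof -
    have "((\<lambda>x. \<bar>det (Df x)\<bar>) has_integral integral A (\<lambda>x. \<bar>det (Df x)\<bar>)) A" using io by (rule integrable_integral)
    from nn_integral_has_integral_lebesgue[OF _ this]
    show ?thesis by simp
  qed
  also have "\<dots> = (\<integral>\<^sup>+ x\<in>A. ennreal \<bar>det (Df x)\<bar> \<partial>lborel)"
    by (rule nn_integral_cong) (auto simp: indicator_def)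
  finally show ?thesis .
qed

text \<open>Two measures are compared: the push-forward under \<open>f\<close> of the Jacobian
  density on the union of the pieces, and Lebesgue measure on the image of that union. On a Borel
  set both are sums over the disjointed pieces, where the change of variables applies. Points
  outside the pieces are left out on both sides, so Lusin's condition does not enter.\<close>

lemma area_formula:
  assumes T: "\<And>n::nat. T n \<in> sets borel" "\<And>n. T n \<subseteq> D"
    and der: "\<And>n x. x \<in> T n \<Longrightarrow> (f has_derivative (\<lambda>h. Df x *v h)) (at x within T n)"
    and F: "F \<in> borel_measurable borel"
  shows "(\<integral>\<^sup>+ x\<in>(\<Union>n. T n). F x * ennreal \<bar>det (Df x)\<bar> \<partial>lborel) = (\<integral>\<^sup>+ y\<in>f ` (\<Union>n. T n). F (g y) \<partial>lborel)"
proof -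
  define S where "S = (\<Union>n. T n)"
  have Sb: "S \<in> sets borel" unfolding S_def using T by auto
  have SD: "S \<subseteq> D" unfolding S_def using T by auto
  \<comment> \<open>Extension by 0 outside the open set gives a Borel map on the whole plane, of
    which a push-forward can be taken.\<close>
  define f' where "f' x = (if x \<in> D then f x else 0)" for x
  have f'm: "f' \<in> borel_measurable borel"
    unfolding f'_def using open_D cont_f by (intro borel_measurable_continuous_on_if) auto
  define J where "J x = ennreal \<bar>det (Df x)\<bar> * indicator S x" for x
  have [measurable]: "S \<in> sets borel" by (rule Sb)
  have Jm: "J \<in> borel_measurable borel" unfolding J_def by measurable
  define M1 where "M1 = distr (density lborel J) borel f'"
  define M2 where "M2 = density lborel (indicator (f ` S) :: R2 \<Rightarrow> ennreal)"
  have fSb: "f ` S \<in> sets borel" by (rule image_borel[OF Sb SD])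
  have "M1 = M2"
  proof (rule measure_eqI)
    show "sets M1 = sets M2" by (simp add: M1_def M2_def)
    fix B assume "B \<in> sets M1"
    then have B: "B \<in> sets borel" by (simp add: M1_def)
    have f'B: "f' -` B \<in> sets borel" using measurable_sets[OF f'm B] by simp
    define A where "A n = disjointed T n \<inter> f' -` B" for n
    have dT: "disjointed T n \<in> sets borel" for n
      using sets.range_disjointed_sets[of T borel] T(1) by blast
    have A: "A n \<in> sets borel" "A n \<subseteq> T n" for n
      unfolding A_def using dT f'B disjointed_subset[of T n] by auto
    have dis: "disjoint_family A" using disjoint_family_disjointed[of T] unfolding A_def disjoint_family_on_def by blast
    have UA: "(\<Union>n. A n) = S \<inter> f' -` B" unfolding A_def S_def using UN_disjointed_eq[of T] by blast
    have "emeasure M1 B = emeasure (density lborel J) (f' -` B)"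
      unfolding M1_def by (subst emeasure_distr) (use f'm B in auto)
    also have "\<dots> = (\<integral>\<^sup>+ x. J x * indicator (f' -` B) x \<partial>lborel)" by (rule emeasure_density) (use Jm f'B in auto)
    also have "\<dots> = (\<integral>\<^sup>+ x\<in>(\<Union>n. A n). ennreal \<bar>det (Df x)\<bar> \<partial>lborel)"
      unfolding UA by (rule nn_integral_cong) (auto simp: J_def indicator_def)
    also have "\<dots> = emeasure (density lborel (\<lambda>x. ennreal \<bar>det (Df x)\<bar>)) (\<Union>n. A n)"
      by (rule emeasure_density[symmetric]) (use A in auto)
    also have "\<dots> = (\<Sum>n. emeasure (density lborel (\<lambda>x. ennreal \<bar>det (Df x)\<bar>)) (A n))"
      by (rule suminf_emeasure[symmetric]) (use A dis in auto)
    also have "\<dots> = (\<Sum>n. emeasure lborel (f ` A n))"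
    proof (intro suminf_cong)
      fix n
      have "emeasure (density lborel (\<lambda>x. ennreal \<bar>det (Df x)\<bar>)) (A n) = (\<integral>\<^sup>+ x\<in>A n. ennreal \<bar>det (Df x)\<bar> \<partial>lborel)"
        by (rule emeasure_density) (use A in auto)
      also have "\<dots> = emeasure lborel (f ` A n)"
        by (rule area_piece[symmetric, OF A(1) A(2) T(2) der])
      finally show "emeasure (density lborel (\<lambda>x. ennreal \<bar>det (Df x)\<bar>)) (A n) = emeasure lborel (f ` A n)" .
    qed
    also have "\<dots> = emeasure lborel (\<Union>n. f ` A n)"
    proof (rule suminf_emeasure)
      have AD: "A n \<subseteq> D" for n using A(2) T(2) by blast
      show "range (\<lambda>n. f ` A n) \<subseteq> sets lborel" using image_borel[OF A(1) AD] by auto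
      show "disjoint_family (\<lambda>n. f ` A n)"
        unfolding disjoint_family_on_def
      proof (intro ballI impI)
        fix m n :: nat assume "m \<noteq> n"
        then have "A m \<inter> A n = {}" using dis by (auto simp: disjoint_family_on_def)
        then show "f ` A m \<inter> f ` A n = {}" using inj_on_image_Int[OF inj_f AD[of m] AD[of n]] by simp
      qed
    qed
    also have "(\<Union>n. f ` A n) = f ` S \<inter> B"
    proof -
      have "(\<Union>n. f ` A n) = f ` (S \<inter> f' -` B)" unfolding UA[symmetric] by blast
      also have "\<dots> = f ` S \<inter> B" using SD by (force simp: f'_def)
      finally show ?thesis .
    qed
    also have "emeasure lborel (f ` S \<inter> B) = emeasure M2 B"
      unfolding M2_def by (rule emeasure_restricted[symmetric]) (use fSb B in auto)
    finally show "emeasure M1 B = emeasure M2 B" .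
  qed
  define h where "h y = F (g y) * indicator (f ` D) y" for y
  have hm: "h \<in> borel_measurable borel"
  proof -
    have "(\<lambda>y. F (g y)) \<in> borel_measurable (restrict_space borel (f ` D))"
      by (rule measurable_compose[OF borel_measurable_continuous_on_restrict[OF cont_g] F])
    then show ?thesis unfolding h_def using open_fD by (subst (asm) borel_measurable_restrict_space_iff_ennreal) auto
  qed
  have "(\<integral>\<^sup>+ y\<in>f ` S. F (g y) \<partial>lborel) = (\<integral>\<^sup>+ y. indicator (f ` S) y * h y \<partial>lborel)"
    by (rule nn_integral_cong) (use SD in \<open>auto simp: h_def indicator_def\<close>)
  also have "\<dots> = (\<integral>\<^sup>+ y. h y \<partial>M2)"
    unfolding M2_def by (rule nn_integral_density[symmetric]) (use fSb hm in auto)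
  also have "\<dots> = (\<integral>\<^sup>+ y. h y \<partial>M1)" using \<open>M1 = M2\<close> by simp
  also have "\<dots> = (\<integral>\<^sup>+ x. h (f' x) \<partial>density lborel J)"
    unfolding M1_def by (rule nn_integral_distr) (use f'm hm in auto)
  also have "\<dots> = (\<integral>\<^sup>+ x. J x * h (f' x) \<partial>lborel)"
    by (rule nn_integral_density) (use Jm measurable_compose[OF f'm hm] in auto)
  also have "\<dots> = (\<integral>\<^sup>+ x\<in>S. F x * ennreal \<bar>det (Df x)\<bar> \<partial>lborel)"
    by (rule nn_integral_cong) (use SD gf in \<open>auto simp: J_def h_def f'_def indicator_def mult.commute\<close>)
  finally show ?thesis by (simp add: S_def)
qed

end

section \<open>Ball averages\<close>

lemma enn_powr_ennreal: "0 \<le> x \<Longrightarrow> enn_powr (ennreal x) a = ennreal (x powr a)"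
  by (simp add: enn_powr_def)

lemma enn_powr_top [simp]: "enn_powr \<infinity> a = \<infinity>" "enn_powr top a = top"
  by (simp_all add: enn_powr_def)

lemma enn_powr_0 [simp]: "enn_powr 0 a = 0"
  by (simp add: enn_powr_def)

lemma enn_powr_mono:
  assumes "x \<le> y" "0 < a"
  shows "enn_powr x a \<le> enn_powr y a"
proof (cases y)
  case (real r)
  then have "x \<noteq> top" using assms(1) by (auto simp: top_unique)
  then obtain s where "x = ennreal s" "0 \<le> s" by (cases x) auto
  then show ?thesis using real assms by (auto simp: enn_powr_ennreal intro!: ennreal_leI powr_mono2)
qed simp

text \<open>The convention that 0 times infinity is 0 is respected, because a power vanishes only at
  0.\<close>

lemma enn_powr_mult:
  assumes "0 < a"
  shows "enn_powr (x * y) a = enn_powr x a * enn_powr y a"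
proof (cases "x = top \<or> y = top")
  case True
  have p: "enn_powr z a = 0 \<longleftrightarrow> z = 0" for z
    by (cases z) (auto simp: enn_powr_ennreal)
  show ?thesis using True p[of x] p[of y] by (auto simp: ennreal_mult_top ennreal_top_mult)
next
  case False
  then obtain r s where "x = ennreal r" "0 \<le> r" "y = ennreal s" "0 \<le> s" by (cases x; cases y) auto
  then show ?thesis by (simp add: enn_powr_ennreal ennreal_mult[symmetric] powr_mult)
qed

lemma enn_powr_inverse:
  assumes "0 < a"
  shows "enn_powr (enn_powr x a) (1/a) = x" "enn_powr (enn_powr x (1/a)) a = x"
  using assms by (cases x; auto simp: enn_powr_ennreal powr_powr)+

lemma borel_measurable_enn_powr [measurable]:
  assumes "F \<in> borel_measurable M"
  shows "(\<lambda>x. enn_powr (F x) a) \<in> borel_measurable M"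
proof -
  have [measurable]: "F \<in> borel_measurable M" by (rule assms)
  show ?thesis unfolding enn_powr_def by measurable
qed

lemma enn_powr_add_le:
  assumes "0 < a"
  shows "enn_powr (x + y) a \<le> ennreal (2 powr a) * (enn_powr x a + enn_powr y a)"
proof (cases "x = top \<or> y = top")
  case True
  then show ?thesis by (auto simp: ennreal_mult_top)
next
  case False
  then obtain r s where rs: "x = ennreal r" "0 \<le> r" "y = ennreal s" "0 \<le> s" by (cases x; cases y) auto
  have "enn_powr (x + y) a = ennreal ((r + s) powr a)"
    using rs enn_powr_ennreal[of "r + s" a] by simp
  also have "\<dots> \<le> ennreal (2 powr a * (r powr a + s powr a))"
    using powr_add_le[of r s a] rs assms by (intro ennreal_leI) auto
  also have "\<dots> = ennreal (2 powr a) * (enn_powr x a + enn_powr y a)"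
    using rs by (simp add: enn_powr_ennreal ennreal_mult)
  finally show ?thesis .
qed

definition ballavg :: "real \<Rightarrow> (R2 \<Rightarrow> ennreal) \<Rightarrow> R2 \<Rightarrow> ennreal" where
  "ballavg \<delta> G w = (\<integral>\<^sup>+ z\<in>ball w \<delta>. G z \<partial>lborel) / emeasure lborel (ball w \<delta>)"

lemma emeasure_ball_R2: "0 \<le> \<delta> \<Longrightarrow> emeasure lborel (ball (w::R2) \<delta>) = ennreal (unit_ball_vol 2 * \<delta>\<^sup>2)"
  by (simp add: emeasure_ball)

lemma ball_pair_borel: "{z::R2 \<times> R2. dist (fst z) (snd z) < \<delta>} \<in> sets borel"
  by (intro borel_open open_Collect_less continuous_intros)

lemma ballavg_borel:
  assumes \<delta>: "0 < \<delta>" and G: "G \<in> borel_measurable borel"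
  shows "ballavg \<delta> G \<in> borel_measurable borel"
proof -
  have "(\<lambda>z::R2 \<times> R2. G (snd z)) \<in> borel_measurable borel"
    by (rule measurable_compose[OF _ G]) (intro borel_measurable_continuous_onI continuous_intros)
  moreover have "(\<lambda>z::R2 \<times> R2. indicator {z::R2 \<times> R2. dist (fst z) (snd z) < \<delta>} z :: ennreal) \<in> borel_measurable borel"
    using ball_pair_borel by simp
  ultimately have "(\<lambda>z::R2 \<times> R2. G (snd z) * indicator {z::R2 \<times> R2. dist (fst z) (snd z) < \<delta>} z) \<in> borel_measurable (lborel \<Otimes>\<^sub>M lborel)"
    unfolding lborel_prod by simp
  from lborel.borel_measurable_nn_integral_fst[OF this]
  have "(\<lambda>w. \<integral>\<^sup>+ z. G z * indicator (ball w \<delta>) z \<partial>lborel) \<in> borel_measurable lborel"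
    by (simp add: indicator_def)
  then show ?thesis
    unfolding ballavg_def emeasure_ball_R2[OF less_imp_le[OF \<delta>]] by simp
qed

text \<open>Being within distance \<delta> is a symmetric relation, so after Tonelli each
  \<open>z\<close> is counted with the area of its own ball, and this cancels the
  denominator.\<close>

lemma nn_integral_ballavg:
  assumes \<delta>: "0 < \<delta>" and G: "G \<in> borel_measurable borel"
  shows "(\<integral>\<^sup>+ w. ballavg \<delta> G w \<partial>lborel) = (\<integral>\<^sup>+ z. G z \<partial>lborel)"
proof -
  let ?b = "ennreal (unit_ball_vol 2 * \<delta>\<^sup>2)"
  have b: "0 < ?b" "?b < top" using \<delta> by auto
  have G2: "(\<lambda>z::R2 \<times> R2. G (snd z)) \<in> borel_measurable borel"
    by (rule measurable_compose[OF _ G]) (intro borel_measurable_continuous_onI continuous_intros)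
  have I2: "(\<lambda>z::R2 \<times> R2. indicator {z::R2 \<times> R2. dist (fst z) (snd z) < \<delta>} z :: ennreal) \<in> borel_measurable borel"
    using ball_pair_borel by simp
  have m: "(\<lambda>z::R2 \<times> R2. G (snd z) * indicator {z::R2 \<times> R2. dist (fst z) (snd z) < \<delta>} z) \<in> borel_measurable (lborel \<Otimes>\<^sub>M lborel)"
    unfolding lborel_prod using G2 I2 by simp
  have m1: "(\<lambda>w. \<integral>\<^sup>+ z. G z * indicator (ball w \<delta>) z \<partial>lborel) \<in> borel_measurable lborel"
    using lborel.borel_measurable_nn_integral_fst[OF m] by (simp add: indicator_def)
  have "(\<integral>\<^sup>+ w. ballavg \<delta> G w \<partial>lborel) = (\<integral>\<^sup>+ w. (\<integral>\<^sup>+ z. G z * indicator (ball w \<delta>) z \<partial>lborel) \<partial>lborel) / ?b"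
    unfolding ballavg_def emeasure_ball_R2[OF less_imp_le[OF \<delta>]] using m1 by (rule nn_integral_divide)
  also have "(\<integral>\<^sup>+ w. (\<integral>\<^sup>+ z. G z * indicator (ball w \<delta>) z \<partial>lborel) \<partial>lborel) = (\<integral>\<^sup>+ z. (\<integral>\<^sup>+ w. G z * indicator (ball w \<delta>) z \<partial>lborel) \<partial>lborel)"
    using lborel_pair.Fubini'[of "\<lambda>w z. G z * indicator (ball w \<delta>) z"] m by (simp add: indicator_def case_prod_unfold)
  also have "\<dots> = (\<integral>\<^sup>+ z. ?b * G z \<partial>lborel)"
  proof (rule nn_integral_cong)
    fix z
    have "(\<integral>\<^sup>+ w. G z * indicator (ball w \<delta>) z \<partial>lborel) = (\<integral>\<^sup>+ w. G z * indicator (ball z \<delta>) w \<partial>lborel)"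
      by (rule nn_integral_cong) (auto simp: indicator_def dist_commute)
    also have "\<dots> = G z * ?b" using \<delta> by (simp add: nn_integral_cmult_indicator emeasure_ball_R2)
    finally show "(\<integral>\<^sup>+ w. G z * indicator (ball w \<delta>) z \<partial>lborel) = ?b * G z" by (simp add: mult.commute)
  qed
  also have "\<dots> = ?b * (\<integral>\<^sup>+ z. G z \<partial>lborel)" by (rule nn_integral_cmult) (use G in simp)
  also have "\<dots> / ?b = (\<integral>\<^sup>+ z. G z \<partial>lborel)"
    by (subst mult.commute, rule mult_divide_eq_ennreal) (use b in auto)
  finally show ?thesis .
qed

text \<open>The graph of t^a lies above its tangent at \<open>m\<close>. The weighted
  arithmetic-geometric inequality for t^a and m^a with weights 1/a and 1 - 1/a says the
  same.\<close>

lemma powr_tangent: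
  fixes t m a :: real
  assumes "0 \<le> t" "0 < m" "1 < a"
  shows "a * m powr (a - 1) * t \<le> t powr a + (a - 1) * m powr a"
proof (cases "t = 0")
  case False
  then have t: "t > 0" using assms by simp
  have "(t powr a) powr (1/a) * (m powr a) powr (1 - 1/a) \<le> (1/a) * (t powr a) + (1 - 1/a) * (m powr a)"
    by (rule Youngs_inequality_0) (use assms t in \<open>auto simp: field_simps\<close>)
  moreover have "(t powr a) powr (1/a) = t" using t assms by (simp add: powr_powr)
  moreover have "(m powr a) powr (1 - 1/a) = m powr (a - 1)" using assms by (simp add: powr_powr algebra_simps)
  ultimately have "t * m powr (a - 1) \<le> (1/a) * (t powr a) + (1 - 1/a) * (m powr a)" by simp
  then have "a * (t * m powr (a - 1)) \<le> a * ((1/a) * (t powr a) + (1 - 1/a) * (m powr a))"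
    using assms by (intro mult_left_mono) auto
  then show ?thesis using assms by (simp add: algebra_simps)
qed (use assms in auto)

text \<open>Jensen's inequality, obtained by integrating the tangent of t^a at the mean
  \<open>m\<close> over the ball.\<close>

lemma ballavg_powr_le:
  fixes u :: "R2 \<Rightarrow> real"
  assumes \<delta>: "0 < \<delta>" and u: "u \<in> borel_measurable borel" "\<And>x. 0 \<le> u x" and a: "1 < a"
  shows "enn_powr (ballavg \<delta> (\<lambda>x. ennreal (u x)) w) a \<le> ballavg \<delta> (\<lambda>x. ennreal (u x powr a)) w"
proof -
  define b where "b = unit_ball_vol 2 * \<delta>\<^sup>2"
  have b: "b > 0" using \<delta> by (simp add: b_def)
  have eb: "emeasure lborel (ball w \<delta>) = ennreal b" using \<delta> by (simp add: emeasure_ball_R2 b_def)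
  have [measurable]: "u \<in> borel_measurable borel" "ball w \<delta> \<in> sets borel" using u by auto
  show ?thesis
  proof (cases "\<integral>\<^sup>+ z\<in>ball w \<delta>. ennreal (u z powr a) \<partial>lborel")
    case top
    then show ?thesis using b by (simp add: ballavg_def eb ennreal_top_divide)
  next
    case (real I)
    \<comment> \<open>The mean has to be finite before a tangent can be taken there; the bound of
      \<open>u\<close> by u^a + 1 deduces this from the finite integral of the power.\<close>
    have "(\<integral>\<^sup>+ z\<in>ball w \<delta>. ennreal (u z) \<partial>lborel) \<le> (\<integral>\<^sup>+ z. ennreal (u z powr a) * indicator (ball w \<delta>) z + indicator (ball w \<delta>) z \<partial>lborel)"
    proof (rule nn_integral_mono)
      fix z
      have "u z \<le> u z powr a + 1"
      proof (cases "u z \<le> 1")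
        case False
        then have "u z powr 1 \<le> u z powr a" using a by (intro powr_mono) auto
        then show ?thesis using False by simp
      qed (simp add: add_increasing)
      then have "ennreal (u z) \<le> ennreal (u z powr a + 1)" by (rule ennreal_leI)
      then have "ennreal (u z) \<le> ennreal (u z powr a) + 1" by (simp add: ennreal_plus)
      then show "ennreal (u z) * indicator (ball w \<delta>) z \<le> ennreal (u z powr a) * indicator (ball w \<delta>) z + indicator (ball w \<delta>) z"
        by (cases "z \<in> ball w \<delta>") auto
    qed
    also have "\<dots> = ennreal I + ennreal b"
      using real eb by (subst nn_integral_add) auto
    finally have "(\<integral>\<^sup>+ z\<in>ball w \<delta>. ennreal (u z) \<partial>lborel) < top" by (simp add: le_less_trans)
    then obtain U where U: "(\<integral>\<^sup>+ z\<in>ball w \<delta>. ennreal (u z) \<partial>lborel) = ennreal U" "0 \<le> U"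
      by (cases "\<integral>\<^sup>+ z\<in>ball w \<delta>. ennreal (u z) \<partial>lborel") auto
    define m where "m = U / b"
    have m0: "m \<ge> 0" using U b by (simp add: m_def)
    have "m powr a * b \<le> I"
    proof (cases "m = 0")
      case False
      then have mp: "m > 0" using m0 by simp
      have "ennreal (a * m powr (a - 1)) * ennreal U = (\<integral>\<^sup>+ z. ennreal (a * m powr (a - 1)) * (ennreal (u z) * indicator (ball w \<delta>) z) \<partial>lborel)"
        unfolding U(1)[symmetric] by (rule nn_integral_cmult[symmetric]) simp
      also have "\<dots> \<le> (\<integral>\<^sup>+ z. ennreal (u z powr a) * indicator (ball w \<delta>) z + ennreal ((a - 1) * m powr a) * indicator (ball w \<delta>) z \<partial>lborel)"
      proof (rule nn_integral_mono)
        fix z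
        show "ennreal (a * m powr (a - 1)) * (ennreal (u z) * indicator (ball w \<delta>) z) \<le> ennreal (u z powr a) * indicator (ball w \<delta>) z + ennreal ((a - 1) * m powr a) * indicator (ball w \<delta>) z"
        proof (cases "z \<in> ball w \<delta>")
          case True
          have "ennreal (a * m powr (a - 1)) * ennreal (u z) = ennreal (a * m powr (a - 1) * u z)" using a u(2) by (subst ennreal_mult) auto
          also have "\<dots> \<le> ennreal (u z powr a + (a - 1) * m powr a)" by (intro ennreal_leI powr_tangent u mp a)
          also have "\<dots> = ennreal (u z powr a) + ennreal ((a - 1) * m powr a)" using a by (intro ennreal_plus) auto
          finally show ?thesis using True by simp
        qed simp
      qed
      also have "\<dots> = ennreal I + ennreal ((a - 1) * m powr a) * ennreal b"
        using real eb by (subst nn_integral_add) (auto simp: nn_integral_cmult_indicator)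
      also have "\<dots> = ennreal (I + (a - 1) * m powr a * b)"
        using real a b by (subst ennreal_mult[symmetric]) (auto simp: ennreal_plus)
      finally have "ennreal (a * m powr (a - 1) * U) \<le> ennreal (I + (a - 1) * m powr a * b)"
        using a U by (subst ennreal_mult) auto
      moreover have "0 \<le> I + (a - 1) * m powr a * b" using real a b by simp
      ultimately have 1: "a * m powr (a - 1) * U \<le> I + (a - 1) * m powr a * b" by (subst (asm) ennreal_le_iff) auto
      have "m powr (a - 1) * U = m powr a * b"
      proof -
        have "U = m * b" using b by (simp add: m_def)
        moreover have "m powr (a - 1) * m = m powr a" using mp by (simp add: powr_diff)
        ultimately show ?thesis by (simp add: mult.assoc[symmetric])
      qed
      then have "a * (m powr a * b) \<le> I + (a - 1) * (m powr a * b)" using 1 by (simp only: mult.assoc)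
      then show ?thesis by (simp add: left_diff_distrib)
    qed (use real in simp)
    then have le: "m powr a \<le> I / b" using b by (simp add: field_simps)
    have "ballavg \<delta> (\<lambda>x. ennreal (u x)) w = ennreal m"
      unfolding ballavg_def U(1) eb m_def using U b by (simp add: divide_ennreal)
    moreover have "ballavg \<delta> (\<lambda>x. ennreal (u x powr a)) w = ennreal (I / b)"
      unfolding ballavg_def real(2) eb using real b by (simp add: divide_ennreal)
    ultimately show ?thesis using le m0 by (simp add: enn_powr_ennreal ennreal_leI)
  qed
qed

text \<open>Truncated subtraction keeps the excess of the average over \<open>G\<close>, the one
  direction that upper gradients need. A continuous \<open>c\<close> close to \<open>F\<close> in
  L^a and uniformly continuous near \<open>C\<close> gives F z \<le> u z + F w + u w + \<tau> for
  \<open>z\<close> near \<open>w\<close>, where u = |F - c|. Jensen and the invariance of the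
  integral under averaging then bound the three error terms.\<close>

lemma ballavg_excess_small:
  assumes G: "G \<in> borel_measurable borel" and C: "compact C" and \<rho>: "0 < \<rho>" and a: "1 < a" and e: "0 < e"
    and fin: "(\<integral>\<^sup>+ x\<in>(\<Union>w\<in>C. ball w \<rho>). enn_powr (G x) a \<partial>lborel) < \<infinity>"
  shows "\<exists>\<rho>0>0. \<rho>0 \<le> \<rho> \<and> (\<forall>\<delta>. 0 < \<delta> \<and> \<delta> < \<rho>0 \<longrightarrow> (\<integral>\<^sup>+ w\<in>C. enn_powr (ballavg \<delta> G w - G w) a \<partial>lborel) \<le> ennreal e)"
proof -
  define C' where "C' = (\<Union>w\<in>C. ball w \<rho>)"
  have C'b: "C' \<in> sets borel" unfolding C'_def by (intro borel_open open_UN) auto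
  have Cb: "C \<in> sets borel" using C by (simp add: borel_compact)
  have [measurable]: "G \<in> borel_measurable borel" "C' \<in> sets borel" "C \<in> sets borel" by (rule G C'b Cb)+
  define F where "F x = enn2real (G x) * indicator C' x" for x
  have Fm [measurable]: "F \<in> borel_measurable borel" unfolding F_def by measurable
  have F0: "0 \<le> F x" for x by (simp add: F_def)
  have FG: "ennreal (F x) \<le> G x" for x
    by (cases "G x") (auto simp: F_def indicator_def)
  have Ffin: "(\<integral>\<^sup>+ x. ennreal (\<bar>F x\<bar> powr a) \<partial>lborel) < \<infinity>"
  proof -
    have "(\<integral>\<^sup>+ x. ennreal (\<bar>F x\<bar> powr a) \<partial>lborel) \<le> (\<integral>\<^sup>+ x\<in>C'. enn_powr (G x) a \<partial>lborel)"
    proof (rule nn_integral_mono)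
      fix x
      have "ennreal (\<bar>F x\<bar> powr a) = enn_powr (ennreal (F x)) a" using F0 by (simp add: enn_powr_ennreal)
      also have "\<dots> \<le> enn_powr (G x) a" by (rule enn_powr_mono[OF FG]) (use a in simp)
      finally show "ennreal (\<bar>F x\<bar> powr a) \<le> enn_powr (G x) a * indicator C' x"
        using a by (cases "x \<in> C'") (auto simp: F_def)
    qed
    then show ?thesis using fin unfolding C'_def by (rule le_less_trans)
  qed
  have GF: "AE x in lborel. x \<in> C' \<longrightarrow> G x = ennreal (F x)"
  proof -
    have "AE x in lborel. enn_powr (G x) a * indicator C' x \<noteq> \<infinity>"
      by (rule nn_integral_noteq_infinite) (use fin in \<open>auto simp: C'_def[symmetric]\<close>)
    then show ?thesis
    proof eventually_elim
      case (elim x)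
      then show ?case by (cases "G x") (auto simp: F_def)
    qed
  qed
  \<comment> \<open>This is the square of the constant \<open>2 powr a\<close>, which is used twice
    to separate three summands; each summand then gets a third of \<open>e / K\<close>.\<close>
  define K where "K = 4 powr a"
  have K: "K > 0" by (simp add: K_def)
  define e1 where "e1 = e / (3 * K)"
  have e1: "e1 > 0" using e K by (simp add: e1_def)
  obtain c where c: "continuous_on UNIV c" "(\<integral>\<^sup>+ x. ennreal (\<bar>F x - c x\<bar> powr a) \<partial>lborel) \<le> ennreal e1"
    by (rule Lp_continuous_dense[OF Fm _ Ffin e1]) (use a in auto)
  have [measurable]: "c \<in> borel_measurable borel" using c by (auto intro: borel_measurable_continuous_onI)
  define u where "u x = \<bar>F x - c x\<bar>" for x
  have um [measurable]: "u \<in> borel_measurable borel" unfolding u_def by measurable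
  have u0: "0 \<le> u x" for x by (simp add: u_def)
  have Cfin: "emeasure lborel C < \<infinity>" using C by (intro emeasure_bounded_finite compact_imp_bounded)
  define mC where "mC = measure lborel C"
  have emC: "emeasure lborel C = ennreal mC" unfolding mC_def using Cfin by (intro emeasure_eq_ennreal_measure) auto
  have mC0: "0 \<le> mC" by (simp add: mC_def)
  \<comment> \<open>Chosen so that \<tau>^a times the measure of \<open>C\<close> is at most
    \<open>e1\<close>; the added 1 covers measure zero.\<close>
  define \<tau> where "\<tau> = (e1 / (mC + 1)) powr (1/a)"
  have \<tau>: "\<tau> > 0" using e1 mC0 by (simp add: \<tau>_def)
  have \<tau>a: "\<tau> powr a * mC \<le> e1"
  proof -
    have "\<tau> powr a = e1 / (mC + 1)" using a e1 mC0 by (simp add: \<tau>_def powr_powr)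
    then have "\<tau> powr a * (mC + 1) = e1" using mC0 by simp
    moreover have "\<tau> powr a * mC \<le> \<tau> powr a * (mC + 1)" by (intro mult_left_mono) auto
    ultimately show ?thesis by simp
  qed
  obtain R where R: "\<And>x. x \<in> C \<Longrightarrow> norm x \<le> R" using compact_imp_bounded[OF C] by (auto simp: bounded_iff)
  have "uniformly_continuous_on (cball 0 (R + 1)) c"
    by (intro compact_uniformly_continuous continuous_on_subset[OF c(1)]) auto
  then obtain \<rho>1 where \<rho>1: "\<rho>1 > 0" "\<And>x y. x \<in> cball 0 (R + 1) \<Longrightarrow> y \<in> cball 0 (R + 1) \<Longrightarrow> dist y x < \<rho>1 \<Longrightarrow> dist (c y) (c x) < \<tau>"
    unfolding uniformly_continuous_on_def using \<tau> by meson
  define \<rho>0 where "\<rho>0 = min \<rho> (min \<rho>1 1)"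
  have main: "(\<integral>\<^sup>+ w\<in>C. enn_powr (ballavg \<delta> G w - G w) a \<partial>lborel) \<le> ennreal e" if \<delta>: "0 < \<delta>" "\<delta> < \<rho>0" for \<delta>
  proof -
    have pw: "ballavg \<delta> G w - G w \<le> ballavg \<delta> (\<lambda>x. ennreal (u x)) w + (ennreal (u w) + ennreal \<tau>)" if w: "w \<in> C" "G w \<noteq> top" for w
    proof -
      define b where "b = unit_ball_vol 2 * \<delta>\<^sup>2"
      have b: "b > 0" using \<delta> by (simp add: b_def)
      have eb: "emeasure lborel (ball w \<delta>) = ennreal b" using \<delta> by (simp add: emeasure_ball_R2 b_def)
      have [measurable]: "ball w \<delta> \<in> sets borel" by simp
      have sub: "ball w \<delta> \<subseteq> C'" using w(1) \<delta> unfolding C'_def \<rho>0_def by force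
      let ?k = "F w + u w + \<tau>"
      have k0: "0 \<le> ?k" using F0[of w] u0[of w] \<tau> by simp
      have Fz: "F z \<le> u z + ?k" if z: "z \<in> ball w \<delta>" for z
      proof -
        have d: "dist z w < \<delta>" using z by (simp add: dist_commute)
        have "norm w \<le> R" by (rule R[OF w(1)])
        moreover have "norm z \<le> R + 1"
          using d \<delta> \<open>norm w \<le> R\<close> norm_triangle_sub[of z w] by (auto simp: dist_norm \<rho>0_def)
        ultimately have "dist (c z) (c w) < \<tau>" using \<rho>1(2)[of w z] d \<delta> by (auto simp: \<rho>0_def)
        then show ?thesis unfolding u_def dist_real_def by linarith
      qed
      have "(\<integral>\<^sup>+ z\<in>ball w \<delta>. G z \<partial>lborel) \<le> (\<integral>\<^sup>+ z. ennreal (u z) * indicator (ball w \<delta>) z + ennreal ?k * indicator (ball w \<delta>) z \<partial>lborel)"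
      proof (rule nn_integral_mono_AE)
        show "AE z in lborel. G z * indicator (ball w \<delta>) z \<le> ennreal (u z) * indicator (ball w \<delta>) z + ennreal ?k * indicator (ball w \<delta>) z"
          using GF
        proof eventually_elim
          case (elim z)
          show ?case
          proof (cases "z \<in> ball w \<delta>")
            case True
            then have "G z = ennreal (F z)" using elim sub by blast
            also have "\<dots> \<le> ennreal (u z + ?k)" using Fz[OF True] by (rule ennreal_leI)
            also have "\<dots> = ennreal (u z) + ennreal ?k" using u0 k0 by (intro ennreal_plus)
            finally show ?thesis using True by simp
          qed simp
        qed
      qed
      also have "\<dots> = (\<integral>\<^sup>+ z\<in>ball w \<delta>. ennreal (u z) \<partial>lborel) + ennreal ?k * ennreal b"
        using eb by (subst nn_integral_add) (auto simp: nn_integral_cmult_indicator)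
      finally have "ballavg \<delta> G w \<le> ((\<integral>\<^sup>+ z\<in>ball w \<delta>. ennreal (u z) \<partial>lborel) + ennreal ?k * ennreal b) / ennreal b"
        unfolding ballavg_def eb by (rule divide_right_mono_ennreal)
      also have "\<dots> = ballavg \<delta> (\<lambda>x. ennreal (u x)) w + ennreal ?k * ennreal b / ennreal b"
        unfolding ballavg_def eb by (simp add: add_divide_distrib_ennreal)
      also have "ennreal ?k * ennreal b / ennreal b = ennreal ?k"
        by (rule mult_divide_eq_ennreal) (use b in auto)
      also have "ennreal ?k = ennreal (F w) + (ennreal (u w) + ennreal \<tau>)"
        using F0[of w] u0[of w] \<tau> by (simp add: ennreal_plus add.assoc)
      also have "\<dots> \<le> G w + (ennreal (u w) + ennreal \<tau>)" by (intro add_right_mono FG)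
      finally have "ballavg \<delta> G w \<le> G w + (ballavg \<delta> (\<lambda>x. ennreal (u x)) w + (ennreal (u w) + ennreal \<tau>))"
        by (simp add: add_left_mono add.left_commute)
      then show ?thesis using w(2) by (auto simp: ennreal_minus_le_iff)
    qed
    have up: "(\<lambda>x. ennreal (u x powr a)) \<in> borel_measurable borel" by measurable
    have "(\<integral>\<^sup>+ w\<in>C. enn_powr (ballavg \<delta> G w - G w) a \<partial>lborel)
       \<le> (\<integral>\<^sup>+ w. ennreal K * (ballavg \<delta> (\<lambda>x. ennreal (u x powr a)) w + (ennreal (u w powr a) + ennreal (\<tau> powr a) * indicator C w)) \<partial>lborel)"
    proof (rule nn_integral_mono_AE)
      show "AE w in lborel. enn_powr (ballavg \<delta> G w - G w) a * indicator C w \<le> ennreal K * (ballavg \<delta> (\<lambda>x. ennreal (u x powr a)) w + (ennreal (u w powr a) + ennreal (\<tau> powr a) * indicator C w))"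
        using GF
      proof eventually_elim
        fix w assume Gw: "w \<in> C' \<longrightarrow> G w = ennreal (F w)"
        show "enn_powr (ballavg \<delta> G w - G w) a * indicator C w \<le> ennreal K * (ballavg \<delta> (\<lambda>x. ennreal (u x powr a)) w + (ennreal (u w powr a) + ennreal (\<tau> powr a) * indicator C w))"
      proof (cases "w \<in> C")
        case True
        then have "w \<in> C'" using \<rho> by (auto simp: C'_def intro!: bexI[of _ w])
        then have nt: "G w \<noteq> top" using Gw by simp
        let ?A = "ballavg \<delta> (\<lambda>x. ennreal (u x)) w"
        have a0: "0 < a" using a by simp
        have "enn_powr (ballavg \<delta> G w - G w) a \<le> enn_powr (?A + (ennreal (u w) + ennreal \<tau>)) a"
          by (rule enn_powr_mono[OF pw[OF True nt] a0])
        also have "\<dots> \<le> ennreal (2 powr a) * (enn_powr ?A a + enn_powr (ennreal (u w) + ennreal \<tau>) a)" by (rule enn_powr_add_le[OF a0])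
        also have "\<dots> \<le> ennreal (2 powr a) * (ballavg \<delta> (\<lambda>x. ennreal (u x powr a)) w + ennreal (2 powr a) * (enn_powr (ennreal (u w)) a + enn_powr (ennreal \<tau>) a))"
          by (intro mult_left_mono add_mono ballavg_powr_le enn_powr_add_le) (use \<delta> a a0 um u0 in auto)
        \<comment> \<open>The first summand is enlarged by a factor at least 1, so that the constant
          can be taken out of all three.\<close>
        also have "\<dots> \<le> ennreal (2 powr a) * (ennreal (2 powr a) * ballavg \<delta> (\<lambda>x. ennreal (u x powr a)) w + ennreal (2 powr a) * (enn_powr (ennreal (u w)) a + enn_powr (ennreal \<tau>) a))"
        proof (intro mult_left_mono add_right_mono)
          have "1 \<le> ennreal (2 powr a)" using a by (simp add: ge_one_powr_ge_zero ennreal_1[symmetric] ennreal_leI del: ennreal_1)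
          then show "ballavg \<delta> (\<lambda>x. ennreal (u x powr a)) w \<le> ennreal (2 powr a) * ballavg \<delta> (\<lambda>x. ennreal (u x powr a)) w"
            using mult_right_mono[of 1 "ennreal (2 powr a)" "ballavg \<delta> (\<lambda>x. ennreal (u x powr a)) w"] by simp
        qed simp
        also have "\<dots> = ennreal (2 powr a) * ennreal (2 powr a) * (ballavg \<delta> (\<lambda>x. ennreal (u x powr a)) w + (enn_powr (ennreal (u w)) a + enn_powr (ennreal \<tau>) a))"
          by (simp only: distrib_left mult.assoc)
        also have "ennreal (2 powr a) * ennreal (2 powr a) = ennreal K"
          by (subst ennreal_mult[symmetric]) (auto simp: K_def powr_mult[symmetric])
        finally show ?thesis using True u0[of w] \<tau> by (simp add: enn_powr_ennreal)
      qed simp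
      qed
    qed
    also have "\<dots> = ennreal K * ((\<integral>\<^sup>+ w. ballavg \<delta> (\<lambda>x. ennreal (u x powr a)) w \<partial>lborel) + ((\<integral>\<^sup>+ w. ennreal (u w powr a) \<partial>lborel) + ennreal (\<tau> powr a) * ennreal mC))"
    proof -
      have bm: "ballavg \<delta> (\<lambda>x. ennreal (u x powr a)) \<in> borel_measurable lborel" using ballavg_borel[OF \<delta>(1) up] by simp
      show ?thesis
        using bm up Cb by (simp add: nn_integral_cmult nn_integral_add nn_integral_cmult_indicator emC)
    qed
    also have "(\<integral>\<^sup>+ w. ballavg \<delta> (\<lambda>x. ennreal (u x powr a)) w \<partial>lborel) = (\<integral>\<^sup>+ w. ennreal (u w powr a) \<partial>lborel)"
      by (rule nn_integral_ballavg[OF \<delta>(1) up])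
    also have "ennreal K * ((\<integral>\<^sup>+ w. ennreal (u w powr a) \<partial>lborel) + ((\<integral>\<^sup>+ w. ennreal (u w powr a) \<partial>lborel) + ennreal (\<tau> powr a) * ennreal mC))
       \<le> ennreal K * (ennreal e1 + (ennreal e1 + ennreal e1))"
    proof (intro mult_left_mono add_mono)
      show "(\<integral>\<^sup>+ w. ennreal (u w powr a) \<partial>lborel) \<le> ennreal e1" "(\<integral>\<^sup>+ w. ennreal (u w powr a) \<partial>lborel) \<le> ennreal e1"
        using c(2) by (simp_all add: u_def)
      show "ennreal (\<tau> powr a) * ennreal mC \<le> ennreal e1"
        using \<tau>a mC0 by (subst ennreal_mult[symmetric]) (auto intro: ennreal_leI)
    qed simp
    also have "\<dots> = ennreal (K * (e1 + (e1 + e1)))"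
    proof -
      have "ennreal (K * (e1 + (e1 + e1))) = ennreal K * ennreal (e1 + (e1 + e1))" using K e1 by (intro ennreal_mult) auto
      also have "ennreal (e1 + (e1 + e1)) = ennreal e1 + ennreal (e1 + e1)" using e1 by (intro ennreal_plus) auto
      also have "ennreal (e1 + e1) = ennreal e1 + ennreal e1" using e1 by (intro ennreal_plus) auto
      finally show ?thesis by simp
    qed
    also have "K * (e1 + (e1 + e1)) = e" using K by (simp add: e1_def)
    finally show ?thesis .
  qed
  show ?thesis
    by (intro exI[of _ \<rho>0] conjI allI impI main) (use \<rho> \<rho>1 in \<open>auto simp: \<rho>0_def\<close>)
qed

section \<open>The upper gradient of the inverse\<close>

text \<open>The signed area spanned by the two vectors; a matrix multiplies it by its
  determinant.\<close>

definition cross2 :: "R2 \<Rightarrow> R2 \<Rightarrow> real" where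
  "cross2 p r = p$1 * r$2 - p$2 * r$1"

definition perp :: "R2 \<Rightarrow> R2" where
  "perp p = vector [- (p$2), p$1]"

lemma perp_simps: "perp p $ 1 = - (p$2)" "perp p $ 2 = p$1"
  by (simp_all add: perp_def)

lemma norm_perp: "norm (perp p) = norm p"
  by (simp add: norm_eq_sqrt_inner inner_vec_def UNIV_2 perp_simps)

lemma inner_perp: "p \<bullet> perp p = 0"
  by (simp add: inner_vec_def UNIV_2 perp_simps)

lemma frame_perp: "norm v = 1 \<Longrightarrow> frame v (perp v)"
  by (simp add: frame_def norm_perp inner_perp)

text \<open>Lagrange's identity, the coordinate form of sin^2 + cos^2 = 1 for the angle between the
  vectors.\<close>

lemma cross2_sq: "(cross2 p r)\<^sup>2 + (p \<bullet> r)\<^sup>2 = (norm p)\<^sup>2 * (norm r)\<^sup>2"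
  unfolding power2_norm_eq_inner
  by (simp add: cross2_def inner_vec_def UNIV_2 power2_eq_square algebra_simps)

lemma abs_cross2_le: "\<bar>cross2 p r\<bar> \<le> norm p * norm r"
proof -
  have "(cross2 p r)\<^sup>2 \<le> (norm p * norm r)\<^sup>2"
    using cross2_sq[of p r] zero_le_power2[of "p \<bullet> r"] by (simp only: power_mult_distrib)
  then show ?thesis using abs_le_square_iff[of "cross2 p r" "norm p * norm r"] by simp
qed

lemma abs_cross2_orthogonal: "p \<bullet> r = 0 \<Longrightarrow> \<bar>cross2 p r\<bar> = norm p * norm r"
proof -
  assume "p \<bullet> r = 0"
  then have "(cross2 p r)\<^sup>2 = (norm p * norm r)\<^sup>2" using cross2_sq[of p r] by (simp add: power_mult_distrib)
  then show ?thesis by (metis abs_mult abs_norm_cancel power2_eq_iff_nonneg abs_ge_zero power2_abs zero_le_mult_iff norm_ge_zero)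
qed

lemma cross2_mult_vec: "cross2 (A *v p) (A *v r) = det A * cross2 p r" for A :: "real^2^2"
  by (simp add: cross2_def det_2 matrix_vector_mult_def UNIV_2 algebra_simps)

lemma lnorm_le: "norm h = 1 \<Longrightarrow> lnorm A \<le> norm (A *v h)"
  unfolding lnorm_def by (rule cInf_lower) (auto intro!: bdd_belowI[of _ 0])

lemma lnorm_greatest:
  assumes "\<And>h. norm h = 1 \<Longrightarrow> c \<le> norm (A *v h)"
  shows "c \<le> lnorm A"
  unfolding lnorm_def
proof (rule cInf_greatest)
  have "norm (axis 1 1 :: R2) = 1" by simp
  then show "{norm (A *v h) |h. norm h = 1} \<noteq> {}" by blast
qed (use assms in auto)

text \<open>Choose a unit vector \<open>h\<close> orthogonal to A^T A w. Then \<open>A h\<close> and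
  \<open>A w\<close> are orthogonal and span the area |A h| |A w|, which is |det A| times the area
  spanned by \<open>h\<close> and \<open>w\<close>, hence at most |det A|. The minimal stretching
  does not exceed |A h|.\<close>

lemma lnorm_mult_norm_le:
  assumes w: "norm w = 1"
  shows "lnorm A * norm (A *v w) \<le> \<bar>det A\<bar>"
proof (cases "A *v w = 0")
  case False
  define q where "q = transpose A *v (A *v w)"
  have adj: "(A *v h) \<bullet> (A *v w) = h \<bullet> q" for h
    unfolding q_def by (simp add: dot_lmul_matrix inner_vec_def matrix_vector_mult_def transpose_def UNIV_2 algebra_simps)
  have "q \<noteq> 0"
  proof
    assume "q = 0"
    then have "(A *v w) \<bullet> (A *v w) = 0" using adj[of w] by simp
    then show False using False by simp
  qed
  define h where "h = (1 / norm q) *\<^sub>R perp q"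
  have h: "norm h = 1" using \<open>q \<noteq> 0\<close> by (simp add: h_def norm_perp)
  have "(A *v h) \<bullet> (A *v w) = 0" unfolding adj h_def using inner_perp[of q] by (simp add: inner_commute)
  then have "norm (A *v w) * norm (A *v h) = \<bar>cross2 (A *v w) (A *v h)\<bar>"
    by (subst abs_cross2_orthogonal) (auto simp: inner_commute)
  also have "\<dots> = \<bar>det A\<bar> * \<bar>cross2 w h\<bar>" by (simp add: cross2_mult_vec abs_mult)
  also have "\<dots> \<le> \<bar>det A\<bar> * 1" using abs_cross2_le[of w h] w h by (intro mult_left_mono) auto
  finally have "norm (A *v w) * norm (A *v h) \<le> \<bar>det A\<bar>" by simp
  moreover have "lnorm A * norm (A *v w) \<le> norm (A *v h) * norm (A *v w)"
    using lnorm_le[OF h] by (intro mult_right_mono) auto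
  ultimately show ?thesis by (simp add: mult.commute)
qed simp

lemma norm_mult_vec_le: "norm (A *v h) \<le> 2 * norm A * norm h" for A :: "real^2^2"
proof -
  have "\<bar>(A *v h) $ i\<bar> \<le> norm A * norm h" for i
  proof -
    have "\<bar>(A *v h) $ i\<bar> = \<bar>A $ i \<bullet> h\<bar>" by (simp add: matrix_vector_mul_component)
    also have "\<dots> \<le> norm (A $ i) * norm h" by (rule Cauchy_Schwarz_ineq2)
    also have "\<dots> \<le> norm A * norm h" by (intro mult_right_mono Finite_Cartesian_Product.norm_nth_le) auto
    finally show ?thesis .
  qed
  from this[of 1] this[of 2] show ?thesis using norm_le_l1_cart[of "A *v h"] by (simp add: UNIV_2)
qed

text \<open>A unit vector and its quarter turn span unit area, so |det A| is at most |A h| times the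
  norm of the image of the turned vector. Bounding the latter by \<open>2 * norm A\<close> leaves a
  lower bound that does not depend on \<open>h\<close>.\<close>

lemma lnorm_pos:
  assumes "det A \<noteq> 0"
  shows "0 < lnorm A"
proof -
  have "A \<noteq> 0" using assms by (auto simp: det_2)
  then have nA: "norm A > 0" by simp
  have "\<bar>det A\<bar> / (2 * norm A) \<le> norm (A *v h)" if h: "norm h = 1" for h
  proof -
    have "\<bar>cross2 h (perp h)\<bar> = 1" using abs_cross2_orthogonal[OF inner_perp[of h]] h by (simp add: norm_perp)
    then have "\<bar>det A\<bar> = \<bar>cross2 (A *v h) (A *v perp h)\<bar>" by (simp add: cross2_mult_vec abs_mult)
    also have "\<dots> \<le> norm (A *v h) * norm (A *v perp h)" by (rule abs_cross2_le)
    also have "\<dots> \<le> norm (A *v h) * (2 * norm A)"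
      using norm_mult_vec_le[of A "perp h"] h by (intro mult_left_mono) (auto simp: norm_perp)
    finally show ?thesis using nA by (simp add: field_simps)
  qed
  then have "\<bar>det A\<bar> / (2 * norm A) \<le> lnorm A" by (rule lnorm_greatest)
  moreover have "0 < \<bar>det A\<bar> / (2 * norm A)" using assms nA by simp
  ultimately show ?thesis by linarith
qed

text \<open>The minimal stretching is 2-Lipschitz in the matrix; its continuity makes it Borel along
  \<open>Df\<close>.\<close>

lemma continuous_lnorm: "continuous_on UNIV lnorm"
proof -
  have le: "lnorm A \<le> lnorm B + 2 * norm (A - B)" for A B :: "real^2^2"
  proof -
    have "lnorm A - 2 * norm (A - B) \<le> norm (B *v h)" if h: "norm h = 1" for h
    proof -
      have "A *v h = B *v h + (A - B) *v h" by (simp add: matrix_vector_mult_diff_rdistrib)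
      then have "norm (A *v h) \<le> norm (B *v h) + norm ((A - B) *v h)" by (metis norm_triangle_ineq)
      also have "norm ((A - B) *v h) \<le> 2 * norm (A - B)" using norm_mult_vec_le[of "A - B" h] h by simp
      finally show ?thesis using lnorm_le[OF h, of A] by simp
    qed
    then have "lnorm A - 2 * norm (A - B) \<le> lnorm B" by (rule lnorm_greatest)
    then show ?thesis by simp
  qed
  have "\<bar>lnorm A - lnorm B\<bar> \<le> 2 * norm (A - B)" for A B :: "real^2^2"
    using le[of A B] le[of B A] by (simp add: norm_minus_commute abs_le_iff)
  then show ?thesis
    unfolding continuous_on_iff dist_norm real_norm_def
  proof (intro ballI allI impI)
    fix A :: "real^2^2" and e :: real
    assume l: "\<And>A B. \<bar>lnorm A - lnorm B\<bar> \<le> 2 * norm (A - B)" and "0 < e"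
    show "\<exists>d>0. \<forall>x'\<in>UNIV. norm (x' - A) < d \<longrightarrow> \<bar>lnorm x' - lnorm A\<bar> < e"
    proof (intro exI[of _ "e/2"] conjI ballI impI)
      fix B assume "norm (B - A) < e/2"
      then show "\<bar>lnorm B - lnorm A\<bar> < e" using l[of B A] by simp
    qed (use \<open>0 < e\<close> in simp)
  qed
qed

text \<open>Finite distortion is recorded through its consequence that the differential vanishes
  almost everywhere where the Jacobian does.\<close>

locale W11_upper_gradient = W11_bounded_homeo +
  fixes T :: "nat \<Rightarrow> R2 set"
  assumes T_borel: "\<And>n. T n \<in> sets borel" and T_sub: "\<And>n. T n \<subseteq> D"
    and T_der: "\<And>n x. x \<in> T n \<Longrightarrow> (f has_derivative (\<lambda>h. Df x *v h)) (at x within T n)"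
    and T_full: "AE x in lborel. x \<in> D \<longrightarrow> x \<in> (\<Union>n. T n)"
    and finite_dist: "AE x in lborel. x \<in> D \<longrightarrow> det (Df x) = 0 \<longrightarrow> Df x = 0"
begin

text \<open>1/l is the operator norm of the inverse matrix. The value 0 at a vanishing determinant
  is harmless, because there the differential itself vanishes almost everywhere.\<close>

definition stretch :: "R2 \<Rightarrow> ennreal" where
  "stretch x = (if det (Df x) = 0 then 0 else ennreal (1 / lnorm (Df x)))"

text \<open>The cut-off to the image of the good pieces lets the area formula turn integrals of the
  weight into integrals over the domain; the remaining part of the image may well have positive
  area.\<close>

definition G :: "R2 \<Rightarrow> ennreal" where
  "G y = stretch (g y) * indicator (f ` (\<Union>n. T n)) y"

lemma stretch_borel [measurable]: "stretch \<in> borel_measurable borel"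
proof -
  have [measurable]: "(\<lambda>x. lnorm (Df x)) \<in> borel_measurable borel"
    by (rule measurable_compose[OF Df_borel borel_measurable_continuous_onI[OF continuous_lnorm]])
  have [measurable]: "(\<lambda>x. det (Df x)) \<in> borel_measurable borel" by (rule det_borel)
  show ?thesis unfolding stretch_def by measurable
qed

lemma comp_g_borel:
  assumes "F \<in> borel_measurable borel"
  shows "(\<lambda>y. (F (g y) :: ennreal) * indicator (f ` (\<Union>n. T n)) y) \<in> borel_measurable borel"
proof -
  have "(\<lambda>y. F (g y)) \<in> borel_measurable (restrict_space borel (f ` D))"
    by (rule measurable_compose[OF borel_measurable_continuous_on_restrict[OF cont_g] assms])
  then have 1: "(\<lambda>y. F (g y) * indicator (f ` D) y) \<in> borel_measurable borel"
    using open_fD by (subst (asm) borel_measurable_restrict_space_iff_ennreal) auto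
  have 2: "f ` (\<Union>n. T n) \<in> sets borel" by (rule image_borel) (use T_borel T_sub in auto)
  have "(\<lambda>y. (F (g y) * indicator (f ` D) y) * indicator (f ` (\<Union>n. T n)) y) \<in> borel_measurable borel"
    using 1 2 by simp
  also have "(\<lambda>y. (F (g y) * indicator (f ` D) y) * indicator (f ` (\<Union>n. T n)) y) = (\<lambda>y. F (g y) * indicator (f ` (\<Union>n. T n)) y)"
    using T_sub by (force simp: fun_eq_iff indicator_def)
  finally show ?thesis .
qed

lemma G_borel [measurable]: "G \<in> borel_measurable borel"
  unfolding G_def by (rule comp_g_borel) measurable

text \<open>Where the Jacobian is nonzero, |Df w| is at most |det| / l; where it vanishes, so does
  the left side almost everywhere. The area formula then moves the integral to the image.\<close>

lemma nn_integral_Df_le: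
  assumes w: "norm w = 1" and U: "open U" "U \<subseteq> f ` D"
  shows "(\<integral>\<^sup>+ x\<in>g ` U. ennreal (norm (Df x *v w)) \<partial>lborel) \<le> (\<integral>\<^sup>+ y\<in>U. G y \<partial>lborel)"
proof -
  let ?S = "\<Union>n. T n"
  have gU: "g ` U = D \<inter> f -` U" by (rule g_image[OF U(2)])
  have gUb: "g ` U \<in> sets borel" unfolding gU by (rule vimage_continuous_borel[OF cont_f]) (use open_D U in auto)
  have [measurable]: "g ` U \<in> sets borel" by (rule gUb)
  have "(\<integral>\<^sup>+ x\<in>g ` U. ennreal (norm (Df x *v w)) \<partial>lborel) \<le> (\<integral>\<^sup>+ x\<in>?S. (stretch x * indicator (g ` U) x) * ennreal \<bar>det (Df x)\<bar> \<partial>lborel)"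
  proof (rule nn_integral_mono_AE)
    show "AE x in lborel. ennreal (norm (Df x *v w)) * indicator (g ` U) x \<le> stretch x * indicator (g ` U) x * ennreal \<bar>det (Df x)\<bar> * indicator ?S x"
      using T_full finite_dist
    proof eventually_elim
      case (elim x)
      show ?case
      proof (cases "x \<in> g ` U")
        case True
        then have "x \<in> D" "x \<in> ?S" using elim gU by auto
        show ?thesis
        proof (cases "det (Df x) = 0")
          case True
          then show ?thesis using elim \<open>x \<in> D\<close> by simp
        next
          case False
          have l: "0 < lnorm (Df x)" by (rule lnorm_pos[OF False])
          have "norm (Df x *v w) \<le> 1 / lnorm (Df x) * \<bar>det (Df x)\<bar>"
            using lnorm_mult_norm_le[OF w, of "Df x"] l by (simp add: field_simps)
          then have "ennreal (norm (Df x *v w)) \<le> ennreal (1 / lnorm (Df x) * \<bar>det (Df x)\<bar>)" by (rule ennreal_leI)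
          also have "\<dots> = stretch x * ennreal \<bar>det (Df x)\<bar>"
            using False l by (simp add: stretch_def ennreal_mult[symmetric])
          finally show ?thesis using \<open>x \<in> g ` U\<close> \<open>x \<in> ?S\<close> by simp
        qed
      qed simp
    qed
  qed
  also have "\<dots> = (\<integral>\<^sup>+ y\<in>f ` ?S. stretch (g y) * indicator (g ` U) (g y) \<partial>lborel)"
    by (rule area_formula[OF T_borel T_sub T_der]) measurable
  also have "\<dots> = (\<integral>\<^sup>+ y\<in>U. G y \<partial>lborel)"
  proof (rule nn_integral_cong)
    fix y
    have "g y \<in> g ` U \<longleftrightarrow> y \<in> U" if "y \<in> f ` ?S"
    proof -
      have y: "y \<in> f ` D" using that T_sub by blast
      then show ?thesis unfolding gU using fg[OF y] gD[OF y] by auto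
    qed
    then show "stretch (g y) * indicator (g ` U) (g y) * indicator (f ` ?S) y = G y * indicator U y"
      by (auto simp: G_def indicator_def)
  qed
  finally show ?thesis .
qed

text \<open>Where the determinant is nonzero, the power \<open>a\<close> of 1/l times the Jacobian
  is \<open>K_I\<close>. Where it vanishes, the left side is 0 while \<open>K_I\<close> is at least
  1 in \<open>D\<close>, hence only an inequality.\<close>

lemma nn_integral_comp_powr_le:
  assumes \<theta>: "\<theta> \<in> borel_measurable borel" and a: "1 < a"
  shows "(\<integral>\<^sup>+ y. enn_powr (\<theta> (g y) * G y) a \<partial>lborel) \<le> (\<integral>\<^sup>+ x\<in>D. K_I D Df a x * enn_powr (\<theta> x) a \<partial>lborel)"
proof -
  let ?S = "\<Union>n. T n"
  have a0: "0 < a" using a by simp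
  have [measurable]: "\<theta> \<in> borel_measurable borel" by (rule \<theta>)
  have "(\<integral>\<^sup>+ y. enn_powr (\<theta> (g y) * G y) a \<partial>lborel) = (\<integral>\<^sup>+ y\<in>f ` ?S. enn_powr (\<theta> (g y) * stretch (g y)) a \<partial>lborel)"
    by (rule nn_integral_cong) (auto simp: G_def indicator_def)
  also have "\<dots> = (\<integral>\<^sup>+ x\<in>?S. enn_powr (\<theta> x * stretch x) a * ennreal \<bar>det (Df x)\<bar> \<partial>lborel)"
    by (rule area_formula[symmetric, OF T_borel T_sub T_der]) measurable
  also have "\<dots> \<le> (\<integral>\<^sup>+ x\<in>D. K_I D Df a x * enn_powr (\<theta> x) a \<partial>lborel)"
  proof (rule nn_integral_mono)
    fix x
    show "enn_powr (\<theta> x * stretch x) a * ennreal \<bar>det (Df x)\<bar> * indicator ?S x \<le> K_I D Df a x * enn_powr (\<theta> x) a * indicator D x"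
    proof (cases "x \<in> ?S \<and> det (Df x) \<noteq> 0")
      case True
      then have xD: "x \<in> D" using T_sub by blast
      have l: "0 < lnorm (Df x)" using True by (intro lnorm_pos) simp
      have "enn_powr (stretch x) a * ennreal \<bar>det (Df x)\<bar> = ennreal ((1 / lnorm (Df x)) powr a * \<bar>det (Df x)\<bar>)"
        using True l by (simp add: stretch_def enn_powr_ennreal ennreal_mult[symmetric])
      also have "(1 / lnorm (Df x)) powr a * \<bar>det (Df x)\<bar> = \<bar>det (Df x)\<bar> / lnorm (Df x) powr a"
        using l by (simp add: powr_divide)
      also have "ennreal \<dots> = K_I D Df a x" using True xD by (simp add: K_I_def)
      finally have "enn_powr (\<theta> x * stretch x) a * ennreal \<bar>det (Df x)\<bar> = enn_powr (\<theta> x) a * K_I D Df a x"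
        by (simp add: enn_powr_mult[OF a0] mult.assoc)
      then show ?thesis using xD by (simp add: mult.commute indicator_def)
    next
      case False
      then show ?thesis by (auto simp: stretch_def)
    qed
  qed
  finally show ?thesis .
qed

definition avg_g :: "real \<Rightarrow> R2 \<Rightarrow> R2" where
  "avg_g \<delta> y = (1 / (unit_ball_vol 2 * \<delta>\<^sup>2)) *\<^sub>R (LINT z:ball 0 \<delta>|lborel. g (y + z))"

lemma g_shift_integrable:
  assumes "0 < \<delta>" "cball y \<delta> \<subseteq> f ` D"
  shows "set_integrable lborel (ball 0 \<delta>) (\<lambda>z. g (y + z))"
proof (rule set_integrable_subset)
  show "set_integrable lborel (cball 0 \<delta>) (\<lambda>z. g (y + z))"
    unfolding set_integrable_def
  proof (rule borel_integrable_compact)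
    show "continuous_on (cball 0 \<delta>) (\<lambda>z. g (y + z))"
      by (rule continuous_on_compose2[OF cont_g]) (use assms(2) in \<open>auto intro!: continuous_intros simp: subset_iff dist_norm\<close>)
  qed simp
qed auto

lemma avg_g_tendsto:
  assumes "0 < \<delta>" "cball y \<delta> \<subseteq> f ` D" and e: "\<And>z. z \<in> ball y \<delta> \<Longrightarrow> norm (g z - g y) \<le> e"
  shows "norm (avg_g \<delta> y - g y) \<le> e"
proof -
  define b where "b = unit_ball_vol 2 * \<delta>\<^sup>2"
  have b: "b > 0" using assms by (simp add: b_def)
  have mb: "measure lborel (ball (0::R2) \<delta>) = b"
    using emeasure_ball_R2[of \<delta> 0] assms(1) b by (simp add: measure_def b_def)
  note i1 = g_shift_integrable[OF assms(1,2)]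
  have ic: "set_integrable lborel (ball 0 \<delta>) (\<lambda>z::R2. c)" for c :: "'b::{banach,second_countable_topology}"
    unfolding set_integrable_def using emeasure_bounded_finite[of "ball (0::R2) \<delta>"] by simp
  have cint: "(LINT z:ball (0::R2) \<delta>|lborel. c) = b *\<^sub>R c" for c :: "'b::{banach,second_countable_topology}"
    unfolding set_lebesgue_integral_def using emeasure_bounded_finite[of "ball (0::R2) \<delta>"] mb by simp
  have "(LINT z:ball 0 \<delta>|lborel. g (y + z) - g y) = (LINT z:ball 0 \<delta>|lborel. g (y + z)) - b *\<^sub>R g y"
    using set_integral_diff(2)[OF i1 ic[of "g y"]] cint[of "g y"] by simp
  then have "avg_g \<delta> y - g y = (1 / b) *\<^sub>R (LINT z:ball 0 \<delta>|lborel. g (y + z) - g y)"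
    using b by (simp add: avg_g_def b_def[symmetric] scaleR_diff_right)
  then have "norm (avg_g \<delta> y - g y) = (1 / b) * norm (LINT z:ball 0 \<delta>|lborel. g (y + z) - g y)" using b by simp
  also have "\<dots> \<le> (1 / b) * (LINT z:ball (0::R2) \<delta>|lborel. e)"
  proof (rule mult_left_mono)
    have "norm (LINT z:ball 0 \<delta>|lborel. g (y + z) - g y) \<le> (LINT z:ball 0 \<delta>|lborel. norm (g (y + z) - g y))"
      by (rule set_integral_norm_bound) (rule set_integral_diff(1)[OF i1 ic])
    also have "\<dots> \<le> (LINT z:ball (0::R2) \<delta>|lborel. e)"
    proof (rule set_integral_mono)
      show "set_integrable lborel (ball 0 \<delta>) (\<lambda>z. norm (g (y + z) - g y))"
        by (rule set_integrable_norm) (rule set_integral_diff(1)[OF i1 ic])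
      show "set_integrable lborel (ball (0::R2) \<delta>) (\<lambda>z. e)" by (rule ic)
      show "norm (g (y + z) - g y) \<le> e" if "z \<in> ball 0 \<delta>" for z by (rule e) (use that in \<open>auto simp: dist_norm\<close>)
    qed
    finally show "norm (LINT z:ball 0 \<delta>|lborel. g (y + z) - g y) \<le> (LINT z:ball (0::R2) \<delta>|lborel. e)" .
  qed (use b in auto)
  also have "\<dots> = e" using cint[of e] b by simp
  finally show ?thesis .
qed

text \<open>With \<open>v\<close> the direction of the increment of the averages, its norm becomes
  an average of scalar increments of \<open>v \<bullet> g\<close>. The slicing estimate holds for
  every frame, so \<open>v\<close> may depend on the two points; it is applied with \<open>w\<close>
  the quarter turn of \<open>v\<close> and with \<open>e\<close> the direction from \<open>y\<close>
  to \<open>y'\<close>.\<close>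

lemma avg_g_increment:
  assumes \<delta>: "0 < \<delta>" and sub: "cball y (\<delta> + dist y y') \<subseteq> f ` D"
  shows "ennreal (norm (avg_g \<delta> y' - avg_g \<delta> y)) \<le> ennreal (dist y y') * ((\<integral>\<^sup>+ z\<in>ball y (\<delta> + dist y y'). G z \<partial>lborel) / ennreal (unit_ball_vol 2 * \<delta>\<^sup>2))"
proof (cases "avg_g \<delta> y' = avg_g \<delta> y")
  case ne: False
  then have "y \<noteq> y'" by auto
  define h where "h = dist y y'"
  define e where "e = (1 / h) *\<^sub>R (y' - y)"
  have h: "h > 0" using \<open>y \<noteq> y'\<close> by (simp add: h_def)
  have e: "norm e = 1" using h by (simp add: e_def h_def dist_norm norm_minus_commute)
  have y': "y' = y + h *\<^sub>R e" using h by (simp add: e_def)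
  define b where "b = unit_ball_vol 2 * \<delta>\<^sup>2"
  have b: "b > 0" using \<delta> by (simp add: b_def)
  define u where "u = avg_g \<delta> y' - avg_g \<delta> y"
  define v where "v = (1 / norm u) *\<^sub>R u"
  have u: "norm u > 0" using ne by (simp add: u_def)
  have v: "norm v = 1" using u by (simp add: v_def)
  have vu: "v \<bullet> u = norm u" using u by (simp add: v_def power2_norm_eq_inner[symmetric] power2_eq_square)
  have s1: "cball y \<delta> \<subseteq> f ` D" by (rule subset_trans[OF subset_cball sub]) simp
  have s2: "cball y' \<delta> \<subseteq> f ` D"
  proof
    fix z assume "z \<in> cball y' \<delta>"
    then have "dist y z \<le> \<delta> + dist y y'" using dist_triangle[of y z y'] by simp
    then show "z \<in> f ` D" using sub by auto
  qed
  note i1 = g_shift_integrable[OF \<delta> s1] and i2 = g_shift_integrable[OF \<delta> s2]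
  have i12: "set_integrable lborel (ball 0 \<delta>) (\<lambda>z. g (y' + z) - g (y + z))" by (rule set_integral_diff(1)[OF i2 i1])
  have ueq: "u = (1 / b) *\<^sub>R (LINT z:ball 0 \<delta>|lborel. g (y' + z) - g (y + z))"
    unfolding u_def avg_g_def b_def[symmetric] using set_integral_diff(2)[OF i2 i1] by (simp add: scaleR_diff_right)
  have iv: "integrable lborel (\<lambda>z. indicator (ball 0 \<delta>) z *\<^sub>R (g (y' + z) - g (y + z)))"
    using i12 by (simp add: set_integrable_def)
  have "norm u = (1 / b) * (\<integral>z. v \<bullet> (indicator (ball 0 \<delta>) z *\<^sub>R (g (y' + z) - g (y + z))) \<partial>lborel)"
  proof -
    have "norm u = v \<bullet> ((1 / b) *\<^sub>R (LINT z:ball 0 \<delta>|lborel. g (y' + z) - g (y + z)))" using vu ueq by metis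
    also have "\<dots> = (1 / b) * (v \<bullet> (\<integral>z. indicator (ball 0 \<delta>) z *\<^sub>R (g (y' + z) - g (y + z)) \<partial>lborel))"
      by (simp add: set_lebesgue_integral_def)
    also have "v \<bullet> (\<integral>z. indicator (ball 0 \<delta>) z *\<^sub>R (g (y' + z) - g (y + z)) \<partial>lborel) = (\<integral>z. v \<bullet> (indicator (ball 0 \<delta>) z *\<^sub>R (g (y' + z) - g (y + z))) \<partial>lborel)"
      by (rule integral_inner_right[symmetric]) (rule iv)
    finally show ?thesis .
  qed
  then have "b * norm u = (\<integral>z. v \<bullet> (indicator (ball 0 \<delta>) z *\<^sub>R (g (y' + z) - g (y + z))) \<partial>lborel)" using b by simp
  then have "ennreal (b * norm u) \<le> ennreal (norm (\<integral>z. v \<bullet> (indicator (ball 0 \<delta>) z *\<^sub>R (g (y' + z) - g (y + z))) \<partial>lborel))"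
    by (intro ennreal_leI) simp
  also have "\<dots> \<le> (\<integral>\<^sup>+ z. ennreal (norm (v \<bullet> (indicator (ball 0 \<delta>) z *\<^sub>R (g (y' + z) - g (y + z))))) \<partial>lborel)"
    by (rule integral_norm_bound_ennreal, rule integrable_inner_right, rule iv)
  also have "\<dots> = (\<integral>\<^sup>+ z. ennreal \<bar>v \<bullet> g (y + z + h *\<^sub>R e) - v \<bullet> g (y + z)\<bar> * indicator (ball y \<delta>) (y + z) \<partial>lborel)"
  proof (rule nn_integral_cong)
    fix z
    have yz: "y' + z = y + z + h *\<^sub>R e" by (simp add: y' algebra_simps)
    show "ennreal (norm (v \<bullet> (indicator (ball 0 \<delta>) z *\<^sub>R (g (y' + z) - g (y + z))))) = ennreal \<bar>v \<bullet> g (y + z + h *\<^sub>R e) - v \<bullet> g (y + z)\<bar> * indicator (ball y \<delta>) (y + z)"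
      unfolding yz by (auto simp: indicator_def dist_norm inner_diff_right)
  qed
  \<comment> \<open>Translation by \<open>y\<close> moves the average from the ball about 0 to the
    ball about \<open>y\<close>, the form in which the slicing estimate is available.\<close>
  also have "\<dots> = (\<integral>\<^sup>+ p. ennreal \<bar>v \<bullet> g (p + h *\<^sub>R e) - v \<bullet> g p\<bar> * indicator (ball y \<delta>) p \<partial>lborel)"
  proof -
    have gc: "continuous_on (ball y \<delta>) (\<lambda>p. \<bar>v \<bullet> g (p + h *\<^sub>R e) - v \<bullet> g p\<bar>)"
    proof (intro continuous_intros)
      show "continuous_on (ball y \<delta>) g" by (rule continuous_on_subset[OF cont_g]) (use s1 in auto)
      have "p + h *\<^sub>R e \<in> f ` D" if "p \<in> ball y \<delta>" for p
      proof -
        have "dist y' (p + h *\<^sub>R e) = dist y p" by (simp add: y' dist_norm)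
        then have "p + h *\<^sub>R e \<in> cball y' \<delta>" using that by simp
        then show ?thesis using s2 by blast
      qed
      then show "continuous_on (ball y \<delta>) (\<lambda>p. g (p + h *\<^sub>R e))"
        by (intro continuous_on_compose2[OF cont_g]) (auto intro!: continuous_intros)
    qed
    have "(\<lambda>p. ennreal \<bar>v \<bullet> g (p + h *\<^sub>R e) - v \<bullet> g p\<bar>) \<in> borel_measurable (restrict_space borel (ball y \<delta>))"
      using borel_measurable_continuous_on_restrict[OF gc] by measurable
    then have m: "(\<lambda>p. ennreal \<bar>v \<bullet> g (p + h *\<^sub>R e) - v \<bullet> g p\<bar> * indicator (ball y \<delta>) p) \<in> borel_measurable borel"
      by (subst (asm) borel_measurable_restrict_space_iff_ennreal) auto
    have "(\<integral>\<^sup>+ p. ennreal \<bar>v \<bullet> g (p + h *\<^sub>R e) - v \<bullet> g p\<bar> * indicator (ball y \<delta>) p \<partial>distr lborel borel ((+) y))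
      = (\<integral>\<^sup>+ z. ennreal \<bar>v \<bullet> g (y + z + h *\<^sub>R e) - v \<bullet> g (y + z)\<bar> * indicator (ball y \<delta>) (y + z) \<partial>lborel)"
      by (rule nn_integral_distr) (use m in auto)
    then show ?thesis by (simp add: lborel_distr_plus)
  qed
  also have "\<dots> \<le> ennreal h * (\<integral>\<^sup>+ x\<in>g ` ball y (\<delta> + h). ennreal (norm (Df x *v perp v)) \<partial>lborel)"
    by (rule inverse_increment_le[OF frame_perp[OF v] frame_perp[OF e] \<delta> h]) (use sub in \<open>simp add: h_def\<close>)
  also have "\<dots> \<le> ennreal h * (\<integral>\<^sup>+ z\<in>ball y (\<delta> + h). G z \<partial>lborel)"
  proof (intro mult_left_mono nn_integral_Df_le)
    show "norm (perp v) = 1" using v by (simp add: norm_perp)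
    show "ball y (\<delta> + h) \<subseteq> f ` D" using sub ball_subset_cball unfolding h_def by blast
  qed auto
  finally have main: "ennreal (b * norm u) \<le> ennreal h * (\<integral>\<^sup>+ z\<in>ball y (\<delta> + h). G z \<partial>lborel)" .
  have "ennreal (norm u) = ennreal (b * norm u) / ennreal b" using b by (simp add: divide_ennreal)
  also have "\<dots> \<le> (ennreal h * (\<integral>\<^sup>+ z\<in>ball y (\<delta> + h). G z \<partial>lborel)) / ennreal b" by (rule divide_right_mono_ennreal[OF main])
  also have "\<dots> = ennreal h * ((\<integral>\<^sup>+ z\<in>ball y (\<delta> + h). G z \<partial>lborel) / ennreal b)" by (simp add: ennreal_times_divide)
  finally show ?thesis unfolding u_def h_def b_def .
qed simp

text \<open>The increment bound integrates over a ball of radius slightly above \<delta> about one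
  curve point, but divides by the area of a \<delta>-ball. Enlarging to the \<delta>'-ball about any
  nearby curve point costs the ratio of the areas, which is the square of
  \<open>\<delta>' / \<delta>\<close>, and gives the freedom in \<open>u\<close> that integration
  along the curve asks for.\<close>

lemma avg_g_curve:
  assumes rect: "loc_rectifiable \<gamma>" and \<delta>: "0 < \<delta>" "\<delta> < \<delta>'" and sub: "\<And>t. t \<in> {0..1} \<Longrightarrow> cball (\<gamma> t) \<delta>' \<subseteq> f ` D"
    and ab: "0 \<le> a" "a \<le> b" "b \<le> 1"
  shows "ennreal (norm (avg_g \<delta> (\<gamma> b) - avg_g \<delta> (\<gamma> a)))
    \<le> ennreal ((\<delta>' / \<delta>)\<^sup>2) * (\<integral>\<^sup>+ t\<in>{a<..b}. ballavg \<delta>' G (\<gamma> t) * indicator {0..1} t \<partial>interval_measure (length_fun \<gamma>))"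
proof -
  define c where "c = ennreal ((\<delta>' / \<delta>)\<^sup>2)"
  define H where "H w = c * ballavg \<delta>' G w" for w
  have \<delta>': "0 < \<delta>'" using \<delta> by simp
  have bm: "ballavg \<delta>' G \<in> borel_measurable borel" by (rule ballavg_borel[OF \<delta>' G_borel])
  have Hm: "H \<in> borel_measurable borel" unfolding H_def using bm by measurable
  have Heq: "H w = (\<integral>\<^sup>+ z\<in>ball w \<delta>'. G z \<partial>lborel) / ennreal (unit_ball_vol 2 * \<delta>\<^sup>2)" for w
  proof -
    have "H w = c * ((\<integral>\<^sup>+ z\<in>ball w \<delta>'. G z \<partial>lborel) / ennreal (unit_ball_vol 2 * \<delta>'\<^sup>2))"
      unfolding H_def ballavg_def using \<delta>' by (simp add: emeasure_ball_R2)
    also have "\<dots> = (\<integral>\<^sup>+ z\<in>ball w \<delta>'. G z \<partial>lborel) * (c / ennreal (unit_ball_vol 2 * \<delta>'\<^sup>2))"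
      by (simp add: divide_ennreal_def mult_ac)
    also have "c / ennreal (unit_ball_vol 2 * \<delta>'\<^sup>2) = 1 / ennreal (unit_ball_vol 2 * \<delta>\<^sup>2)"
    proof -
      have "c / ennreal (unit_ball_vol 2 * \<delta>'\<^sup>2) = ennreal ((\<delta>' / \<delta>)\<^sup>2 / (unit_ball_vol 2 * \<delta>'\<^sup>2))"
        unfolding c_def using \<delta>' by (intro divide_ennreal) auto
      also have "(\<delta>' / \<delta>)\<^sup>2 / (unit_ball_vol 2 * \<delta>'\<^sup>2) = 1 / (unit_ball_vol 2 * \<delta>\<^sup>2)"
        using \<delta> \<delta>' by (simp add: power_divide field_simps)
      also have "ennreal \<dots> = ennreal 1 / ennreal (unit_ball_vol 2 * \<delta>\<^sup>2)"
        using \<delta> by (intro divide_ennreal[symmetric]) auto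
      finally show ?thesis by simp
    qed
    finally show ?thesis by (simp add: divide_ennreal_def)
  qed
  have "ennreal (norm (avg_g \<delta> (\<gamma> b) - avg_g \<delta> (\<gamma> a)))
     \<le> (\<integral>\<^sup>+ t\<in>{a<..b}. H (\<gamma> t) * indicator {0..1} t \<partial>interval_measure (length_fun \<gamma>))"
  proof (rule norm_diff_le_line_integral[OF rect Hm _ _ ab])
    \<comment> \<open>The slack between the radii is spent in equal halves on the distances from
      \<open>\<gamma> s\<close> to \<open>\<gamma> t\<close> and to
      \<open>\<gamma> u\<close>.\<close>
    show "0 < (\<delta>' - \<delta>) / 2" using \<delta> by simp
    fix s t u assume stu: "s \<in> {0..1}" "t \<in> {0..1}" "u \<in> {0..1}" "dist (\<gamma> s) (\<gamma> t) < (\<delta>' - \<delta>) / 2" "dist (\<gamma> s) (\<gamma> u) < (\<delta>' - \<delta>) / 2"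
    have b1: "ball (\<gamma> s) (\<delta> + dist (\<gamma> s) (\<gamma> t)) \<subseteq> ball (\<gamma> u) \<delta>'"
    proof
      fix z assume "z \<in> ball (\<gamma> s) (\<delta> + dist (\<gamma> s) (\<gamma> t))"
      then have "dist (\<gamma> s) z < \<delta> + (\<delta>' - \<delta>) / 2" using stu(4) unfolding mem_ball by linarith
      moreover have "dist (\<gamma> u) z \<le> dist (\<gamma> s) (\<gamma> u) + dist (\<gamma> s) z"
        using dist_triangle[of "\<gamma> u" z "\<gamma> s"] by (simp only: dist_commute)
      ultimately have "dist (\<gamma> u) z < \<delta>'" using stu(5) by argo
      then show "z \<in> ball (\<gamma> u) \<delta>'" by simp
    qed
    have b2: "cball (\<gamma> s) (\<delta> + dist (\<gamma> s) (\<gamma> t)) \<subseteq> f ` D"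
    proof
      fix z assume "z \<in> cball (\<gamma> s) (\<delta> + dist (\<gamma> s) (\<gamma> t))"
      then have "z \<in> cball (\<gamma> s) \<delta>'" using stu(4) \<delta> unfolding mem_cball by argo
      then show "z \<in> f ` D" using sub[OF stu(1)] by blast
    qed
    have "ennreal (norm (avg_g \<delta> (\<gamma> t) - avg_g \<delta> (\<gamma> s))) \<le> ennreal (dist (\<gamma> s) (\<gamma> t)) * ((\<integral>\<^sup>+ z\<in>ball (\<gamma> s) (\<delta> + dist (\<gamma> s) (\<gamma> t)). G z \<partial>lborel) / ennreal (unit_ball_vol 2 * \<delta>\<^sup>2))"
      by (rule avg_g_increment[OF \<delta>(1) b2])
    also have "\<dots> \<le> ennreal (dist (\<gamma> s) (\<gamma> t)) * H (\<gamma> u)"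
      unfolding Heq by (intro mult_left_mono divide_right_mono_ennreal nn_integral_mono) (use b1 in \<open>auto simp: indicator_def\<close>)
    finally show "ennreal (norm (avg_g \<delta> (\<gamma> t) - avg_g \<delta> (\<gamma> s))) \<le> ennreal (dist (\<gamma> s) (\<gamma> t)) * H (\<gamma> u)" .
  qed
  also have "\<dots> = c * (\<integral>\<^sup>+ t\<in>{a<..b}. ballavg \<delta>' G (\<gamma> t) * indicator {0..1} t \<partial>interval_measure (length_fun \<gamma>))"
  proof -
    have \<gamma>: "continuous_on {0..1} \<gamma>" using rect by (auto simp: loc_rectifiable_def path_def)
    have "(\<lambda>t. (ballavg \<delta>' G (\<gamma> t) * indicator {0..1} t) * indicator {a<..b} t) \<in> borel_measurable (interval_measure (length_fun \<gamma>))"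
      using borel_measurable_on_path[OF \<gamma> bm] unfolding measurable_cong_sets[OF sets_interval_measure refl] by measurable
    from nn_integral_cmult[OF this, of c] show ?thesis by (simp add: H_def mult.assoc)
  qed
  finally show ?thesis unfolding c_def .
qed

section \<open>Exhaustion of the image and passage to the limit\<close>

text \<open>Compact exhaustion by distance to the complement. The margins 2/(k + 1) here and 1/(k +
  1) in \<open>exh'\<close> leave room for balls of radius 1/(k + 1) about the smaller set inside
  the larger one.\<close>

definition exh :: "nat \<Rightarrow> R2 set" where
  "exh k = {y. \<forall>z\<in>- (f ` D). 2 / (real k + 1) \<le> dist y z}"

definition exh' :: "nat \<Rightarrow> R2 set" where
  "exh' k = {y. \<forall>z\<in>- (f ` D). 1 / (real k + 1) \<le> dist y z}"

lemma compact_dist_set: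
  assumes "0 < c"
  shows "compact {y. \<forall>z\<in>- (f ` D). c \<le> dist y z}" "{y. \<forall>z\<in>- (f ` D). c \<le> dist y z} \<subseteq> f ` D"
proof -
  show sub: "{y. \<forall>z\<in>- (f ` D). c \<le> dist y z} \<subseteq> f ` D"
  proof
    fix y assume y: "y \<in> {y. \<forall>z\<in>- (f ` D). c \<le> dist y z}"
    show "y \<in> f ` D"
    proof (rule ccontr)
      assume "y \<notin> f ` D"
      then have "c \<le> dist y y" using y by blast
      then show False using assms by simp
    qed
  qed
  have "{y. \<forall>z\<in>- (f ` D). c \<le> dist y z} = (\<Inter>z\<in>- (f ` D). {y. c \<le> dist y z})" by auto
  moreover have "closed \<dots>" by (intro closed_INT ballI closed_Collect_le continuous_intros)
  ultimately show "compact {y. \<forall>z\<in>- (f ` D). c \<le> dist y z}"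
    using bounded_subset[OF bounded_image sub] by (simp add: compact_eq_bounded_closed)
qed

lemma exh_props: "compact (exh k)" "exh k \<subseteq> f ` D" "compact (exh' k)" "exh' k \<subseteq> f ` D"
  unfolding exh_def exh'_def by (intro compact_dist_set; simp)+

lemma exh_nbhd: "w \<in> exh k \<Longrightarrow> ball w (1 / (real k + 1)) \<subseteq> exh' k"
proof
  fix y assume w: "w \<in> exh k" and y: "y \<in> ball w (1 / (real k + 1))"
  have "1 / (real k + 1) \<le> dist y z" if "z \<in> - (f ` D)" for z
  proof -
    have "2 / (real k + 1) \<le> dist w z" using w that by (auto simp: exh_def)
    moreover have "2 / (real k + 1) = 1 / (real k + 1) + 1 / (real k + 1)" by simp
    ultimately show ?thesis using y dist_triangle[of w z y] unfolding mem_ball by linarith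
  qed
  then show "y \<in> exh' k" by (simp add: exh'_def)
qed

lemma exh_cball:
  assumes "w \<in> exh k" "r \<le> 1 / (real k + 1)"
  shows "cball w r \<subseteq> f ` D"
proof
  fix y assume y: "y \<in> cball w r"
  show "y \<in> f ` D"
  proof (rule ccontr)
    assume "y \<notin> f ` D"
    then have "2 / (real k + 1) \<le> dist w y" using assms(1) by (auto simp: exh_def)
    moreover have "dist w y \<le> 1 / (real k + 1)" using y assms(2) by simp
    moreover have "1 / (real k + 1) < 2 / (real k + 1)" by (simp add: divide_strict_right_mono)
    ultimately show False by linarith
  qed
qed

lemma exh_covers:
  assumes "compact K" "K \<subseteq> f ` D"
  shows "\<exists>k0. \<forall>k\<ge>k0. K \<subseteq> exh k"
proof -
  obtain d where d: "d > 0" "(\<Union>x\<in>K. ball x d) \<subseteq> f ` D"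
    using compact_subset_open_imp_ball_epsilon_subset[OF assms(1) open_fD assms(2)] by metis
  obtain k0 :: nat where k0: "2 / d < real k0" using reals_Archimedean2 by blast
  have "K \<subseteq> exh k" if "k \<ge> k0" for k
  proof
    fix y assume y: "y \<in> K"
    have "2 / (real k + 1) \<le> d"
    proof -
      have "2 / d < real k + 1" using k0 that by simp
      then show ?thesis using d(1) by (simp add: field_simps)
    qed
    moreover have "d \<le> dist y z" if "z \<in> - (f ` D)" for z
    proof (rule ccontr)
      assume "\<not> d \<le> dist y z"
      then have "z \<in> (\<Union>x\<in>K. ball x d)" using y by (intro UN_I[of y]) auto
      then show False using d(2) that by blast
    qed
    ultimately show "y \<in> exh k" by (force simp: exh_def)
  qed
  then show ?thesis by blast
qed

text \<open>The averages of \<open>g\<close> converge to \<open>g\<close> at every point of the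
  curve, the averages of \<open>G\<close> exceed \<open>G\<close> by an amount whose line integral
  tends to 0, and the ratio of the areas tends to 1. The finite line integral of \<open>G\<close>
  allows the limit to be taken in real numbers.\<close>

lemma upper_gradient_limit:
  assumes rect: "loc_rectifiable \<gamma>" and img: "\<And>t. t \<in> {0..1} \<Longrightarrow> \<gamma> t \<in> f ` D"
    and LG: "line_integral G \<gamma> < \<infinity>"
    and \<delta>': "\<And>k. 0 < \<delta>' k \<and> \<delta>' k \<le> 1 / (real k + 1)"
    and ex: "\<And>k. k \<ge> k0 \<Longrightarrow> line_integral (\<lambda>y. ballavg (\<delta>' k) G y - G y) \<gamma> \<le> ennreal (err k)"
    and err: "err \<longlonglongrightarrow> 0" "\<And>k. 0 \<le> err k"
    and ab: "0 \<le> a" "a \<le> b" "b \<le> 1"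
  shows "ennreal (norm (g (\<gamma> b) - g (\<gamma> a))) \<le> (\<integral>\<^sup>+ t\<in>{a<..b}. G (\<gamma> t) * indicator {0..1} t \<partial>interval_measure (length_fun \<gamma>))"
proof -
  let ?\<mu> = "interval_measure (length_fun \<gamma>)"
  let ?I = "\<integral>\<^sup>+ t\<in>{a<..b}. G (\<gamma> t) * indicator {0..1} t \<partial>?\<mu>"
  have \<gamma>: "continuous_on {0..1} \<gamma>" using rect by (auto simp: loc_rectifiable_def path_def)
  have "?I \<le> line_integral G \<gamma>" unfolding line_integral_def by (rule nn_integral_mono) (auto simp: indicator_def)
  then have "?I < top" using LG by (simp add: le_less_trans)
  then obtain A where A: "?I = ennreal A" "0 \<le> A" by (cases ?I) auto
  have pm: "(\<lambda>t. F (\<gamma> t) * indicator {0..1} t) \<in> borel_measurable ?\<mu>" if "F \<in> borel_measurable borel" for F :: "R2 \<Rightarrow> ennreal"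
    using borel_measurable_on_path[OF \<gamma> that] unfolding measurable_cong_sets[OF sets_interval_measure refl] .
  have cK: "compact (\<gamma> ` {0..1})" by (rule compact_continuous_image[OF \<gamma>]) simp
  obtain k1 where k1: "\<And>k. k \<ge> k1 \<Longrightarrow> \<gamma> ` {0..1} \<subseteq> exh k"
    using exh_covers[OF cK] img by (metis image_subset_iff)
  \<comment> \<open>The inner radius is a fraction of the outer one that tends to 1, so that the
    factor \<open>c k\<close> tends to 1.\<close>
  define \<delta> where "\<delta> k = \<delta>' k * ((real k + 1) / (real k + 2))" for k
  have \<delta>pos: "0 < \<delta> k" "\<delta> k < \<delta>' k" for k
  proof -
    show "0 < \<delta> k" unfolding \<delta>_def using \<delta>'[of k] by (intro mult_pos_pos) auto
    have "\<delta>' k * ((real k + 1) / (real k + 2)) < \<delta>' k * 1" using \<delta>'[of k] by (intro mult_strict_left_mono) auto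
    then show "\<delta> k < \<delta>' k" by (simp add: \<delta>_def)
  qed
  define c where "c k = ((real k + 2) / (real k + 1))\<^sup>2" for k
  have ck: "(\<delta>' k / \<delta> k)\<^sup>2 = c k" for k
  proof -
    have "\<delta>' k / \<delta> k = (real k + 2) / (real k + 1)" using \<delta>'[of k] by (simp add: \<delta>_def)
    then show ?thesis by (simp add: c_def)
  qed
  have bound: "norm (avg_g (\<delta> k) (\<gamma> b) - avg_g (\<delta> k) (\<gamma> a)) \<le> c k * (A + err k)" if k: "k \<ge> max k0 k1" for k
  proof -
    have bm: "ballavg (\<delta>' k) G \<in> borel_measurable borel" using \<delta>'[of k] by (intro ballavg_borel G_borel) auto
    have "ennreal (norm (avg_g (\<delta> k) (\<gamma> b) - avg_g (\<delta> k) (\<gamma> a)))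
      \<le> ennreal ((\<delta>' k / \<delta> k)\<^sup>2) * (\<integral>\<^sup>+ t\<in>{a<..b}. ballavg (\<delta>' k) G (\<gamma> t) * indicator {0..1} t \<partial>?\<mu>)"
    proof (rule avg_g_curve[OF rect \<delta>pos _ ab])
      fix t :: real assume "t \<in> {0..1}"
      then have "\<gamma> t \<in> exh k" using k1[of k] k by auto
      then show "cball (\<gamma> t) (\<delta>' k) \<subseteq> f ` D" by (rule exh_cball) (use \<delta>' in auto)
    qed
    also have "\<dots> \<le> ennreal (c k) * (\<integral>\<^sup>+ t. (G (\<gamma> t) * indicator {0..1} t) * indicator {a<..b} t + (ballavg (\<delta>' k) G (\<gamma> t) - G (\<gamma> t)) * indicator {0..1} t \<partial>?\<mu>)"
      unfolding ck
    proof (intro mult_left_mono nn_integral_mono)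
      fix t
      have "ballavg (\<delta>' k) G (\<gamma> t) \<le> G (\<gamma> t) + (ballavg (\<delta>' k) G (\<gamma> t) - G (\<gamma> t))"
      proof (cases "G (\<gamma> t) \<le> ballavg (\<delta>' k) G (\<gamma> t)")
        case True then show ?thesis by (simp add: add_diff_inverse_ennreal)
      qed (simp add: add_increasing2)
      then show "ballavg (\<delta>' k) G (\<gamma> t) * indicator {0..1} t * indicator {a<..b} t \<le> (G (\<gamma> t) * indicator {0..1} t) * indicator {a<..b} t + (ballavg (\<delta>' k) G (\<gamma> t) - G (\<gamma> t)) * indicator {0..1} t"
        by (auto simp: indicator_def)
    qed simp
    also have "\<dots> = ennreal (c k) * (?I + line_integral (\<lambda>y. ballavg (\<delta>' k) G y - G y) \<gamma>)"
    proof -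
      have m1: "(\<lambda>t. (G (\<gamma> t) * indicator {0..1} t) * indicator {a<..b} t) \<in> borel_measurable ?\<mu>"
        by (rule borel_measurable_times_ennreal[OF pm[OF G_borel]]) simp
      have m2: "(\<lambda>t. (ballavg (\<delta>' k) G (\<gamma> t) - G (\<gamma> t)) * indicator {0..1} t) \<in> borel_measurable ?\<mu>"
        by (rule pm[of "\<lambda>y. ballavg (\<delta>' k) G y - G y"]) (use bm in measurable)
      show ?thesis unfolding line_integral_def nn_integral_add[OF m1 m2] ..
    qed
    also have "\<dots> \<le> ennreal (c k) * (ennreal A + ennreal (err k))"
      unfolding A(1) using ex[of k] k by (intro mult_left_mono add_left_mono) auto
    also have "\<dots> = ennreal (c k * (A + err k))"
    proof -
      have "ennreal (c k * (A + err k)) = ennreal (c k) * ennreal (A + err k)"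
        using A err(2)[of k] by (intro ennreal_mult) (auto simp: c_def)
      also have "ennreal (A + err k) = ennreal A + ennreal (err k)" using A err(2)[of k] by (intro ennreal_plus) auto
      finally show ?thesis by simp
    qed
    finally have *: "ennreal (norm (avg_g (\<delta> k) (\<gamma> b) - avg_g (\<delta> k) (\<gamma> a))) \<le> ennreal (c k * (A + err k))" .
    have "0 \<le> c k * (A + err k)" using A err(2)[of k] by (auto simp: c_def)
    then show ?thesis using * by (simp only: ennreal_le_iff)
  qed
  have \<delta>0: "\<delta>' \<longlonglongrightarrow> 0"
  proof (rule tendsto_sandwich[of "\<lambda>_. 0" \<delta>' _ "\<lambda>k. 1 / (real k + 1)"])
    show "(\<lambda>k. 1 / (real k + 1)) \<longlonglongrightarrow> 0" using LIMSEQ_inverse_real_of_nat by (simp add: inverse_eq_divide add.commute)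
  qed (use \<delta>' in \<open>auto intro!: always_eventually simp: less_imp_le\<close>)
  have lim: "(\<lambda>k. avg_g (\<delta> k) (\<gamma> t)) \<longlonglongrightarrow> g (\<gamma> t)" if t: "t \<in> {0..1}" for t
  proof (rule LIMSEQ_I)
    fix e :: real assume "e > 0"
    have "continuous (at (\<gamma> t)) g" using continuous_on_eq_continuous_at[OF open_fD, of g] cont_g img[OF t] by blast
    then obtain d where d: "d > 0" "\<And>z. dist z (\<gamma> t) < d \<Longrightarrow> dist (g z) (g (\<gamma> t)) < e/2"
      unfolding continuous_at_eps_delta using \<open>e > 0\<close> by (meson half_gt_zero)
    have "eventually (\<lambda>k. \<delta>' k < d) sequentially" using \<delta>0 d(1) by (rule order_tendstoD)
    then have "eventually (\<lambda>k. \<delta>' k < d \<and> k \<ge> k1) sequentially"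
      by (rule eventually_conj[OF _ eventually_ge_at_top])
    then obtain no where no: "\<And>k. k \<ge> no \<Longrightarrow> \<delta>' k < d \<and> k \<ge> k1" unfolding eventually_sequentially by blast
    have "norm (avg_g (\<delta> k) (\<gamma> t) - g (\<gamma> t)) < e" if "k \<ge> no" for k
    proof -
      have "norm (avg_g (\<delta> k) (\<gamma> t) - g (\<gamma> t)) \<le> e/2"
      proof (rule avg_g_tendsto[OF \<delta>pos(1)])
        have "\<gamma> t \<in> exh k" using k1[of k] no[OF that] t by auto
        then show "cball (\<gamma> t) (\<delta> k) \<subseteq> f ` D" by (rule exh_cball) (use \<delta>'[of k] \<delta>pos[of k] in auto)
        fix z assume "z \<in> ball (\<gamma> t) (\<delta> k)"
        then have "dist z (\<gamma> t) < d" using \<delta>pos[of k] no[OF that] by (simp add: dist_commute)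
        then show "norm (g z - g (\<gamma> t)) \<le> e/2" using d(2)[of z] by (simp add: dist_norm)
      qed
      then show ?thesis using \<open>e > 0\<close> by simp
    qed
    then show "\<exists>no. \<forall>k\<ge>no. norm (avg_g (\<delta> k) (\<gamma> t) - g (\<gamma> t)) < e" by blast
  qed
  have l1: "(\<lambda>k. norm (avg_g (\<delta> k) (\<gamma> b) - avg_g (\<delta> k) (\<gamma> a))) \<longlonglongrightarrow> norm (g (\<gamma> b) - g (\<gamma> a))"
    by (intro tendsto_norm tendsto_diff lim) (use ab in auto)
  have c1: "c \<longlonglongrightarrow> 1"
  proof -
    have "(\<lambda>k. 1 + 1 / (real k + 1)) \<longlonglongrightarrow> 1 + 0"
      by (intro tendsto_add tendsto_const) (use LIMSEQ_inverse_real_of_nat in \<open>simp add: inverse_eq_divide add.commute\<close>)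
    from tendsto_power[OF this, of 2] have "(\<lambda>k. (1 + 1 / (real k + 1))\<^sup>2) \<longlonglongrightarrow> 1" by simp
    moreover have "c k = (1 + 1 / (real k + 1))\<^sup>2" for k by (simp add: c_def field_simps)
    ultimately show ?thesis by presburger
  qed
  have "(\<lambda>k. c k * (A + err k)) \<longlonglongrightarrow> 1 * (A + 0)" by (intro tendsto_intros c1 err)
  then have "norm (g (\<gamma> b) - g (\<gamma> a)) \<le> 1 * (A + 0)"
    by (rule LIMSEQ_le[OF l1]) (use bound in blast)
  then show ?thesis unfolding A(1) by (simp add: ennreal_leI)
qed

end

lemma line_integral_mono:
  assumes "\<And>t. t \<in> {0..1} \<Longrightarrow> F (\<gamma> t) \<le> F' (\<gamma> t)"
  shows "line_integral F \<gamma> \<le> line_integral F' \<gamma>"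
  unfolding line_integral_def by (rule nn_integral_mono) (use assms in \<open>auto simp: indicator_def\<close>)

lemma line_integral_cmult:
  assumes \<gamma>: "continuous_on {0..1} \<gamma>" and F: "F \<in> borel_measurable borel"
  shows "line_integral (\<lambda>y. c * F y) \<gamma> = c * line_integral F \<gamma>"
proof -
  have "(\<lambda>t. F (\<gamma> t) * indicator {0..1} t) \<in> borel_measurable (interval_measure (length_fun \<gamma>))"
    using borel_measurable_on_path[OF \<gamma> F] unfolding measurable_cong_sets[OF sets_interval_measure refl] .
  from nn_integral_cmult[OF this, of c] show ?thesis by (simp add: line_integral_def mult.assoc)
qed

lemma ennreal_le_suminf: "(F k :: ennreal) \<le> (\<Sum>i. F i)"
  using sum_le_suminf[of F "{k}"] by simp

lemma enn_powr_root:
  assumes "0 < a" "0 \<le> c"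
  shows "enn_powr (ennreal c * enn_powr x a) (1/a) = ennreal (c powr (1/a)) * x"
  using assms by (simp add: enn_powr_mult enn_powr_inverse enn_powr_ennreal)

section \<open>Fuglede's argument and admissibility\<close>

context W11_upper_gradient begin

text \<open>The change of variables is applied with the indicator of the compact preimage of
  \<open>C\<close>, over which \<open>K_I\<close> is integrable.\<close>

lemma G_locally_Lp:
  assumes a: "1 < a" and K: "\<And>C. compact C \<Longrightarrow> C \<subseteq> D \<Longrightarrow> (\<integral>\<^sup>+ x\<in>C. K_I D Df a x \<partial>lborel) < \<infinity>"
    and C: "compact C" "C \<subseteq> f ` D"
  shows "(\<integral>\<^sup>+ y\<in>C. enn_powr (G y) a \<partial>lborel) < \<infinity>"
proof -
  have gC: "compact (g ` C)" by (rule compact_continuous_image[OF continuous_on_subset[OF cont_g C(2)] C(1)])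
  have gCD: "g ` C \<subseteq> D" using gD C(2) by blast
  have gCb: "g ` C \<in> sets borel" using gC by (simp add: borel_compact)
  have "(\<integral>\<^sup>+ y\<in>C. enn_powr (G y) a \<partial>lborel) \<le> (\<integral>\<^sup>+ y. enn_powr (indicator (g ` C) (g y) * G y) a \<partial>lborel)"
    by (rule nn_integral_mono) (auto simp: indicator_def)
  also have "\<dots> \<le> (\<integral>\<^sup>+ x\<in>D. K_I D Df a x * enn_powr (indicator (g ` C) x) a \<partial>lborel)"
    by (rule nn_integral_comp_powr_le[OF _ a]) (use gCb in simp)
  also have "\<dots> \<le> (\<integral>\<^sup>+ x\<in>g ` C. K_I D Df a x \<partial>lborel)"
  proof (rule nn_integral_mono)
    fix x
    have "enn_powr (1::ennreal) a = 1" using enn_powr_ennreal[of 1 a] by simp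
    then show "K_I D Df a x * enn_powr (indicator (g ` C) x) a * indicator D x \<le> K_I D Df a x * indicator (g ` C) x"
      using gCD by (auto simp: indicator_def)
  qed
  also have "\<dots> < \<infinity>" by (rule K[OF gC gCD])
  finally show ?thesis .
qed

text \<open>\<open>H\<close> is a single integrable function that detects exceptional curves: if the
  a-th root of \<open>H\<close> has finite integral along a rectifiable curve in the image, then the
  line integrals of the excesses of the ball averages decay geometrically, by the first family of
  bounds, and \<open>G\<close> has finite line integral, by the second. Each family contributes a
  geometric series with sum 2, hence the 4.\<close>

lemma exceptional_weight:
  assumes a: "1 < a" and K: "\<And>C. compact C \<Longrightarrow> C \<subseteq> D \<Longrightarrow> (\<integral>\<^sup>+ x\<in>C. K_I D Df a x \<partial>lborel) < \<infinity>"
  shows "\<exists>H \<delta>' d. H \<in> borel_measurable borel \<and> (\<integral>\<^sup>+ y. H y \<partial>lborel) \<le> 4 \<and>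
    (\<forall>k. 0 < \<delta>' k \<and> \<delta>' k \<le> 1 / (real k + 1)) \<and> (\<forall>k::nat. 0 < (d k :: real)) \<and>
    (\<forall>k. \<forall>y\<in>exh k. ennreal (2^k) * enn_powr (ballavg (\<delta>' k) G y - G y) a \<le> H y) \<and>
    (\<forall>k. \<forall>y\<in>exh k. ennreal (d k) * enn_powr (G y) a \<le> H y)"
proof -
  have eb: "exh k \<in> sets borel" for k using exh_props by (simp add: borel_compact)
  have fin: "(\<integral>\<^sup>+ y\<in>exh k. enn_powr (G y) a \<partial>lborel) < \<infinity>" for k
    by (rule G_locally_Lp[OF a K]) (use exh_props in auto)
  \<comment> \<open>The excess is made as small as 4^(-k), so that its integral is still summable
    after weighting by 2^k.\<close>
  have ex\<delta>: "\<exists>\<delta>. 0 < \<delta> \<and> \<delta> \<le> 1 / (real k + 1) \<and> (\<integral>\<^sup>+ w\<in>exh k. enn_powr (ballavg \<delta> G w - G w) a \<partial>lborel) \<le> ennreal ((1/4)^k)" for k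
  proof -
    have "(\<integral>\<^sup>+ x\<in>(\<Union>w\<in>exh k. ball w (1 / (real k + 1))). enn_powr (G x) a \<partial>lborel) \<le> (\<integral>\<^sup>+ x\<in>exh' k. enn_powr (G x) a \<partial>lborel)"
    proof (rule nn_integral_mono)
      have sub: "(\<Union>w\<in>exh k. ball w (1 / (real k + 1))) \<subseteq> exh' k" using exh_nbhd by blast
      show "enn_powr (G x) a * indicator (\<Union>w\<in>exh k. ball w (1 / (real k + 1))) x \<le> enn_powr (G x) a * indicator (exh' k) x" for x
        by (intro mult_left_mono indicator_leI subsetD[OF sub]) simp_all
    qed
    also have "\<dots> < \<infinity>" by (rule G_locally_Lp[OF a K]) (use exh_props in auto)
    finally have f: "(\<integral>\<^sup>+ x\<in>(\<Union>w\<in>exh k. ball w (1 / (real k + 1))). enn_powr (G x) a \<partial>lborel) < \<infinity>" .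
    have "\<exists>\<rho>0>0. \<rho>0 \<le> 1 / (real k + 1) \<and> (\<forall>\<delta>. 0 < \<delta> \<and> \<delta> < \<rho>0 \<longrightarrow> (\<integral>\<^sup>+ w\<in>exh k. enn_powr (ballavg \<delta> G w - G w) a \<partial>lborel) \<le> ennreal ((1/4)^k))"
      by (rule ballavg_excess_small[OF G_borel exh_props(1) _ a _ f]) auto
    then obtain \<rho>0 where r: "\<rho>0 > 0" "\<rho>0 \<le> 1 / (real k + 1)"
      "\<And>\<delta>. 0 < \<delta> \<Longrightarrow> \<delta> < \<rho>0 \<Longrightarrow> (\<integral>\<^sup>+ w\<in>exh k. enn_powr (ballavg \<delta> G w - G w) a \<partial>lborel) \<le> ennreal ((1/4)^k)" by blast
    show ?thesis by (rule exI[of _ "\<rho>0/2"]) (use r(1,2) r(3)[of "\<rho>0/2"] in auto)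
  qed
  obtain \<delta>' where \<delta>': "\<And>k. 0 < \<delta>' k \<and> \<delta>' k \<le> 1 / (real k + 1)"
    "\<And>k. (\<integral>\<^sup>+ w\<in>exh k. enn_powr (ballavg (\<delta>' k) G w - G w) a \<partial>lborel) \<le> ennreal ((1/4)^k)"
    using choice[of "\<lambda>k \<delta>. 0 < \<delta> \<and> \<delta> \<le> 1 / (real k + 1) \<and> (\<integral>\<^sup>+ w\<in>exh k. enn_powr (ballavg \<delta> G w - G w) a \<partial>lborel) \<le> ennreal ((1/4)^k)"] ex\<delta> by auto
  define I where "I k = enn2real (\<integral>\<^sup>+ y\<in>exh k. enn_powr (G y) a \<partial>lborel)" for k
  have I: "(\<integral>\<^sup>+ y\<in>exh k. enn_powr (G y) a \<partial>lborel) = ennreal (I k)" "0 \<le> I k" for k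
    using fin[of k] by (auto simp: I_def)
  \<comment> \<open>The k-th weighted integral of G^a becomes at most 2^(-k); the added 1 avoids
    division by 0.\<close>
  define d where "d k = (1/2)^k / (1 + I k)" for k
  have d: "0 < d k" for k using I(2)[of k] by (simp add: d_def add_pos_nonneg)
  let ?X = "\<lambda>k y. ballavg (\<delta>' k) G y - G y"
  define H1 where "H1 k y = ennreal (2^k) * (enn_powr (?X k y) a * indicator (exh k) y)" for k y
  define H2 where "H2 k y = ennreal (d k) * (enn_powr (G y) a * indicator (exh k) y)" for k y
  have Xm: "?X k \<in> borel_measurable borel" for k
    by (rule borel_measurable_minus_ennreal[OF ballavg_borel[OF conjunct1[OF \<delta>'(1)] G_borel] G_borel])
  have X1: "(\<lambda>y. enn_powr (?X k y) a * indicator (exh k) y) \<in> borel_measurable borel" for k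
    using borel_measurable_enn_powr[OF Xm[of k], of a] eb[of k] by measurable
  have X2: "(\<lambda>y. enn_powr (G y) a * indicator (exh k) y) \<in> borel_measurable borel" for k
    using borel_measurable_enn_powr[OF G_borel, of a] eb[of k] by measurable
  have H1m: "H1 k \<in> borel_measurable borel" for k unfolding H1_def using X1[of k] by measurable
  have H2m: "H2 k \<in> borel_measurable borel" for k unfolding H2_def using X2[of k] by measurable
  define H where "H y = (\<Sum>k. H1 k y) + (\<Sum>k. H2 k y)" for y
  have Hm: "H \<in> borel_measurable borel" unfolding H_def using H1m H2m by measurable
  have geo: "(\<Sum>k. ennreal ((1/2)^k)) = 2"
  proof -
    have "(\<lambda>k. (1/2::real)^k) sums (1 / (1 - 1/2))" by (rule geometric_sums) simp
    then have "(\<Sum>k. ennreal ((1/2)^k)) = ennreal (1 / (1 - 1/2))" by (intro suminf_ennreal_eq) auto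
    then show ?thesis by simp
  qed
  have "(\<integral>\<^sup>+ y. H y \<partial>lborel) = (\<integral>\<^sup>+ y. (\<Sum>k. H1 k y) \<partial>lborel) + (\<integral>\<^sup>+ y. (\<Sum>k. H2 k y) \<partial>lborel)"
    unfolding H_def by (rule nn_integral_add) (use H1m H2m in measurable)
  also have "(\<integral>\<^sup>+ y. (\<Sum>k. H1 k y) \<partial>lborel) = (\<Sum>k. \<integral>\<^sup>+ y. H1 k y \<partial>lborel)" by (rule nn_integral_suminf) (use H1m in simp)
  also have "(\<integral>\<^sup>+ y. (\<Sum>k. H2 k y) \<partial>lborel) = (\<Sum>k. \<integral>\<^sup>+ y. H2 k y \<partial>lborel)" by (rule nn_integral_suminf) (use H2m in simp)
  also have "(\<Sum>k. \<integral>\<^sup>+ y. H1 k y \<partial>lborel) \<le> (\<Sum>k. ennreal ((1/2)^k))"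
  proof (intro suminf_le summableI)
    fix k
    have "(\<integral>\<^sup>+ y. H1 k y \<partial>lborel) = ennreal (2^k) * (\<integral>\<^sup>+ y\<in>exh k. enn_powr (?X k y) a \<partial>lborel)"
      unfolding H1_def by (rule nn_integral_cmult) (use X1 in simp)
    also have "\<dots> \<le> ennreal (2^k) * ennreal ((1/4)^k)" by (intro mult_left_mono \<delta>') simp
    also have "\<dots> = ennreal ((1/2)^k)"
      by (subst ennreal_mult[symmetric]) (auto simp: power_mult_distrib[symmetric])
    finally show "(\<integral>\<^sup>+ y. H1 k y \<partial>lborel) \<le> ennreal ((1/2)^k)" .
  qed
  also have "(\<Sum>k. \<integral>\<^sup>+ y. H2 k y \<partial>lborel) \<le> (\<Sum>k. ennreal ((1/2)^k))"
  proof (intro suminf_le summableI)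
    fix k
    have "(\<integral>\<^sup>+ y. H2 k y \<partial>lborel) = ennreal (d k) * ennreal (I k)"
      unfolding H2_def I(1)[symmetric] by (rule nn_integral_cmult) (use X2 in simp)
    also have "\<dots> = ennreal (d k * I k)" using d[of k] I(2)[of k] by (subst ennreal_mult) auto
    also have "\<dots> \<le> ennreal ((1/2)^k)"
    proof (rule ennreal_leI)
      have "d k * I k \<le> d k * (1 + I k)" using d[of k] by (intro mult_left_mono) auto
      also have "\<dots> = (1/2)^k" using I(2)[of k] by (simp add: d_def)
      finally show "d k * I k \<le> (1/2)^k" .
    qed
    finally show "(\<integral>\<^sup>+ y. H2 k y \<partial>lborel) \<le> ennreal ((1/2)^k)" .
  qed
  finally have HI: "(\<integral>\<^sup>+ y. H y \<partial>lborel) \<le> 4" unfolding geo by (simp add: add_left_mono add_right_mono)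
  have b1: "ennreal (2^k) * enn_powr (?X k y) a \<le> H y" if "y \<in> exh k" for k y
  proof -
    have "ennreal (2^k) * enn_powr (?X k y) a = H1 k y" using that by (simp add: H1_def)
    also have "\<dots> \<le> (\<Sum>k. H1 k y)" by (rule ennreal_le_suminf)
    finally show ?thesis unfolding H_def by (simp add: add_increasing2)
  qed
  have b2: "ennreal (d k) * enn_powr (G y) a \<le> H y" if "y \<in> exh k" for k y
  proof -
    have "ennreal (d k) * enn_powr (G y) a = H2 k y" using that by (simp add: H2_def)
    also have "\<dots> \<le> (\<Sum>k. H2 k y)" by (rule ennreal_le_suminf)
    finally show ?thesis unfolding H_def by (simp add: add_increasing)
  qed
  show ?thesis
    by (intro exI[of _ H] exI[of _ \<delta>'] exI[of _ d] conjI allI ballI Hm HI d b1 b2) (use \<delta>'(1) in auto)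
qed

text \<open>Instead of discarding a family of modulus zero, \<rho>^a is increased by \<tau> H before
  the root is taken. A curve with infinite integral is admissible for trivial reasons, and
  finiteness supplies what the upper gradient inequality needs. The perturbation costs at most 4
  \<tau>, and \<tau> is arbitrary.\<close>

lemma modulus_le:
  assumes a: "1 < a" and K: "\<And>C. compact C \<Longrightarrow> C \<subseteq> D \<Longrightarrow> (\<integral>\<^sup>+ x\<in>C. K_I D Df a x \<partial>lborel) < \<infinity>"
    and \<epsilon>: "\<epsilon> < \<epsilon>0" and C1: "C1 \<subseteq> cball x0 \<epsilon> \<inter> D" and C2: "C2 \<subseteq> D - ball x0 \<epsilon>0"
    and \<eta>: "\<eta> \<in> borel_measurable borel" "1 \<le> (\<integral>\<^sup>+ r\<in>{\<epsilon><..<\<epsilon>0}. \<eta> r \<partial>lborel)"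
  shows "modulus a ((\<lambda>\<gamma>. f \<circ> \<gamma>) ` joining_paths C1 C2 D)
     \<le> (\<integral>\<^sup>+ x\<in>D. K_I D Df a x * enn_powr (\<eta> (dist x x0) * indicator {\<epsilon><..<\<epsilon>0} (dist x x0)) a \<partial>lborel)"
    (is "_ \<le> ?R")
proof -
  have a0: "0 < a" using a by simp
  define \<theta> where "\<theta> x = \<eta> (dist x x0) * indicator {\<epsilon><..<\<epsilon>0} (dist x x0)" for x :: R2
  have dm: "(\<lambda>x::R2. dist x x0) \<in> borel \<rightarrow>\<^sub>M borel" by (intro borel_measurable_continuous_onI continuous_intros)
  have "(\<lambda>r. \<eta> r * indicator {\<epsilon><..<\<epsilon>0} r) \<in> borel_measurable borel" using \<eta>(1) by measurable
  from measurable_compose[OF dm this] have \<theta>m: "\<theta> \<in> borel_measurable borel" unfolding \<theta>_def .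
  define \<rho> where "\<rho> y = \<theta> (g y) * G y" for y
  have \<rho>m: "\<rho> \<in> borel_measurable borel"
  proof -
    have "(\<lambda>x. \<theta> x * stretch x) \<in> borel_measurable borel" using \<theta>m by measurable
    from comp_g_borel[OF this] show ?thesis unfolding \<rho>_def G_def by (simp add: mult.assoc)
  qed
  have \<rho>I: "(\<integral>\<^sup>+ y. enn_powr (\<rho> y) a \<partial>lborel) \<le> ?R"
    unfolding \<rho>_def using nn_integral_comp_powr_le[OF \<theta>m a] by (simp add: \<theta>_def)
  obtain H \<delta>' d where H: "H \<in> borel_measurable borel" "(\<integral>\<^sup>+ y. H y \<partial>lborel) \<le> 4"
    "\<And>k. 0 < \<delta>' k \<and> \<delta>' k \<le> 1 / (real k + 1)" "\<And>k::nat. 0 < (d k :: real)"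
    "\<And>k y. y \<in> exh k \<Longrightarrow> ennreal (2^k) * enn_powr (ballavg (\<delta>' k) G y - G y) a \<le> H y"
    "\<And>k y. y \<in> exh k \<Longrightarrow> ennreal (d k) * enn_powr (G y) a \<le> H y"
    using exceptional_weight[OF a K] by blast
  have main: "modulus a ((\<lambda>\<gamma>. f \<circ> \<gamma>) ` joining_paths C1 C2 D) \<le> ?R + ennreal (4 * \<tau>)" if \<tau>: "\<tau> > 0" for \<tau>
  proof -
    define Z where "Z y = enn_powr (\<rho> y) a + ennreal \<tau> * H y" for y
    define \<rho>' where "\<rho>' y = enn_powr (Z y) (1/a)" for y
    have Zm: "Z \<in> borel_measurable borel" unfolding Z_def using borel_measurable_enn_powr[OF \<rho>m, of a] H(1) by measurable
    have \<rho>'m: "\<rho>' \<in> borel_measurable borel" unfolding \<rho>'_def by (rule borel_measurable_enn_powr[OF Zm])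
    have a1: "0 < 1/a" using a0 by simp
    have ge\<rho>: "\<rho> y \<le> \<rho>' y" for y
    proof -
      have "\<rho> y = enn_powr (enn_powr (\<rho> y) a) (1/a)" using enn_powr_inverse(1)[OF a0] by simp
      also have "\<dots> \<le> \<rho>' y" unfolding \<rho>'_def by (rule enn_powr_mono[OF _ a1]) (simp add: Z_def add_increasing2)
      finally show ?thesis .
    qed
    \<comment> \<open>Whatever has a multiple of its a-th power below \<open>H\<close> is itself, up
      to a factor, below \<open>\<rho>'\<close>; this turns the bounds by \<open>H\<close> into
      bounds on line integrals.\<close>
    have ge: "ennreal ((\<tau> * c) powr (1/a)) * x \<le> \<rho>' y" if c: "0 < c" "ennreal c * enn_powr x a \<le> H y" for c x y
    proof -
      have "ennreal ((\<tau> * c) powr (1/a)) * x = enn_powr (ennreal (\<tau> * c) * enn_powr x a) (1/a)"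
        using \<tau> c by (intro enn_powr_root[symmetric] a0) auto
      also have "ennreal (\<tau> * c) * enn_powr x a = ennreal \<tau> * (ennreal c * enn_powr x a)"
        using \<tau> c by (simp add: ennreal_mult mult.assoc)
      also have "enn_powr \<dots> (1/a) \<le> \<rho>' y" unfolding \<rho>'_def
      proof (rule enn_powr_mono[OF _ a1])
        have "ennreal \<tau> * (ennreal c * enn_powr x a) \<le> ennreal \<tau> * H y" by (rule mult_left_mono[OF c(2)]) simp
        then show "ennreal \<tau> * (ennreal c * enn_powr x a) \<le> Z y" unfolding Z_def by (simp add: add_increasing)
      qed
      finally show ?thesis .
    qed
    have adm: "admissible ((\<lambda>\<gamma>. f \<circ> \<gamma>) ` joining_paths C1 C2 D) \<rho>'"
      unfolding admissible_def
    proof (intro conjI ballI impI \<rho>'m)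
      fix \<gamma> assume "\<gamma> \<in> (\<lambda>\<gamma>. f \<circ> \<gamma>) ` joining_paths C1 C2 D" and rect: "loc_rectifiable \<gamma>"
      then obtain \<gamma>0 where \<gamma>0: "\<gamma> = f \<circ> \<gamma>0" "path \<gamma>0" "\<gamma>0 0 \<in> C1" "\<gamma>0 1 \<in> C2" "\<forall>t\<in>{0<..<1}. \<gamma>0 t \<in> D"
        by (auto simp: joining_paths_def)
      have inD: "\<gamma>0 t \<in> D" if "t \<in> {0..1}" for t
      proof -
        consider "t = 0" | "t = 1" | "t \<in> {0<..<1}" using \<open>t \<in> {0..1}\<close> by force
        then show ?thesis using \<gamma>0 C1 C2 by cases auto
      qed
      have img: "\<gamma> t \<in> f ` D" if "t \<in> {0..1}" for t using inD[OF that] by (simp add: \<gamma>0(1))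
      have g\<gamma>: "g (\<gamma> t) = \<gamma>0 t" if "t \<in> {0..1}" for t using gf[OF inD[OF that]] by (simp add: \<gamma>0(1))
      have \<gamma>c: "continuous_on {0..1} \<gamma>" using rect by (auto simp: loc_rectifiable_def path_def)
      have \<gamma>0c: "continuous_on {0..1} \<gamma>0" using \<gamma>0(2) by (simp add: path_def)
      show "1 \<le> line_integral \<rho>' \<gamma>"
      proof (cases "line_integral \<rho>' \<gamma>")
        case top then show ?thesis by simp
      next
        case (real L)
        have cK: "compact (\<gamma> ` {0..1})" by (rule compact_continuous_image[OF \<gamma>c]) simp
        obtain k0 where k0: "\<And>k. k \<ge> k0 \<Longrightarrow> \<gamma> ` {0..1} \<subseteq> exh k"
          using exh_covers[OF cK] img by (metis image_subset_iff)
        have bnd: "line_integral F \<gamma> \<le> ennreal (L / c')" if c': "c' > 0" and F: "F \<in> borel_measurable borel" and le: "\<And>t. t \<in> {0..1} \<Longrightarrow> ennreal c' * F (\<gamma> t) \<le> \<rho>' (\<gamma> t)" for F c'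
        proof -
          have "ennreal c' * line_integral F \<gamma> \<le> ennreal L"
            unfolding real(2)[symmetric] line_integral_cmult[OF \<gamma>c F, symmetric] by (rule line_integral_mono) (rule le)
          then have "line_integral F \<gamma> * ennreal c' / ennreal c' \<le> ennreal L / ennreal c'"
            by (intro divide_right_mono_ennreal) (simp add: mult.commute)
          moreover have "line_integral F \<gamma> * ennreal c' / ennreal c' = line_integral F \<gamma>"
            by (rule mult_divide_eq_ennreal) (use c' in auto)
          moreover have "ennreal L / ennreal c' = ennreal (L / c')" using c' real by (intro divide_ennreal) auto
          ultimately show ?thesis by simp
        qed
        have LG: "line_integral G \<gamma> < \<infinity>"
        proof -
          have "line_integral G \<gamma> \<le> ennreal (L / ((\<tau> * d k0) powr (1/a)))"
          proof (rule bnd)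
            show "0 < (\<tau> * d k0) powr (1/a)" using \<tau> H(4)[of k0] by simp
            fix t :: real assume "t \<in> {0..1}"
            then have "\<gamma> t \<in> exh k0" using k0[of k0] by auto
            from ge[OF H(4) H(6)[OF this]] show "ennreal ((\<tau> * d k0) powr (1/a)) * G (\<gamma> t) \<le> \<rho>' (\<gamma> t)" .
          qed (rule G_borel)
          then show ?thesis by (simp add: le_less_trans)
        qed
        \<comment> \<open>The weight 2^k turns the finite integral \<open>L\<close> into an error
          that decays like 2^(-k/a).\<close>
        define err where "err k = L / ((\<tau> * 2^k) powr (1/a))" for k :: nat
        have err0: "0 \<le> err k" for k using real by (simp add: err_def)
        have errlim: "err \<longlonglongrightarrow> 0"
        proof -
          define q where "q = (1/2::real) powr (1/a)"
          have q: "0 < q" "q < 1" unfolding q_def using powr_less_mono2[of "1/a" "1/2" 1] a0 by auto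
          have eq: "err k = L / \<tau> powr (1/a) * q ^ k" for k
          proof -
            have "q ^ k = ((1/2)^k) powr (1/a)" unfolding q_def by (simp add: powr_power powr_realpow[symmetric] powr_powr mult.commute)
            moreover have "(\<tau> * 2^k) powr (1/a) = \<tau> powr (1/a) * (2^k) powr (1/a)" using \<tau> by (simp add: powr_mult)
            moreover have "((1/2::real)^k) powr (1/a) = 1 / (2^k) powr (1/a)" by (simp add: power_one_over powr_divide)
            ultimately show ?thesis by (simp add: err_def)
          qed
          have "err = (\<lambda>k. L / \<tau> powr (1/a) * q ^ k)" by (rule ext) (rule eq)
          moreover have "(\<lambda>k. L / \<tau> powr (1/a) * q ^ k) \<longlonglongrightarrow> L / \<tau> powr (1/a) * 0"
            by (intro tendsto_mult tendsto_const LIMSEQ_power_zero) (use q in auto)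
          ultimately show ?thesis by simp
        qed
        have ex: "line_integral (\<lambda>y. ballavg (\<delta>' k) G y - G y) \<gamma> \<le> ennreal (err k)" if "k \<ge> k0" for k
          unfolding err_def
        proof (rule bnd)
          show "0 < (\<tau> * 2^k) powr (1/a)" using \<tau> by simp
          have "ballavg (\<delta>' k) G \<in> borel_measurable borel" using H(3)[of k] by (intro ballavg_borel G_borel) auto
          then show "(\<lambda>y. ballavg (\<delta>' k) G y - G y) \<in> borel_measurable borel" using G_borel by measurable
          fix t :: real assume "t \<in> {0..1}"
          then have y: "\<gamma> t \<in> exh k" using k0[of k] that by auto
          show "ennreal ((\<tau> * 2^k) powr (1/a)) * (ballavg (\<delta>' k) G (\<gamma> t) - G (\<gamma> t)) \<le> \<rho>' (\<gamma> t)"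
            by (rule ge[OF _ H(5)[OF y]]) simp
        qed
        let ?\<mu> = "interval_measure (length_fun \<gamma>)"
        \<comment> \<open>For the measure \<open>G ds\<close> on the parameter interval, the upper
          gradient inequality bounds the increments of \<open>g\<close> along the curve by the mass
          of half-open intervals.\<close>
        define \<nu> where "\<nu> = density ?\<mu> (\<lambda>t. G (\<gamma> t) * indicator {0..1} t)"
        have Gm: "(\<lambda>t. G (\<gamma> t) * indicator {0..1} t) \<in> borel_measurable ?\<mu>"
          using borel_measurable_on_path[OF \<gamma>c G_borel] unfolding measurable_cong_sets[OF sets_interval_measure refl] .
        have s\<nu>: "sets \<nu> = sets borel" by (simp add: \<nu>_def)
        have fin\<nu>: "emeasure \<nu> UNIV < \<infinity>"
        proof -
          have "emeasure \<nu> UNIV = line_integral G \<gamma>"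
            unfolding \<nu>_def line_integral_def by (subst emeasure_density[OF Gm]) auto
          then show ?thesis using LG by simp
        qed
        \<comment> \<open>The distance from \<open>x0\<close> is 1-Lipschitz, so its increments
          inherit the bound. It runs from at most \<epsilon> to at least \<epsilon>0, and the
          crossing estimate then brings in the integral of \<eta>.\<close>
        define r where "r t = dist (\<gamma>0 t) x0" for t
        have rc: "continuous_on {0..1} r" unfolding r_def by (intro continuous_intros \<gamma>0c)
        have ug: "ennreal \<bar>r t - r s\<bar> \<le> emeasure \<nu> {s<..t}" if st: "0 \<le> s" "s \<le> t" "t \<le> 1" for s t
        proof -
          have "\<bar>r t - r s\<bar> \<le> norm (\<gamma>0 t - \<gamma>0 s)"
            unfolding r_def using dist_triangle[of "\<gamma>0 t" x0 "\<gamma>0 s"] dist_triangle[of "\<gamma>0 s" x0 "\<gamma>0 t"]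
            by (simp add: dist_norm norm_minus_commute abs_le_iff)
          also have "\<dots> = norm (g (\<gamma> t) - g (\<gamma> s))" using g\<gamma>[of t] g\<gamma>[of s] st by simp
          finally have "ennreal \<bar>r t - r s\<bar> \<le> ennreal (norm (g (\<gamma> t) - g (\<gamma> s)))" by (rule ennreal_leI)
          also have "\<dots> \<le> (\<integral>\<^sup>+ t\<in>{s<..t}. G (\<gamma> t) * indicator {0..1} t \<partial>?\<mu>)"
            by (rule upper_gradient_limit[OF rect img LG H(3) ex errlim err0 st])
          also have "\<dots> = emeasure \<nu> {s<..t}" unfolding \<nu>_def by (rule emeasure_density[OF Gm, symmetric]) simp
          finally show ?thesis .
        qed
        have "1 \<le> (\<integral>\<^sup>+ x\<in>{\<epsilon><..<\<epsilon>0}. \<eta> x \<partial>lborel)" by (rule \<eta>(2))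
        also have "\<dots> \<le> (\<integral>\<^sup>+ t. \<eta> (r t) * indicator {\<epsilon><..<\<epsilon>0} (r t) * indicator {0..1} t \<partial>\<nu>)"
        proof (rule nn_integral_Ioo_le_crossing[OF s\<nu> fin\<nu> rc ug \<epsilon> _ _ \<eta>(1)])
          show "r 0 \<le> \<epsilon>" using \<gamma>0(3) C1 by (auto simp: r_def dist_commute)
          show "\<epsilon>0 \<le> r 1" using \<gamma>0(4) C2 by (auto simp: r_def dist_commute)
        qed
        also have "\<dots> = (\<integral>\<^sup>+ t. (G (\<gamma> t) * indicator {0..1} t) * (\<theta> (\<gamma>0 t) * indicator {0..1} t) \<partial>?\<mu>)"
        proof -
          have "(\<lambda>t. \<theta> (\<gamma>0 t) * indicator {0..1} t) \<in> borel_measurable ?\<mu>"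
            using borel_measurable_on_path[OF \<gamma>0c \<theta>m] unfolding measurable_cong_sets[OF sets_interval_measure refl] .
          from nn_integral_density[OF Gm this] show ?thesis unfolding \<nu>_def \<theta>_def r_def .
        qed
        also have "\<dots> = line_integral \<rho> \<gamma>"
          unfolding line_integral_def
        proof (rule nn_integral_cong)
          fix t
          show "G (\<gamma> t) * indicator {0..1} t * (\<theta> (\<gamma>0 t) * indicator {0..1} t) = \<rho> (\<gamma> t) * indicator {0..1} t"
            using g\<gamma>[of t] by (cases "t \<in> {0..1}") (auto simp: \<rho>_def mult.commute)
        qed
        also have "\<dots> \<le> line_integral \<rho>' \<gamma>" by (rule line_integral_mono) (rule ge\<rho>)
        finally show ?thesis .
      qed
    qed
    have "modulus a ((\<lambda>\<gamma>. f \<circ> \<gamma>) ` joining_paths C1 C2 D) \<le> (\<integral>\<^sup>+ y. enn_powr (\<rho>' y) a \<partial>lebesgue)"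
      unfolding modulus_def by (rule INF_lower) (use adm in simp)
    also have "\<dots> = (\<integral>\<^sup>+ y. Z y \<partial>lborel)"
      unfolding \<rho>'_def enn_powr_inverse(2)[OF a0] by (rule nn_integral_completion)
    also have "\<dots> = (\<integral>\<^sup>+ y. enn_powr (\<rho> y) a \<partial>lborel) + ennreal \<tau> * (\<integral>\<^sup>+ y. H y \<partial>lborel)"
      unfolding Z_def using borel_measurable_enn_powr[OF \<rho>m, of a] H(1)
      by (simp add: nn_integral_add nn_integral_cmult)
    also have "\<dots> \<le> ?R + ennreal \<tau> * 4" by (intro add_mono \<rho>I mult_left_mono H(2)) simp
    also have "ennreal \<tau> * 4 = ennreal (4 * \<tau>)" using \<tau> by (simp add: ennreal_mult mult.commute)
    finally show ?thesis .
  qed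
  show ?thesis
  proof (rule ennreal_le_epsilon)
    fix e :: real assume "0 < e"
    then show "modulus a ((\<lambda>\<gamma>. f \<circ> \<gamma>) ` joining_paths C1 C2 D) \<le> ?R + ennreal e" using main[of "e/4"] by simp
  qed
qed

end

section \<open>Borel representatives and the modulus inequality\<close>

text \<open>Lowering a Borel version to 0 on a null set keeps it below \<eta> at every point. The
  pointwise inequality survives composition with the distance from \<open>x0\<close> without any
  argument about null sets of radii.\<close>

lemma lebesgue_ex_borel_ennreal_le:
  fixes \<eta> :: "real \<Rightarrow> ennreal"
  assumes "\<eta> \<in> borel_measurable lebesgue"
  obtains \<eta>' where "\<eta>' \<in> borel_measurable borel" "\<And>r. \<eta>' r \<le> \<eta> r" "AE r in lborel. \<eta>' r = \<eta> r"
proof -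
  obtain h where h: "h \<in> borel_measurable lborel" "AE x in lborel. \<eta> x = h x"
    using completion_ex_borel_measurable[OF assms] by blast
  obtain N where N: "N \<in> null_sets lborel" "{x. \<eta> x \<noteq> h x} \<subseteq> N" using h(2) unfolding eventually_ae_filter by auto
  define \<eta>' where "\<eta>' r = h r * indicator (- N) r" for r
  show thesis
  proof (rule that)
    have "- N \<in> sets borel" using N(1) by auto
    then show "\<eta>' \<in> borel_measurable borel" unfolding \<eta>'_def using h(1) by measurable
    show "\<eta>' r \<le> \<eta> r" for r
    proof (cases "r \<in> N")
      case False
      then have "\<eta> r = h r" using N(2) by blast
      then show ?thesis using False by (simp add: \<eta>'_def)
    qed (simp add: \<eta>'_def)
    show "AE r in lborel. \<eta>' r = \<eta> r"
      using AE_not_in[OF N(1)] 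
    proof eventually_elim
      case (elim r)
      then have "\<eta> r = h r" using N(2) by blast
      then show ?case using elim by (simp add: \<eta>'_def)
    qed
  qed
qed

text \<open>Local integrability gives measurability on compact sets; countably many of them exhaust
  \<open>D\<close>, and a pointwise limit passes it to all of \<open>D\<close>.\<close>

lemma lebesgue_measurable_of_compact_exhaustion:
  fixes u :: "R2 \<Rightarrow> real"
  assumes D: "open D" and u: "\<And>C. compact C \<Longrightarrow> C \<subseteq> D \<Longrightarrow> (\<lambda>x. indicator C x * u x) \<in> borel_measurable lebesgue"
  shows "(\<lambda>x. indicator D x * u x) \<in> borel_measurable lebesgue"
proof -
  obtain C :: "nat \<Rightarrow> R2 set" where C: "\<And>n. compact (C n)" "\<And>n. C n \<subseteq> D" "\<And>n. C n \<subseteq> interior (C (Suc n))" "\<Union> (range C) = D"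
    by (rule open_Union_compact_subsets[OF D]) blast
  have step: "C n \<subseteq> C (Suc n)" for n using C(3)[of n] interior_subset[of "C (Suc n)"] by (rule order_trans)
  have mono: "C m \<subseteq> C n" if "m \<le> n" for m n
    by (rule lift_Suc_mono_le[of C, OF step that])
  show ?thesis
  proof (rule borel_measurable_LIMSEQ_real)
    show "(\<lambda>x. indicator (C n) x * u x) \<in> borel_measurable lebesgue" for n by (rule u[OF C(1,2)])
    fix x :: R2
    show "(\<lambda>n. indicator (C n) x * u x) \<longlonglongrightarrow> indicator D x * u x"
    proof (cases "x \<in> D")
      case True
      then obtain m where m: "x \<in> C m" using C(4) by blast
      have "eventually (\<lambda>n. indicator (C n) x * u x = indicator D x * u x) sequentially"
        using eventually_ge_at_top[of m] by eventually_elim (use m mono True in \<open>auto simp: indicator_def\<close>)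
      then show ?thesis by (rule tendsto_eventually)
    next
      case False
      then have "x \<notin> C n" for n using C(2) by blast
      then show ?thesis using False by simp
    qed
  qed
qed

text \<open>The entries of the columns are replaced one by one by Borel functions and then
  reassembled to a matrix; finitely many null sets are lost.\<close>

lemma borel_matrix_version:
  fixes Df :: "R2 \<Rightarrow> real^2^2"
  assumes D: "open D" and int: "\<And>j. loc_integrable D (\<lambda>x. column j (Df x))"
  obtains Df' where "Df' \<in> borel_measurable borel" "AE x in lborel. x \<in> D \<longrightarrow> Df' x = Df x"
    "\<And>C. compact C \<Longrightarrow> C \<subseteq> D \<Longrightarrow> set_integrable lborel C Df'"
    "\<And>i j. (\<lambda>x. indicator D x * Df x $ i $ j) \<in> borel_measurable lebesgue"
proof -
  have comp: "integrable lebesgue (\<lambda>x. indicator C x * Df x $ i $ j)" if C: "compact C" "C \<subseteq> D" for C i j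
  proof -
    have "integrable lebesgue (\<lambda>x. indicator C x *\<^sub>R column j (Df x))"
      using int[of j] C unfolding loc_integrable_def set_integrable_def by blast
    from integrable_bounded_linear[OF bounded_linear_vec_nth[of i] this]
    show ?thesis by (simp add: column_def)
  qed
  have meas: "(\<lambda>x. indicator D x * Df x $ i $ j) \<in> borel_measurable lebesgue" for i j
    by (rule lebesgue_measurable_of_compact_exhaustion[OF D]) (rule borel_measurable_integrable[OF comp])
  have exh: "\<exists>h. h \<in> borel_measurable borel \<and> (AE x in lborel. indicator D x * Df x $ i $ j = h x)" for i j
    using completion_ex_borel_measurable_real[OF meas[of i j]] by auto
  define h where "h i j = (SOME h. h \<in> borel_measurable borel \<and> (AE x in lborel. indicator D x * Df x $ i $ j = h x))" for i j
  have h: "h i j \<in> borel_measurable borel" "AE x in lborel. indicator D x * Df x $ i $ j = h i j x" for i j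
    using someI_ex[OF exh[of i j]] unfolding h_def by auto
  define Df' where "Df' x = (\<Sum>i\<in>UNIV. \<Sum>j\<in>UNIV. h i j x *\<^sub>R axis i (axis j 1) :: real^2^2)" for x
  have ent: "Df' x $ i $ j = h i j x" for x i j
  proof -
    have "\<forall>i j. Df' x $ i $ j = h i j x"
      unfolding forall_2 Df'_def by (simp add: UNIV_2 axis_def)
    then show ?thesis by blast
  qed
  have m: "Df' \<in> borel_measurable borel" unfolding Df'_def using h(1) by (intro borel_measurable_sum borel_measurable_scaleR) auto
  have "AE x in lborel. \<forall>i j. indicator D x * Df x $ i $ j = h i j x"
    using h(2) by (simp add: AE_all_countable)
  then have ae: "AE x in lborel. x \<in> D \<longrightarrow> Df' x = Df x"
  proof eventually_elim
    case (elim x)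
    show ?case
    proof
      assume "x \<in> D"
      then have "Df x $ i $ j = h i j x" for i j using elim by (auto simp: indicator_def)
      then show "Df' x = Df x" by (simp add: vec_eq_iff ent)
    qed
  qed
  have "set_integrable lborel C Df'" if C: "compact C" "C \<subseteq> D" for C
  proof -
    have Cb: "C \<in> sets borel" using C by (simp add: borel_compact)
    have hi: "integrable lborel (\<lambda>x. indicator C x * h i j x)" for i j
    proof -
      have hm: "(\<lambda>x. indicator C x * h i j x) \<in> borel_measurable lborel" using h(1)[of i j] Cb by measurable
      have "integrable lebesgue (\<lambda>x. indicator C x * h i j x)"
      proof (rule integrable_cong_AE_imp[OF comp[OF C, of i j]])
        show "(\<lambda>x. indicator C x * h i j x) \<in> borel_measurable lebesgue" using hm by (rule measurable_completion)
        have "AE x in lborel. indicator C x * Df x $ i $ j = indicator C x * h i j x"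
          using h(2)[of i j] by eventually_elim (use C(2) in \<open>auto simp: indicator_def\<close>)
        then show "AE x in lebesgue. indicator C x * Df x $ i $ j = indicator C x * h i j x" by (rule AE_completion)
      qed
      then show ?thesis using integrable_completion[OF hm] by simp
    qed
    have "integrable lborel (\<lambda>x. \<Sum>i\<in>UNIV. \<Sum>j\<in>UNIV. (indicator C x * h i j x) *\<^sub>R (axis i (axis j 1) :: real^2^2))"
      using hi by (intro Bochner_Integration.integrable_sum integrable_scaleR_left) auto
    also have "(\<lambda>x. \<Sum>i\<in>UNIV. \<Sum>j\<in>UNIV. (indicator C x * h i j x) *\<^sub>R (axis i (axis j 1) :: real^2^2)) = (\<lambda>x. indicator C x *\<^sub>R Df' x)"
      by (simp add: Df'_def scaleR_sum_right fun_eq_iff)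
    finally show ?thesis unfolding set_integrable_def .
  qed
  then show thesis by (rule that[OF m ae _ meas])
qed

theorem theorem4p3:
  fixes D C1 C2 :: "R2 set" and x0 :: R2 and \<epsilon> \<epsilon>0 \<alpha> :: real
    and f :: "R2 \<Rightarrow> R2" and Df :: "R2 \<Rightarrow> real^2^2" and \<eta> :: "real \<Rightarrow> ennreal"
  assumes "open D" and "connected D" and "D \<noteq> {}"
    and "0 < \<epsilon>" and "\<epsilon> < \<epsilon>0" and "1 < \<alpha>"
    and "\<exists>g. homeomorphism D (f ` D) f g"
    and "bounded (f ` D)"
    and "sobolev_W11_loc D f Df"
    and "finite_distortion D f Df"
    and "loc_integrable_enn D (K_I D Df \<alpha>)"
    and "compact C2" and "C2 \<subseteq> D - ball x0 \<epsilon>0"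
    and "compact C1" and "C1 \<subseteq> cball x0 \<epsilon> \<inter> D"
    and "(\<lambda>r. \<eta> r * indicator {\<epsilon><..<\<epsilon>0} r) \<in> borel_measurable lebesgue"
    and "(\<integral>\<^sup>+ r\<in>{\<epsilon><..<\<epsilon>0}. \<eta> r \<partial>lebesgue) = 1"
  shows "modulus \<alpha> ((\<lambda>\<gamma>. f \<circ> \<gamma>) ` joining_paths C1 C2 D)
         \<le> (\<integral>\<^sup>+ x\<in>annulus x0 \<epsilon> \<epsilon>0. K_I D Df \<alpha> x * enn_powr (\<eta> (dist x x0)) \<alpha> \<partial>lebesgue)"
proof -
  obtain g where hom: "homeomorphism D (f ` D) f g" using assms(7) by blast
  then have contf: "continuous_on D f" by (simp add: homeomorphism_def)
  have sob: "\<And>j. loc_integrable D (\<lambda>x. column j (Df x))" "weak_differential D f Df"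
    using assms(9) by (auto simp: sobolev_W11_loc_def)
  have Db: "D \<in> sets borel" using assms(1) by simp
  obtain Df' where Df': "Df' \<in> borel_measurable borel" "AE x in lborel. x \<in> D \<longrightarrow> Df' x = Df x"
    "\<And>C. compact C \<Longrightarrow> C \<subseteq> D \<Longrightarrow> set_integrable lborel C Df'"
    "\<And>i j. (\<lambda>x. indicator D x * Df x $ i $ j) \<in> borel_measurable lebesgue"
    by (rule borel_matrix_version[OF assms(1) sob(1)]) (rule that; assumption)
  \<comment> \<open>The weak equation moves from \<open>lebesgue\<close> to \<open>lborel\<close>:
    one integrand is Borel already, the other is altered on a null set.\<close>
  have weak': "(LINT x:D|lborel. partial_deriv \<phi> j x *\<^sub>R f x) = - (LINT x:D|lborel. \<phi> x *\<^sub>R column j (Df' x))"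
    if \<phi>: "test_fun D \<phi>" for j \<phi>
  proof -
    have sm: "C_k 1 \<phi>" "C_k 0 \<phi>" using \<phi> by (auto simp: test_fun_def smooth_fun_def)
    have cp: "continuous_on UNIV (partial_deriv \<phi> j)" using sm(1) by simp
    have c\<phi>: "continuous_on UNIV \<phi>" using sm(2) by simp
    have \<phi>m: "\<phi> \<in> borel_measurable borel" "partial_deriv \<phi> j \<in> borel_measurable borel"
      using cp c\<phi> by (auto intro: borel_measurable_continuous_onI)
    have fm: "(\<lambda>x. indicator D x *\<^sub>R f x) \<in> borel_measurable borel"
      using borel_measurable_continuous_on_indicator[OF Db contf] by simp
    have m1: "(\<lambda>x. indicator D x *\<^sub>R (partial_deriv \<phi> j x *\<^sub>R f x)) \<in> borel_measurable lborel"
      using borel_measurable_scaleR[OF \<phi>m(2) fm] by (simp add: mult.commute)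
    have colm: "(\<lambda>x. column j (Df' x)) \<in> borel_measurable borel"
    proof -
      have "(\<lambda>A::real^2^2. column j A) \<in> borel_measurable borel"
        unfolding column_def by (intro borel_measurable_continuous_onI continuous_on_vec_lambda continuous_intros)
      then show ?thesis by (rule measurable_compose[OF Df'(1)])
    qed
    have m2: "(\<lambda>x. indicator D x *\<^sub>R (\<phi> x *\<^sub>R column j (Df' x))) \<in> borel_measurable lborel"
      using borel_measurable_scaleR[OF borel_measurable_indicator[OF Db] borel_measurable_scaleR[OF \<phi>m(1) colm]] by simp
    have m3: "(\<lambda>x. indicator D x *\<^sub>R (\<phi> x *\<^sub>R column j (Df x))) \<in> borel_measurable lebesgue"
    proof -
      have \<phi>l: "\<phi> \<in> borel_measurable lebesgue" by (rule measurable_completion) (use \<phi>m(1) in simp)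
      have "(\<lambda>x. \<Sum>i\<in>UNIV. (\<phi> x * (indicator D x * Df x $ i $ j)) *\<^sub>R (axis i 1 :: R2)) \<in> borel_measurable lebesgue"
        by (rule borel_measurable_sum, rule borel_measurable_scaleR[OF borel_measurable_times[OF \<phi>l Df'(4)] borel_measurable_const])
      also have "(\<lambda>x. \<Sum>i\<in>UNIV. (\<phi> x * (indicator D x * Df x $ i $ j)) *\<^sub>R (axis i 1 :: R2)) = (\<lambda>x. indicator D x *\<^sub>R (\<phi> x *\<^sub>R column j (Df x)))"
        by (auto simp: fun_eq_iff vec_eq_iff forall_2 UNIV_2 axis_def column_def mult_ac)
      finally show ?thesis .
    qed
    have "(LINT x:D|lborel. partial_deriv \<phi> j x *\<^sub>R f x) = (LINT x:D|lebesgue. partial_deriv \<phi> j x *\<^sub>R f x)"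
      unfolding set_lebesgue_integral_def by (rule integral_completion[symmetric, OF m1])
    also have "\<dots> = - (LINT x:D|lebesgue. \<phi> x *\<^sub>R column j (Df x))"
      using sob(2) \<phi> unfolding weak_differential_def by blast
    also have "(LINT x:D|lebesgue. \<phi> x *\<^sub>R column j (Df x)) = (LINT x:D|lebesgue. \<phi> x *\<^sub>R column j (Df' x))"
      unfolding set_lebesgue_integral_def
    proof (rule integral_cong_AE[OF m3 measurable_completion[OF m2]])
      have "AE x in lborel. indicat_real D x *\<^sub>R (\<phi> x *\<^sub>R column j (Df x)) = indicat_real D x *\<^sub>R (\<phi> x *\<^sub>R column j (Df' x))"
        using Df'(2) by eventually_elim (auto simp: indicator_def)
      then show "AE x in lebesgue. indicat_real D x *\<^sub>R (\<phi> x *\<^sub>R column j (Df x)) = indicat_real D x *\<^sub>R (\<phi> x *\<^sub>R column j (Df' x))"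
        by (rule AE_completion)
    qed
    also have "\<dots> = (LINT x:D|lborel. \<phi> x *\<^sub>R column j (Df' x))"
      unfolding set_lebesgue_integral_def by (rule integral_completion[OF m2])
    finally show ?thesis .
  qed
  interpret W11 D f Df'
    by unfold_locales (fact assms(1) contf Df'(1) Df'(3) weak')+
  obtain T :: "nat \<Rightarrow> R2 set" where T: "\<forall>n. T n \<in> sets borel \<and> T n \<subseteq> D \<and> (\<forall>x\<in>T n. (f has_derivative (\<lambda>h. Df' x *v h)) (at x within T n))"
    "AE x in lborel. x \<in> D \<longrightarrow> x \<in> (\<Union>n. T n)"
    using differentiable_pieces by blast
  have fd: "AE x in lborel. x \<in> D \<longrightarrow> det (Df' x) = 0 \<longrightarrow> Df' x = 0"
  proof -
    obtain K :: "R2 \<Rightarrow> real" where "AE x in lebesgue. x \<in> D \<longrightarrow> (mnorm (Df x))\<^sup>2 \<le> K x * det (Df x)"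
      using assms(10) by (auto simp: finite_distortion_def)
    then have "AE x in lborel. x \<in> D \<longrightarrow> (mnorm (Df x))\<^sup>2 \<le> K x * det (Df x)" by (simp only: AE_completion_iff)
    then show ?thesis using Df'(2)
    proof eventually_elim
      case (elim x)
      show ?case
      proof (intro impI)
        assume "x \<in> D" "det (Df' x) = 0"
        \<comment> \<open>At a vanishing determinant the distortion inequality bounds the square by
          K times 0, whatever the real value of \<open>K\<close>.\<close>
        then have "(mnorm (Df x))\<^sup>2 \<le> 0" "Df' x = Df x" using elim by auto
        then have "onorm (\<lambda>h. Df x *v h) = 0" by (simp add: mnorm_def)
        then have "\<forall>h. Df x *v h = 0" using onorm_eq_0[OF matrix_vector_mul_bounded_linear[of "Df x"]] by simp
        then have "Df x = 0" by (simp add: matrix_eq)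
        then show "Df' x = 0" using \<open>Df' x = Df x\<close> by simp
      qed
    qed
  qed
  interpret W11_upper_gradient D f Df' g T
    by unfold_locales (fact hom assms(8) T(2) fd T(1)[rule_format, THEN conjunct1] T(1)[rule_format, THEN conjunct2, THEN conjunct1] T(1)[rule_format, THEN conjunct2, THEN conjunct2, rule_format])+
  have Keq: "AE x in lborel. K_I D Df' \<alpha> x = K_I D Df \<alpha> x"
    using Df'(2) by eventually_elim (auto simp: K_I_def)
  have Kfin: "(\<integral>\<^sup>+ x\<in>C. K_I D Df' \<alpha> x \<partial>lborel) < \<infinity>" if C: "compact C" "C \<subseteq> D" for C
  proof -
    have "(\<integral>\<^sup>+ x\<in>C. K_I D Df' \<alpha> x \<partial>lborel) = (\<integral>\<^sup>+ x\<in>C. K_I D Df \<alpha> x \<partial>lborel)"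
      by (rule nn_integral_cong_AE) (use Keq in eventually_elim, simp)
    also have "\<dots> = (\<integral>\<^sup>+ x\<in>C. K_I D Df \<alpha> x \<partial>lebesgue)" by (rule nn_integral_completion[symmetric])
    also have "\<dots> < \<infinity>" using assms(11) C by (simp add: loc_integrable_enn_def)
    finally show ?thesis .
  qed
  obtain \<eta>' where \<eta>': "\<eta>' \<in> borel_measurable borel" "\<And>r. \<eta>' r \<le> \<eta> r * indicator {\<epsilon><..<\<epsilon>0} r"
    "AE r in lborel. \<eta>' r = \<eta> r * indicator {\<epsilon><..<\<epsilon>0} r"
    by (rule lebesgue_ex_borel_ennreal_le[OF assms(16)]) (rule that; assumption)
  have \<eta>I: "1 \<le> (\<integral>\<^sup>+ r\<in>{\<epsilon><..<\<epsilon>0}. \<eta>' r \<partial>lborel)"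
  proof -
    \<comment> \<open>\<open>nn_integral\<close> has the same value for a measure and its completion
      for arbitrary integrands, so no Borel version is needed at this point.\<close>
    have "1 = (\<integral>\<^sup>+ r\<in>{\<epsilon><..<\<epsilon>0}. \<eta> r \<partial>lborel)" unfolding assms(17)[symmetric] by (rule nn_integral_completion)
    also have "\<dots> = (\<integral>\<^sup>+ r\<in>{\<epsilon><..<\<epsilon>0}. \<eta>' r \<partial>lborel)"
    proof (rule nn_integral_cong_AE)
      show "AE r in lborel. \<eta> r * indicator {\<epsilon><..<\<epsilon>0} r = \<eta>' r * indicator {\<epsilon><..<\<epsilon>0} r"
        using \<eta>'(3) by eventually_elim (auto simp: indicator_def)
    qed
    finally show ?thesis by simp
  qed
  have "modulus \<alpha> ((\<lambda>\<gamma>. f \<circ> \<gamma>) ` joining_paths C1 C2 D)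
     \<le> (\<integral>\<^sup>+ x\<in>D. K_I D Df' \<alpha> x * enn_powr (\<eta>' (dist x x0) * indicator {\<epsilon><..<\<epsilon>0} (dist x x0)) \<alpha> \<partial>lborel)"
    by (rule modulus_le[OF assms(6) Kfin assms(5,15,13) \<eta>'(1) \<eta>I])
  also have "\<dots> \<le> (\<integral>\<^sup>+ x\<in>annulus x0 \<epsilon> \<epsilon>0. K_I D Df \<alpha> x * enn_powr (\<eta> (dist x x0)) \<alpha> \<partial>lborel)"
  proof (rule nn_integral_mono_AE)
    show "AE x in lborel. K_I D Df' \<alpha> x * enn_powr (\<eta>' (dist x x0) * indicator {\<epsilon><..<\<epsilon>0} (dist x x0)) \<alpha> * indicator D x
       \<le> K_I D Df \<alpha> x * enn_powr (\<eta> (dist x x0)) \<alpha> * indicator (annulus x0 \<epsilon> \<epsilon>0) x"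
      using Keq
    proof eventually_elim
      case (elim x)
      show ?case
      proof (cases "dist x x0 \<in> {\<epsilon><..<\<epsilon>0}")
        case True
        then have "x \<in> annulus x0 \<epsilon> \<epsilon>0" by (simp add: annulus_def)
        moreover have "enn_powr (\<eta>' (dist x x0)) \<alpha> \<le> enn_powr (\<eta> (dist x x0)) \<alpha>"
          using \<eta>'(2)[of "dist x x0"] True assms(6) by (intro enn_powr_mono) auto
        ultimately show ?thesis using True elim by (auto simp: indicator_def intro: mult_left_mono)
      qed simp
    qed
  qed
  also have "\<dots> = (\<integral>\<^sup>+ x\<in>annulus x0 \<epsilon> \<epsilon>0. K_I D Df \<alpha> x * enn_powr (\<eta> (dist x x0)) \<alpha> \<partial>lebesgue)"
    by (rule nn_integral_completion[symmetric])
  finally show ?thesis .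
qed

end
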